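(* Let $d\in\{2,3\}$, let $\Omega\subset\mathbb{R}^d$ be a polyhedral (polygonal) domain, and let $\mathcal{T}_0,\mathcal{T}_1,\dots$ be a sequence of triangulations of $\Omega$ produced by local red-green refinement as described in the context, with linear finite element spaces $\mathcal{S}_0\subset\mathcal{S}_1\subset\cdots\subset H_0^1(\Omega)$ and $L_2$-orthogonal projections $Q_j:L_2(\Omega)\to\mathcal{S}_j$. Then there is a (sufficiently small) $\gamma_0>0$ such that, if the approximations $Q_j^a:L_2(\Omega)\to\mathcal{S}_j$ satisfy $$\|(Q_j^a-Q_j)v\|_{L_2}\le\gamma\|Q_jv\|_{L_2}\qquad\forall v\in L_2(\Omega),\ \forall j,$$ for some $\gamma\in[0,\gamma_0)$, then $$\sum_{j=0}^J2^{2j}\|(\tilde{Q}_j-\tilde{Q}_{j-1})u\|_{L_2}^2\;\eqsim\;\|u\|_{H^1}^2,\qquad u\in\mathcal{S}_J,$$ where $\tilde{Q}_k=\prod_{i=k}^{J-1}\bigl[I_i+Q_i^a(I_{i+1}-I_i)\bigr]$ for $0\le k\le J-1$, $\tilde{Q}_J=I$, $\tilde{Q}_{-1}=0$. Here $\eqsim$ means two-sided inequalities with positive constants independent of $u$ and $J$.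
   Context: Triangulations. Each $\mathcal{T}_j$ is a finite collection of simplices (triangles if $d=2$, tetrahedra if $d=3$) with mutually disjoint interiors whose union covers (the closure of) $\Omega$. $\mathcal{T}_0$ is conforming, shape regular and quasiuniform. $\mathcal{T}_{j+1}$ is obtained from $\mathcal{T}_j$ by refining some of its simplices; the resulting simplices are the sons, the refined simplex is their father (an unrefined simplex is carried over unchanged). Regular (red) refinement: for $d=2$, division of a triangle into 4 congruent triangles by joining edge midpoints; for $d=3$, bisection of all six edges and division into 8 subtetrahedra of equal volume, four corner subtetrahedra similar to the father being cut off and the remaining octahedron being cut into four tetrahedra using one diagonal chosen so that successive refinements remain nondegenerate. Irregular (green) refinement, used to restore conformity: for $d=2$, bisection of a triangle by joining the midpoint of one edge to the opposite vertex; for $d=3$, a subdivision into tetrahedra with corners among the vertices and edge midpoints of the father in which at least one, but not all six, edges are refined. Sons of an irregular refinement are called irregular. The level of a simplex is $L(\tau)=\min\{j:\tau\in\mathcal{T}_j\}$. The refinement obeys: (1) Nestedness: each $\tau\in\mathcal{T}_j$ is covered by exactly one $\tau'\in\mathcal{T}_{j-1}$, and any corner of $\tau$ is a corner or an edge midpoint of $\tau'$. (2) Conformity: the intersection of any two simplices in $\mathcal{T}_j$ is empty or a common lower-dimensional face (vertex, edge, or, for $d=3$, face). (3) Nondegeneracy: the interior angles of all simplices in all $\mathcal{T}_j$ are bounded away from zero (uniform shape regularity). (4) Irregular simplices are not refined further. (5) Only $\tau\in\mathcal{T}_j$ with $L(\tau)=j$ are refined in the construction of $\mathcal{T}_{j+1}$.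 (6) (For $d=3$) if three or more edges of a tetrahedron are refined and do not belong to a common face, then the tetrahedron is refined regularly. Spaces and operators. $\mathcal{S}_j$ is the space of continuous functions that are affine on each simplex of $\mathcal{T}_j$ and vanish on $\partial\Omega$. $I_j$ is the nodal (Lagrange) interpolation operator onto $\mathcal{S}_j$. The $Q_j^a:L_2(\Omega)\to\mathcal{S}_j$ are linear operators (computable approximations of $Q_j$). The operators $\tilde{Q}_k$ are considered as acting on $\mathcal{S}_J$; the product is ordered with the factor of smallest index $i=k$ leftmost (applied last). *)

theory Defs
  imports "HOL-Analysis.Analysis"
begin

section \<open>Domains and function spaces\<close>

text \<open>
  Regular openness \<open>interior (closure \<Omega>) = \<Omega>\<close> excludes slits and punctures, on which a
  triangulation of the closure would carry no information. Boundedness is implied, since polytopes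
  are compact.
\<close>

definition polyhedral_domain :: "'a::euclidean_space set \<Rightarrow> bool" where
  "polyhedral_domain \<Omega> \<longleftrightarrow>
     open \<Omega> \<and> connected \<Omega> \<and> \<Omega> \<noteq> {} \<and> interior (closure \<Omega>) = \<Omega> \<and>
     (\<exists>\<F>. finite \<F> \<and> (\<forall>P\<in>\<F>. polytope P) \<and> closure \<Omega> = \<Union>\<F>)"

text \<open>
  Functions on \<open>\<Omega>\<close> are total functions on the whole space; elements of \<open>L2 \<Omega>\<close> are representatives,
  and only their values on \<open>\<Omega>\<close> matter.
\<close>

definition L2 :: "'a::euclidean_space set \<Rightarrow> ('a \<Rightarrow> real) set" where
  "L2 \<Omega> = {v. v \<in> borel_measurable (lebesgue_on \<Omega>) \<and> integrable (lebesgue_on \<Omega>) (\<lambda>x. (v x)\<^sup>2)}"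

definition L2_inner :: "'a::euclidean_space set \<Rightarrow> ('a \<Rightarrow> real) \<Rightarrow> ('a \<Rightarrow> real) \<Rightarrow> real" where
  "L2_inner \<Omega> v w = integral\<^sup>L (lebesgue_on \<Omega>) (\<lambda>x. v x * w x)"

definition L2_norm :: "'a::euclidean_space set \<Rightarrow> ('a \<Rightarrow> real) \<Rightarrow> real" where
  "L2_norm \<Omega> v = sqrt (L2_inner \<Omega> v v)"

primrec C_k :: "nat \<Rightarrow> ('a::euclidean_space \<Rightarrow> real) \<Rightarrow> bool" where
  "C_k 0 f \<longleftrightarrow> continuous_on UNIV f"
| "C_k (Suc k) f \<longleftrightarrow>
     f differentiable_on UNIV \<and> (\<forall>b\<in>Basis. C_k k (\<lambda>x. frechet_derivative f (at x) b))"

definition test_function :: "'a::euclidean_space set \<Rightarrow> ('a \<Rightarrow> real) \<Rightarrow> bool" where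
  "test_function \<Omega> \<phi> \<longleftrightarrow>
     (\<forall>k. C_k k \<phi>) \<and> compact (closure {x. \<phi> x \<noteq> 0}) \<and> closure {x. \<phi> x \<noteq> 0} \<subseteq> \<Omega>"

definition L2_weak_gradient :: "'a::euclidean_space set \<Rightarrow> ('a \<Rightarrow> real) \<Rightarrow> ('a \<Rightarrow> 'a) \<Rightarrow> bool" where
  "L2_weak_gradient \<Omega> u g \<longleftrightarrow>
     (\<forall>b\<in>Basis. (\<lambda>x. g x \<bullet> b) \<in> L2 \<Omega>) \<and>
     (\<forall>\<phi>. test_function \<Omega> \<phi> \<longrightarrow>
        (\<forall>b\<in>Basis. L2_inner \<Omega> u (\<lambda>x. frechet_derivative \<phi> (at x) b)
                  = - L2_inner \<Omega> (\<lambda>x. g x \<bullet> b) \<phi>))"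

text \<open>
  The weak gradient is unique up to null sets, so the choice below does not affect the norm. The
  norm is meaningful only for \<open>u\<close> in \<open>L2 \<Omega>\<close> that have a weak gradient in \<open>L2\<close>.
\<close>

definition H1_norm :: "'a::euclidean_space set \<Rightarrow> ('a \<Rightarrow> real) \<Rightarrow> real" where
  "H1_norm \<Omega> u =
     (let g = SOME g. L2_weak_gradient \<Omega> u g
      in sqrt ((L2_norm \<Omega> u)\<^sup>2 + (\<Sum>b\<in>Basis. (L2_norm \<Omega> (\<lambda>x. g x \<bullet> b))\<^sup>2)))"


section \<open>Simplices and their refinements\<close>

definition corners :: "'a::euclidean_space set \<Rightarrow> 'a set" where
  "corners \<tau> = {p. p extreme_point_of \<tau>}"

definition edge_midpoints :: "'a::euclidean_space set \<Rightarrow> 'a set" where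
  "edge_midpoints \<tau> = {midpoint a b | a b. a \<in> corners \<tau> \<and> b \<in> corners \<tau> \<and> a \<noteq> b}"

text \<open>The edges of \<open>\<tau>\<close> whose midpoint is a corner of one of the sons \<open>\<S>\<close>.\<close>

definition refined_edges :: "'a::euclidean_space set \<Rightarrow> 'a set set \<Rightarrow> 'a set set" where
  "refined_edges \<tau> \<S> =
     {closed_segment a b | a b. a \<in> corners \<tau> \<and> b \<in> corners \<tau> \<and> a \<noteq> b \<and>
        midpoint a b \<in> \<Union>(corners ` \<S>)}"

text \<open>
  Interior angle at a corner: the planar angle in radians if the dimension is 2, the solid angle in
  steradians if it is 3. (In dimension 3 a lower bound on the planar angles of the faces alone would
  admit degenerating tetrahedra.) The measure of the unit sphere sector is the dimension times the
  volume of the unit ball sector.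
\<close>

definition interior_angle :: "'a::euclidean_space set \<Rightarrow> 'a \<Rightarrow> real" where
  "interior_angle \<tau> p =
     real DIM('a) * measure lebesgue (cone hull ((\<lambda>x. x - p) ` \<tau>) \<inter> ball 0 1)"

definition mesh_of :: "'a::euclidean_space set \<Rightarrow> 'a set set \<Rightarrow> bool" where
  "mesh_of X \<T> \<longleftrightarrow>
     finite \<T> \<and> (\<forall>\<tau>\<in>\<T>. int DIM('a) simplex \<tau>) \<and>
     (\<forall>\<sigma>\<in>\<T>. \<forall>\<tau>\<in>\<T>. \<sigma> \<noteq> \<tau> \<longrightarrow> interior \<sigma> \<inter> interior \<tau> = {}) \<and>
     \<Union>\<T> = X"

definition conforming :: "'a::euclidean_space set set \<Rightarrow> bool" where
  "conforming \<T> \<longleftrightarrow>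
     (\<forall>\<sigma>\<in>\<T>. \<forall>\<tau>\<in>\<T>. \<sigma> \<noteq> \<tau> \<longrightarrow>
        \<sigma> \<inter> \<tau> = {} \<or>
        (\<sigma> \<inter> \<tau>) face_of \<sigma> \<and> (\<sigma> \<inter> \<tau>) face_of \<tau> \<and> aff_dim (\<sigma> \<inter> \<tau>) < int DIM('a))"

definition quasiuniform :: "'a::euclidean_space set set \<Rightarrow> bool" where
  "quasiuniform \<T> \<longleftrightarrow> (\<exists>\<kappa>>0. \<forall>\<sigma>\<in>\<T>. \<forall>\<tau>\<in>\<T>. diameter \<tau> \<le> \<kappa> * diameter \<sigma>)"

definition red_triangle :: "'a::euclidean_space \<Rightarrow> 'a \<Rightarrow> 'a \<Rightarrow> 'a set set" where
  "red_triangle a b c =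
     {convex hull {a, midpoint a b, midpoint a c},
      convex hull {b, midpoint a b, midpoint b c},
      convex hull {c, midpoint a c, midpoint b c},
      convex hull {midpoint a b, midpoint a c, midpoint b c}}"

text \<open>
  The inner octahedron is cut along the diagonal from \<open>midpoint a b\<close> to \<open>midpoint c e\<close>; the other
  two diagonals arise by relabelling the corners.
\<close>

definition red_tetrahedron :: "'a::euclidean_space \<Rightarrow> 'a \<Rightarrow> 'a \<Rightarrow> 'a \<Rightarrow> 'a set set" where
  "red_tetrahedron a b c e =
     {convex hull {a, midpoint a b, midpoint a c, midpoint a e},
      convex hull {b, midpoint a b, midpoint b c, midpoint b e},
      convex hull {c, midpoint a c, midpoint b c, midpoint c e},
      convex hull {e, midpoint a e, midpoint b e, midpoint c e},
      convex hull {midpoint a b, midpoint c e, midpoint a c, midpoint b c},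
      convex hull {midpoint a b, midpoint c e, midpoint b c, midpoint b e},
      convex hull {midpoint a b, midpoint c e, midpoint b e, midpoint a e},
      convex hull {midpoint a b, midpoint c e, midpoint a e, midpoint a c}}"

definition regular_refinement :: "'a::euclidean_space set \<Rightarrow> 'a set set \<Rightarrow> bool" where
  "regular_refinement \<tau> \<S> \<longleftrightarrow>
     DIM('a) = 2 \<and> (\<exists>a b c. corners \<tau> = {a, b, c} \<and> \<S> = red_triangle a b c) \<or>
     DIM('a) = 3 \<and> (\<exists>a b c e. corners \<tau> = {a, b, c, e} \<and> \<S> = red_tetrahedron a b c e)"

definition irregular_refinement :: "'a::euclidean_space set \<Rightarrow> 'a set set \<Rightarrow> bool" where
  "irregular_refinement \<tau> \<S> \<longleftrightarrow>
     DIM('a) = 2 \<and>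
       (\<exists>a b c. corners \<tau> = {a, b, c} \<and>
          \<S> = {convex hull {a, b, midpoint b c}, convex hull {a, c, midpoint b c}}) \<or>
     DIM('a) = 3 \<and> mesh_of \<tau> \<S> \<and>
       (\<forall>\<sigma>\<in>\<S>. corners \<sigma> \<subseteq> corners \<tau> \<union> edge_midpoints \<tau>) \<and>
       1 \<le> card (refined_edges \<tau> \<S>) \<and> card (refined_edges \<tau> \<S>) < 6"


section \<open>Red-green refinement sequences\<close>

definition sons :: "(nat \<Rightarrow> 'a::euclidean_space set set) \<Rightarrow> nat \<Rightarrow> 'a set \<Rightarrow> 'a set set" where
  "sons T j \<tau> = {\<sigma> \<in> T (Suc j). \<sigma> \<subseteq> \<tau>}"

definition level :: "(nat \<Rightarrow> 'a::euclidean_space set set) \<Rightarrow> 'a set \<Rightarrow> nat" where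
  "level T \<tau> = (LEAST j. \<tau> \<in> T j)"

definition irregular :: "(nat \<Rightarrow> 'a::euclidean_space set set) \<Rightarrow> 'a set \<Rightarrow> bool" where
  "irregular T \<sigma> \<longleftrightarrow> (\<exists>j. \<exists>\<tau>\<in>T j. irregular_refinement \<tau> (sons T j \<tau>) \<and> \<sigma> \<in> sons T j \<tau>)"

text \<open>
  A simplex of \<open>T j\<close> is refined in the construction of \<open>T (Suc j)\<close> iff it is not in \<open>T (Suc j)\<close>.
\<close>

locale red_green_sequence =
  fixes \<Omega> :: "'a::euclidean_space set"
    and T :: "nat \<Rightarrow> 'a set set"
  assumes mesh: "mesh_of (closure \<Omega>) (T j)"
    and initial_quasiuniform: "quasiuniform (T 0)"
    and refinement:
      "\<tau> \<in> T j \<Longrightarrow> sons T j \<tau> = {\<tau>} \<or> regular_refinement \<tau> (sons T j \<tau>)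
                     \<or> irregular_refinement \<tau> (sons T j \<tau>)"
    and nested: "\<sigma> \<in> T (Suc j) \<Longrightarrow> \<exists>!\<tau>. \<tau> \<in> T j \<and> \<sigma> \<subseteq> \<tau>"
    and nested_corners:
      "\<sigma> \<in> T (Suc j) \<Longrightarrow> \<tau> \<in> T j \<Longrightarrow> \<sigma> \<subseteq> \<tau> \<Longrightarrow> corners \<sigma> \<subseteq> corners \<tau> \<union> edge_midpoints \<tau>"
    and conforming: "conforming (T j)"
    and nondegenerate: "\<exists>\<theta>>0. \<forall>j. \<forall>\<tau>\<in>T j. \<forall>p\<in>corners \<tau>. \<theta> \<le> interior_angle \<tau> p"
    and irregular_final: "\<tau> \<in> T j \<Longrightarrow> irregular T \<tau> \<Longrightarrow> \<tau> \<in> T (Suc j)"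
    and refined_level: "\<tau> \<in> T j \<Longrightarrow> \<tau> \<notin> T (Suc j) \<Longrightarrow> level T \<tau> = j"
    and many_refined_edges:
      "DIM('a) = 3 \<Longrightarrow> \<tau> \<in> T j \<Longrightarrow> 3 \<le> card (refined_edges \<tau> (sons T j \<tau>)) \<Longrightarrow>
       \<not> (\<exists>F. F facet_of \<tau> \<and> \<Union>(refined_edges \<tau> (sons T j \<tau>)) \<subseteq> F) \<Longrightarrow>
       regular_refinement \<tau> (sons T j \<tau>)"


section \<open>Finite element spaces and operators\<close>

text \<open>
  Extension by zero outside \<open>\<Omega>\<close> encodes the boundary condition and makes the elements of the space
  unique as total functions.
\<close>

definition fe_space :: "'a::euclidean_space set \<Rightarrow> 'a set set \<Rightarrow> ('a \<Rightarrow> real) set" where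
  "fe_space \<Omega> \<T> =
     {u. continuous_on (closure \<Omega>) u \<and>
         (\<forall>\<tau>\<in>\<T>. \<exists>g c. \<forall>x\<in>\<tau>. u x = g \<bullet> x + c) \<and>
         (\<forall>x. x \<notin> \<Omega> \<longrightarrow> u x = 0)}"

text \<open>Only the nodes inside \<open>\<Omega>\<close> carry degrees of freedom.\<close>

definition nodal_interp ::
    "'a::euclidean_space set \<Rightarrow> 'a set set \<Rightarrow> ('a \<Rightarrow> real) \<Rightarrow> 'a \<Rightarrow> real" where
  "nodal_interp \<Omega> \<T> v =
     (THE p. p \<in> fe_space \<Omega> \<T> \<and> (\<forall>x \<in> \<Union>(corners ` \<T>) \<inter> \<Omega>. p x = v x))"

definition L2_proj ::
    "'a::euclidean_space set \<Rightarrow> 'a set set \<Rightarrow> ('a \<Rightarrow> real) \<Rightarrow> 'a \<Rightarrow> real" where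
  "L2_proj \<Omega> \<T> v =
     (THE p. p \<in> fe_space \<Omega> \<T> \<and> (\<forall>w \<in> fe_space \<Omega> \<T>. L2_inner \<Omega> (\<lambda>x. v x - p x) w = 0))"

definition linear_L2_into_fe ::
    "'a::euclidean_space set \<Rightarrow> 'a set set \<Rightarrow> (('a \<Rightarrow> real) \<Rightarrow> 'a \<Rightarrow> real) \<Rightarrow> bool" where
  "linear_L2_into_fe \<Omega> \<T> A \<longleftrightarrow>
     (\<forall>v\<in>L2 \<Omega>. A v \<in> fe_space \<Omega> \<T>) \<and>
     (\<forall>v\<in>L2 \<Omega>. \<forall>w\<in>L2 \<Omega>. A (\<lambda>x. v x + w x) = (\<lambda>x. A v x + A w x)) \<and>
     (\<forall>v\<in>L2 \<Omega>. \<forall>c. A (\<lambda>x. c * v x) = (\<lambda>x. c * A v x))"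

definition Q_factor ::
    "'a::euclidean_space set \<Rightarrow> (nat \<Rightarrow> 'a set set) \<Rightarrow> (nat \<Rightarrow> ('a \<Rightarrow> real) \<Rightarrow> 'a \<Rightarrow> real) \<Rightarrow>
     nat \<Rightarrow> ('a \<Rightarrow> real) \<Rightarrow> 'a \<Rightarrow> real" where
  "Q_factor \<Omega> T Qa i v =
     (\<lambda>x. nodal_interp \<Omega> (T i) v x
        + Qa i (\<lambda>y. nodal_interp \<Omega> (T (Suc i)) v y - nodal_interp \<Omega> (T i) v y) x)"

text \<open>
  The composition \<open>Q_factor k \<circ> \<dots> \<circ> Q_factor (J - 1)\<close>; the integer index admits \<open>k = -1\<close>, and
  \<open>k = J\<close> gives the identity.
\<close>

definition Q_tilde ::
    "'a::euclidean_space set \<Rightarrow> (nat \<Rightarrow> 'a set set) \<Rightarrow> (nat \<Rightarrow> ('a \<Rightarrow> real) \<Rightarrow> 'a \<Rightarrow> real) \<Rightarrow>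
     nat \<Rightarrow> int \<Rightarrow> ('a \<Rightarrow> real) \<Rightarrow> 'a \<Rightarrow> real" where
  "Q_tilde \<Omega> T Qa J k =
     (if k < 0 then (\<lambda>u x. 0)
      else foldr (\<circ>) (map (Q_factor \<Omega> T Qa) [nat k..<J]) id)"

end

theory Submission
  imports Defs
begin

text \<open>
  With the exact projections the product defining \<open>Q~\<^sub>j\<close> would be \<open>Q\<^sub>j\<close>. Since nodal interpolation is
  \<open>L2\<close>-stable on \<open>S\<^sub>j\<^sub>+\<^sub>1\<close>, for small \<open>\<gamma>\<close> the error \<open>Q~\<^sub>j u - Q\<^sub>j u\<close> is amplified by a factor of at most
  \<open>3/2 < 2\<close> from level \<open>j + 1\<close> to level \<open>j\<close>, so its weighted square sum is absorbed by that of the increments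
  of \<open>Q\<^sub>j u\<close>. What remains are a Jackson and a Bernstein inequality. Both rest on viewing the means of the
  gradient of \<open>u\<close> over the cells of level \<open>j\<close> as a martingale, whose fluctuations are square summable to the
  energy of \<open>u\<close>.

  Bernstein: for \<open>v\<close> in \<open>S\<^sub>k\<close>, integrating by parts against a cut-off shows that the mean gradient over a cell
  of level \<open>j < k\<close> only sees strips of width \<open>2 ^ - k\<close> along the boundary of the cell, which gains a factor
  \<open>2 ^ - ((k - j) / 2)\<close>.

  Jackson: a quasi-interpolant takes its nodal values from the affine functions with the mean gradient and the
  mean value of \<open>u\<close> on the cells. The values at a node obtained from two cells with a common facet are compared
  by integrating by parts against polynomial weights, those from two arbitrary cells by a chain of such pairs;
  at boundary nodes the same argument compares with zero. Hence the increments of the quasi-interpolants are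
  bounded by the fluctuations of finer levels.
\<close>

section \<open>Barycentric coordinates\<close>

text \<open>Local refinement is the obstacle: level \<open>j\<close> still contains cells that
  stopped being refined long before, so \<open>T j\<close> is not quasiuniform of size
  \<open>2^-j\<close>. The lower bound \<open>h0 / 2^j\<close> on diameters holds for every cell,
  the upper bound \<open>h1 / 2^j\<close> only for cells about to be refined. This is enough:
  fluctuations vanish on cells that are not refined, so estimates that need small cells only meet
  refined ones, while the Bernstein side lives on the lower bound. Integration by parts is done
  without traces or surface integrals. It always has the form that a compactly supported function,
  Lipschitz along one direction, has a directional derivative with integral zero; the weights are
  polynomials in barycentric coordinates that vanish on the facets to be avoided. The geometric
  constants have two sources: the angle bound, for shape and for the number of cells at a node, and
  the arithmetic of edge midpoints, for sizes. The threshold for \<gamma> is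
  \<open>1 / (4 * CI)\<close>, with \<open>CI\<close> the \<open>L2\<close> bound of
  \<open>v - I i v\<close> on the next finer space; the perturbation then adds at most
  \<open>2 * \<gamma> * CI \<le> 1/2\<close> to the factor one of the exact projections.\<close>

abbreviation full_simplex :: "'a::euclidean_space set => bool" where
  "full_simplex K \<equiv> int DIM('a) simplex K"

lemma full_simplex_corners:
  fixes K :: "'a::euclidean_space set"
  assumes "full_simplex K"
  shows finite_corners: "finite (corners K)"
    and card_corners: "card (corners K) = Suc DIM('a)"
    and hull_corners: "convex hull (corners K) = K"
    and indep_corners: "\<not> affine_dependent (corners K)"
proof -
  obtain C where C: "\<not> affine_dependent C" "int (card C) = int DIM('a) + 1" "K = convex hull C"
    using assms unfolding simplex_def by blast
  have "corners K = C"
    unfolding corners_def C(3) using extreme_point_of_convex_hull_affine_independent[OF C(1)] by auto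
  then show "finite (corners K)" "card (corners K) = Suc DIM('a)" "convex hull (corners K) = K"
    "\<not> affine_dependent (corners K)"
    using C aff_independent_finite by auto
qed

lemma corners_subset: "p \<in> corners K ==> p \<in> K"
  by (simp add: corners_def extreme_point_of_def)

lemma linear_functional_inner:
  fixes f :: "'a::euclidean_space => real"
  assumes "linear f" shows "\<exists>g. \<forall>x. f x = g \<bullet> x"
proof (intro exI allI)
  fix x
  have "f x = f (\<Sum>b\<in>Basis. (x \<bullet> b) *\<^sub>R b)" by (simp add: euclidean_representation)
  also have "\<dots> = (\<Sum>b\<in>Basis. (x \<bullet> b) * f b)"
    using assms by (simp add: linear_sum linear_cmul)
  also have "\<dots> = (\<Sum>b\<in>Basis. f b *\<^sub>R b) \<bullet> x"
    by (simp add: inner_sum_left mult.commute inner_commute[of x])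
  finally show "f x = (\<Sum>b\<in>Basis. f b *\<^sub>R b) \<bullet> x" .
qed

text \<open>The gradient of the barycentric coordinate of \<open>p\<close>. On a full simplex the
  vectors \<open>q - p\<close> form a basis, so the prescribed values determine it; its norm is the
  reciprocal of the height over the facet opposite to \<open>p\<close>.\<close>

definition bg :: "'a::euclidean_space set => 'a => 'a" where
  "bg K p = (SOME g. \<forall>q\<in>corners K - {p}. g \<bullet> (q - p) = - 1)"

definition lam :: "'a::euclidean_space set => 'a => 'a => real" where
  "lam K p x = 1 + bg K p \<bullet> (x - p)"

lemma bg_corner:
  assumes "full_simplex K" "p \<in> corners K" "q \<in> corners K" "q \<noteq> p"
  shows "bg K p \<bullet> (q - p) = - 1"
proof -
  let ?S = "corners K - {p}"
  have "\<not> affine_dependent (insert p ?S)"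
    using indep_corners[OF assms(1)] assms(2) by (simp add: insert_absorb)
  then have ind: "independent ((\<lambda>x. - p + x) ` ?S)"
    using affine_dependent_iff_dependent[of p ?S] by auto
  obtain f :: "'a => real" where f: "linear f" "\<And>x. x \<in> (\<lambda>x. - p + x) ` ?S ==> f x = - 1"
    using linear_independent_extend[OF ind, of "\<lambda>_. -1"] by auto
  obtain g where g: "\<And>x. f x = g \<bullet> x" using linear_functional_inner[OF f(1)] by auto
  have "\<forall>q\<in>?S. g \<bullet> (q - p) = - 1"
    using f(2) by (auto simp: g[symmetric])
  then have "\<forall>q\<in>?S. bg K p \<bullet> (q - p) = - 1" unfolding bg_def by (rule someI)
  then show ?thesis using assms by auto
qed

lemma lam_corner:
  assumes "full_simplex K" "p \<in> corners K" "q \<in> corners K"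
  shows "lam K p q = (if q = p then 1 else 0)"
  using bg_corner[OF assms] by (auto simp: lam_def)

lemma lam_diff: "lam K p x - lam K p y = bg K p \<bullet> (x - y)"
  by (simp add: lam_def algebra_simps)

lemma lam_sum:
  assumes "finite C" "sum u C = 1"
  shows "lam K p (\<Sum>q\<in>C. u q *\<^sub>R q) = (\<Sum>q\<in>C. u q * lam K p q)"
proof -
  have "lam K p (\<Sum>q\<in>C. u q *\<^sub>R q) = sum u C * (1 - bg K p \<bullet> p) + (\<Sum>q\<in>C. u q * (bg K p \<bullet> q))"
    using assms by (simp add: lam_def inner_sum_right algebra_simps)
  also have "\<dots> = (\<Sum>q\<in>C. u q * lam K p q)"
    by (simp add: lam_def sum_distrib_right sum.distrib[symmetric] algebra_simps)
  finally show ?thesis .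
qed

lemma lam_coeff:
  assumes "full_simplex K" "C \<subseteq> corners K" "sum u C = 1" "p \<in> corners K"
  shows "lam K p (\<Sum>q\<in>C. u q *\<^sub>R q) = (if p \<in> C then u p else 0)"
proof -
  have fin: "finite C" using assms(1,2) finite_corners finite_subset by blast
  have "lam K p (\<Sum>q\<in>C. u q *\<^sub>R q) = (\<Sum>q\<in>C. u q * (if q = p then 1 else 0))"
    unfolding lam_sum[OF fin assms(3)]
    by (intro sum.cong refl arg_cong2[of _ _ _ _ times] lam_corner[OF assms(1,4)]) (use assms in auto)
  also have "\<dots> = (if p \<in> C then u p else 0)" using fin by (simp add: if_distrib sum.delta cong: if_cong)
  finally show ?thesis .
qed

lemma lam_repr:
  assumes "full_simplex (K :: 'a::euclidean_space set)"
  shows lam_sum_1: "(\<Sum>p\<in>corners K. lam K p x) = 1"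
    and lam_sum_x: "(\<Sum>p\<in>corners K. lam K p x *\<^sub>R p) = x"
proof -
  have "affine hull corners K = UNIV"
    using affine_independent_span_eq indep_corners[OF assms] card_corners[OF assms] by blast
  then obtain u where u: "sum u (corners K) = 1" "(\<Sum>q\<in>corners K. u q *\<^sub>R q) = x"
    using affine_hull_finite[OF finite_corners[OF assms]] by blast
  have "lam K p x = u p" if "p \<in> corners K" for p
    using lam_coeff[OF assms subset_refl u(1) that] u(2) that by simp
  with u show "(\<Sum>p\<in>corners K. lam K p x) = 1" "(\<Sum>p\<in>corners K. lam K p x *\<^sub>R p) = x"
    by simp_all
qed

lemma mem_convex_hull_corners:
  assumes "full_simplex K" "C \<subseteq> corners K"
  shows "x \<in> convex hull C \<longleftrightarrow>
    (\<forall>p\<in>corners K. lam K p x \<ge> 0) \<and> (\<forall>p\<in>corners K - C. lam K p x = 0)"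
proof -
  have fin: "finite C" using assms finite_corners finite_subset by blast
  show ?thesis
  proof
    assume "x \<in> convex hull C"
    then obtain u where u: "\<forall>q\<in>C. 0 \<le> u q" "sum u C = 1" "(\<Sum>q\<in>C. u q *\<^sub>R q) = x"
      unfolding convex_hull_finite[OF fin] by blast
    show "(\<forall>p\<in>corners K. lam K p x \<ge> 0) \<and> (\<forall>p\<in>corners K - C. lam K p x = 0)"
      using lam_coeff[OF assms u(2)] u by auto
  next
    assume *: "(\<forall>p\<in>corners K. lam K p x \<ge> 0) \<and> (\<forall>p\<in>corners K - C. lam K p x = 0)"
    have "(\<Sum>p\<in>C. lam K p x) = 1"
      using lam_sum_1[OF assms(1), of x] * assms(2) finite_corners[OF assms(1)]
      by (subst (asm) sum.mono_neutral_right[of _ C]) auto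
    moreover have "(\<Sum>p\<in>C. lam K p x *\<^sub>R p) = x"
      using lam_sum_x[OF assms(1), of x] * assms(2) finite_corners[OF assms(1)]
      by (subst (asm) sum.mono_neutral_right[of _ C]) auto
    ultimately show "x \<in> convex hull C"
      unfolding convex_hull_finite[OF fin] using * assms(2) by (intro CollectI exI[of _ "\<lambda>p. lam K p x"]) auto
  qed
qed

lemma mem_simplex_iff:
  assumes "full_simplex K"
  shows "x \<in> K \<longleftrightarrow> (\<forall>p\<in>corners K. lam K p x \<ge> 0)"
  using mem_convex_hull_corners[OF assms subset_refl, of x] hull_corners[OF assms] by simp

lemma lam_le_1:
  assumes "full_simplex K" "x \<in> K" "p \<in> corners K"
  shows "lam K p x \<le> 1"
proof -
  have "lam K p x \<le> (\<Sum>q\<in>corners K. lam K q x)"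
    using assms mem_simplex_iff[OF assms(1)] finite_corners[OF assms(1)]
    by (intro member_le_sum) auto
  then show ?thesis using lam_sum_1[OF assms(1)] by simp
qed

lemma continuous_on_lam: "continuous_on S (lam K p)"
  unfolding lam_def by (intro continuous_intros)

lemma other_corner:
  assumes "full_simplex (K :: 'a::euclidean_space set)"
  obtains q where "q \<in> corners K" "q \<noteq> p"
proof -
  have "\<not> corners K \<subseteq> {p}"
    using card_corners[OF assms] DIM_positive[where 'a='a] card_mono[of "{p}" "corners K"] by auto
  then show ?thesis using that by auto
qed

lemma mem_interior_simplex_iff:
  assumes "full_simplex K"
  shows "x \<in> interior K \<longleftrightarrow> (\<forall>p\<in>corners K. lam K p x > 0)"
proof
  assume R: "\<forall>p\<in>corners K. lam K p x > 0"
  have "open (\<Inter>p\<in>corners K. {y. lam K p y > 0})"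
    using finite_corners[OF assms] continuous_on_lam
    by (intro open_INT ballI open_Collect_less) auto
  moreover have "(\<Inter>p\<in>corners K. {y. lam K p y > 0}) \<subseteq> K"
    using mem_simplex_iff[OF assms] by (auto intro: less_imp_le)
  ultimately show "x \<in> interior K" using R by (auto intro: interiorI)
next
  assume "x \<in> interior K"
  then obtain e where e: "e > 0" "cball x e \<subseteq> K" using mem_interior_cball by blast
  show "\<forall>p\<in>corners K. lam K p x > 0"
  proof
    fix p assume p: "p \<in> corners K"
    obtain q where q: "q \<in> corners K" "q \<noteq> p" using other_corner[OF assms] .
    then have nz: "bg K p \<noteq> 0" using bg_corner[OF assms p q(1)] by auto
    \<comment> \<open>Steepest descent inside the ball: the coordinate drops by
      \<open>e * norm (bg K p)\<close> and is still nonnegative.\<close>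
    define y where "y = x - (e / norm (bg K p)) *\<^sub>R bg K p"
    have "y \<in> cball x e" using nz e by (simp add: y_def dist_norm)
    then have "lam K p y \<ge> 0" using e p mem_simplex_iff[OF assms] by blast
    moreover have "lam K p x - lam K p y = e * norm (bg K p)"
      unfolding lam_diff y_def using nz by (simp add: dot_square_norm power2_eq_square)
    moreover have "e * norm (bg K p) > 0" using e nz by simp
    ultimately show "lam K p x > 0" by linarith
  qed
qed

lemma bg_nonzero:
  assumes "full_simplex (K :: 'a::euclidean_space set)" "p \<in> corners K"
  shows "bg K p \<noteq> 0"
proof -
  obtain q where q: "q \<in> corners K" "q \<noteq> p" using other_corner[OF assms(1)] .
  then show ?thesis using bg_corner[OF assms q(1)] by auto
qed

lemma full_simplex_props:
  assumes "full_simplex (K :: 'a::euclidean_space set)"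
  shows convex_fs: "convex K" and compact_fs: "compact K" and closed_fs: "closed K"
    and bounded_fs: "bounded K" and lmeasurable_fs: "K \<in> lmeasurable" and sets_fs: "K \<in> sets lebesgue"
  using assms convex_simplex compact_simplex closed_simplex compact_imp_bounded lmeasurable_compact by blast+

text \<open>A sample point with known coordinates: for all corners it lies in the interior of the
  cell, for all corners but one in the relative interior of a facet.\<close>

definition centroid :: "'a::euclidean_space set => 'a" where
  "centroid C = (\<Sum>p\<in>C. (1 / card C) *\<^sub>R p)"

lemma lam_centroid:
  assumes "full_simplex (K :: 'a::euclidean_space set)" "C \<subseteq> corners K" "C \<noteq> {}" "p \<in> corners K"
  shows "lam K p (centroid C) = (if p \<in> C then 1 / card C else 0)"
proof -
  have fin: "finite C" using assms finite_corners finite_subset by blast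
  then have "sum (\<lambda>_. 1 / real (card C)) C = 1" using assms(3) by simp
  from lam_coeff[OF assms(1,2) this assms(4)] show ?thesis by (simp add: centroid_def)
qed

lemma centroid_in_interior:
  assumes "full_simplex (K :: 'a::euclidean_space set)"
  shows "centroid (corners K) \<in> interior K"
proof -
  have "corners K \<noteq> {}" using card_corners[OF assms] by auto
  then show ?thesis
    using lam_centroid[OF assms subset_refl] finite_corners[OF assms] card_corners[OF assms]
    by (subst mem_interior_simplex_iff[OF assms]) auto
qed

lemma interior_fs_nonempty: "full_simplex K ==> interior K \<noteq> {}"
  using centroid_in_interior by blast

lemma measure_fs_pos: "full_simplex K ==> measure lebesgue K > 0"
  by (metis bounded_fs convex_fs interior_fs_nonempty measure_nonneg negligible_convex_interior
      negligible_iff_measure lmeasurable_fs order_less_le)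

lemma closure_interior_fs: "full_simplex K ==> closure (interior K) = K"
  using convex_closure_interior[of K] convex_fs interior_fs_nonempty closed_fs by (metis closure_closed)

section \<open>Affine functions on simplices\<close>

definition affine_on :: "'a::euclidean_space set => ('a => real) => bool" where
  "affine_on K u \<longleftrightarrow> (\<exists>g c. \<forall>x\<in>K. u x = g \<bullet> x + c)"

lemma affine_on_subset: "affine_on K u ==> H \<subseteq> K ==> affine_on H u"
  unfolding affine_on_def by blast

lemma affine_on_sum:
  assumes "affine_on K u" "finite C" "C \<subseteq> K" "sum w C = 1" "(\<Sum>p\<in>C. w p *\<^sub>R p) \<in> K"
  shows "u (\<Sum>p\<in>C. w p *\<^sub>R p) = (\<Sum>p\<in>C. w p * u p)"
proof -
  obtain g c where gc: "\<And>x. x \<in> K ==> u x = g \<bullet> x + c" using assms(1) unfolding affine_on_def by blast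
  have "u (\<Sum>p\<in>C. w p *\<^sub>R p) = (\<Sum>p\<in>C. w p * (g \<bullet> p)) + sum w C * c"
    using gc[OF assms(5)] assms(4) by (simp add: inner_sum_right)
  also have "\<dots> = (\<Sum>p\<in>C. w p * (g \<bullet> p + c))" by (simp add: sum_distrib_right sum.distrib distrib_left)
  also have "\<dots> = (\<Sum>p\<in>C. w p * u p)" using gc assms(3) by (intro sum.cong) auto
  finally show ?thesis .
qed

text \<open>Built from corner values alone, so it is linear in \<open>u\<close> without any
  hypothesis; for \<open>u\<close> affine on a full simplex it is the gradient.\<close>

definition gr :: "('a::euclidean_space => real) => 'a set => 'a" where
  "gr u K = (\<Sum>p\<in>corners K. u p *\<^sub>R bg K p)"

lemma affine_on_lam:
  assumes "full_simplex K" "affine_on K u" "x \<in> K"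
  shows "u x = (\<Sum>p\<in>corners K. lam K p x * u p)"
  using affine_on_sum[OF assms(2) finite_corners[OF assms(1)], of "\<lambda>p. lam K p x"]
    lam_repr[OF assms(1), of x] assms(3) corners_subset by auto

lemma affine_on_gr:
  assumes "full_simplex K" "affine_on K u" "x \<in> K" "y \<in> K"
  shows "u x - u y = gr u K \<bullet> (x - y)"
proof -
  have "u x - u y = (\<Sum>p\<in>corners K. (lam K p x - lam K p y) * u p)"
    unfolding affine_on_lam[OF assms(1,2,3)] affine_on_lam[OF assms(1,2,4)]
    by (simp add: sum_subtractf algebra_simps)
  also have "\<dots> = gr u K \<bullet> (x - y)"
    unfolding lam_diff gr_def by (simp add: inner_sum_left mult.commute)
  finally show ?thesis .
qed

lemma affine_on_eq:
  assumes "full_simplex K" "affine_on K u" "affine_on K v" "\<And>p. p \<in> corners K ==> u p = v p" "x \<in> K"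
  shows "u x = v x"
  unfolding affine_on_lam[OF assms(1,2,5)] affine_on_lam[OF assms(1,3,5)] using assms(4) by simp

text \<open>A full simplex contains a ball, in which the difference of two candidate gradients can
  be tested along its own direction.\<close>

lemma gr_unique:
  assumes "full_simplex (K :: 'a::euclidean_space set)" "\<And>x. x \<in> K ==> u x = g \<bullet> x + c"
  shows "gr u K = g"
proof -
  have aff: "affine_on K u" using assms(2) unfolding affine_on_def by blast
  obtain x e where e: "e > 0" "cball x e \<subseteq> K"
    using interior_fs_nonempty[OF assms(1)] mem_interior_cball by blast
  let ?h = "gr u K - g"
  have x: "x \<in> K" using e by auto
  have "e *\<^sub>R sgn ?h + x \<in> cball x e" using e by (simp add: dist_norm norm_sgn)
  then have y: "e *\<^sub>R sgn ?h + x \<in> K" using e by blast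
  have "gr u K \<bullet> (e *\<^sub>R sgn ?h) = g \<bullet> (e *\<^sub>R sgn ?h)"
    using affine_on_gr[OF assms(1) aff y x] assms(2)[OF x] assms(2)[OF y] by (auto simp: inner_add_right)
  then have "gr u K \<bullet> sgn ?h = g \<bullet> sgn ?h" using e(1) by simp
  then have "?h \<bullet> sgn ?h = 0" by (simp add: inner_diff_left)
  then show ?thesis by (auto simp: sgn_div_norm)
qed

lemma gr_affine_subset:
  assumes "full_simplex K" "full_simplex H" "H \<subseteq> K" "affine_on K u"
  shows "gr u H = gr u K"
proof -
  obtain g c where gc: "\<And>x. x \<in> K ==> u x = g \<bullet> x + c" using assms(4) unfolding affine_on_def by blast
  have "gr u K = g" using gr_unique[OF assms(1) gc] by simp
  moreover have "gr u H = g" using gr_unique[OF assms(2), of u g c] gc assms(3) by auto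
  ultimately show ?thesis by simp
qed

lemma gr_diff: "gr (\<lambda>x. u x - v x) K = gr u K - gr v K"
  by (simp add: gr_def scaleR_left_diff_distrib sum_subtractf)

lemma gr_sum: "gr (\<lambda>x. \<Sum>i\<in>I. u i x) K = (\<Sum>i\<in>I. gr (u i) K)"
  unfolding gr_def by (subst sum.swap) (simp add: scaleR_sum_left)

lemma affine_on_continuous: "affine_on K u ==> continuous_on K u"
proof -
  assume "affine_on K u"
  then obtain g c where gc: "\<And>x. x \<in> K ==> u x = g \<bullet> x + c" unfolding affine_on_def by blast
  have "continuous_on K (\<lambda>x. g \<bullet> x + c)" by (intro continuous_intros)
  then show ?thesis using gc by (subst continuous_on_cong[OF refl gc]) auto
qed

lemma affine_on_ops:
  assumes "affine_on K u" "affine_on K v"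
  shows affine_on_add: "affine_on K (\<lambda>x. u x + v x)"
    and affine_on_diff: "affine_on K (\<lambda>x. u x - v x)"
    and affine_on_cmult: "\<And>e. affine_on K (\<lambda>x. e * u x)"
proof -
  obtain g c where gc: "\<And>x. x \<in> K ==> u x = g \<bullet> x + c" using assms(1) unfolding affine_on_def by blast
  obtain h d where hd: "\<And>x. x \<in> K ==> v x = h \<bullet> x + d" using assms(2) unfolding affine_on_def by blast
  show "affine_on K (\<lambda>x. u x + v x)" unfolding affine_on_def
    by (rule exI[of _ "g + h"], rule exI[of _ "c + d"]) (simp add: gc hd inner_add_left)
  show "affine_on K (\<lambda>x. u x - v x)" unfolding affine_on_def
    by (rule exI[of _ "g - h"], rule exI[of _ "c - d"]) (simp add: gc hd inner_diff_left)
  show "affine_on K (\<lambda>x. e * u x)" for e unfolding affine_on_def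
    by (rule exI[of _ "e *\<^sub>R g"], rule exI[of _ "e * c"]) (simp add: gc algebra_simps)
qed

lemma affine_on_abs_le_corners:
  assumes "full_simplex K" "affine_on K u" "x \<in> K" "\<And>p. p \<in> corners K ==> \<bar>u p\<bar> \<le> B"
  shows "\<bar>u x\<bar> \<le> B"
proof -
  have "\<bar>u x\<bar> \<le> (\<Sum>p\<in>corners K. \<bar>lam K p x * u p\<bar>)"
    unfolding affine_on_lam[OF assms(1-3)] by (rule sum_abs)
  also have "\<dots> \<le> (\<Sum>p\<in>corners K. lam K p x * B)"
    using assms mem_simplex_iff[OF assms(1)] by (intro sum_mono) (auto simp: abs_mult intro!: mult_left_mono)
  also have "\<dots> = B" using lam_sum_1[OF assms(1)] by (simp add: sum_distrib_right[symmetric])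
  finally show ?thesis .
qed

section \<open>Square integrable functions\<close>

lemma L2_inner_commute: "L2_inner \<Omega> v w = L2_inner \<Omega> w v"
  by (simp add: L2_inner_def mult.commute)

lemma L2_prod_integrable:
  assumes "v \<in> L2 \<Omega>" "w \<in> L2 \<Omega>"
  shows "integrable (lebesgue_on \<Omega>) (\<lambda>x. v x * w x)"
proof (rule Bochner_Integration.integrable_bound)
  show "integrable (lebesgue_on \<Omega>) (\<lambda>x. (v x)\<^sup>2 + (w x)\<^sup>2)"
    using assms by (auto simp: L2_def)
  show "(\<lambda>x. v x * w x) \<in> borel_measurable (lebesgue_on \<Omega>)"
    using assms by (auto simp: L2_def)
  have "\<bar>a * b\<bar> \<le> a\<^sup>2 + b\<^sup>2" for a b :: real
  proof -
    have "0 \<le> (\<bar>a\<bar> - \<bar>b\<bar>)\<^sup>2" by simp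
    then have "2 * (\<bar>a\<bar> * \<bar>b\<bar>) \<le> a\<^sup>2 + b\<^sup>2" by (simp add: power2_eq_square algebra_simps)
    moreover have "0 \<le> \<bar>a\<bar> * \<bar>b\<bar>" by simp
    ultimately show ?thesis unfolding abs_mult by linarith
  qed
  then show "AE x in lebesgue_on \<Omega>. norm (v x * w x) \<le> norm ((v x)\<^sup>2 + (w x)\<^sup>2)" by simp
qed

lemma L2_add: assumes "v \<in> L2 \<Omega>" "w \<in> L2 \<Omega>" shows "(\<lambda>x. v x + w x) \<in> L2 \<Omega>"
proof -
  have "integrable (lebesgue_on \<Omega>) (\<lambda>x. (v x)\<^sup>2 + (w x)\<^sup>2 + 2 * (v x * w x))"
    using assms L2_prod_integrable[OF assms] by (auto simp: L2_def)
  moreover have "(\<lambda>x. (v x)\<^sup>2 + (w x)\<^sup>2 + 2 * (v x * w x)) = (\<lambda>x. (v x + w x)\<^sup>2)"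
    by (auto simp: power2_sum algebra_simps)
  ultimately show ?thesis using assms by (auto simp: L2_def)
qed

lemma L2_cmult: assumes "v \<in> L2 \<Omega>" shows "(\<lambda>x. c * v x) \<in> L2 \<Omega>"
  using assms by (auto simp: L2_def power_mult_distrib)

lemma L2_diff: assumes "v \<in> L2 \<Omega>" "w \<in> L2 \<Omega>" shows "(\<lambda>x. v x - w x) \<in> L2 \<Omega>"
  using L2_add[OF assms(1) L2_cmult[OF assms(2), of "-1"]] by simp

lemma L2_zero: "(\<lambda>x. 0) \<in> L2 \<Omega>"
  by (simp add: L2_def)

lemma L2_sum: "(\<And>i. i \<in> I ==> v i \<in> L2 \<Omega>) ==> (\<lambda>x. \<Sum>i\<in>I. v i x) \<in> L2 \<Omega>"
  by (induction I rule: infinite_finite_induct) (auto intro: L2_zero L2_add)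

lemma L2_inner_add_left:
  assumes "v \<in> L2 \<Omega>" "w \<in> L2 \<Omega>" "z \<in> L2 \<Omega>"
  shows "L2_inner \<Omega> (\<lambda>x. v x + w x) z = L2_inner \<Omega> v z + L2_inner \<Omega> w z"
  unfolding L2_inner_def using L2_prod_integrable[OF assms(1,3)] L2_prod_integrable[OF assms(2,3)] by (simp add: distrib_right)

lemma L2_inner_cmult_left: "L2_inner \<Omega> (\<lambda>x. c * v x) z = c * L2_inner \<Omega> v z"
  unfolding L2_inner_def by (simp add: mult.assoc)

lemma L2_inner_diff_left:
  assumes "v \<in> L2 \<Omega>" "w \<in> L2 \<Omega>" "z \<in> L2 \<Omega>"
  shows "L2_inner \<Omega> (\<lambda>x. v x - w x) z = L2_inner \<Omega> v z - L2_inner \<Omega> w z"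
  unfolding L2_inner_def using L2_prod_integrable[OF assms(1,3)] L2_prod_integrable[OF assms(2,3)] by (simp add: left_diff_distrib)

lemma L2_inner_nonneg: "0 \<le> L2_inner \<Omega> v v"
  unfolding L2_inner_def by simp

lemma L2_norm_nonneg: "0 \<le> L2_norm \<Omega> v"
  by (simp add: L2_norm_def L2_inner_nonneg)

lemma L2_norm_sq: "(L2_norm \<Omega> v)\<^sup>2 = L2_inner \<Omega> v v"
  by (simp add: L2_norm_def L2_inner_nonneg)

lemma L2_inner_expand:
  assumes "v \<in> L2 \<Omega>" "w \<in> L2 \<Omega>"
  shows "L2_inner \<Omega> (\<lambda>x. v x + c * w x) (\<lambda>x. v x + c * w x)
    = L2_inner \<Omega> v v + 2 * c * L2_inner \<Omega> v w + c\<^sup>2 * L2_inner \<Omega> w w"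
proof -
  have cw: "(\<lambda>x. c * w x) \<in> L2 \<Omega>" and vw: "(\<lambda>x. v x + c * w x) \<in> L2 \<Omega>"
    using assms L2_cmult L2_add by blast+
  have "L2_inner \<Omega> (\<lambda>x. v x + c * w x) (\<lambda>x. v x + c * w x)
    = L2_inner \<Omega> v (\<lambda>x. v x + c * w x) + c * L2_inner \<Omega> w (\<lambda>x. v x + c * w x)"
    unfolding L2_inner_add_left[OF assms(1) cw vw] L2_inner_cmult_left ..
  also have "L2_inner \<Omega> v (\<lambda>x. v x + c * w x) = L2_inner \<Omega> v v + c * L2_inner \<Omega> v w"
    using L2_inner_add_left[OF assms(1) cw assms(1)]
    unfolding L2_inner_cmult_left by (metis L2_inner_commute)
  also have "L2_inner \<Omega> w (\<lambda>x. v x + c * w x) = L2_inner \<Omega> v w + c * L2_inner \<Omega> w w"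
    using L2_inner_add_left[OF assms(1) cw assms(2)]
    unfolding L2_inner_cmult_left by (metis L2_inner_commute)
  finally show ?thesis by (simp add: power2_eq_square algebra_simps)
qed

lemma L2_Cauchy_Schwarz:
  assumes "v \<in> L2 \<Omega>" "w \<in> L2 \<Omega>"
  shows "\<bar>L2_inner \<Omega> v w\<bar> \<le> L2_norm \<Omega> v * L2_norm \<Omega> w"
proof -
  let ?a = "L2_inner \<Omega> w w" and ?b = "L2_inner \<Omega> v w" and ?c = "L2_inner \<Omega> v v"
  have q: "0 \<le> ?c + 2 * t * ?b + t\<^sup>2 * ?a" for t
    using L2_inner_expand[OF assms, of t] L2_inner_nonneg[of \<Omega> "\<lambda>x. v x + t * w x"] by simp
  have "?b\<^sup>2 \<le> ?c * ?a"
  proof (cases "?a = 0")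
    case True
    have "?b = 0"
    proof (rule ccontr)
      assume b: "?b \<noteq> 0"
      \<comment> \<open>With \<open>?a = 0\<close> the quadratic is affine in \<open>t\<close>; at
        this \<open>t\<close> it takes the value \<open>- 1\<close> unless \<open>?b\<close>
        vanishes.\<close>
      have "0 \<le> ?c + 2 * (- (?c + 1) / (2 * ?b)) * ?b"
        using q[of "- (?c + 1) / (2 * ?b)"] True by simp
      also have "\<dots> = - 1" using b by (simp add: field_simps)
      finally show False by simp
    qed
    then show ?thesis using True by simp
  next
    case False
    then have a: "?a > 0" using L2_inner_nonneg[of \<Omega> w] by simp
    have "0 \<le> ?c + 2 * (- ?b / ?a) * ?b + (- ?b / ?a)\<^sup>2 * ?a" by (rule q)
    also have "\<dots> = ?c - ?b\<^sup>2 / ?a" using a by (simp add: field_simps power2_eq_square)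
    finally show ?thesis using a by (simp add: field_simps)
  qed
  then have "sqrt (?b\<^sup>2) \<le> sqrt (?c * ?a)" by (rule real_sqrt_le_mono)
  then show ?thesis by (simp add: L2_norm_def real_sqrt_mult)
qed

lemma L2_norm_triangle:
  assumes "v \<in> L2 \<Omega>" "w \<in> L2 \<Omega>"
  shows "L2_norm \<Omega> (\<lambda>x. v x + w x) \<le> L2_norm \<Omega> v + L2_norm \<Omega> w"
proof (rule power2_le_imp_le)
  show "(L2_norm \<Omega> (\<lambda>x. v x + w x))\<^sup>2 \<le> (L2_norm \<Omega> v + L2_norm \<Omega> w)\<^sup>2"
    using L2_inner_expand[OF assms, of 1] L2_Cauchy_Schwarz[OF assms]
    by (simp add: L2_norm_sq power2_sum)
qed (simp add: L2_norm_nonneg)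

lemma L2_norm_cmult: "L2_norm \<Omega> (\<lambda>x. c * v x) = \<bar>c\<bar> * L2_norm \<Omega> v"
proof -
  have "L2_inner \<Omega> (\<lambda>x. c * v x) (\<lambda>x. c * v x) = c\<^sup>2 * L2_inner \<Omega> v v"
    by (simp add: L2_inner_def power2_eq_square mult_ac)
  then show ?thesis by (simp add: L2_norm_def real_sqrt_mult)
qed

lemma L2_norm_diff:
  assumes "v \<in> L2 \<Omega>" "w \<in> L2 \<Omega>"
  shows "L2_norm \<Omega> (\<lambda>x. v x - w x) \<le> L2_norm \<Omega> v + L2_norm \<Omega> w"
  using L2_norm_triangle[OF assms(1) L2_cmult[OF assms(2), of "-1"]] L2_norm_cmult[of \<Omega> "-1" w] by simp

lemma L2_norm_sum:
  assumes "\<And>i. i \<in> I ==> v i \<in> L2 \<Omega>"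
  shows "L2_norm \<Omega> (\<lambda>x. \<Sum>i\<in>I. v i x) \<le> (\<Sum>i\<in>I. L2_norm \<Omega> (v i))"
  using assms
proof (induction I rule: infinite_finite_induct)
  case (insert i I)
  have "L2_norm \<Omega> (\<lambda>x. v i x + (\<Sum>i\<in>I. v i x)) \<le> L2_norm \<Omega> (v i) + L2_norm \<Omega> (\<lambda>x. \<Sum>i\<in>I. v i x)"
    using insert.prems by (intro L2_norm_triangle L2_sum) auto
  also have "\<dots> \<le> L2_norm \<Omega> (v i) + (\<Sum>i\<in>I. L2_norm \<Omega> (v i))"
    using insert by auto
  finally show ?case using insert.hyps by simp
qed (auto simp: L2_norm_def L2_inner_def)

section \<open>Conforming meshes\<close>

lemma ball_meets_only_containing:
  assumes "finite \<T>" "\<And>H. H \<in> \<T> ==> closed H"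
  shows "\<exists>e>0. \<forall>H\<in>\<T>. H \<inter> ball x e \<noteq> {} \<longrightarrow> (x::'a::metric_space) \<in> H"
proof -
  have "closed (\<Union>{H \<in> \<T>. x \<notin> H})" using assms by (intro closed_Union) auto
  then have "open (- \<Union>{H \<in> \<T>. x \<notin> H})" by (simp add: open_Compl)
  then obtain e where "e > 0" "ball x e \<subseteq> - \<Union>{H \<in> \<T>. x \<notin> H}" using open_contains_ball by blast
  then show ?thesis by blast
qed

locale conf_mesh =
  fixes \<Omega> :: "'a::euclidean_space set" and \<T> :: "'a set set"
  assumes open_dom: "open \<Omega>"
    and regular_dom: "interior (closure \<Omega>) = \<Omega>"
    and is_mesh: "mesh_of (closure \<Omega>) \<T>"
    and is_conforming: "conforming \<T>"
begin

lemma finite_mesh: "finite \<T>" and full: "K \<in> \<T> ==> full_simplex K"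
  and Union_mesh: "\<Union>\<T> = closure \<Omega>"
  using is_mesh by (auto simp: mesh_of_def)

text \<open>The common face is the hull of some corners of \<open>H\<close>; these are extreme
  points of a face of \<open>K\<close>, hence corners of \<open>K\<close> as well.\<close>

lemma inter_hull:
  assumes "H \<in> \<T>" "K \<in> \<T>"
  shows "H \<inter> K = convex hull (corners H \<inter> corners K)"
proof (cases "H = K")
  case True then show ?thesis using hull_corners[OF full[OF assms(1)]] by simp
next
  case False
  show ?thesis
  proof (cases "H \<inter> K = {}")
    case True
    then have "corners H \<inter> corners K = {}" using corners_subset by blast
    then show ?thesis using True by simp
  next
    case ne: False
    have f: "(H \<inter> K) face_of H" "(H \<inter> K) face_of K"
      using is_conforming assms False ne unfolding conforming_def by blast+
    have "H \<inter> K face_of convex hull (corners H)" using f(1) hull_corners[OF full[OF assms(1)]] by simp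
    then obtain C where C: "C \<subseteq> corners H" "H \<inter> K = convex hull C"
      unfolding face_of_convex_hull_affine_independent[OF indep_corners[OF full[OF assms(1)]]] by blast
    have indC: "\<not> affine_dependent C"
      using C(1) indep_corners[OF full[OF assms(1)]] affine_dependent_subset by blast
    have "C \<subseteq> corners K"
    proof
      fix p assume "p \<in> C"
      then have "p extreme_point_of (H \<inter> K)"
        using extreme_point_of_convex_hull_affine_independent[OF indC] C(2) by simp
      then show "p \<in> corners K" using extreme_point_of_face[OF f(2)] by (simp add: corners_def)
    qed
    then have "convex hull C \<subseteq> convex hull (corners H \<inter> corners K)" using C(1) by (intro hull_mono) auto
    moreover have "convex hull (corners H \<inter> corners K) \<subseteq> H \<inter> K"
      using hull_mono[of "corners H \<inter> corners K" "corners H" convex] hull_mono[of "corners H \<inter> corners K" "corners K" convex]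
        hull_corners[OF full[OF assms(1)]] hull_corners[OF full[OF assms(2)]] by simp
    ultimately show ?thesis using C(2) by blast
  qed
qed

text \<open>A point of two cells lies in the hull of the shared corners, where the coordinates of
  all other corners vanish.\<close>

lemma lam_pos_common:
  assumes "H \<in> \<T>" "K \<in> \<T>" "x \<in> H" "x \<in> K" "p \<in> corners K" "lam K p x > 0"
  shows "p \<in> corners H"
proof -
  have "x \<in> convex hull (corners H \<inter> corners K)" using inter_hull assms by blast
  then show ?thesis
    using mem_convex_hull_corners[OF full[OF assms(2)] Int_lower2, of x "corners H"] assms(5,6) by force
qed

lemma lam_common:
  assumes "H \<in> \<T>" "K \<in> \<T>" "x \<in> H" "x \<in> K" "p \<in> corners H \<inter> corners K"
  shows "lam H p x = lam K p x"
proof -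
  let ?C = "corners H \<inter> corners K"
  have "x \<in> convex hull ?C" using inter_hull assms by blast
  then obtain u where u: "sum u ?C = 1" "(\<Sum>q\<in>?C. u q *\<^sub>R q) = x"
    using convex_hull_finite[of ?C] finite_corners[OF full[OF assms(1)]] by auto
  then show ?thesis
    using lam_coeff[OF full[OF assms(1)] _ u(1), of p] lam_coeff[OF full[OF assms(2)] _ u(1), of p] assms(5) by auto
qed

lemma corner_common:
  assumes "H \<in> \<T>" "K \<in> \<T>" "p \<in> H" "p \<in> corners K"
  shows "p \<in> corners H"
  using lam_pos_common[OF assms(1,2,3) corners_subset assms(4)] lam_corner[OF full[OF assms(2)] assms(4,4)] assms by simp

text \<open>All coordinates of \<open>K\<close> are positive at \<open>x\<close>, so
  \<open>H\<close> contains every corner of \<open>K\<close> and, by counting, no other.\<close>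

lemma interior_unique:
  assumes "H \<in> \<T>" "K \<in> \<T>" "x \<in> H" "x \<in> interior K"
  shows "H = K"
proof -
  have "corners K \<subseteq> corners H"
    using lam_pos_common[OF assms(1-3)] mem_interior_simplex_iff[OF full[OF assms(2)]] assms(4) interior_subset by blast
  then have "corners K = corners H"
    by (rule card_subset_eq[OF finite_corners[OF full[OF assms(1)]]])
      (simp add: card_corners full assms(1,2))
  then show ?thesis using hull_corners[OF full[OF assms(1)]] hull_corners[OF full[OF assms(2)]] by simp
qed

text \<open>Points \<open>y\<close> near \<open>x\<close> are moved towards \<open>z\<close>, where they lie in a cell containing \<open>z\<close>, and back.\<close>

lemma mem_dom_transfer:
  assumes K: "K \<in> \<T>" and x: "x \<in> K" and z: "z \<in> K" "z \<in> \<Omega>"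
    and eq: "\<And>q. q \<in> corners K ==> lam K q z > 0 ==> lam K q x > 0"
  shows "x \<in> \<Omega>"
proof -
  obtain e where e: "e > 0" "ball z e \<subseteq> \<Omega>" "\<And>H. H \<in> \<T> ==> H \<inter> ball z e \<noteq> {} ==> z \<in> H"
  proof -
    obtain e1 where "e1 > 0" "ball z e1 \<subseteq> \<Omega>" using z open_dom open_contains_ball by blast
    moreover obtain e2 where "e2 > 0" "\<forall>H\<in>\<T>. H \<inter> ball z e2 \<noteq> {} \<longrightarrow> z \<in> H"
      using ball_meets_only_containing[OF finite_mesh closed_fs[OF full]] by blast
    moreover have "ball z (min e1 e2) \<subseteq> ball z e1" "ball z (min e1 e2) \<subseteq> ball z e2" by auto
    ultimately show ?thesis by (intro that[of "min e1 e2"]) (simp, blast+)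
  qed
  \<comment> \<open>Small enough for \<open>w\<close>, the contraction towards \<open>z\<close>, to
    bring \<open>x\<close> into the ball around \<open>z\<close>.\<close>
  define s where "s = min 1 (e / (norm (x - z) + 1))"
  have s: "0 < s" "s \<le> 1" using e(1) by (auto simp: s_def add_nonneg_pos)
  define w where "w y = z + s *\<^sub>R (y - z)" for y
  have wl: "lam H q (w y) = (1 - s) * lam H q z + s * lam H q y" for H q y
    by (simp add: w_def lam_def inner_diff_right inner_add_right algebra_simps)
  have "s * norm (x - z) \<le> e / (norm (x - z) + 1) * norm (x - z)" unfolding s_def by (intro mult_right_mono) auto
  also have "\<dots> < e" using e(1) by (simp add: pos_divide_less_eq add_pos_nonneg add.commute[of _ 1] distrib_left)
  finally have wx: "w x \<in> ball z e" using s by (simp add: w_def dist_norm)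
  have wxK: "w x \<in> K" unfolding mem_simplex_iff[OF full[OF K]] wl using s x z mem_simplex_iff[OF full[OF K]] by simp
  obtain e' where e': "e' > 0" "\<forall>H\<in>\<T>. H \<inter> ball (w x) e' \<noteq> {} \<longrightarrow> w x \<in> H"
    using ball_meets_only_containing[OF finite_mesh closed_fs[OF full], of "w x"] by auto
  \<comment> \<open>For \<open>y\<close> near \<open>x\<close> the contracted point stays near
    \<open>z\<close>, hence in a cell containing \<open>z\<close>. In that cell the coordinates
    positive at \<open>z\<close> are positive at \<open>x\<close> and so at \<open>y\<close>; those
    vanishing at \<open>z\<close> keep their sign under the contraction.\<close>
  let ?U = "(w -` (ball z e \<inter> ball (w x) e')) \<inter> (\<Inter>H\<in>\<T>. \<Inter>q\<in>{q \<in> corners H. lam H q x > 0}. {y. lam H q y > 0})"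
  have "open ?U"
  proof (intro open_Int open_INT ballI finite_mesh open_Collect_less continuous_on_const continuous_on_lam)
    show "open (w -` (ball z e \<inter> ball (w x) e'))"
      unfolding w_def by (intro open_vimage continuous_intros open_Int open_ball)
    show "finite {q \<in> corners H. lam H q x > 0}" if "H \<in> \<T>" for H using finite_corners[OF full[OF that]] by simp
  qed
  moreover have "x \<in> ?U" using wx e'(1) by simp
  moreover have "?U \<subseteq> closure \<Omega>"
  proof
    fix y assume y: "y \<in> ?U"
    then have wy: "w y \<in> ball z e" "w y \<in> ball (w x) e'" by auto
    then obtain H where H: "H \<in> \<T>" "w y \<in> H" using e(2) Union_mesh closure_subset by blast
    have zH: "z \<in> H" and wxH: "w x \<in> H" using e(3)[OF H(1)] bspec[OF e'(2) H(1)] H(2) wy by blast+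
    have "lam H r y \<ge> 0" if r: "r \<in> corners H" for r
    proof (cases "lam H r z > 0")
      case True
      then have rK: "r \<in> corners H \<inter> corners K" using lam_pos_common[OF K H(1) z(1) zH r] r by blast
      have "lam H r z = lam K r z" "lam H r (w x) = lam K r (w x)"
        using lam_common[OF H(1) K _ _ rK] zH z(1) wxH wxK by blast+
      then have "lam H r x = lam K r x" "lam K r z > 0" using True s unfolding wl by auto
      then have "lam H r x > 0" using eq rK by auto
      then show ?thesis using y H(1) r by (auto intro: less_imp_le)
    next
      case False
      then have "lam H r z = 0" using zH r mem_simplex_iff[OF full[OF H(1)], of z] by force
      then have "0 \<le> s * lam H r y" using wl[of H r y] H(2) r mem_simplex_iff[OF full[OF H(1)], of "w y"] by auto
      then show ?thesis using s by (simp add: zero_le_mult_iff)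
    qed
    then have "y \<in> H" using mem_simplex_iff[OF full[OF H(1)]] by blast
    then show "y \<in> closure \<Omega>" using H(1) Union_mesh by blast
  qed
  ultimately have "x \<in> interior (closure \<Omega>)" by (rule interiorI)
  then show ?thesis using regular_dom by simp
qed

end

section \<open>Integrals over cells\<close>

text \<open>All cell integrals live in one measure space, with an indicator as factor, so that an
  almost everywhere identity between indicators decomposes them.\<close>

definition int_on :: "'a::euclidean_space set => ('a => real) => real" where
  "int_on K f = (LINT x|lebesgue. indicator K x * f x)"

definition intg_on :: "'a::euclidean_space set => ('a => real) => bool" where
  "intg_on K f \<longleftrightarrow> integrable lebesgue (\<lambda>x. indicator K x * f x)"

lemma intg_on_continuous:
  assumes "compact K" "continuous_on K f" shows "intg_on K f"
proof -
  have "integrable lborel (\<lambda>x. indicat_real K x *\<^sub>R f x)"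
    by (rule borel_integrable_compact[OF assms])
  then show ?thesis unfolding intg_on_def by (simp add: integrable_completion)
qed

lemma
  assumes "intg_on K f" "intg_on K g"
  shows intg_on_add: "intg_on K (\<lambda>x. f x + g x)" and int_on_add: "int_on K (\<lambda>x. f x + g x) = int_on K f + int_on K g"
    and intg_on_diff: "intg_on K (\<lambda>x. f x - g x)" and int_on_diff: "int_on K (\<lambda>x. f x - g x) = int_on K f - int_on K g"
  using assms unfolding intg_on_def int_on_def by (simp_all add: distrib_left right_diff_distrib)

lemma int_on_cmult: "int_on K (\<lambda>x. c * f x) = c * int_on K f"
  unfolding int_on_def by (simp add: mult.left_commute)

lemma intg_on_cmult: "intg_on K f ==> intg_on K (\<lambda>x. c * f x)"
  unfolding intg_on_def by (simp add: mult.left_commute)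

lemma int_on_sum:
  assumes "\<And>i. i \<in> I ==> intg_on K (f i)"
  shows "int_on K (\<lambda>x. \<Sum>i\<in>I. f i x) = (\<Sum>i\<in>I. int_on K (f i))"
  using assms unfolding int_on_def intg_on_def by (simp add: sum_distrib_left Bochner_Integration.integral_sum)

lemma intg_on_sum:
  assumes "\<And>i. i \<in> I ==> intg_on K (f i)"
  shows "intg_on K (\<lambda>x. \<Sum>i\<in>I. f i x)"
  using assms unfolding intg_on_def by (simp add: sum_distrib_left)

lemma int_on_mono:
  assumes "intg_on K f" "intg_on K g" "\<And>x. x \<in> K ==> f x \<le> g x"
  shows "int_on K f \<le> int_on K g"
  using assms unfolding int_on_def intg_on_def by (intro integral_mono) (auto simp: indicator_def)

lemma int_on_nonneg: "(\<And>x. x \<in> K ==> 0 \<le> f x) ==> 0 \<le> int_on K f"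
  unfolding int_on_def by (rule Bochner_Integration.integral_nonneg) (auto simp: indicator_def)

lemma int_on_cong: "(\<And>x. x \<in> K ==> f x = g x) ==> int_on K f = int_on K g"
  unfolding int_on_def by (intro Bochner_Integration.integral_cong) (auto simp: indicator_def)

lemma
  assumes "K \<in> lmeasurable"
  shows intg_on_const: "intg_on K (\<lambda>x. c)" and int_on_const: "int_on K (\<lambda>x. c) = c * measure lebesgue K"
proof -
  have "emeasure lebesgue K < \<infinity>" "K \<in> sets lebesgue" using assms by (auto simp: fmeasurable_def)
  then show "intg_on K (\<lambda>x. c)" "int_on K (\<lambda>x. c) = c * measure lebesgue K"
    unfolding intg_on_def int_on_def by (auto simp: mult.commute)
qed

lemma int_on_abs_le:
  assumes "K \<in> lmeasurable" "\<And>x. x \<in> K ==> \<bar>f x\<bar> \<le> B" "B \<ge> 0"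
  shows "\<bar>int_on K f\<bar> \<le> B * measure lebesgue K"
proof (cases "intg_on K f")
  case True
  note c = intg_on_const[OF assms(1)] int_on_const[OF assms(1)]
  have "int_on K f \<le> int_on K (\<lambda>x. B)"
    using assms(2) by (intro int_on_mono True c) (auto simp: abs_le_iff)
  moreover have "int_on K (\<lambda>x. - B) \<le> int_on K f"
    using assms(2) by (intro int_on_mono True c) (auto simp: abs_le_iff minus_le_iff)
  ultimately show ?thesis using c(2) by auto
next
  \<comment> \<open>The integral of a non-integrable function is zero by convention.\<close>
  case False
  then have "int_on K f = 0" unfolding int_on_def intg_on_def by (rule not_integrable_integral_eq)
  then show ?thesis using assms(3) by simp
qed

text \<open>Cells with disjoint interiors overlap only in their frontiers, which are null sets by
  convexity.\<close>

lemma AE_indicator_Union: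
  assumes "finite \<F>" "\<And>H. H \<in> \<F> ==> full_simplex H"
    "\<And>H K. H \<in> \<F> ==> K \<in> \<F> ==> H \<noteq> K ==> interior H \<inter> interior K = {}"
  shows "AE x in lebesgue. indicat_real (\<Union>\<F>) x = (\<Sum>H\<in>\<F>. indicator H x)"
proof (rule AE_I')
  have "negligible (\<Union>H\<in>\<F>. frontier H)"
    using assms(1) by (intro negligible_Union) (auto intro!: negligible_convex_frontier convex_fs assms(2))
  then show "(\<Union>H\<in>\<F>. frontier H) \<in> null_sets lebesgue" by (simp add: negligible_iff_null_sets)
  show "{x \<in> space lebesgue. indicat_real (\<Union>\<F>) x \<noteq> (\<Sum>H\<in>\<F>. indicator H x)} \<subseteq> (\<Union>H\<in>\<F>. frontier H)"
  proof
    fix x assume x: "x \<in> {x \<in> space lebesgue. indicat_real (\<Union>\<F>) x \<noteq> (\<Sum>H\<in>\<F>. indicator H x)}"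
    show "x \<in> (\<Union>H\<in>\<F>. frontier H)"
    proof (rule ccontr)
      assume nf: "x \<notin> (\<Union>H\<in>\<F>. frontier H)"
      have int: "x \<in> interior H" if "H \<in> \<F>" "x \<in> H" for H
        using that nf closure_subset[of H] unfolding frontier_def by blast
      have "indicat_real (\<Union>\<F>) x = (\<Sum>H\<in>\<F>. indicator H x)"
      proof (cases "x \<in> \<Union>\<F>")
        case True
        then obtain K where K: "K \<in> \<F>" "x \<in> K" by blast
        have "x \<notin> H" if "H \<in> \<F>" "H \<noteq> K" for H
          using int[OF that(1)] int[OF K] assms(3)[OF that(1) K(1) that(2)] by blast
        then have "(\<Sum>H\<in>\<F>. indicat_real H x) = (\<Sum>H\<in>\<F>. if H = K then 1 else 0)"
          using K by (intro sum.cong) (auto simp: indicator_def)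
        then show ?thesis using True K assms(1) by simp
      next
        case False
        then have "(\<Sum>H\<in>\<F>. indicat_real H x) = 0" by (intro sum.neutral) (auto simp: indicator_def)
        then show ?thesis using False by simp
      qed
      then show False using x by simp
    qed
  qed
qed

lemma int_on_AE_sum:
  fixes f :: "'a::euclidean_space => real"
  assumes "AE x in lebesgue. indicat_real U x = (\<Sum>H\<in>\<F>. indicator H x)"
    and "\<And>H. H \<in> \<F> ==> intg_on H f"
  shows "intg_on U f \<and> int_on U f = (\<Sum>H\<in>\<F>. int_on H f)"
proof -
  have i: "integrable lebesgue (\<lambda>x. \<Sum>H\<in>\<F>. indicator H x * f x)"
    using assms(2) by (intro Bochner_Integration.integrable_sum) (auto simp: intg_on_def)
  have ae: "AE x in lebesgue. (\<Sum>H\<in>\<F>. indicator H x * f x) = indicator U x * f x"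
    using assms(1) by eventually_elim (simp add: sum_distrib_right)
  have m: "(\<lambda>x. indicator U x * f x) \<in> borel_measurable lebesgue"
    by (rule borel_measurable_AE[OF _ ae]) (use i in auto)
  have "integrable lebesgue (\<lambda>x. indicator U x * f x)"
    using integrable_cong_AE[OF _ m ae] i by auto
  moreover have "(LINT x|lebesgue. indicator U x * f x) = (LINT x|lebesgue. (\<Sum>H\<in>\<F>. indicator H x * f x))"
    using i by (intro integral_cong_AE m) (use ae in \<open>auto elim: eventually_mono\<close>)
  ultimately show ?thesis
    unfolding intg_on_def int_on_def using assms(2) by (simp add: Bochner_Integration.integral_sum intg_on_def)
qed

lemma L2_inner_int_on:
  assumes "\<Omega> \<in> sets lebesgue" shows "L2_inner \<Omega> v w = int_on \<Omega> (\<lambda>x. v x * w x)"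
  unfolding L2_inner_def int_on_def using assms by (subst integral_restrict_space) auto

text \<open>The homothetic copy of ratio 1/4 at a corner lies where the barycentric coordinate of that
  corner is at least 3/4.\<close>

lemma inverse_estimate_corners:
  fixes K :: "'a::euclidean_space set"
  assumes fs: "full_simplex K" and u: "affine_on K u" and q: "q \<in> corners K"
  shows "measure lebesgue K * (u q)\<^sup>2 \<le> 4 ^ Suc DIM('a) * int_on K (\<lambda>x. (u x)\<^sup>2)"
proof -
  let ?V = "(\<lambda>p. \<bar>u p\<bar>) ` corners K"
  have "Max ?V \<in> ?V" using finite_corners[OF fs] q by (intro Max_in) auto
  then obtain p where p: "p \<in> corners K" "\<bar>u p\<bar> = Max ?V" by auto
  then have pm: "\<bar>u r\<bar> \<le> \<bar>u p\<bar>" if "r \<in> corners K" for r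
    using that finite_corners[OF fs] by simp
  define S where "S = (\<lambda>x. (1/4) *\<^sub>R x + (3/4) *\<^sub>R p) ` K"
  have mS: "measure lebesgue S = measure lebesgue K / 4 ^ DIM('a)"
    unfolding S_def measure_lebesgue_affine by (simp add: power_one_over)
  have SK: "S \<subseteq> K"
    unfolding S_def using convex_fs[OF fs] corners_subset[OF p(1)] by (auto simp: convex_def)
  have "compact S" unfolding S_def using compact_fs[OF fs] by (intro compact_continuous_image continuous_intros)
  then have Sl: "S \<in> lmeasurable" by (rule lmeasurable_compact)
  \<comment> \<open>On the small copy at least half of the maximal corner value survives,
    \<open>3/4\<close> minus at most \<open>1/4\<close>. Squared this costs a factor 4; the volume
    of the copy costs \<open>4 ^ DIM('a)\<close>.\<close>
  have low: "(u p)\<^sup>2 / 4 \<le> (u x)\<^sup>2" if "x \<in> S" for x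
  proof -
    have "x \<in> (\<lambda>x. (1/4) *\<^sub>R x + (3/4) *\<^sub>R p) ` K" using that unfolding S_def .
    then obtain y where y: "y \<in> K" "x = (1/4) *\<^sub>R y + (3/4) *\<^sub>R p" by (elim imageE) simp
    obtain g c where gc: "\<And>x. x \<in> K ==> u x = g \<bullet> x + c" using u unfolding affine_on_def by blast
    have "u x = u y / 4 + 3 / 4 * u p"
      using gc[OF y(1)] gc[OF corners_subset[OF p(1)]] gc[of x] SK that y(2)
      by (auto simp: inner_add_right field_simps)
    moreover have "\<bar>u y\<bar> \<le> \<bar>u p\<bar>" by (rule affine_on_abs_le_corners[OF fs u y(1) pm])
    ultimately have "\<bar>u p\<bar> / 2 \<le> \<bar>u x\<bar>" by linarith
    then have "(\<bar>u p\<bar> / 2)\<^sup>2 \<le> \<bar>u x\<bar>\<^sup>2" by (intro power_mono) auto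
    then show ?thesis by (simp add: power_divide)
  qed
  have "(u p)\<^sup>2 / 4 * (measure lebesgue K / 4 ^ DIM('a)) = int_on S (\<lambda>x. (u p)\<^sup>2 / 4)"
    using int_on_const[OF Sl] mS by simp
  also have "\<dots> \<le> int_on S (\<lambda>x. (u x)\<^sup>2)"
    using affine_on_continuous[OF u] SK low \<open>compact S\<close>
    by (intro int_on_mono intg_on_const Sl intg_on_continuous continuous_intros)
      (auto intro: continuous_on_subset)
  also have "\<dots> \<le> int_on K (\<lambda>x. (u x)\<^sup>2)"
    unfolding int_on_def using \<open>compact S\<close> compact_fs[OF fs] affine_on_continuous[OF u] SK
    by (intro integral_mono intg_on_continuous[unfolded intg_on_def] continuous_intros)
      (auto simp: indicator_def intro: continuous_on_subset)
  finally have "measure lebesgue K * (u p)\<^sup>2 \<le> 4 ^ Suc DIM('a) * int_on K (\<lambda>x. (u x)\<^sup>2)"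
    by (simp add: field_simps)
  moreover have "(u q)\<^sup>2 \<le> (u p)\<^sup>2" using pm[OF q] by (simp add: abs_le_square_iff)
  ultimately show ?thesis
    by (meson measure_nonneg mult_left_mono order_trans)
qed

lemma int_on_sq_le_corners:
  assumes fs: "full_simplex K" and u: "affine_on K u" and B: "\<And>p. p \<in> corners K ==> (u p)\<^sup>2 \<le> B"
  shows "int_on K (\<lambda>x. (u x)\<^sup>2) \<le> B * measure lebesgue K"
proof -
  have B0: "B \<ge> 0" using B other_corner[OF fs] by (meson order_trans zero_le_power2)
  have "\<bar>u x\<bar> \<le> sqrt B" if "x \<in> K" for x
    using B real_le_rsqrt by (intro affine_on_abs_le_corners[OF fs u that]) (auto simp: power2_abs intro: real_le_rsqrt)
  then have "(u x)\<^sup>2 \<le> B" if "x \<in> K" for x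
    using that B0 by (metis abs_ge_zero power2_abs power_mono real_sqrt_pow2)
  then have "int_on K (\<lambda>x. (u x)\<^sup>2) \<le> int_on K (\<lambda>x. B)"
    using affine_on_continuous[OF u]
    by (intro int_on_mono intg_on_const lmeasurable_fs fs intg_on_continuous compact_fs continuous_intros)
  then show ?thesis using int_on_const[OF lmeasurable_fs[OF fs]] by simp
qed

section \<open>Finite element spaces on a conforming mesh\<close>

context conf_mesh begin

lemma sets_dom: "\<Omega> \<in> sets lebesgue"
  using open_dom by (simp add: borel_open sets_completionI_sets)

lemma interior_cell_dom: "K \<in> \<T> ==> interior K \<subseteq> \<Omega>"
  using Union_mesh interior_mono[of K "closure \<Omega>"] regular_dom by blast

text \<open>Points of the closure outside \<Omega> lie in some cell but in the interior of none, so
  the triangulation itself shows that the boundary is a null set.\<close>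

lemma AE_indicator_dom: "AE x in lebesgue. indicat_real \<Omega> x = (\<Sum>H\<in>\<T>. indicator H x)"
proof -
  have disj: "H \<in> \<T> ==> K \<in> \<T> ==> H \<noteq> K ==> interior H \<inter> interior K = {}" for H K
    using is_mesh by (simp add: mesh_of_def)
  have neg: "(\<Union>H\<in>\<T>. frontier H) \<in> null_sets lebesgue"
    using finite_mesh
    by (subst negligible_iff_null_sets[symmetric], intro negligible_Union)
      (auto intro!: negligible_convex_frontier convex_fs full)
  have "AE x in lebesgue. indicat_real \<Omega> x = indicator (\<Union>\<T>) x"
  proof (rule AE_I'[OF neg], safe)
    fix x assume "indicat_real \<Omega> x \<noteq> indicator (\<Union>\<T>) x"
    then have "x \<in> closure \<Omega>" "x \<notin> \<Omega>"
      using Union_mesh subsetD[OF closure_subset, of x \<Omega>] by (auto simp: indicator_def split: if_splits)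
    then obtain H where "H \<in> \<T>" "x \<in> H" "x \<notin> interior H" using Union_mesh interior_cell_dom by blast
    then show "x \<in> (\<Union>H\<in>\<T>. frontier H)" using closure_subset[of H] by (auto simp: frontier_def)
  qed
  moreover have "AE x in lebesgue. indicat_real (\<Union>\<T>) x = (\<Sum>H\<in>\<T>. indicator H x)"
    by (rule AE_indicator_Union[OF finite_mesh full disj])
  ultimately show ?thesis by eventually_elim simp
qed

lemma int_on_dom:
  assumes "\<And>H. H \<in> \<T> ==> intg_on H f"
  shows "intg_on \<Omega> f" and "int_on \<Omega> f = (\<Sum>H\<in>\<T>. int_on H f)"
  using int_on_AE_sum[OF AE_indicator_dom assms] by auto

abbreviation "nodes \<equiv> \<Union>(corners ` \<T>) \<inter> \<Omega>"

lemma fe_affine: "u \<in> fe_space \<Omega> \<T> ==> K \<in> \<T> ==> affine_on K u"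
  by (simp add: fe_space_def affine_on_def)

lemma fe_zero: "u \<in> fe_space \<Omega> \<T> ==> x \<notin> \<Omega> ==> u x = 0"
  by (simp add: fe_space_def)

lemma fe_ext:
  assumes "u \<in> fe_space \<Omega> \<T>" "v \<in> fe_space \<Omega> \<T>" "\<And>x. x \<in> nodes ==> u x = v x"
  shows "u = v"
proof
  fix x
  show "u x = v x"
  proof (cases "x \<in> \<Omega>")
    case True
    then obtain K where K: "K \<in> \<T>" "x \<in> K" using Union_mesh closure_subset by blast
    have "u p = v p" if "p \<in> corners K" for p
      using assms that K fe_zero[OF assms(1)] fe_zero[OF assms(2)] by (cases "p \<in> \<Omega>") auto
    then show ?thesis using affine_on_eq[OF full[OF K(1)] fe_affine[OF assms(1) K(1)] fe_affine[OF assms(2) K(1)]] K(2) by blast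
  next
    case False
    then show ?thesis using fe_zero[OF assms(1)] fe_zero[OF assms(2)] by simp
  qed
qed

text \<open>Barycentric interpolation in any cell that contains the point; coordinates agree on
  common faces, so the choice of the cell does not matter. The interpolant vanishes outside \<Omega>
  because a corner in \<Omega> with a positive coordinate at \<open>x\<close> would force
  \<open>x\<close> into \<Omega> by \<open>mem_dom_transfer\<close>.\<close>

lemma fe_interpolant_exists:
  "\<exists>u\<in>fe_space \<Omega> \<T>. \<forall>x\<in>nodes. u x = val x"
proof -
  define v where "v p = (if p \<in> \<Omega> then val p else 0)" for p
  define cell where "cell x = (SOME K. K \<in> \<T> \<and> x \<in> K)" for x
  define u where "u x = (if x \<in> \<Omega> then \<Sum>p\<in>corners (cell x). lam (cell x) p x * v p else 0)" for x
  have indep: "(\<Sum>p\<in>corners H. lam H p x * v p) = (\<Sum>p\<in>corners K. lam K p x * v p)"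
    if "H \<in> \<T>" "K \<in> \<T>" "x \<in> H" "x \<in> K" for H K x
  proof -
    have red: "(\<Sum>p\<in>corners H. lam H p x * v p) = (\<Sum>p\<in>corners H \<inter> corners K. lam H p x * v p)"
      if "H \<in> \<T>" "K \<in> \<T>" "x \<in> H" "x \<in> K" for H K
    proof (rule sum.mono_neutral_right[OF finite_corners[OF full[OF that(1)]]])
      show "\<forall>p\<in>corners H - corners H \<inter> corners K. lam H p x * v p = 0"
      proof
        fix p assume p: "p \<in> corners H - corners H \<inter> corners K"
        then have "\<not> lam H p x > 0" using lam_pos_common[OF that(2,1,4,3)] by blast
        moreover have "lam H p x \<ge> 0" using mem_simplex_iff[OF full[OF that(1)]] that p by blast
        ultimately show "lam H p x * v p = 0" by simp
      qed
    qed simp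
    have "(\<Sum>p\<in>corners H \<inter> corners K. lam H p x * v p) = (\<Sum>p\<in>corners H \<inter> corners K. lam K p x * v p)"
      using lam_common[OF that] by (intro sum.cong) auto
    then show ?thesis using red[OF that] red[OF that(2,1,4,3)] by (simp add: Int_commute)
  qed
  have u_eq: "u x = (\<Sum>p\<in>corners K. lam K p x * v p)" if "K \<in> \<T>" "x \<in> K" for K x
  proof (cases "x \<in> \<Omega>")
    case True
    have "cell x \<in> \<T> \<and> x \<in> cell x" unfolding cell_def by (rule someI[of _ K]) (use that in auto)
    then have "(\<Sum>p\<in>corners (cell x). lam (cell x) p x * v p) = (\<Sum>p\<in>corners K. lam K p x * v p)"
      by (intro indep that) auto
    then show ?thesis using True by (simp add: u_def)
  next
    case False
    have "(\<Sum>p\<in>corners K. lam K p x * v p) = 0"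
    proof (rule sum.neutral, rule ballI)
      fix p assume p: "p \<in> corners K"
      show "lam K p x * v p = 0"
      proof (cases "lam K p x > 0")
        case True
        have "p \<notin> \<Omega>"
        proof
          assume "p \<in> \<Omega>"
          have "q = p" if "q \<in> corners K" "lam K q p > 0" for q
            using lam_corner[OF full[OF \<open>K \<in> \<T>\<close>] that(1) p] that(2) by (auto split: if_splits)
          then have "x \<in> \<Omega>"
            using mem_dom_transfer[OF \<open>K \<in> \<T>\<close> \<open>x \<in> K\<close> corners_subset[OF p] \<open>p \<in> \<Omega>\<close>] True by blast
          then show False using False by simp
        qed
        then show ?thesis by (simp add: v_def)
      next
        case False
        moreover have "lam K p x \<ge> 0" using mem_simplex_iff[OF full[OF that(1)]] that p by blast
        ultimately show ?thesis by simp
      qed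
    qed
    then show ?thesis using False by (simp add: u_def)
  qed
  have aff: "affine_on K u" if "K \<in> \<T>" for K
    unfolding affine_on_def
  proof (intro exI ballI)
    fix x assume "x \<in> K"
    show "u x = (\<Sum>p\<in>corners K. v p *\<^sub>R bg K p) \<bullet> x + (\<Sum>p\<in>corners K. (1 - bg K p \<bullet> p) * v p)"
      unfolding u_eq[OF that \<open>x \<in> K\<close>] lam_def
      by (simp add: inner_sum_left sum.distrib[symmetric] algebra_simps)
  qed
  have "continuous_on (\<Union>K\<in>\<T>. K) u"
    using finite_mesh closed_fs[OF full] affine_on_continuous[OF aff] by (intro continuous_on_closed_Union) auto
  then have "continuous_on (closure \<Omega>) u" using Union_mesh by simp
  then have "u \<in> fe_space \<Omega> \<T>"
    unfolding fe_space_def affine_on_def[symmetric] using aff by (simp add: u_def)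
  moreover have "u x = val x" if nx: "x \<in> nodes" for x
  proof -
    obtain K where K: "K \<in> \<T>" "x \<in> corners K" using nx by (elim IntE UN_E)
    have "u x = (\<Sum>p\<in>corners K. (if p = x then 1 else 0) * v p)"
      unfolding u_eq[OF K(1) corners_subset[OF K(2)]]
      using lam_corner[OF full[OF K(1)] _ K(2)] by (intro sum.cong) auto
    also have "\<dots> = v x" using finite_corners[OF full[OF K(1)]] K(2)
      by (subst sum.cong[OF refl, of _ _ "\<lambda>p. if p = x then v x else 0"]) auto
    finally show ?thesis using that by (simp add: v_def)
  qed
  ultimately show ?thesis by blast
qed

lemma
  shows nodal_interp_fe: "nodal_interp \<Omega> \<T> v \<in> fe_space \<Omega> \<T>"
    and nodal_interp_node: "\<And>x. x \<in> nodes ==> nodal_interp \<Omega> \<T> v x = v x"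
proof -
  obtain u where u: "u \<in> fe_space \<Omega> \<T>" "\<forall>x\<in>nodes. u x = v x" using fe_interpolant_exists by blast
  have "nodal_interp \<Omega> \<T> v \<in> fe_space \<Omega> \<T> \<and> (\<forall>x\<in>nodes. nodal_interp \<Omega> \<T> v x = v x)"
    unfolding nodal_interp_def by (rule theI[of _ u]) (use u fe_ext in auto)
  then show "nodal_interp \<Omega> \<T> v \<in> fe_space \<Omega> \<T>" "\<And>x. x \<in> nodes ==> nodal_interp \<Omega> \<T> v x = v x" by auto
qed

lemma nodal_interp_corner:
  assumes "K \<in> \<T>" "p \<in> corners K"
  shows "nodal_interp \<Omega> \<T> v p = (if p \<in> \<Omega> then v p else 0)"
  using nodal_interp_node[of p v] fe_zero[OF nodal_interp_fe] assms by auto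

lemma nodal_interp_id: "u \<in> fe_space \<Omega> \<T> ==> nodal_interp \<Omega> \<T> u = u"
  using fe_ext[OF nodal_interp_fe] nodal_interp_node by blast

lemma fe_space_ops:
  assumes "u \<in> fe_space \<Omega> \<T>" "v \<in> fe_space \<Omega> \<T>"
  shows fe_add: "(\<lambda>x. u x + v x) \<in> fe_space \<Omega> \<T>" and fe_diff: "(\<lambda>x. u x - v x) \<in> fe_space \<Omega> \<T>"
    and fe_cmult: "\<And>c. (\<lambda>x. c * u x) \<in> fe_space \<Omega> \<T>"
  using assms affine_on_ops[of _ u v] unfolding fe_space_def affine_on_def[symmetric]
  by (auto intro!: continuous_intros)

lemma fe_0: "(\<lambda>x. 0) \<in> fe_space \<Omega> \<T>"
  by (auto simp: fe_space_def intro!: exI[of _ 0])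

lemma fe_sum: "(\<And>i. i \<in> I ==> u i \<in> fe_space \<Omega> \<T>) ==> (\<lambda>x. \<Sum>i\<in>I. u i x) \<in> fe_space \<Omega> \<T>"
  by (induction I rule: infinite_finite_induct) (auto intro: fe_0 fe_add)

lemma fe_intg:
  assumes "u \<in> fe_space \<Omega> \<T>" "v \<in> fe_space \<Omega> \<T>" "K \<in> \<T>"
  shows "intg_on K (\<lambda>x. u x * v x)"
  using assms by (intro intg_on_continuous compact_fs full continuous_intros affine_on_continuous fe_affine)

lemma fe_L2: assumes "u \<in> fe_space \<Omega> \<T>" shows "u \<in> L2 \<Omega>"
proof -
  have c: "continuous_on \<Omega> u"
    using assms closure_subset by (auto simp: fe_space_def intro: continuous_on_subset)
  have "u \<in> borel_measurable (lebesgue_on \<Omega>)"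
    using c sets_dom by (rule continuous_imp_measurable_on_sets_lebesgue)
  moreover have "intg_on \<Omega> (\<lambda>x. u x * u x)"
    using int_on_dom(1) fe_intg[OF assms assms] by blast
  then have "integrable (lebesgue_on \<Omega>) (\<lambda>x. (u x)\<^sup>2)"
    using sets_dom by (subst integrable_restrict_space) (auto simp: intg_on_def power2_eq_square)
  ultimately show ?thesis by (simp add: L2_def)
qed

lemma fe_L2_inner:
  assumes "u \<in> fe_space \<Omega> \<T>" "v \<in> fe_space \<Omega> \<T>"
  shows "L2_inner \<Omega> u v = (\<Sum>K\<in>\<T>. int_on K (\<lambda>x. u x * v x))"
  unfolding L2_inner_int_on[OF sets_dom] using int_on_dom(2) fe_intg[OF assms] by blast

lemma fe_L2_norm_sq:
  "u \<in> fe_space \<Omega> \<T> ==> (L2_norm \<Omega> u)\<^sup>2 = (\<Sum>K\<in>\<T>. int_on K (\<lambda>x. (u x)\<^sup>2))"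
  unfolding L2_norm_sq by (simp add: fe_L2_inner power2_eq_square)

lemma fe_definite:
  assumes "u \<in> fe_space \<Omega> \<T>" "L2_norm \<Omega> u = 0" shows "u = (\<lambda>x. 0)"
proof (rule fe_ext[OF assms(1) fe_0])
  fix x assume "x \<in> nodes"
  then obtain K where K: "K \<in> \<T>" "x \<in> corners K" by auto
  have "(\<Sum>K\<in>\<T>. int_on K (\<lambda>x. (u x)\<^sup>2)) = 0" using fe_L2_norm_sq[OF assms(1)] assms(2) by simp
  then have "int_on K (\<lambda>x. (u x)\<^sup>2) = 0"
    using K finite_mesh int_on_nonneg by (subst (asm) sum_nonneg_eq_0_iff) (auto intro: int_on_nonneg)
  then have "measure lebesgue K * (u x)\<^sup>2 \<le> 0"
    using inverse_estimate_corners[OF full[OF K(1)] fe_affine[OF assms(1) K(1)] K(2)] by simp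
  then show "u x = 0" using measure_fs_pos[OF full[OF K(1)]]
    by (simp add: mult_le_0_iff)
qed

text \<open>Best approximation in a finitely spanned space, adding one spanning element at a time. The
  last clause says that the approximation lies in the span.\<close>

lemma L2_proj_span:
  fixes h :: "'i => 'a => real"
  assumes "finite I" "\<And>i. i \<in> I ==> h i \<in> fe_space \<Omega> \<T>" "v \<in> L2 \<Omega>"
  shows "\<exists>p\<in>fe_space \<Omega> \<T>. (\<forall>i\<in>I. L2_inner \<Omega> (\<lambda>x. v x - p x) (h i) = 0) \<and>
    (\<forall>z\<in>L2 \<Omega>. (\<forall>i\<in>I. L2_inner \<Omega> z (h i) = 0) \<longrightarrow> L2_inner \<Omega> z p = 0)"
  using assms
proof (induction I arbitrary: v rule: finite_induct)
  case empty
  show ?case by (rule bexI[OF _ fe_0]) (simp add: L2_inner_def)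
next
  case (insert i I)
  obtain p where p: "p \<in> fe_space \<Omega> \<T>" "\<forall>k\<in>I. L2_inner \<Omega> (\<lambda>x. v x - p x) (h k) = 0"
    "\<forall>z\<in>L2 \<Omega>. (\<forall>i\<in>I. L2_inner \<Omega> z (h i) = 0) \<longrightarrow> L2_inner \<Omega> z p = 0"
    using insert.IH[of v] insert.prems by blast
  have hi: "h i \<in> fe_space \<Omega> \<T>" using insert.prems by blast
  obtain q where q: "q \<in> fe_space \<Omega> \<T>" "\<forall>k\<in>I. L2_inner \<Omega> (\<lambda>x. h i x - q x) (h k) = 0"
    "\<forall>z\<in>L2 \<Omega>. (\<forall>i\<in>I. L2_inner \<Omega> z (h i) = 0) \<longrightarrow> L2_inner \<Omega> z q = 0"
    using insert.IH[of "h i"] insert.prems fe_L2 by blast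
  \<comment> \<open>The Gram-Schmidt residual of the new element. If it is orthogonal to
    \<open>h i\<close>, it is zero and the old approximation serves unchanged.\<close>
  define b where "b = (\<lambda>x. h i x - q x)"
  have b: "b \<in> fe_space \<Omega> \<T>" unfolding b_def using fe_diff hi q(1) by blast
  have bI: "L2_inner \<Omega> b (h k) = 0" if "k \<in> I" for k using q(2) that by (simp add: b_def)
  have vp: "(\<lambda>x. v x - p x) \<in> L2 \<Omega>" using L2_diff insert.prems fe_L2 p(1) by blast
  let ?r = "\<lambda>x. v x - p x"
  show ?case
  proof (cases "L2_inner \<Omega> b (h i) = 0")
    case True
    have "L2_inner \<Omega> b q = 0" using q(3) bI fe_L2[OF b] by blast
    then have "L2_inner \<Omega> b b = 0"
      using True L2_inner_diff_left[OF fe_L2[OF hi] fe_L2[OF q(1)] fe_L2[OF b]]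
      by (simp add: b_def[symmetric] L2_inner_commute[of \<Omega> "h i"] L2_inner_commute[of \<Omega> q])
    then have "b = (\<lambda>x. 0)" using fe_definite[OF b] by (simp add: L2_norm_def)
    then have "h i = q" unfolding b_def by (auto simp: fun_eq_iff)
    then have "L2_inner \<Omega> ?r (h i) = 0" using q(3) vp p(2) by blast
    then show ?thesis using p by blast
  next
    case False
    define c where "c = L2_inner \<Omega> ?r (h i) / L2_inner \<Omega> b (h i)"
    define p' where "p' = (\<lambda>x. p x + c * b x)"
    have p': "p' \<in> fe_space \<Omega> \<T>" unfolding p'_def using fe_add[OF p(1) fe_cmult[OF b b]] by simp
    moreover have "L2_inner \<Omega> (\<lambda>x. v x - p' x) (h k) = 0" if "k \<in> insert i I" for k
    proof -
      have hk: "h k \<in> L2 \<Omega>" using that insert.prems fe_L2 by blast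
      have "L2_inner \<Omega> (\<lambda>x. ?r x - c * b x) (h k) = L2_inner \<Omega> ?r (h k) - c * L2_inner \<Omega> b (h k)"
        using L2_inner_diff_left[OF vp L2_cmult[OF fe_L2[OF b]] hk] by (simp add: L2_inner_cmult_left)
      moreover have "L2_inner \<Omega> ?r (h k) - c * L2_inner \<Omega> b (h k) = 0"
        using that p(2) bI False by (auto simp: c_def)
      ultimately show ?thesis by (simp add: p'_def diff_diff_eq)
    qed
    moreover have "L2_inner \<Omega> z p' = 0" if z: "z \<in> L2 \<Omega>" "\<forall>k\<in>insert i I. L2_inner \<Omega> z (h k) = 0" for z
    proof -
      have "L2_inner \<Omega> z p = 0" "L2_inner \<Omega> z q = 0" "L2_inner \<Omega> z (h i) = 0" using z p(3) q(3) by auto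
      then have "L2_inner \<Omega> p z = 0" "L2_inner \<Omega> q z = 0" "L2_inner \<Omega> (h i) z = 0"
        by (simp_all add: L2_inner_commute[of \<Omega> _ z])
      then have "L2_inner \<Omega> p z + c * (L2_inner \<Omega> (h i) z - L2_inner \<Omega> q z) = 0" by simp
      then have "L2_inner \<Omega> p' z = 0"
        using L2_inner_add_left[OF fe_L2[OF p(1)] L2_cmult[OF fe_L2[OF b], of c] z(1)]
          L2_inner_diff_left[OF fe_L2[OF hi] fe_L2[OF q(1)] z(1)]
        by (simp add: p'_def L2_inner_cmult_left b_def)
      then show ?thesis by (simp add: L2_inner_commute[of \<Omega> z])
    qed
    ultimately show ?thesis by blast
  qed
qed

lemma L2_proj_exists:
  assumes "v \<in> L2 \<Omega>"
  shows "\<exists>p\<in>fe_space \<Omega> \<T>. \<forall>w\<in>fe_space \<Omega> \<T>. L2_inner \<Omega> (\<lambda>x. v x - p x) w = 0"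
proof -
  define h where "h n = nodal_interp \<Omega> \<T> (\<lambda>x. if x = n then 1 else 0)" for n
  have h: "h n \<in> fe_space \<Omega> \<T>" for n unfolding h_def by (rule nodal_interp_fe)
  have fin: "finite nodes" using finite_mesh finite_corners full by auto
  from L2_proj_span[of nodes h, OF fin h assms]
  obtain p where p: "p \<in> fe_space \<Omega> \<T>" "\<forall>n\<in>nodes. L2_inner \<Omega> (\<lambda>x. v x - p x) (h n) = 0"
    by (elim bexE conjE)
  have r: "(\<lambda>x. v x - p x) \<in> L2 \<Omega>" by (intro L2_diff assms fe_L2 p(1))
  have "L2_inner \<Omega> (\<lambda>x. v x - p x) w = 0" if w: "w \<in> fe_space \<Omega> \<T>" for w
  proof -
    have w_eq: "w = (\<lambda>x. \<Sum>n\<in>nodes. w n * h n x)"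
    proof (rule fe_ext[OF w fe_sum[OF fe_cmult[OF h h]]])
      fix x assume x: "x \<in> nodes"
      have "(\<Sum>n\<in>nodes. w n * h n x) = (\<Sum>n\<in>nodes. if n = x then w x else 0)"
        using nodal_interp_node[OF x] by (intro sum.cong) (auto simp: h_def)
      then show "w x = (\<Sum>n\<in>nodes. w n * h n x)" using fin x by simp
    qed
    have part: "L2_inner \<Omega> (\<lambda>x. \<Sum>n\<in>N. w n * h n x) (\<lambda>x. v x - p x) = 0" if "finite N" "N \<subseteq> nodes" for N
      using that
    proof (induction N rule: finite_induct)
      case (insert n N)
      have "L2_inner \<Omega> (\<lambda>x. w n * h n x + (\<Sum>n\<in>N. w n * h n x)) (\<lambda>x. v x - p x)
          = w n * L2_inner \<Omega> (h n) (\<lambda>x. v x - p x) + L2_inner \<Omega> (\<lambda>x. \<Sum>n\<in>N. w n * h n x) (\<lambda>x. v x - p x)"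
        using L2_inner_add_left[OF L2_cmult[OF fe_L2[OF h]] fe_L2[OF fe_sum[OF fe_cmult[OF h h]]] r]
        by (simp add: L2_inner_cmult_left)
      then show ?case using insert p(2) by (simp add: L2_inner_commute[of \<Omega> "h n"])
    qed (simp add: L2_inner_def)
    have "L2_inner \<Omega> w (\<lambda>x. v x - p x) = 0" by (subst w_eq) (rule part[OF fin subset_refl])
    then show ?thesis by (simp add: L2_inner_commute[of \<Omega> _ w])
  qed
  then show ?thesis using p(1) by blast
qed

lemma
  assumes v: "v \<in> L2 \<Omega>"
  shows L2_proj_fe: "L2_proj \<Omega> \<T> v \<in> fe_space \<Omega> \<T>"
    and L2_proj_orth: "\<And>w. w \<in> fe_space \<Omega> \<T> ==> L2_inner \<Omega> (\<lambda>x. v x - L2_proj \<Omega> \<T> v x) w = 0"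
    and L2_proj_unique: "\<And>p. p \<in> fe_space \<Omega> \<T> ==> (\<And>w. w \<in> fe_space \<Omega> \<T> ==> L2_inner \<Omega> (\<lambda>x. v x - p x) w = 0)
      ==> L2_proj \<Omega> \<T> v = p"
proof -
  let ?P = "\<lambda>p. p \<in> fe_space \<Omega> \<T> \<and> (\<forall>w\<in>fe_space \<Omega> \<T>. L2_inner \<Omega> (\<lambda>x. v x - p x) w = 0)"
  have uniq: "p = q" if "?P p" "?P q" for p q
  proof -
    have d: "(\<lambda>x. p x - q x) \<in> fe_space \<Omega> \<T>" using fe_diff that by blast
    have L: "(\<lambda>x. v x - q x) \<in> L2 \<Omega>" "(\<lambda>x. v x - p x) \<in> L2 \<Omega>" using L2_diff v fe_L2 that by blast+
    have "L2_inner \<Omega> (\<lambda>x. (v x - q x) - (v x - p x)) (\<lambda>x. p x - q x) = 0"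
      using L2_inner_diff_left[OF L fe_L2[OF d]] that d by simp
    then have "L2_norm \<Omega> (\<lambda>x. p x - q x) = 0" by (simp add: L2_norm_def)
    from fe_definite[OF d this] show ?thesis by (auto simp: fun_eq_iff)
  qed
  obtain p where p: "?P p" using L2_proj_exists[OF v] by blast
  have *: "?P (L2_proj \<Omega> \<T> v)" unfolding L2_proj_def by (rule theI[of ?P, OF p]) (use uniq p in blast)
  then show "L2_proj \<Omega> \<T> v \<in> fe_space \<Omega> \<T>"
    "\<And>w. w \<in> fe_space \<Omega> \<T> ==> L2_inner \<Omega> (\<lambda>x. v x - L2_proj \<Omega> \<T> v x) w = 0" by auto
  show "L2_proj \<Omega> \<T> v = p" if "p \<in> fe_space \<Omega> \<T>" "\<And>w. w \<in> fe_space \<Omega> \<T> ==> L2_inner \<Omega> (\<lambda>x. v x - p x) w = 0" for p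
    using uniq[OF *] that by blast
qed

lemma L2_proj_id: "u \<in> fe_space \<Omega> \<T> ==> L2_proj \<Omega> \<T> u = u"
  by (rule L2_proj_unique[OF fe_L2]) (auto simp: L2_inner_def)

lemma L2_proj_diff:
  assumes "v \<in> L2 \<Omega>" "w \<in> L2 \<Omega>"
  shows "L2_proj \<Omega> \<T> (\<lambda>x. v x - w x) = (\<lambda>x. L2_proj \<Omega> \<T> v x - L2_proj \<Omega> \<T> w x)"
proof (rule L2_proj_unique[OF L2_diff[OF assms]])
  show "(\<lambda>x. L2_proj \<Omega> \<T> v x - L2_proj \<Omega> \<T> w x) \<in> fe_space \<Omega> \<T>"
    using fe_diff L2_proj_fe assms by blast
  fix z assume z: "z \<in> fe_space \<Omega> \<T>"
  have L: "(\<lambda>x. v x - L2_proj \<Omega> \<T> v x) \<in> L2 \<Omega>" "(\<lambda>x. w x - L2_proj \<Omega> \<T> w x) \<in> L2 \<Omega>"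
    using L2_diff assms fe_L2 L2_proj_fe by blast+
  have "L2_inner \<Omega> (\<lambda>x. (v x - L2_proj \<Omega> \<T> v x) - (w x - L2_proj \<Omega> \<T> w x)) z = 0"
    using L2_inner_diff_left[OF L fe_L2[OF z]] L2_proj_orth z assms by simp
  then show "L2_inner \<Omega> (\<lambda>x. v x - w x - (L2_proj \<Omega> \<T> v x - L2_proj \<Omega> \<T> w x)) z = 0"
    by (simp add: algebra_simps)
qed

lemma L2_proj_norm:
  assumes v: "v \<in> L2 \<Omega>"
  shows "L2_norm \<Omega> (L2_proj \<Omega> \<T> v) \<le> L2_norm \<Omega> v"
proof -
  let ?p = "L2_proj \<Omega> \<T> v"
  have p: "?p \<in> L2 \<Omega>" using L2_proj_fe[OF v] fe_L2 by blast
  have "L2_inner \<Omega> v ?p = L2_inner \<Omega> ?p ?p"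
    using L2_proj_orth[OF v L2_proj_fe[OF v]] L2_inner_diff_left[OF v p p] by simp
  then have "(L2_norm \<Omega> ?p)\<^sup>2 \<le> L2_norm \<Omega> v * L2_norm \<Omega> ?p"
    using L2_Cauchy_Schwarz[OF v p] by (simp add: L2_norm_sq)
  then show ?thesis using L2_norm_nonneg[of \<Omega> ?p] L2_norm_nonneg[of \<Omega> v]
    by (cases "L2_norm \<Omega> ?p = 0") (auto simp: power2_eq_square)
qed

end

section \<open>Smooth bumps and uniqueness of weak gradients\<close>

lemma C_k_Suc_imp: "C_k (Suc k) f ==> C_k k f"
proof (induction k arbitrary: f)
  case 0
  then show ?case using differentiable_imp_continuous_on by auto
next
  case (Suc k)
  then show ?case by simp
qed

lemma C_k_const: "C_k k (\<lambda>x. c)"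
proof (induction k arbitrary: c)
  case (Suc k)
  have "frechet_derivative (\<lambda>x. c) (at x) b = 0" for x b :: 'a by simp
  then show ?case using Suc[of 0] by simp
qed simp

lemma C_k_add: "C_k k f ==> C_k k g ==> C_k k (\<lambda>x. f x + g x)"
proof (induction k arbitrary: f g)
  case 0 then show ?case by (auto intro: continuous_intros)
next
  case (Suc k)
  then have d: "f differentiable (at x)" "g differentiable (at x)" for x
    by (auto simp: differentiable_on_def)
  have "frechet_derivative (\<lambda>x. f x + g x) (at x) b
    = frechet_derivative f (at x) b + frechet_derivative g (at x) b" for x b
    using frechet_derivative_at[OF has_derivative_add[OF d[THEN frechet_derivative_works[THEN iffD1]]]] by metis
  then show ?case using Suc by (auto intro: differentiable_on_add)
qed

lemma C_k_mult: "C_k k f ==> C_k k g ==> C_k k (\<lambda>x. f x * g x)"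
proof (induction k arbitrary: f g)
  case 0 then show ?case by (auto intro: continuous_intros)
next
  case (Suc k)
  then have d: "f differentiable (at x)" "g differentiable (at x)" for x
    by (auto simp: differentiable_on_def)
  have "frechet_derivative (\<lambda>x. f x * g x) (at x) b
    = f x * frechet_derivative g (at x) b + frechet_derivative f (at x) b * g x" for x b
    using frechet_derivative_at[OF has_derivative_mult[OF d[THEN frechet_derivative_works[THEN iffD1]]]] by metis
  moreover have "C_k k (\<lambda>x. f x * frechet_derivative g (at x) b + frechet_derivative f (at x) b * g x)"
    if "b \<in> Basis" for b
    using Suc.prems that C_k_Suc_imp[OF Suc.prems(1)] C_k_Suc_imp[OF Suc.prems(2)]
    by (intro C_k_add Suc.IH) auto
  ultimately show ?case using Suc.prems by (auto intro: differentiable_on_mult)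
qed

lemma C_k_prod: "(\<And>i. i \<in> I ==> C_k k (f i)) ==> C_k k (\<lambda>x. \<Prod>i\<in>I. f i x)"
  by (induction I rule: infinite_finite_induct) (auto intro: C_k_const C_k_mult)

text \<open>The powers of \<open>1 / t\<close> make the family closed under differentiation; the
  parameter \<open>e\<close> later tends to zero, so that the bumps tend to an indicator.\<close>

definition bump :: "real => nat => real => real" where
  "bump e k t = (if t > 0 then (1 / t) ^ k * exp (- e / t) else 0)"

text \<open>After the substitution \<open>s = e / t\<close> the exponential beats every
  power.\<close>

lemma bump_tendsto_0:
  fixes e :: real
  assumes "e > 0" shows "((\<lambda>t. (1 / t) ^ k * exp (- e / t)) \<longlongrightarrow> 0) (at_right 0)"
proof -
  have "((\<lambda>s::real. (1/e)^k * (s ^ k / exp s)) \<longlongrightarrow> (1/e)^k * 0) at_top"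
    by (intro tendsto_intros tendsto_power_div_exp_0)
  moreover have "filterlim (\<lambda>t. e * inverse t) at_top (at_right (0::real))"
    using assms by (intro filterlim_tendsto_pos_mult_at_top[OF tendsto_const] filterlim_inverse_at_top_right)
  ultimately have "((\<lambda>t. (1/e)^k * ((e * inverse t) ^ k / exp (e * inverse t))) \<longlongrightarrow> 0) (at_right 0)"
    using filterlim_compose by fastforce
  moreover have "(1/e)^k * ((e * inverse t) ^ k / exp (e * inverse t)) = (1 / t) ^ k * exp (- e / t)" for t
    using assms by (simp add: power_mult_distrib power_divide exp_minus field_simps)
  ultimately show ?thesis by simp
qed

lemma bump_derivative:
  assumes e: "e > 0"
  shows "(bump e k has_real_derivative (- real k * bump e (Suc k) t + e * bump e (Suc (Suc k)) t)) (at t)"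
proof -
  consider "t > 0" | "t < 0" | "t = 0" by linarith
  then show ?thesis
  proof cases
    case 1
    have "((\<lambda>t. (1 / t) ^ k * exp (- e / t)) has_real_derivative
        (- real k * bump e (Suc k) t + e * bump e (Suc (Suc k)) t)) (at t)"
    proof -
      have inv: "((\<lambda>t. 1 / t) has_real_derivative - (1 / t)\<^sup>2) (at t)"
        using 1 by (auto intro!: derivative_eq_intros simp: power2_eq_square)
      have "((\<lambda>t. exp (- e / t)) has_real_derivative exp (- e / t) * (e * (1 / t)\<^sup>2)) (at t)"
        using 1 by (auto intro!: derivative_eq_intros simp: power2_eq_square)
      note DERIV_mult[OF DERIV_power[OF inv, of k] this]
      moreover have "real k * (- r\<^sup>2 * r ^ (k - Suc 0)) * E + E * (e * r\<^sup>2) * r ^ k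
        = - real k * (r ^ Suc k * E) + e * (r ^ Suc (Suc k) * E)" for r E
        by (cases k) (simp_all add: power2_eq_square algebra_simps)
      moreover have "bump e m t = (1 / t) ^ m * exp (- e / t)" for m using 1 by (simp add: bump_def)
      ultimately show ?thesis by (simp only:)
    qed
    moreover have "\<forall>\<^sub>F s in nhds t. bump e k s = (1 / s) ^ k * exp (- e / s)"
      using eventually_nhds_in_open[of "{0<..}" t] 1 by (auto simp: bump_def elim: eventually_mono)
    ultimately show ?thesis by (subst DERIV_cong_ev[OF refl _ refl]) auto
  next
    case 2
    have "\<forall>\<^sub>F s in nhds t. bump e k s = 0"
      using eventually_nhds_in_open[of "{..<0}" t] 2 by (auto simp: bump_def elim: eventually_mono)
    then show ?thesis using 2 by (subst DERIV_cong_ev[OF refl _ refl]) (auto simp: bump_def)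
  next
    case 3
    \<comment> \<open>At zero, from the right, the difference quotient is the next member of the
      family, which tends to zero.\<close>
    have r: "((\<lambda>h. bump e k h / h) \<longlongrightarrow> 0) (at_right 0)"
    proof (rule Lim_transform_eventually[OF bump_tendsto_0[OF e, of "Suc k"]])
      show "\<forall>\<^sub>F t in at_right 0. (1 / t) ^ Suc k * exp (- e / t) = bump e k t / t"
        unfolding eventually_at_right_field by (auto simp: bump_def intro!: exI[of _ 1])
    qed
    have l: "((\<lambda>h. bump e k h / h) \<longlongrightarrow> 0) (at_left 0)"
    proof (rule Lim_transform_eventually[OF tendsto_const])
      show "\<forall>\<^sub>F t in at_left 0. 0 = bump e k t / t"
        unfolding eventually_at_left_field by (auto simp: bump_def intro!: exI[of _ "-1"])
    qed
    have "((\<lambda>h. bump e k h / h) \<longlongrightarrow> 0) (at 0)" using l r by (simp add: filterlim_at_split)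
    then show ?thesis using 3 by (simp add: DERIV_def bump_def)
  qed
qed

lemma C_k_bump:
  fixes b :: "'a::euclidean_space"
  assumes e: "e > 0" shows "C_k n (\<lambda>x. bump e k (s * (x \<bullet> b) + a))"
proof (induction n arbitrary: k)
  case 0
  have "continuous_on UNIV (bump e k)"
    using bump_derivative[OF e] DERIV_isCont by (blast intro: continuous_at_imp_continuous_on)
  then show ?case
    by (auto intro!: continuous_on_compose2[of UNIV "bump e k"] continuous_intros)
next
  case (Suc n)
  let ?D = "\<lambda>t. - real k * bump e (Suc k) t + e * bump e (Suc (Suc k)) t"
  have hd: "((\<lambda>x. bump e k (s * (x \<bullet> b) + a)) has_derivative
      (\<lambda>v. ?D (s * (x \<bullet> b) + a) * (s * (v \<bullet> b)))) (at x)" for x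
  proof -
    have "(bump e k has_derivative (\<lambda>h. ?D (s * (x \<bullet> b) + a) * h)) (at (s * (x \<bullet> b) + a))"
      using bump_derivative[OF e] by (simp add: has_field_derivative_def)
    moreover have "((\<lambda>x. s * (x \<bullet> b) + a) has_derivative (\<lambda>v. s * (v \<bullet> b))) (at x)"
      by (auto intro!: derivative_eq_intros)
    ultimately show ?thesis
      using has_derivative_compose[of "\<lambda>x. s * (x \<bullet> b) + a" "\<lambda>v. s * (v \<bullet> b)" x UNIV "bump e k"] by simp
  qed
  have "frechet_derivative (\<lambda>x. bump e k (s * (x \<bullet> b) + a)) (at x) v
      = ((- real k * (s * (v \<bullet> b))) * bump e (Suc k) (s * (x \<bullet> b) + a)
       + (e * (s * (v \<bullet> b))) * bump e (Suc (Suc k)) (s * (x \<bullet> b) + a))" for x v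
    using frechet_derivative_at[OF hd, symmetric] by (simp add: algebra_simps)
  moreover have "C_k n (\<lambda>x. (- real k * (s * (v \<bullet> b))) * bump e (Suc k) (s * (x \<bullet> b) + a)
       + (e * (s * (v \<bullet> b))) * bump e (Suc (Suc k)) (s * (x \<bullet> b) + a))" for v
    by (intro C_k_add C_k_mult C_k_const Suc.IH)
  moreover have "(\<lambda>x. bump e k (s * (x \<bullet> b) + a)) differentiable_on UNIV"
    using hd unfolding differentiable_on_def differentiable_def by blast
  ultimately show ?case by simp
qed

text \<open>The arguments are written as \<open>s * (x \<bullet> b) + a\<close> with
  \<open>s = 1\<close> and \<open>s = - 1\<close>, the form to which \<open>C_k_bump\<close>
  applies.\<close>

definition box_bump :: "real => 'a::euclidean_space => 'a => 'a => real" where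
  "box_bump e l u x = (\<Prod>b\<in>Basis. bump e 0 (1 * (x \<bullet> b) + - (l \<bullet> b)) * bump e 0 (- 1 * (x \<bullet> b) + u \<bullet> b))"

lemma box_bump_eq_0_iff: "box_bump e l u x = 0 \<longleftrightarrow> x \<notin> box l u"
proof -
  have "bump e 0 t = 0 \<longleftrightarrow> \<not> t > 0" for t by (simp add: bump_def)
  then have "box_bump e l u x = 0 \<longleftrightarrow> (\<exists>b\<in>Basis. \<not> l \<bullet> b < x \<bullet> b \<or> \<not> x \<bullet> b < u \<bullet> b)"
    unfolding box_bump_def by simp
  then show ?thesis unfolding mem_box by blast
qed

lemma box_bump_bounds: assumes "e > 0" shows "0 \<le> box_bump e l u x" "box_bump e l u x \<le> indicator (box l u) x"
proof -
  have b: "0 \<le> bump e 0 t" "bump e 0 t \<le> 1" for t using assms by (auto simp: bump_def)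
  show "0 \<le> box_bump e l u x" unfolding box_bump_def using b by (intro prod_nonneg) auto
  have "box_bump e l u x \<le> 1"
    unfolding box_bump_def using b by (intro prod_le_1) (auto intro: mult_le_one)
  then show "box_bump e l u x \<le> indicator (box l u) x"
    using box_bump_eq_0_iff[of e l u x] by (auto simp: indicator_def)
qed

lemma box_bump_tendsto:
  fixes l u x :: "'a::euclidean_space"
  shows "(\<lambda>n. box_bump (1 / real (Suc n)) l u x) \<longlonglongrightarrow> indicator (box l u) x"
proof (cases "x \<in> box l u")
  case True
  have t: "(\<lambda>n. bump (1 / real (Suc n)) 0 t) \<longlonglongrightarrow> 1" if "t > 0" for t
  proof -
    have "(\<lambda>n. exp (- (1 / real (Suc n)) / t)) \<longlonglongrightarrow> exp (- 0 / t)"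
      using that by (intro tendsto_intros LIMSEQ_Suc[OF lim_1_over_n]) auto
    then show ?thesis using that by (simp add: bump_def)
  qed
  have "(\<lambda>n. box_bump (1 / real (Suc n)) l u x) \<longlonglongrightarrow> (\<Prod>b\<in>(Basis :: 'a set). 1 * 1)"
    unfolding box_bump_def
  proof (intro tendsto_prod tendsto_mult t)
    fix b :: 'a assume "b \<in> Basis"
    then have "l \<bullet> b < x \<bullet> b" "x \<bullet> b < u \<bullet> b" using True by (auto simp: mem_box)
    then show "0 < 1 * (x \<bullet> b) + - (l \<bullet> b)" "0 < - 1 * (x \<bullet> b) + u \<bullet> b" by auto
  qed
  then show ?thesis using True by simp
next
  case False
  then show ?thesis using box_bump_eq_0_iff[of _ l u x] by simp
qed

lemma test_function_box_bump:
  fixes l u :: "'a::euclidean_space"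
  assumes "e > 0" "cbox l u \<subseteq> \<Omega>" shows "test_function \<Omega> (box_bump e l u)"
proof -
  have "C_k k (box_bump e l u)" for k
    unfolding box_bump_def by (intro C_k_prod C_k_mult C_k_bump assms)
  moreover have "closure {x. box_bump e l u x \<noteq> 0} \<subseteq> cbox l u"
    unfolding box_bump_eq_0_iff by (intro closure_minimal) (auto simp: box_subset_cbox[THEN subsetD])
  moreover then have "compact (closure {x. box_bump e l u x \<noteq> 0})"
    using bounded_subset[OF bounded_cbox] by (auto simp: compact_eq_bounded_closed)
  ultimately show ?thesis using assms(2) unfolding test_function_def by blast
qed

text \<open>Boxes are an intersection-stable generator of the Borel sets, so the integrals vanish
  over every Borel set, in particular over the sets where \<open>h\<close> is positive and where it
  is negative.\<close>

lemma integral_indicator_boxes_zero: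
  fixes h :: "'a::euclidean_space => real"
  assumes h: "integrable lborel h" and z: "\<And>l u. (LINT x|lborel. indicator (box l u) x * h x) = 0"
    and z1: "(LINT x|lborel. h x) = 0"
  shows "AE x in lborel. h x = 0"
proof -
  have i: "integrable lborel (\<lambda>x. indicator A x * h x)" if "A \<in> sets borel" for A
    using integrable_real_mult_indicator[of A lborel h] h that by (simp add: mult.commute)
  have S: "sigma_sets UNIV (range (\<lambda>(a, b). box a b)) = sets (borel :: 'a measure)"
    by (simp add: borel_eq_box)
  have A0: "(LINT x|lborel. indicator A x * h x) = 0" if "A \<in> sets borel" for A
  proof -
    have "Int_stable (range (\<lambda>(a, b). box a b :: 'a set))"
      by (auto simp: Int_stable_def box_Int_box)
    moreover have "range (\<lambda>(a, b). box a b :: 'a set) \<subseteq> Pow UNIV" by simp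
    moreover have "A \<in> sigma_sets UNIV (range (\<lambda>(a, b). box a b))" using that S by simp
    ultimately show ?thesis
    proof (induction rule: sigma_sets_induct_disjoint)
      case (basic B) then show ?case using z by auto
    next
      case empty show ?case by simp
    next
      case (compl B)
      then have B: "B \<in> sets borel" using S by simp
      have "(\<lambda>x. indicator (UNIV - B) x * h x) = (\<lambda>x. h x - indicator B x * h x)"
        by (auto simp: indicator_def)
      then show ?case using compl z1 h i[OF B] by simp
    next
      case (union B)
      then have B: "B n \<in> sets borel" for n using S by auto
      have "set_lebesgue_integral lborel (\<Union>n. B n) h = (\<Sum>n. set_lebesgue_integral lborel (B n) h)"
        using union(1) B i[of "\<Union>n. B n"]
        by (intro lebesgue_integral_countable_add) (auto simp: disjoint_family_on_def set_integrable_def)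
      then show ?case using union by (simp add: set_lebesgue_integral_def)
    qed
  qed
  have m: "h \<in> borel_measurable lborel" using h by simp
  have P: "AE x in lborel. indicator {x. h x > 0} x * h x = 0"
    using A0[of "{x. h x > 0}"] i[of "{x. h x > 0}"] m
    by (subst integral_nonneg_eq_0_iff_AE[symmetric]) (auto simp: indicator_def)
  have N: "AE x in lborel. - (indicator {x. h x < 0} x * h x) = 0"
    using A0[of "{x. h x < 0}"] i[of "{x. h x < 0}"] m
    by (subst integral_nonneg_eq_0_iff_AE[symmetric]) (auto simp: indicator_def)
  show ?thesis using P N by eventually_elim (auto simp: indicator_def split: if_splits)
qed

text \<open>Bumps converge boundedly to the indicator of a box whose closure lies in \<Omega>, so
  \<open>h\<close> has integral zero over all such boxes; countably many closed boxes inside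
  \<Omega> cover it.\<close>

lemma AE_zero_of_test_functions:
  fixes \<Omega> :: "'a::euclidean_space set"
  assumes \<Omega>: "open \<Omega>" and h: "h \<in> L2 \<Omega>"
    and z: "\<And>\<phi>. test_function \<Omega> \<phi> ==> L2_inner \<Omega> h \<phi> = 0"
  shows "AE x in lebesgue. x \<in> \<Omega> \<longrightarrow> h x = 0"
proof -
  have S: "\<Omega> \<in> sets lebesgue" using \<Omega> by (simp add: borel_open sets_completionI_sets)
  have hm: "(\<lambda>x. indicator \<Omega> x * h x) \<in> borel_measurable lebesgue"
    using h S by (simp add: L2_def borel_measurable_restrict_space_iff)
  have hb: "intg_on (box l u) (\<lambda>x. indicator \<Omega> x * h x)" for l u
  proof -
    have "integrable lebesgue (\<lambda>x. indicator \<Omega> x * (h x)\<^sup>2)"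
      using h S integrable_restrict_space[of \<Omega> lebesgue "\<lambda>x. (h x)\<^sup>2"] by (simp add: L2_def)
    then have "integrable lebesgue (\<lambda>x. indicator (box l u) x * (1 + indicator \<Omega> x * (h x)\<^sup>2))"
      using integrable_real_mult_indicator[of "box l u" lebesgue "\<lambda>x. indicator \<Omega> x * (h x)\<^sup>2"]
        lmeasurable_box[of l u] by (simp add: distrib_left mult.commute fmeasurable_def)
    then show ?thesis unfolding intg_on_def
    proof (rule Bochner_Integration.integrable_bound)
      show "(\<lambda>x. indicat_real (box l u) x * (indicat_real \<Omega> x * h x)) \<in> borel_measurable lebesgue"
        by (rule borel_measurable_times[OF borel_measurable_indicator hm]) simp
      \<comment> \<open>Square integrable functions are integrable on bounded sets.\<close>
      have "\<bar>a\<bar> \<le> 1 + a\<^sup>2" for a :: real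
        using zero_le_power2[of "\<bar>a\<bar> - 1/2"] by (simp add: power2_eq_square algebra_simps)
      then show "AE x in lebesgue. norm (indicat_real (box l u) x * (indicat_real \<Omega> x * h x))
          \<le> norm (indicat_real (box l u) x * (1 + indicat_real \<Omega> x * (h x)\<^sup>2))"
        by (auto simp: indicator_def)
    qed
  qed
  have boxz: "int_on (box l u) h = 0" if "cbox l u \<subseteq> \<Omega>" for l u
  proof -
    have ind: "indicator (box l u) x * (indicator \<Omega> x * h x) = indicator (box l u) x * h x" for x
      using that box_subset_cbox[of l u] by (auto simp: indicator_def)
    have "(\<lambda>n. LINT x|lebesgue. box_bump (1 / real (Suc n)) l u x * (indicator \<Omega> x * h x))
        \<longlonglongrightarrow> (LINT x|lebesgue. indicator (box l u) x * (indicator \<Omega> x * h x))"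
    proof (rule integral_dominated_convergence[where w = "\<lambda>x. \<bar>indicator (box l u) x * (indicator \<Omega> x * h x)\<bar>"])
      show "(\<lambda>x. indicat_real (box l u) x * (indicat_real \<Omega> x * h x)) \<in> borel_measurable lebesgue"
        using hb[of l u] by (auto simp: intg_on_def)
      show "(\<lambda>x. box_bump (1 / real (Suc n)) l u x * (indicat_real \<Omega> x * h x)) \<in> borel_measurable lebesgue" for n
      proof (rule borel_measurable_times[OF _ hm])
        have "C_k 0 (box_bump (1 / real (Suc n)) l u)"
          using test_function_box_bump[OF _ that, of "1 / real (Suc n)"] unfolding test_function_def by auto
        then show "box_bump (1 / real (Suc n)) l u \<in> borel_measurable lebesgue"
          by (simp add: borel_measurable_continuous_onI measurable_completion)
      qed
      show "integrable lebesgue (\<lambda>x. \<bar>indicat_real (box l u) x * (indicat_real \<Omega> x * h x)\<bar>)"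
        using hb[of l u] by (auto simp: intg_on_def)
      show "AE x in lebesgue. (\<lambda>n. box_bump (1 / real (Suc n)) l u x * (indicat_real \<Omega> x * h x))
          \<longlonglongrightarrow> indicat_real (box l u) x * (indicat_real \<Omega> x * h x)"
        by (intro AE_I2 tendsto_mult box_bump_tendsto tendsto_const)
      show "AE x in lebesgue. norm (box_bump (1 / real (Suc n)) l u x * (indicat_real \<Omega> x * h x))
          \<le> \<bar>indicat_real (box l u) x * (indicat_real \<Omega> x * h x)\<bar>" for n
      proof (intro AE_I2)
        fix x
        have "\<bar>box_bump (1 / real (Suc n)) l u x\<bar> \<le> indicat_real (box l u) x"
          using box_bump_bounds[of "1 / real (Suc n)" l u x] by simp
        then show "norm (box_bump (1 / real (Suc n)) l u x * (indicat_real \<Omega> x * h x))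
          \<le> \<bar>indicat_real (box l u) x * (indicat_real \<Omega> x * h x)\<bar>"
          by (simp add: abs_mult mult_right_mono)
      qed
    qed
    moreover have "(LINT x|lebesgue. box_bump (1 / real (Suc n)) l u x * (indicator \<Omega> x * h x)) = 0" for n
      using z[OF test_function_box_bump[OF _ that, of "1 / real (Suc n)"]]
      unfolding L2_inner_int_on[OF S] int_on_def by (simp add: mult_ac)
    ultimately have "(\<lambda>n. 0) \<longlonglongrightarrow> (LINT x|lebesgue. indicator (box l u) x * (indicator \<Omega> x * h x))"
      by (simp only:)
    then have "(LINT x|lebesgue. indicator (box l u) x * (indicator \<Omega> x * h x)) = 0"
      by (simp add: LIMSEQ_const_iff)
    then show ?thesis unfolding int_on_def using ind by simp
  qed
  have local: "AE x in lebesgue. x \<in> box l u \<longrightarrow> h x = 0" if lu: "cbox l u \<subseteq> \<Omega>" for l u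
  proof -
    have ind: "(\<lambda>x. indicator (box l u) x * (indicator \<Omega> x * h x)) = (\<lambda>x. indicator (box l u) x * h x)"
      using lu box_subset_cbox[of l u] by (auto simp: fun_eq_iff indicator_def)
    have int: "integrable lebesgue (\<lambda>x. indicator (box l u) x * h x)"
      using hb[of l u] by (simp add: intg_on_def ind)
    \<comment> \<open>A Borel representative, since the generator argument runs over Borel sets
      while \<open>h\<close> is only Lebesgue measurable.\<close>
    obtain h' where h': "h' \<in> borel_measurable lborel" "AE x in lborel. indicator (box l u) x * h x = h' x"
      using completion_ex_borel_measurable_real[of "\<lambda>x. indicator (box l u) x * h x" lborel] int by auto
    have ae: "AE x in lebesgue. indicator (box l u) x * h x = h' x" using h'(2) by (rule AE_completion)
    have h'l: "integrable lebesgue h'"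
      using integrable_cong_AE[OF _ measurable_completion[OF h'(1)] ae] int by auto
    then have h'i: "integrable lborel h'" using h'(1) by (simp add: integrable_completion)
    have zero: "(LINT x|lborel. indicator (box a b) x * h' x) = 0" for a b
    proof -
      have mm: "(\<lambda>x. indicator (box a b) x * h' x) \<in> borel_measurable lborel" using h'(1) by simp
      have "(LINT x|lborel. indicator (box a b) x * h' x) = (LINT x|lebesgue. indicator (box a b) x * h' x)"
        using integral_completion[OF mm] by simp
      also have "\<dots> = (LINT x|lebesgue. indicator (box a b) x * (indicator (box l u) x * h x))"
      proof (rule integral_cong_AE)
        show "(\<lambda>x. indicat_real (box a b) x * h' x) \<in> borel_measurable lebesgue" using measurable_completion[OF mm] .
        show "(\<lambda>x. indicat_real (box a b) x * (indicat_real (box l u) x * h x)) \<in> borel_measurable lebesgue"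
          by (rule borel_measurable_times[OF borel_measurable_indicator]) (use int in auto)
        show "AE x in lebesgue. indicat_real (box a b) x * h' x = indicat_real (box a b) x * (indicat_real (box l u) x * h x)"
          using ae by eventually_elim simp
      qed
      finally have 1: "(LINT x|lborel. indicator (box a b) x * h' x)
        = (LINT x|lebesgue. indicator (box a b) x * (indicator (box l u) x * h x))" .
      obtain a' b' where ab: "box a b \<inter> box l u = box a' b'" unfolding box_Int_box by blast
      have "(\<lambda>x. indicator (box a b) x * (indicator (box l u) x * h x)) = (\<lambda>x. indicator (box a' b') x * h x)"
        unfolding ab[symmetric] by (auto simp: fun_eq_iff indicator_def)
      then have "(LINT x|lborel. indicator (box a b) x * h' x) = int_on (box a' b') h"
        unfolding 1 by (simp add: int_on_def)
      also have "\<dots> = 0"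
      proof (cases "box a' b' = {}")
        case True then show ?thesis by (simp add: int_on_def)
      next
        case False
        then have "cbox a' b' = closure (box a' b')" by (simp add: closure_box)
        also have "\<dots> \<subseteq> cbox l u" using ab box_subset_cbox[of l u] by (intro closure_minimal) auto
        finally show ?thesis using boxz[of a' b'] lu by blast
      qed
      finally show ?thesis .
    qed
    moreover have "(LINT x|lborel. h' x) = 0"
    proof -
      have "(LINT x|lborel. h' x) = (LINT x|lebesgue. h' x)" using integral_completion[OF h'(1)] by simp
      also have "\<dots> = int_on (box l u) h"
        unfolding int_on_def using int h'l by (intro integral_cong_AE) (use ae in \<open>auto elim: eventually_mono\<close>)
      finally show ?thesis using boxz[OF lu] by simp
    qed
    ultimately have "AE x in lborel. h' x = 0" using integral_indicator_boxes_zero[OF h'i] by blast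
    then have "AE x in lebesgue. h' x = 0" by (rule AE_completion)
    then show ?thesis using ae by eventually_elim (auto simp: indicator_def)
  qed
  obtain \<D> where \<D>: "countable \<D>" "\<D> \<subseteq> Pow \<Omega>" "\<And>X. X \<in> \<D> ==> \<exists>a b. X = cbox a b" "\<Union>\<D> = \<Omega>"
    using open_countable_Union_open_cbox[OF \<Omega>] by metis
  have "AE x in lebesgue. x \<in> X \<longrightarrow> h x = 0" if X: "X \<in> \<D>" for X
  proof -
    obtain a b where ab: "X = cbox a b" using \<D>(3)[OF X] by blast
    have "cbox a b - box a b \<in> null_sets lebesgue"
      using negligible_frontier_interval by (simp add: negligible_iff_null_sets)
    then have "AE x in lebesgue. x \<notin> cbox a b - box a b" by (rule AE_not_in)
    moreover have "AE x in lebesgue. x \<in> box a b \<longrightarrow> h x = 0" using local[of a b] \<D>(2) X ab by blast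
    ultimately show ?thesis unfolding ab by eventually_elim blast
  qed
  then have "AE x in lebesgue. \<forall>X\<in>\<D>. x \<in> X \<longrightarrow> h x = 0"
    using AE_ball_countable[OF \<D>(1), of "\<lambda>x X. x \<in> X \<longrightarrow> h x = 0" lebesgue] by blast
  then show ?thesis by eventually_elim (use \<D>(4) in blast)
qed

section \<open>Difference quotients\<close>

lemma lipschitz_continuous: "L-lipschitz_on UNIV f ==> continuous_on S f"
  using lipschitz_on_continuous_on continuous_on_subset by blast

lemma continuous_compact_support_integrable:
  fixes f :: "'a::euclidean_space => real"
  assumes "continuous_on UNIV f" "\<And>x. x \<notin> cball 0 R ==> f x = 0" shows "integrable lebesgue f"
proof -
  have "intg_on (cball 0 R) f" using assms by (intro intg_on_continuous) (auto intro: continuous_on_subset)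
  moreover have "(\<lambda>x. indicator (cball 0 R) x * f x) = f" using assms(2) by (auto simp: fun_eq_iff indicator_def)
  ultimately show ?thesis by (simp add: intg_on_def)
qed

lemma continuous_lebesgue_measurable: "continuous_on UNIV f ==> f \<in> borel_measurable lebesgue"
  by (simp add: borel_measurable_continuous_onI measurable_completion)

lemma filterlim_1_over_Suc: "filterlim (\<lambda>n. 1 / real (Suc n)) (at 0) sequentially"
proof -
  have "(\<lambda>n. 1 / real (Suc n)) \<longlonglongrightarrow> 0" by (rule LIMSEQ_Suc[OF lim_1_over_n])
  then show ?thesis by (simp add: filterlim_at del: of_nat_Suc)
qed

lemma lebesgue_shift:
  fixes f :: "'a::euclidean_space => real"
  assumes f: "f \<in> borel_measurable borel" "integrable lebesgue f"
  shows "integrable lebesgue (\<lambda>x. f (x + c))" and "(LINT x|lebesgue. f (x + c)) = (LINT x|lebesgue. f x)"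
proof -
  have m: "(\<lambda>x. f (x + c)) \<in> borel_measurable borel" using f(1) by measurable
  have "integrable lborel f" using f by (simp add: integrable_completion)
  then have "integrable (distr lborel borel ((+) c)) f" by (simp add: lborel_distr_plus)
  then have "integrable lborel (\<lambda>x. f (c + x))" using f(1) by (subst (asm) integrable_distr_eq) auto
  then show "integrable lebesgue (\<lambda>x. f (x + c))" using m by (simp add: integrable_completion add.commute)
  have "(LINT x|lebesgue. f (x + c)) = (LINT x|lborel. f (c + x))"
    using m by (simp add: integral_completion add.commute)
  also have "\<dots> = (LINT x|distr lborel borel ((+) c). f x)" using f(1) by (subst integral_distr) auto
  also have "\<dots> = (LINT x|lebesgue. f x)" using f(1) by (simp add: lborel_distr_plus integral_completion)
  finally show "(LINT x|lebesgue. f (x + c)) = (LINT x|lebesgue. f x)" .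
qed

text \<open>The difference quotients of a compactly supported Lipschitz function have integral zero; this
  passes to the limit.\<close>

lemma directional_derivative_integral_zero:
  fixes f D :: "'a::euclidean_space => real"
  assumes f: "f \<in> borel_measurable borel" "integrable lebesgue f"
    and L: "\<And>x t. \<bar>f (x + t *\<^sub>R b) - f x\<bar> \<le> L * \<bar>t\<bar>" and supp: "\<And>x. x \<notin> cball 0 R ==> f x = 0"
    and D: "AE x in lebesgue. ((\<lambda>t. f (x + t *\<^sub>R b)) has_real_derivative D x) (at 0)"
  shows "(LINT x|lebesgue. D x) = 0"
proof -
  let ?q = "\<lambda>n x. (f (x + (1 / real (Suc n)) *\<^sub>R b) - f x) / (1 / real (Suc n))"
  have qm: "?q n \<in> borel_measurable lebesgue" for n
  proof -
    have "?q n \<in> borel_measurable borel" using f(1) by measurable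
    then show ?thesis by (simp add: measurable_completion)
  qed
  have lim: "AE x in lebesgue. (\<lambda>n. ?q n x) \<longlonglongrightarrow> D x"
    using D
  proof eventually_elim
    case (elim x)
    then have "((\<lambda>t. (f (x + t *\<^sub>R b) - f x) / t) \<longlongrightarrow> D x) (at 0)"
      by (simp add: DERIV_def)
    from filterlim_compose[OF this filterlim_1_over_Suc] show ?case .
  qed
  have Dm: "D \<in> borel_measurable lebesgue"
  proof -
    have "(\<lambda>x. lim (\<lambda>n. ?q n x)) \<in> borel_measurable lebesgue"
      using qm by (intro borel_measurable_lim_metric)
    then show ?thesis
      by (rule borel_measurable_AE) (use lim in \<open>auto elim!: eventually_mono intro: limI\<close>)
  qed
  \<comment> \<open>The steps \<open>1 / real (Suc n)\<close> are at most one, so all quotients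
    vanish outside the support enlarged by \<open>norm b\<close>.\<close>
  have w: "integrable lebesgue (\<lambda>x. L * indicator (cball 0 (R + norm b)) x)"
    using lmeasurable_cball[of 0 "R + norm b"] by (intro integrable_mult_right) (auto simp: fmeasurable_def)
  have "(\<lambda>n. LINT x|lebesgue. ?q n x) \<longlonglongrightarrow> (LINT x|lebesgue. D x)"
  proof (rule integral_dominated_convergence[OF Dm qm w lim], rule AE_I2)
    fix n x
    show "norm (?q n x) \<le> L * indicator (cball 0 (R + norm b)) x"
    proof (cases "x \<in> cball 0 (R + norm b)")
      case True
      have "\<bar>f (x + (1 / real (Suc n)) *\<^sub>R b) - f x\<bar> \<le> L * (1 / real (Suc n))"
        using L[of x "1 / real (Suc n)"] by simp
      then show ?thesis unfolding real_norm_def abs_divide using True by (subst pos_divide_le_eq) simp_all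
    next
      case False
      have "norm ((1 / real (Suc n)) *\<^sub>R b) \<le> norm b" by (simp add: divide_le_eq mult_le_cancel_left1 mult.commute)
      then have "norm x \<le> norm (x + (1 / real (Suc n)) *\<^sub>R b) + norm b"
        using norm_triangle_ineq4[of "x + (1 / real (Suc n)) *\<^sub>R b" "(1 / real (Suc n)) *\<^sub>R b"] by simp
      moreover have "norm x > R + norm b" "norm b \<ge> 0" using False by simp_all
      ultimately have "norm (x + (1 / real (Suc n)) *\<^sub>R b) > R" "norm x > R" by linarith+
      then have "x + (1 / real (Suc n)) *\<^sub>R b \<notin> cball 0 R" "x \<notin> cball 0 R" by simp_all
      then show ?thesis using supp False by simp
    qed
  qed
  moreover have "(LINT x|lebesgue. ?q n x) = 0" for n
    using lebesgue_shift[OF f, of "(1 / real (Suc n)) *\<^sub>R b"] f(2) by simp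
  ultimately show ?thesis by (simp add: LIMSEQ_const_iff)
qed

lemma lipschitz_directional_integral_zero:
  fixes f D :: "'a::euclidean_space => real"
  assumes L: "L-lipschitz_on UNIV f" and supp: "\<And>x. x \<notin> cball 0 R ==> f x = 0"
    and D: "AE x in lebesgue. ((\<lambda>t. f (x + t *\<^sub>R b)) has_real_derivative D x) (at 0)"
  shows "(LINT x|lebesgue. D x) = 0"
proof (rule directional_derivative_integral_zero[OF _ _ _ supp D])
  show "f \<in> borel_measurable borel" "integrable lebesgue f"
    by (rule borel_measurable_continuous_onI[OF lipschitz_continuous[OF L]])
      (rule continuous_compact_support_integrable[OF lipschitz_continuous[OF L] supp])
  show "\<bar>f (x + t *\<^sub>R b) - f x\<bar> \<le> L * norm b * \<bar>t\<bar>" for x t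
    using lipschitz_onD[OF L, of "x + t *\<^sub>R b" x] by (simp add: dist_norm mult_ac)
qed

section \<open>Weak gradients of finite element functions\<close>

context conf_mesh begin

text \<open>A segment between two arbitrary points may leave \<Omega> and cross many cells. The
  cells and the complement of \<Omega> cut it into finitely many closed pieces with a common
  Lipschitz constant, and on an interval such bounds add up.\<close>

lemma fe_lipschitz:
  assumes u: "u \<in> fe_space \<Omega> \<T>" shows "\<exists>L. L-lipschitz_on UNIV u"
proof -
  define L where "L = (\<Sum>K\<in>\<T>. norm (gr u K))"
  have L0: "L \<ge> 0" unfolding L_def by (intro sum_nonneg) auto
  have piece: "\<bar>u x - u y\<bar> \<le> L * norm (x - y)" if "H \<in> insert (- \<Omega>) \<T>" "x \<in> H" "y \<in> H" for H x y
  proof (cases "H \<in> \<T>")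
    case True
    have "\<bar>u x - u y\<bar> \<le> norm (gr u H) * norm (x - y)"
      unfolding affine_on_gr[OF full[OF True] fe_affine[OF u True] that(2,3)] by (rule Cauchy_Schwarz_ineq2)
    also have "\<dots> \<le> L * norm (x - y)"
      unfolding L_def using True finite_mesh by (intro mult_right_mono member_le_sum) auto
    finally show ?thesis .
  next
    case False
    then show ?thesis using that fe_zero[OF u] L0 by simp
  qed
  have "\<bar>u x - u y\<bar> \<le> L * norm (x - y)" for x y
  proof -
    let ?g = "\<lambda>t. x + t *\<^sub>R (y - x)"
    let ?U = "\<lambda>H. ?g -` H"
    have "(L * norm (x - y))-lipschitz_on {0..1} (\<lambda>t. u (?g t))"
    proof (rule lipschitz_on_closed_Union[of "insert (- \<Omega>) \<T>" _ ?U])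
      show "(L * norm (x - y))-lipschitz_on (?U H) (\<lambda>t. u (?g t))" if "H \<in> insert (- \<Omega>) \<T>" for H
      proof (rule lipschitz_onI)
        fix s t assume "s \<in> ?U H" "t \<in> ?U H"
        then have "\<bar>u (?g s) - u (?g t)\<bar> \<le> L * norm (?g s - ?g t)" by (intro piece[OF that]) (simp_all only: vimage_eq)
        moreover have "?g s - ?g t = (s - t) *\<^sub>R (y - x)" by (simp add: algebra_simps)
        ultimately show "dist (u (?g s)) (u (?g t)) \<le> L * norm (x - y) * dist s t"
          by (simp add: dist_norm norm_minus_commute mult_ac)
      qed (use L0 in simp)
      show "closed (?U H)" if "H \<in> insert (- \<Omega>) \<T>" for H
        using that open_dom closed_fs[OF full] by (intro closed_vimage continuous_intros) (auto simp: closed_def)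
      show "{0..1} \<subseteq> \<Union> (?U ` insert (- \<Omega>) \<T>)"
      proof
        fix t :: real
        have "?g t \<in> - \<Omega> \<or> ?g t \<in> \<Union>\<T>" unfolding Union_mesh using closure_subset by blast
        then show "t \<in> \<Union> (?U ` insert (- \<Omega>) \<T>)" by blast
      qed
    qed (use finite_mesh L0 in auto)
    from lipschitz_onD[OF this, of 0 1] show ?thesis by (simp add: dist_norm)
  qed
  then show ?thesis using L0 by (intro exI[of _ L] lipschitz_onI) (auto simp: dist_norm)
qed

text \<open>Zero on the cell frontiers, where the gradient may jump; they are null sets.\<close>

definition pgrad :: "('a => real) => 'a => 'a" where
  "pgrad u x = (\<Sum>K\<in>\<T>. indicator (interior K) x *\<^sub>R gr u K)"

lemma pgrad_interior:
  assumes "K \<in> \<T>" "x \<in> interior K" shows "pgrad u x = gr u K"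
proof -
  have "x \<notin> interior H" if "H \<in> \<T>" "H \<noteq> K" for H
    using interior_unique[OF that(1) assms(1) _ assms(2)] that(2) interior_subset by blast
  then have "pgrad u x = (\<Sum>H\<in>\<T>. if H = K then gr u K else 0)"
    unfolding pgrad_def using assms by (intro sum.cong) (auto simp: indicator_def)
  then show ?thesis using finite_mesh assms by simp
qed

lemma pgrad_outside: "x \<notin> \<Omega> ==> pgrad u x = 0"
  unfolding pgrad_def using interior_cell_dom by (intro sum.neutral) (auto simp: indicator_def)

lemma fe_has_derivative:
  assumes u: "u \<in> fe_space \<Omega> \<T>"
  shows "AE x in lebesgue. (u has_derivative (\<lambda>v. pgrad u x \<bullet> v)) (at x)"
proof (rule AE_I')
  show "(\<Union>H\<in>\<T>. frontier H) \<in> null_sets lebesgue"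
    using finite_mesh
    by (subst negligible_iff_null_sets[symmetric], intro negligible_Union)
      (auto intro!: negligible_convex_frontier convex_fs full)
  show "{x \<in> space lebesgue. \<not> (u has_derivative (\<lambda>v. pgrad u x \<bullet> v)) (at x)} \<subseteq> (\<Union>H\<in>\<T>. frontier H)"
  proof
    fix x assume x: "x \<in> {x \<in> space lebesgue. \<not> (u has_derivative (\<lambda>v. pgrad u x \<bullet> v)) (at x)}"
    show "x \<in> (\<Union>H\<in>\<T>. frontier H)"
    proof (rule ccontr)
      assume nf: "x \<notin> (\<Union>H\<in>\<T>. frontier H)"
      have "(u has_derivative (\<lambda>v. pgrad u x \<bullet> v)) (at x)"
      proof (cases "x \<in> closure \<Omega>")
        case True
        then obtain K where K: "K \<in> \<T>" "x \<in> K" using Union_mesh by blast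
        have xi: "x \<in> interior K" using nf K closure_subset[of K] unfolding frontier_def by blast
        have "((\<lambda>y. u x + gr u K \<bullet> (y - x)) has_derivative (\<lambda>v. gr u K \<bullet> v)) (at x)"
          by (auto intro!: derivative_eq_intros)
        then have "(u has_derivative (\<lambda>v. gr u K \<bullet> v)) (at x)"
        proof (rule has_derivative_transform_within_open[OF _ open_interior xi])
          fix y assume "y \<in> interior K"
          then have "y \<in> K" using interior_subset by blast
          from affine_on_gr[OF full[OF K(1)] fe_affine[OF u K(1)] this K(2)]
          show "u x + gr u K \<bullet> (y - x) = u y" by simp
        qed
        then show ?thesis using pgrad_interior[OF K(1) xi] by simp
      next
        case False
        have o: "open (- closure \<Omega>)" by auto
        have "((\<lambda>y. 0) has_derivative (\<lambda>v. 0)) (at x)" by simp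
        then have "(u has_derivative (\<lambda>v. 0)) (at x)"
          by (rule has_derivative_transform_within_open[OF _ o])
            (use False fe_zero[OF u] closure_subset[of \<Omega>] in auto)
        moreover have "pgrad u x = 0" using False closure_subset[of \<Omega>] by (intro pgrad_outside) auto
        ultimately show ?thesis by simp
      qed
      then show False using x by simp
    qed
  qed
qed

lemma has_derivative_directional:
  assumes "(f has_derivative (\<lambda>v. g \<bullet> v)) (at x)"
  shows "((\<lambda>t. f (x + t *\<^sub>R b)) has_real_derivative g \<bullet> b) (at 0)"
proof -
  have "((\<lambda>t. x + t *\<^sub>R b) has_derivative (\<lambda>t. t *\<^sub>R b)) (at 0)" by (auto intro!: derivative_eq_intros)
  moreover have "(f has_derivative (\<lambda>v. g \<bullet> v)) (at (x + 0 *\<^sub>R b))" using assms by simp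
  ultimately have "((\<lambda>t. f (x + t *\<^sub>R b)) has_derivative (\<lambda>t. g \<bullet> (t *\<^sub>R b))) (at 0)"
    by (rule has_derivative_compose)
  then show ?thesis by (simp add: has_field_derivative_def mult_commute_abs)
qed

lemma pgrad_intg:
  assumes "K \<in> \<T>"
  shows "intg_on K (\<lambda>x. (pgrad u x \<bullet> b)\<^sup>2)" and "int_on K (\<lambda>x. (pgrad u x \<bullet> b)\<^sup>2) = measure lebesgue K * (gr u K \<bullet> b)\<^sup>2"
proof -
  note fs = full[OF assms]
  have neg: "frontier K \<in> null_sets lebesgue"
    using negligible_convex_frontier[OF convex_fs[OF fs]] by (simp add: negligible_iff_null_sets)
  have ae: "AE x in lebesgue. indicator K x * (gr u K \<bullet> b)\<^sup>2 = indicator K x * (pgrad u x \<bullet> b)\<^sup>2"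
  proof (rule AE_I'[OF neg], safe)
    fix x assume "indicator K x * (gr u K \<bullet> b)\<^sup>2 \<noteq> indicator K x * (pgrad u x \<bullet> b)\<^sup>2"
    then have "x \<in> K" "x \<notin> interior K" using pgrad_interior[OF assms] by (auto simp: indicator_def split: if_splits)
    then show "x \<in> frontier K" using closure_subset[of K] unfolding frontier_def by blast
  qed
  have c: "integrable lebesgue (\<lambda>x. indicator K x * (gr u K \<bullet> b)\<^sup>2)"
    using intg_on_const[OF lmeasurable_fs[OF fs]] by (simp add: intg_on_def)
  have m: "(\<lambda>x. indicator K x * (pgrad u x \<bullet> b)\<^sup>2) \<in> borel_measurable lebesgue"
    by (rule borel_measurable_AE[OF _ ae]) (use c in auto)
  show "intg_on K (\<lambda>x. (pgrad u x \<bullet> b)\<^sup>2)"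
    unfolding intg_on_def using integrable_cong_AE[OF _ m ae] c by auto
  have "int_on K (\<lambda>x. (pgrad u x \<bullet> b)\<^sup>2) = int_on K (\<lambda>x. (gr u K \<bullet> b)\<^sup>2)"
    unfolding int_on_def using c by (intro integral_cong_AE m) (use ae in \<open>auto elim: eventually_mono\<close>)
  then show "int_on K (\<lambda>x. (pgrad u x \<bullet> b)\<^sup>2) = measure lebesgue K * (gr u K \<bullet> b)\<^sup>2"
    using int_on_const[OF lmeasurable_fs[OF fs]] by simp
qed

lemma pgrad_measurable: "(\<lambda>x. pgrad u x \<bullet> b) \<in> borel_measurable lebesgue"
  unfolding pgrad_def inner_sum_left inner_scaleR_left
  by (intro borel_measurable_sum borel_measurable_times borel_measurable_indicator borel_measurable_const)
    (simp add: borel_open sets_completionI_sets)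

lemma pgrad_L2: "(\<lambda>x. pgrad u x \<bullet> b) \<in> L2 \<Omega>"
proof -
  have "intg_on \<Omega> (\<lambda>x. (pgrad u x \<bullet> b)\<^sup>2)" using int_on_dom(1) pgrad_intg(1) by blast
  then have "integrable (lebesgue_on \<Omega>) (\<lambda>x. (pgrad u x \<bullet> b)\<^sup>2)"
    using sets_dom by (subst integrable_restrict_space) (auto simp: intg_on_def)
  moreover have "(\<lambda>x. pgrad u x \<bullet> b) \<in> borel_measurable (lebesgue_on \<Omega>)"
    by (rule measurable_restrict_space1[OF pgrad_measurable])
  ultimately show ?thesis by (simp add: L2_def)
qed

lemma pgrad_norm: "(L2_norm \<Omega> (\<lambda>x. pgrad u x \<bullet> b))\<^sup>2 = (\<Sum>K\<in>\<T>. measure lebesgue K * (gr u K \<bullet> b)\<^sup>2)"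
  unfolding L2_norm_sq L2_inner_int_on[OF sets_dom] power2_eq_square[symmetric]
  using int_on_dom(2)[OF pgrad_intg(1)] pgrad_intg(2) by simp

text \<open>The Lipschitz bound holds because the partial derivatives are bounded on the compact
  support and vanish off it.\<close>

lemma test_function_lipschitz:
  assumes "test_function \<Omega> \<phi>"
  shows "\<exists>L. L-lipschitz_on UNIV \<phi>" and "\<phi> differentiable_on UNIV"
    and "\<exists>R. \<forall>x. x \<notin> cball 0 R \<longrightarrow> \<phi> x = 0"
    and "b \<in> Basis ==> continuous_on UNIV (\<lambda>x. frechet_derivative \<phi> (at x) b)"
proof -
  let ?K = "closure {x. \<phi> x \<noteq> 0}"
  have Lk: "compact ?K" "?K \<subseteq> \<Omega>" and C: "C_k (Suc 0) \<phi>" using assms unfolding test_function_def by auto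
  show diff: "\<phi> differentiable_on UNIV" using C by simp
  show cont: "continuous_on UNIV (\<lambda>x. frechet_derivative \<phi> (at x) b)" if "b \<in> Basis" for b
    using C that by simp
  obtain R where "\<forall>x\<in>?K. norm x \<le> R" using compact_imp_bounded[OF Lk(1)] unfolding bounded_iff by blast
  then have R: "?K \<subseteq> cball 0 R" by auto
  have "\<phi> x = 0" if "x \<notin> cball 0 R" for x
    using R that closure_subset[of "{x. \<phi> x \<noteq> 0}"] by blast
  then show "\<exists>R. \<forall>x. x \<notin> cball 0 R \<longrightarrow> \<phi> x = 0" by blast
  have hd: "(\<phi> has_derivative frechet_derivative \<phi> (at x)) (at x)" for x
    using diff frechet_derivative_works by (auto simp: differentiable_on_def)
  have d0: "frechet_derivative \<phi> (at x) = (\<lambda>v. 0)" if "x \<notin> ?K" for x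
  proof -
    have "((\<lambda>y. 0) has_derivative (\<lambda>v. 0)) (at x)" by simp
    then have "(\<phi> has_derivative (\<lambda>v. 0)) (at x)"
      by (rule has_derivative_transform_within_open[of _ _ _ _ "- ?K"])
        (use that closure_subset[of "{x. \<phi> x \<noteq> 0}"] in auto)
    then show ?thesis using frechet_derivative_at by metis
  qed
  have "\<exists>B. \<forall>x\<in>?K. \<bar>frechet_derivative \<phi> (at x) b\<bar> \<le> B" if "b \<in> Basis" for b
  proof -
    have "bounded ((\<lambda>x. frechet_derivative \<phi> (at x) b) ` ?K)"
      by (intro compact_imp_bounded compact_continuous_image Lk(1) continuous_on_subset[OF cont[OF that]]) simp
    then show ?thesis unfolding bounded_iff by auto
  qed
  then obtain B where B: "\<And>b x. b \<in> Basis ==> x \<in> ?K ==> \<bar>frechet_derivative \<phi> (at x) b\<bar> \<le> B b" by metis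
  define M where "M = (\<Sum>b\<in>(Basis::'a set). \<bar>B b\<bar>)"
  have on: "onorm (frechet_derivative \<phi> (at x)) \<le> M" for x
  proof (rule onorm_le)
    fix v
    show "norm (frechet_derivative \<phi> (at x) v) \<le> M * norm v"
    proof (cases "x \<in> ?K")
      case True
      have lin: "linear (frechet_derivative \<phi> (at x))" using hd has_derivative_linear by blast
      have "frechet_derivative \<phi> (at x) v = (\<Sum>b\<in>Basis. (v \<bullet> b) * frechet_derivative \<phi> (at x) b)"
        using lin by (subst euclidean_representation[of v, symmetric]) (simp add: linear_sum linear_cmul)
      also have "\<bar>\<dots>\<bar> \<le> (\<Sum>b\<in>Basis. \<bar>B b\<bar> * norm v)"
      proof (rule order_trans[OF sum_abs], rule sum_mono)
        fix b :: 'a assume b: "b \<in> Basis"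
        have "\<bar>v \<bullet> b\<bar> * \<bar>frechet_derivative \<phi> (at x) b\<bar> \<le> norm v * \<bar>B b\<bar>"
          using Basis_le_norm[OF b, of v] B[OF b True] by (intro mult_mono) auto
        then show "\<bar>(v \<bullet> b) * frechet_derivative \<phi> (at x) b\<bar> \<le> \<bar>B b\<bar> * norm v" by (simp add: abs_mult mult.commute)
      qed
      finally show ?thesis by (simp add: M_def sum_distrib_right)
    next
      case False
      then show ?thesis using d0[OF False] by (simp add: M_def sum_nonneg)
    qed
  qed
  have "norm (\<phi> x - \<phi> y) \<le> M * norm (x - y)" for x y
    by (rule differentiable_bound[of UNIV \<phi> "\<lambda>x. frechet_derivative \<phi> (at x)"]) (use hd on in auto)
  then show "\<exists>L. L-lipschitz_on UNIV \<phi>"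
    by (intro exI[of _ M] lipschitz_onI) (auto simp: dist_norm M_def intro: sum_nonneg)
qed

text \<open>\<open>f\<close> may be unbounded: the product difference is arranged so that
  \<open>f\<close> is evaluated at a point of the ball that carries \<open>g\<close>.\<close>

lemma lipschitz_mult_compact_support:
  fixes f g :: "'a => real"
  assumes f: "L-lipschitz_on UNIV f" and g: "M-lipschitz_on UNIV g" and s: "\<And>x. x \<notin> cball 0 R ==> g x = 0"
  shows "\<exists>Lk. Lk-lipschitz_on UNIV (\<lambda>x. f x * g x)"
proof -
  have M0: "M \<ge> 0" and L0: "L \<ge> 0" using f g lipschitz_on_nonneg by blast+
  obtain A where A: "\<And>x. x \<in> cball 0 R ==> \<bar>f x\<bar> \<le> A"
  proof -
    have "bounded (f ` cball 0 R)"
      by (intro compact_imp_bounded compact_continuous_image lipschitz_continuous[OF f]) simp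
    then obtain A where "\<forall>y\<in>f ` cball 0 R. norm y \<le> A" unfolding bounded_iff by blast
    then show ?thesis using that[of A] by simp
  qed
  obtain B where B: "\<And>x. x \<in> cball 0 R ==> \<bar>g x\<bar> \<le> B"
  proof -
    have "bounded (g ` cball 0 R)"
      by (intro compact_imp_bounded compact_continuous_image lipschitz_continuous[OF g]) simp
    then obtain B where "\<forall>y\<in>g ` cball 0 R. norm y \<le> B" unfolding bounded_iff by blast
    then show ?thesis using that[of B] by simp
  qed
  have B': "\<bar>g x\<bar> \<le> \<bar>B\<bar>" for x using B[of x] s[of x] by (cases "x \<in> cball 0 R") auto
  let ?K = "\<bar>A\<bar> * M + L * \<bar>B\<bar>"
  have main: "\<bar>f x * g x - f y * g y\<bar> \<le> ?K * norm (x - y)" if "x \<in> cball 0 R" for x y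
  proof -
    have "f x * g x - f y * g y = f x * (g x - g y) + (f x - f y) * g y" by (simp add: algebra_simps)
    also have "\<bar>\<dots>\<bar> \<le> \<bar>f x\<bar> * \<bar>g x - g y\<bar> + \<bar>f x - f y\<bar> * \<bar>g y\<bar>"
      using abs_triangle_ineq[of "f x * (g x - g y)" "(f x - f y) * g y"] by (simp add: abs_mult)
    also have "\<dots> \<le> \<bar>A\<bar> * (M * norm (x - y)) + (L * norm (x - y)) * \<bar>B\<bar>"
      using A[OF that] B' lipschitz_onD[OF f, of x y] lipschitz_onD[OF g, of x y] L0
      by (intro add_mono mult_mono) (auto simp: dist_norm)
    finally show ?thesis by (simp add: algebra_simps)
  qed
  have "\<bar>f x * g x - f y * g y\<bar> \<le> ?K * norm (x - y)" for x y
  proof -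
    consider "x \<in> cball 0 R" | "y \<in> cball 0 R" | "x \<notin> cball 0 R" "y \<notin> cball 0 R" by blast
    then show ?thesis
    proof cases
      case 1 then show ?thesis by (rule main)
    next
      case 2 from main[OF 2, of x] show ?thesis by (simp add: norm_minus_commute abs_minus_commute)
    next
      case 3 then show ?thesis using s M0 L0 by simp
    qed
  qed
  then show ?thesis using M0 L0 by (intro exI[of _ ?K] lipschitz_onI) (auto simp: dist_norm)
qed

text \<open>The product \<open>u * \<phi>\<close> is Lipschitz with compact support, so its
  directional derivative, given almost everywhere by the product rule, has integral zero.\<close>

lemma fe_weak_gradient:
  assumes u: "u \<in> fe_space \<Omega> \<T>" shows "L2_weak_gradient \<Omega> u (pgrad u)"
  unfolding L2_weak_gradient_def
proof (intro conjI ballI allI impI)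
  show "(\<lambda>x. pgrad u x \<bullet> b) \<in> L2 \<Omega>" for b by (rule pgrad_L2)
next
  fix \<phi> :: "'a => real" and b :: 'a assume t: "test_function \<Omega> \<phi>" and b: "b \<in> Basis"
  let ?d = "\<lambda>x. frechet_derivative \<phi> (at x) b"
  note T = test_function_lipschitz[OF t]
  obtain L where L: "L-lipschitz_on UNIV u" using fe_lipschitz[OF u] by blast
  obtain M where M: "M-lipschitz_on UNIV \<phi>" using T(1) by blast
  obtain R where R: "\<And>x. x \<notin> cball 0 R ==> \<phi> x = 0" using T(3) by blast
  obtain Lk where Lk: "Lk-lipschitz_on UNIV (\<lambda>x. u x * \<phi> x)" using lipschitz_mult_compact_support[OF L M R] by blast
  have hd: "(\<phi> has_derivative frechet_derivative \<phi> (at x)) (at x)" for x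
    using T(2) frechet_derivative_works by (auto simp: differentiable_on_def)
  have D: "AE x in lebesgue. ((\<lambda>t. u (x + t *\<^sub>R b) * \<phi> (x + t *\<^sub>R b)) has_real_derivative
      (pgrad u x \<bullet> b) * \<phi> x + u x * ?d x) (at 0)"
    using fe_has_derivative[OF u]
  proof eventually_elim
    case (elim x)
    have "((\<lambda>t. x + t *\<^sub>R b) has_derivative (\<lambda>t. t *\<^sub>R b)) (at 0)" by (auto intro!: derivative_eq_intros)
    moreover have "(\<phi> has_derivative frechet_derivative \<phi> (at x)) (at (x + 0 *\<^sub>R b))" using hd by simp
    ultimately have "((\<lambda>t. \<phi> (x + t *\<^sub>R b)) has_derivative (\<lambda>t. frechet_derivative \<phi> (at x) (t *\<^sub>R b))) (at 0)"
      by (rule has_derivative_compose)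
    then have "((\<lambda>t. \<phi> (x + t *\<^sub>R b)) has_real_derivative ?d x) (at 0)"
      using has_derivative_linear[OF hd[of x]]
      by (simp add: has_field_derivative_def linear_cmul mult_commute_abs)
    from DERIV_mult[OF has_derivative_directional[OF elim, of b] this]
    show ?case by (simp add: mult.commute)
  qed
  have "(LINT x|lebesgue. (pgrad u x \<bullet> b) * \<phi> x + u x * ?d x) = 0"
    by (rule lipschitz_directional_integral_zero[OF Lk _ D, of R]) (use R in simp)
  moreover have phiL: "\<phi> \<in> L2 \<Omega>" and dL: "?d \<in> L2 \<Omega>"
  proof -
    have phc: "continuous_on UNIV \<phi>" using M by (rule lipschitz_continuous)
    have d0: "?d x = 0" if "x \<notin> cball 0 R" for x
    proof -
      have "((\<lambda>y. 0) has_derivative (\<lambda>v. 0)) (at x)" by simp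
      then have "(\<phi> has_derivative (\<lambda>v. 0)) (at x)"
        by (rule has_derivative_transform_within_open[of _ _ _ _ "- cball 0 R"]) (use that R in auto)
      then have "(\<lambda>v. 0) = frechet_derivative \<phi> (at x)" by (rule frechet_derivative_at)
      from fun_cong[OF this, of b] show ?thesis by simp
    qed
    have gen: "f \<in> L2 \<Omega>" if c: "continuous_on UNIV f" and z: "\<And>x. x \<notin> cball 0 R ==> f x = 0" for f
    proof -
      have "integrable lebesgue (\<lambda>x. (f x)\<^sup>2)"
        using z by (intro continuous_compact_support_integrable[of _ R] continuous_intros c) auto
      then have "integrable (lebesgue_on \<Omega>) (\<lambda>x. (f x)\<^sup>2)"
        using sets_dom integrable_mult_indicator[OF sets_dom, of "\<lambda>x. (f x)\<^sup>2"] by (subst integrable_restrict_space) simp_all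
      moreover have "f \<in> borel_measurable (lebesgue_on \<Omega>)"
        by (rule measurable_restrict_space1[OF continuous_lebesgue_measurable[OF c]])
      ultimately show ?thesis by (simp add: L2_def)
    qed
    show "\<phi> \<in> L2 \<Omega>" using gen[OF phc R] .
    show "?d \<in> L2 \<Omega>" using gen[OF T(4)[OF b] d0] .
  qed
  moreover have i1: "integrable lebesgue (\<lambda>x. u x * ?d x)" and i2: "integrable lebesgue (\<lambda>x. (pgrad u x \<bullet> b) * \<phi> x)"
    and e1: "L2_inner \<Omega> u ?d = (LINT x|lebesgue. u x * ?d x)"
    and e2: "L2_inner \<Omega> (\<lambda>x. pgrad u x \<bullet> b) \<phi> = (LINT x|lebesgue. (pgrad u x \<bullet> b) * \<phi> x)"
  proof -
    have a1: "(\<lambda>x. indicator \<Omega> x * (u x * ?d x)) = (\<lambda>x. u x * ?d x)"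
      using fe_zero[OF u] by (auto simp: fun_eq_iff indicator_def)
    have a2: "(\<lambda>x. indicator \<Omega> x * ((pgrad u x \<bullet> b) * \<phi> x)) = (\<lambda>x. (pgrad u x \<bullet> b) * \<phi> x)"
      using pgrad_outside by (auto simp: fun_eq_iff indicator_def)
    show "integrable lebesgue (\<lambda>x. u x * ?d x)"
      using L2_prod_integrable[OF fe_L2[OF u] dL] sets_dom a1 by (subst (asm) integrable_restrict_space) auto
    show "integrable lebesgue (\<lambda>x. (pgrad u x \<bullet> b) * \<phi> x)"
      using L2_prod_integrable[OF pgrad_L2[of u b] phiL] sets_dom a2 by (subst (asm) integrable_restrict_space) auto
    show "L2_inner \<Omega> u ?d = (LINT x|lebesgue. u x * ?d x)"
      unfolding L2_inner_int_on[OF sets_dom] int_on_def a1 ..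
    show "L2_inner \<Omega> (\<lambda>x. pgrad u x \<bullet> b) \<phi> = (LINT x|lebesgue. (pgrad u x \<bullet> b) * \<phi> x)"
      unfolding L2_inner_int_on[OF sets_dom] int_on_def a2 ..
  qed
  ultimately show "L2_inner \<Omega> u ?d = - L2_inner \<Omega> (\<lambda>x. pgrad u x \<bullet> b) \<phi>"
    by simp
qed

text \<open>Needed because \<open>H1_norm\<close> selects a weak gradient by choice; two of them
  differ by functions orthogonal to all test functions.\<close>

lemma weak_gradient_norm_unique:
  assumes g: "L2_weak_gradient \<Omega> u g" and h: "L2_weak_gradient \<Omega> u h" and b: "b \<in> Basis"
  shows "L2_norm \<Omega> (\<lambda>x. g x \<bullet> b) = L2_norm \<Omega> (\<lambda>x. h x \<bullet> b)"
proof -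
  have gL: "(\<lambda>x. g x \<bullet> b) \<in> L2 \<Omega>" and hL: "(\<lambda>x. h x \<bullet> b) \<in> L2 \<Omega>"
    using g h b unfolding L2_weak_gradient_def by blast+
  have "L2_inner \<Omega> (\<lambda>x. g x \<bullet> b - h x \<bullet> b) \<phi> = 0" if t: "test_function \<Omega> \<phi>" for \<phi>
  proof -
    have "L2_inner \<Omega> (\<lambda>x. g x \<bullet> b) \<phi> = L2_inner \<Omega> (\<lambda>x. h x \<bullet> b) \<phi>"
      using g h b t unfolding L2_weak_gradient_def by (metis neg_equal_iff_equal)
    moreover have "\<phi> \<in> L2 \<Omega>"
    proof -
      obtain M where M: "M-lipschitz_on UNIV \<phi>" using test_function_lipschitz(1)[OF t] by blast
      obtain R where R: "\<And>x. x \<notin> cball 0 R ==> \<phi> x = 0" using test_function_lipschitz(3)[OF t] by blast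
      have c: "continuous_on UNIV \<phi>" using M by (rule lipschitz_continuous)
      have "integrable lebesgue (\<lambda>x. (\<phi> x)\<^sup>2)"
        using R by (intro continuous_compact_support_integrable[of _ R] continuous_intros c) auto
      then have "integrable (lebesgue_on \<Omega>) (\<lambda>x. (\<phi> x)\<^sup>2)"
        using sets_dom integrable_mult_indicator[OF sets_dom, of "\<lambda>x. (\<phi> x)\<^sup>2"] by (subst integrable_restrict_space) simp_all
      moreover have "\<phi> \<in> borel_measurable (lebesgue_on \<Omega>)"
        by (rule measurable_restrict_space1[OF continuous_lebesgue_measurable[OF c]])
      ultimately show ?thesis by (simp add: L2_def)
    qed
    ultimately show ?thesis using L2_inner_diff_left[OF gL hL] by simp
  qed
  then have ae: "AE x in lebesgue. x \<in> \<Omega> \<longrightarrow> g x \<bullet> b - h x \<bullet> b = 0"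
    by (intro AE_zero_of_test_functions[OF open_dom L2_diff[OF gL hL]])
  have m: "(\<lambda>x. indicator \<Omega> x * ((f x \<bullet> b) * (f x \<bullet> b))) \<in> borel_measurable lebesgue"
    if "(\<lambda>x. f x \<bullet> b) \<in> L2 \<Omega>" for f
    using L2_prod_integrable[OF that that] sets_dom by (subst (asm) integrable_restrict_space) auto
  have "L2_inner \<Omega> (\<lambda>x. g x \<bullet> b) (\<lambda>x. g x \<bullet> b) = L2_inner \<Omega> (\<lambda>x. h x \<bullet> b) (\<lambda>x. h x \<bullet> b)"
    unfolding L2_inner_int_on[OF sets_dom] int_on_def
    by (rule integral_cong_AE[OF m[OF gL] m[OF hL]])
      (use ae in \<open>auto elim!: eventually_mono simp: indicator_def\<close>)
  then show ?thesis by (simp add: L2_norm_def)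
qed

lemma H1_norm_fe:
  assumes u: "u \<in> fe_space \<Omega> \<T>"
  shows "(H1_norm \<Omega> u)\<^sup>2 = (L2_norm \<Omega> u)\<^sup>2 + (\<Sum>K\<in>\<T>. measure lebesgue K * (norm (gr u K))\<^sup>2)"
proof -
  define g where "g = (SOME g. L2_weak_gradient \<Omega> u g)"
  have g: "L2_weak_gradient \<Omega> u g" unfolding g_def by (rule someI[where P = "L2_weak_gradient \<Omega> u", OF fe_weak_gradient[OF u]])
  have "(\<Sum>b\<in>Basis. (L2_norm \<Omega> (\<lambda>x. g x \<bullet> b))\<^sup>2) = (\<Sum>b\<in>Basis. \<Sum>K\<in>\<T>. measure lebesgue K * (gr u K \<bullet> b)\<^sup>2)"
    using weak_gradient_norm_unique[OF g fe_weak_gradient[OF u]] by (intro sum.cong) (auto simp: pgrad_norm)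
  also have "\<dots> = (\<Sum>K\<in>\<T>. measure lebesgue K * (\<Sum>b\<in>Basis. (gr u K \<bullet> b)\<^sup>2))"
    by (subst sum.swap) (simp add: sum_distrib_left)
  also have "\<dots> = (\<Sum>K\<in>\<T>. measure lebesgue K * (norm (gr u K))\<^sup>2)"
  proof -
    have "(\<Sum>b\<in>Basis. (z \<bullet> b)\<^sup>2) = (norm z)\<^sup>2" for z :: 'a
      unfolding power2_norm_eq_inner by (subst euclidean_inner[of z z]) (simp add: power2_eq_square)
    then show ?thesis by simp
  qed
  finally have "H1_norm \<Omega> u = sqrt ((L2_norm \<Omega> u)\<^sup>2 + (\<Sum>K\<in>\<T>. measure lebesgue K * (norm (gr u K))\<^sup>2))"
    unfolding H1_norm_def g_def[symmetric] Let_def by simp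
  then show ?thesis by (simp add: sum_nonneg)
qed

end

section \<open>Shape regularity\<close>

lemma measure_image_affine:
  fixes S :: "'a::euclidean_space set"
  shows "measure lebesgue ((\<lambda>x. r *\<^sub>R x + c) ` S) = \<bar>r\<bar> ^ DIM('a) * measure lebesgue S"
  by (rule measure_lebesgue_affine)

lemma sets_image_affine:
  fixes S :: "'a::euclidean_space set"
  assumes "S \<in> sets lebesgue" "r \<noteq> 0"
  shows "(\<lambda>x. r *\<^sub>R x + c) ` S \<in> sets lebesgue"
proof -
  have "(\<lambda>x. (1 / r) *\<^sub>R x + (- (1 / r)) *\<^sub>R c) -` S \<inter> space lebesgue \<in> sets lebesgue"
  proof (rule measurable_sets[OF _ assms(1)])
    have "(\<lambda>x. - ((1 / r) *\<^sub>R c) + (\<Sum>j\<in>Basis. ((1 / r) * (x \<bullet> j)) *\<^sub>R j)) \<in> lebesgue \<rightarrow>\<^sub>M (lebesgue :: 'a measure)"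
      using assms(2) by (intro lebesgue_affine_measurable) auto
    moreover have "- ((1 / r) *\<^sub>R c) + (\<Sum>j\<in>Basis. ((1 / r) * (x \<bullet> j)) *\<^sub>R j) = (1 / r) *\<^sub>R x + (- (1 / r)) *\<^sub>R c" for x :: 'a
    proof -
      have "(\<Sum>j\<in>Basis. ((1 / r) * (x \<bullet> j)) *\<^sub>R j) = (1 / r) *\<^sub>R (\<Sum>j\<in>Basis. (x \<bullet> j) *\<^sub>R j)"
        by (simp only: scaleR_sum_right scaleR_scaleR)
      then show ?thesis by (simp only: euclidean_representation) simp
    qed
    ultimately show "(\<lambda>x. (1 / r) *\<^sub>R x + (- (1 / r)) *\<^sub>R c) \<in> lebesgue \<rightarrow>\<^sub>M lebesgue" by simp
  qed
  moreover have "(\<lambda>x. (1 / r) *\<^sub>R x + (- (1 / r)) *\<^sub>R c) -` S \<inter> space lebesgue = (\<lambda>x. r *\<^sub>R x + c) ` S"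
  proof (intro set_eqI iffI)
    fix x assume "x \<in> (\<lambda>x. (1 / r) *\<^sub>R x + (- (1 / r)) *\<^sub>R c) -` S \<inter> space lebesgue"
    then have "(1 / r) *\<^sub>R x + (- (1 / r)) *\<^sub>R c \<in> S" by simp
    moreover have "x = r *\<^sub>R ((1 / r) *\<^sub>R x + (- (1 / r)) *\<^sub>R c) + c"
      using assms(2) by (simp add: scaleR_diff_right)
    ultimately show "x \<in> (\<lambda>x. r *\<^sub>R x + c) ` S" by blast
  next
    fix z assume "z \<in> (\<lambda>x. r *\<^sub>R x + c) ` S"
    then obtain x where x: "x \<in> S" "z = r *\<^sub>R x + c" by blast
    have "(1 / r) *\<^sub>R (r *\<^sub>R x + c) + (- (1 / r)) *\<^sub>R c = x" using assms(2) by (simp add: scaleR_add_right)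
    then show "z \<in> (\<lambda>x. (1 / r) *\<^sub>R x + (- (1 / r)) *\<^sub>R c) -` S \<inter> space lebesgue" using x by simp
  qed
  ultimately show ?thesis by simp
qed

lemma measure_ball_scaled:
  fixes c :: "'a::euclidean_space"
  assumes "r > 0" shows "measure lebesgue (ball c r) = r ^ DIM('a) * measure lebesgue (ball (0::'a) 1)"
proof -
  have "(\<lambda>x. r *\<^sub>R x + c) ` ball 0 1 = ball c r"
  proof safe
    fix x :: 'a assume "x \<in> ball 0 1" then show "r *\<^sub>R x + c \<in> ball c r" using assms by (simp add: dist_norm)
  next
    fix y assume y: "y \<in> ball c r"
    have "(1 / r) *\<^sub>R (y - c) \<in> ball 0 1" using y assms by (simp add: dist_norm norm_minus_commute)
    moreover have "y = r *\<^sub>R ((1 / r) *\<^sub>R (y - c)) + c" using assms by simp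
    ultimately show "y \<in> (\<lambda>x. r *\<^sub>R x + c) ` ball 0 1" by blast
  qed
  then show ?thesis using measure_image_affine[of r c "ball 0 1"] assms by simp
qed

lemma measure_ball_pos: "r > 0 ==> 0 < measure lebesgue (ball (c::'a::euclidean_space) r)"
  by (simp add: content_ball_pos)

text \<open>Disjoint translates of a slab of width \<open>s\<close> fill a ball.\<close>

lemma slab_measure_le:
  fixes S :: "'a::euclidean_space set"
  assumes e: "norm e = 1" and s: "s > 0" and S: "S \<in> sets lebesgue" "S \<subseteq> ball 0 1" "\<And>x. x \<in> S ==> \<bar>e \<bullet> x\<bar> \<le> s"
  shows "measure lebesgue S \<le> 3 * s * measure lebesgue (ball (0::'a) 2)"
proof -
  define N where "N = nat \<lceil>1 / (3 * s)\<rceil>"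
  have N: "real N \<ge> 1 / (3 * s)" unfolding N_def using s by (simp add: of_nat_nat)
  have kN: "3 * s * real k < 1" if "k < N" for k
  proof -
    have "int k < \<lceil>1 / (3 * s)\<rceil>" using that unfolding N_def by linarith
    then have "real k < 1 / (3 * s)" by (simp add: less_ceiling_iff)
    then show ?thesis using s by (simp add: field_simps)
  qed
  \<comment> \<open>Translates by multiples of \<open>3 * s\<close> are disjoint since the slab has
    width \<open>2 * s\<close>; shifts below one keep them in the ball of radius 2.\<close>
  define A where "A k = (\<lambda>x. 1 *\<^sub>R x + (3 * s * real k) *\<^sub>R e) ` S" for k
  have Am: "A k \<in> sets lebesgue" for k unfolding A_def by (rule sets_image_affine[OF S(1)]) simp
  have Asub: "A k \<subseteq> ball 0 2" if "k < N" for k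
  proof
    fix y assume "y \<in> A k"
    then obtain x where x: "x \<in> S" "y = 1 *\<^sub>R x + (3 * s * real k) *\<^sub>R e" unfolding A_def by blast
    have "norm y \<le> norm x + 3 * s * real k" using x(2) e s norm_triangle_ineq[of x "(3 * s * real k) *\<^sub>R e"] by simp
    moreover have "norm x < 1" using x(1) S(2) by auto
    ultimately show "y \<in> ball 0 2" using kN[OF that] by simp
  qed
  have Al: "A k \<in> lmeasurable" if "k < N" for k
    by (rule fmeasurableI2[OF lmeasurable_ball Asub[OF that] Am])
  have disj: "disjoint_family_on A {..<N}"
  proof (unfold disjoint_family_on_def, intro ballI impI)
    fix j k assume jk: "j \<in> {..<N}" "k \<in> {..<N}" "j \<noteq> k"
    show "A j \<inter> A k = {}"
    proof (rule ccontr)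
      assume "A j \<inter> A k \<noteq> {}"
      then obtain x y where xy: "x \<in> S" "y \<in> S" "1 *\<^sub>R x + (3 * s * real j) *\<^sub>R e = 1 *\<^sub>R y + (3 * s * real k) *\<^sub>R e"
        unfolding A_def by auto
      have "e \<bullet> (1 *\<^sub>R x + (3 * s * real j) *\<^sub>R e) = e \<bullet> (1 *\<^sub>R y + (3 * s * real k) *\<^sub>R e)" using xy(3) by simp
      then have "e \<bullet> x + 3 * s * real j = e \<bullet> y + 3 * s * real k" using e by (simp add: inner_add_right dot_square_norm)
      then have eq: "s * (3 * (real j - real k)) = e \<bullet> y - e \<bullet> x" by (simp add: algebra_simps)
      have "\<bar>e \<bullet> y - e \<bullet> x\<bar> \<le> 2 * s" using S(3)[OF xy(1)] S(3)[OF xy(2)] by linarith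
      then have "s * \<bar>3 * (real j - real k)\<bar> \<le> s * 2" using eq s by (metis abs_mult abs_of_pos mult.commute)
      then have "\<bar>3 * (real j - real k)\<bar> \<le> 2" using s by simp
      moreover have "real j - real k \<ge> 1 \<or> real k - real j \<ge> 1"
        using jk(3) by (cases j k rule: linorder_cases) auto
      ultimately show False by (auto simp: abs_le_iff)
    qed
  qed
  have "real N * measure lebesgue S = (\<Sum>k<N. measure lebesgue (A k))"
    unfolding A_def measure_image_affine by simp
  also have "\<dots> = measure lebesgue (\<Union>k<N. A k)"
    using disj Am Al by (intro measure_finite_Union[symmetric]) (auto simp: fmeasurable_def image_subset_iff less_top[symmetric])
  also have "\<dots> \<le> measure lebesgue (ball (0::'a) 2)"
    using Asub Am by (intro measure_mono_fmeasurable lmeasurable_ball) auto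
  finally have "real N * measure lebesgue S \<le> measure lebesgue (ball (0::'a) 2)" .
  moreover have "1 / (3 * s) * measure lebesgue S \<le> real N * measure lebesgue S"
    using N by (intro mult_right_mono) auto
  ultimately have "1 / (3 * s) * measure lebesgue S \<le> measure lebesgue (ball (0::'a) 2)" by linarith
  then have "3 * s * (1 / (3 * s) * measure lebesgue S) \<le> 3 * s * measure lebesgue (ball (0::'a) 2)"
    using s by (intro mult_left_mono) auto
  then show ?thesis using s by simp
qed

section \<open>Corner angles, heights and volumes\<close>

abbreviation corner_cone :: "'a::euclidean_space set => 'a => 'a set" where
  "corner_cone K p \<equiv> cone hull ((\<lambda>x. x - p) ` K) \<inter> ball 0 1"

lemma corner_cone_memD:
  assumes "y \<in> corner_cone K p"
  obtains c x where "c \<ge> 0" "x \<in> K" "y = c *\<^sub>R (x - p)" "norm y < 1"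
  using assms unfolding cone_hull_expl by auto

text \<open>A non-measurable set has measure zero by convention, so a positive angle already makes
  the cone measurable.\<close>

lemma angle_pos_imp_measurable:
  fixes K :: "'a::euclidean_space set"
  assumes "\<theta> > 0" "\<theta> \<le> interior_angle K p"
  shows "corner_cone K p \<in> lmeasurable" "\<theta> / DIM('a) \<le> measure lebesgue (corner_cone K p)"
proof -
  show 1: "\<theta> / DIM('a) \<le> measure lebesgue (corner_cone K p)"
    using assms(2) by (simp add: interior_angle_def field_simps)
  then have "measure lebesgue (corner_cone K p) \<noteq> 0"
    using assms(1) DIM_positive[where 'a='a] by (metis divide_pos_pos not_le of_nat_0_less_iff)
  then have "corner_cone K p \<in> sets lebesgue" using measure_notin_sets by blast
  then show "corner_cone K p \<in> lmeasurable"
    by (intro fmeasurableI2[OF lmeasurable_ball[of 0 1]]) auto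
qed

lemma diameter_corners:
  assumes "full_simplex (K :: 'a::euclidean_space set)"
  obtains p q where "p \<in> corners K" "q \<in> corners K" "dist p q = diameter K" "diameter K > 0"
    "\<And>x y. x \<in> corners K ==> y \<in> corners K ==> dist x y \<le> diameter K"
proof -
  have le: "dist x y \<le> diameter K" if "x \<in> corners K" "y \<in> corners K" for x y
    using diameter_bounded_bound[OF bounded_fs[OF assms]] corners_subset that by blast
  obtain x where x: "x \<in> corners K" using other_corner[OF assms] .
  obtain y where y: "y \<in> corners K" "y \<noteq> x" using other_corner[OF assms] .
  have pos: "diameter K > 0" using le[OF x y(1)] y(2) by (metis dist_pos_lt less_le_trans)
  have "K \<noteq> {}" using corners_subset[OF x] by blast
  then obtain a b where ab: "a \<in> K" "b \<in> K" "dist a b = diameter K"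
    using diameter_compact_attained[OF compact_fs[OF assms]] by blast
  have "\<exists>u\<in>corners K. \<exists>v\<in>corners K. norm (a - b) \<le> norm (u - v)"
    using simplex_extremal_le_exists[OF finite_corners[OF assms], of a b] ab hull_corners[OF assms] by simp
  then obtain p q where pq: "p \<in> corners K" "q \<in> corners K" "dist a b \<le> dist p q" by (auto simp: dist_norm)
  have "dist p q = diameter K" using le[OF pq(1,2)] pq(3) ab(3) by simp
  then show ?thesis using that pq le pos by blast
qed

text \<open>\<open>norm (bg K v)\<close> is the reciprocal of the height over \<open>v\<close>. If
  that height is small against the diameter, then at one end of the longest edge all directions into
  the cell are nearly parallel to the facet opposite to \<open>v\<close>; the cone there lies in a
  thin slab, and its angle is small.\<close>

lemma height_lower_bound:
  fixes K :: "'a::euclidean_space set"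
  assumes fs: "full_simplex K" and \<theta>: "\<theta> > 0" "\<And>p. p \<in> corners K ==> \<theta> \<le> interior_angle K p"
    and v: "v \<in> corners K"
  shows "norm (bg K v) * diameter K \<le> 6 * DIM('a) * measure lebesgue (ball (0::'a) 2) / \<theta>"
proof -
  define h where "h = diameter K"
  obtain p0 q0 where pq: "p0 \<in> corners K" "q0 \<in> corners K" "dist p0 q0 = h" "h > 0"
    "\<And>x y. x \<in> corners K ==> y \<in> corners K ==> dist x y \<le> h"
    unfolding h_def using diameter_corners[OF fs] by metis
  \<comment> \<open>No corner lies behind an end of the longest edge: its distance to the other end
    would exceed \<open>h\<close>.\<close>
  have side: "0 \<le> (x - p) \<bullet> (q - p)" if "p \<in> corners K" "q \<in> corners K" "dist p q = h" "x \<in> corners K" for p q x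
  proof (rule ccontr)
    assume neg: "\<not> 0 \<le> (x - p) \<bullet> (q - p)"
    have "(norm (x - q))\<^sup>2 = (norm (x - p))\<^sup>2 - 2 * ((x - p) \<bullet> (q - p)) + (norm (q - p))\<^sup>2"
      by (simp add: power2_norm_eq_inner algebra_simps inner_commute)
    moreover have "(norm (q - p))\<^sup>2 = h\<^sup>2" using that(3) by (simp add: dist_norm norm_minus_commute)
    moreover have "norm (x - q) \<le> h" using pq(5)[OF that(4,2)] by (simp add: dist_norm)
    then have "(norm (x - q))\<^sup>2 \<le> h\<^sup>2" by (intro power_mono) auto
    moreover have "0 \<le> (norm (x - p))\<^sup>2" by simp
    ultimately show False using neg by linarith
  qed
  \<comment> \<open>The projections of \<open>v\<close> onto the edge, taken from its two ends, add
    up to the whole edge, so one of them is at least half.\<close>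
  have "(v - p0) \<bullet> (q0 - p0) + (v - q0) \<bullet> (p0 - q0) = h\<^sup>2"
  proof -
    have "h\<^sup>2 = (p0 - q0) \<bullet> (p0 - q0)" using pq(3) by (simp add: dist_norm power2_norm_eq_inner[symmetric])
    then show ?thesis by (simp add: algebra_simps inner_commute)
  qed
  then have "(v - p0) \<bullet> (q0 - p0) \<ge> h\<^sup>2 / 2 \<or> (v - q0) \<bullet> (p0 - q0) \<ge> h\<^sup>2 / 2" by linarith
  then obtain p q where p: "p \<in> corners K" "q \<in> corners K" "dist p q = h" "(v - p) \<bullet> (q - p) \<ge> h\<^sup>2 / 2"
  proof
    assume "(v - p0) \<bullet> (q0 - p0) \<ge> h\<^sup>2 / 2"
    then show thesis by (rule that[OF pq(1-3)])
  next
    assume "(v - q0) \<bullet> (p0 - q0) \<ge> h\<^sup>2 / 2"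
    moreover have "dist q0 p0 = h" using pq(3) by (simp add: dist_commute)
    ultimately show thesis by (intro that[OF pq(2,1)])
  qed
  have vp: "v \<noteq> p" using p(4) pq(4) by auto
  have nz: "bg K v \<noteq> 0" using bg_nonzero[OF fs v] .
  define n where "n = (1 / norm (bg K v)) *\<^sub>R bg K v"
  have n: "norm n = 1" using nz by (simp add: n_def)
  define s where "s = 2 / (h * norm (bg K v))"
  have s: "s > 0" using nz pq(4) by (simp add: s_def)
  have le: "\<bar>n \<bullet> y\<bar> \<le> s" if y: "y \<in> corner_cone K p" for y
  proof -
    obtain c x where cx: "c \<ge> 0" "x \<in> K" "y = c *\<^sub>R (x - p)" "norm y < 1" using corner_cone_memD[OF y] .
    have l0: "lam K w x \<ge> 0" if "w \<in> corners K" for w using mem_simplex_iff[OF fs] cx(2) that by blast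
    have bx: "bg K v \<bullet> (x - p) = lam K v x"
      using lam_diff[of K v x p] lam_corner[OF fs v p(1)] vp by simp
    have "(x - p) \<bullet> (q - p) = (\<Sum>w\<in>corners K. lam K w x * ((w - p) \<bullet> (q - p)))"
    proof -
      have "x - p = (\<Sum>w\<in>corners K. lam K w x *\<^sub>R w) - (\<Sum>w\<in>corners K. lam K w x) *\<^sub>R p"
        using lam_repr[OF fs, of x] by simp
      also have "\<dots> = (\<Sum>w\<in>corners K. lam K w x *\<^sub>R (w - p))"
        by (simp add: scaleR_sum_left sum_subtractf[symmetric] scaleR_diff_right)
      finally show ?thesis by (simp add: inner_sum_left)
    qed
    \<comment> \<open>By \<open>side\<close> all terms are nonnegative, and the term of
      \<open>v\<close> alone is kept.\<close>
    also have "\<dots> \<ge> lam K v x * ((v - p) \<bullet> (q - p))"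
      using l0 side[OF p(1-3)] finite_corners[OF fs] v by (intro member_le_sum) auto
    finally have "lam K v x * (h\<^sup>2 / 2) \<le> (x - p) \<bullet> (q - p)"
      using mult_left_mono[OF p(4) l0[OF v]] by linarith
    then have "c * (lam K v x * (h\<^sup>2 / 2)) \<le> y \<bullet> (q - p)"
      unfolding cx(3) inner_scaleR_left using cx(1) by (intro mult_left_mono)
    also have "\<dots> \<le> norm y * norm (q - p)" by (rule norm_cauchy_schwarz)
    also have "\<dots> \<le> 1 * h" using cx(4) p(3) by (intro mult_mono) (auto simp: dist_norm norm_minus_commute)
    finally have "(c * lam K v x) * (h\<^sup>2 / 2) \<le> h" by (simp add: mult.assoc)
    then have "c * lam K v x * h \<le> 2" using pq(4) by (simp add: power2_eq_square)
    then have "c * lam K v x \<le> 2 / h" using pq(4) by (simp add: field_simps)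
    moreover have "n \<bullet> y = c * lam K v x / norm (bg K v)" using bx by (simp add: n_def cx(3))
    moreover have "c * lam K v x \<ge> 0" using cx(1) l0[OF v] by simp
    ultimately have "\<bar>n \<bullet> y\<bar> = c * lam K v x / norm (bg K v)" by simp
    also have "\<dots> \<le> (2 / h) / norm (bg K v)" using \<open>c * lam K v x \<le> 2 / h\<close> by (intro divide_right_mono) auto
    finally show ?thesis by (simp add: s_def)
  qed
  have m: "corner_cone K p \<in> lmeasurable" "\<theta> / DIM('a) \<le> measure lebesgue (corner_cone K p)"
    using angle_pos_imp_measurable[OF \<theta>(1) \<theta>(2)[OF p(1)]] by auto
  have "measure lebesgue (corner_cone K p) \<le> 3 * s * measure lebesgue (ball (0::'a) 2)"
    using m(1) le by (intro slab_measure_le[OF n s]) (auto simp: fmeasurable_def)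
  with m(2) have "\<theta> / DIM('a) \<le> 6 * measure lebesgue (ball (0::'a) 2) / (h * norm (bg K v))"
    by (simp add: s_def)
  then show ?thesis using \<theta>(1) pq(4) nz unfolding h_def[symmetric] by (simp add: field_simps)
qed

text \<open>The condition on \<open>r\<close> says that \<open>r\<close> is at most the height over
  \<open>p\<close>, so the scaled cone does not reach beyond the opposite facet.\<close>

lemma scaled_corner_cone_subset:
  fixes K :: "'a::euclidean_space set"
  assumes fs: "full_simplex K" and p: "p \<in> corners K" and r: "0 < r" "r * norm (bg K p) \<le> 1"
  shows "(\<lambda>y. r *\<^sub>R y + p) ` corner_cone K p \<subseteq> K \<inter> ball p r"
proof
  fix z assume "z \<in> (\<lambda>y. r *\<^sub>R y + p) ` corner_cone K p"
  then obtain y where y: "y \<in> corner_cone K p" "z = r *\<^sub>R y + p" by blast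
  obtain c x where cx: "c \<ge> 0" "x \<in> K" "y = c *\<^sub>R (x - p)" "norm y < 1" using corner_cone_memD[OF y(1)] .
  have "lam K q z \<ge> 0" if q: "q \<in> corners K" for q
  proof (cases "q = p")
    case True
    have "\<bar>bg K p \<bullet> (r *\<^sub>R y)\<bar> \<le> norm (bg K p) * (r * norm y)"
      using Cauchy_Schwarz_ineq2[of "bg K p" "r *\<^sub>R y"] r by simp
    also have "\<dots> = (r * norm (bg K p)) * norm y" by simp
    also have "\<dots> \<le> 1 * 1" using r cx(4) by (intro mult_mono) auto
    finally show ?thesis unfolding True lam_def y(2) by (simp del: inner_scaleR_right)
  next
    case False
    have "lam K q z = r * c * lam K q x"
      using lam_diff[of K q z p] lam_diff[of K q x p] lam_corner[OF fs q p] False by (simp add: y(2) cx(3))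
    then show ?thesis using r cx(1) mem_simplex_iff[OF fs] cx(2) q by simp
  qed
  then have "z \<in> K" using mem_simplex_iff[OF fs] by blast
  moreover have "z \<in> ball p r" using r cx(4) by (simp add: y(2) dist_norm)
  ultimately show "z \<in> K \<inter> ball p r" by blast
qed

lemma measure_ge_angle:
  fixes K :: "'a::euclidean_space set"
  assumes fs: "full_simplex K" and p: "p \<in> corners K" and \<theta>: "\<theta> > 0" "\<theta> \<le> interior_angle K p"
    and r: "0 < r" "r * norm (bg K p) \<le> 1"
  shows "r ^ DIM('a) * (\<theta> / DIM('a)) \<le> measure lebesgue (K \<inter> ball p r)"
proof -
  note m = angle_pos_imp_measurable[OF \<theta>]
  have "r ^ DIM('a) * (\<theta> / DIM('a)) \<le> measure lebesgue ((\<lambda>y. r *\<^sub>R y + p) ` corner_cone K p)"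
    unfolding measure_image_affine abs_of_pos[OF r(1)] by (intro mult_left_mono m(2)) (use r in auto)
  also have "\<dots> \<le> measure lebesgue (K \<inter> ball p r)"
    using scaled_corner_cone_subset[OF fs p r] m(1) r
    by (intro measure_mono_fmeasurable sets_image_affine fmeasurable.Int lmeasurable_fs fs lmeasurable_ball)
      (auto simp: fmeasurable_def)
  finally show ?thesis .
qed

lemma measure_le_diameter:
  fixes K :: "'a::euclidean_space set"
  assumes fs: "full_simplex K"
  shows "measure lebesgue K \<le> (2 * diameter K) ^ DIM('a) * measure lebesgue (ball (0::'a) 1)"
proof -
  obtain p q where p: "p \<in> corners K" "diameter K > 0" using diameter_corners[OF fs] by metis
  have "K \<subseteq> ball p (2 * diameter K)"
  proof
    fix x assume "x \<in> K"
    then have "dist p x \<le> diameter K" using diameter_bounded_bound[OF bounded_fs[OF fs] corners_subset[OF p(1)]] by blast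
    then show "x \<in> ball p (2 * diameter K)" using p(2) by simp
  qed
  then have "measure lebesgue K \<le> measure lebesgue (ball p (2 * diameter K))"
    using sets_fs[OF fs] by (intro measure_mono_fmeasurable lmeasurable_ball) auto
  then show ?thesis using measure_ball_scaled[of "2 * diameter K" p] p(2) by simp
qed

text \<open>In a ball no larger than any of the heights over \<open>p\<close>, every cell fills at
  least the share given by its angle, and the shares overlap only in null sets.\<close>

lemma card_star_le:
  fixes \<F> :: "'a::euclidean_space set set"
  assumes fin: "finite \<F>" and fs: "\<And>H. H \<in> \<F> ==> full_simplex H"
    and disj: "\<And>H K. H \<in> \<F> ==> K \<in> \<F> ==> H \<noteq> K ==> interior H \<inter> interior K = {}"
    and p: "\<And>H. H \<in> \<F> ==> p \<in> corners H"
    and \<theta>: "\<theta> > 0" "\<And>H. H \<in> \<F> ==> \<theta> \<le> interior_angle H p"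
  shows "real (card \<F>) * (\<theta> / DIM('a)) \<le> measure lebesgue (ball (0::'a) 1)"
proof (cases "\<F> = {}")
  case True then show ?thesis by simp
next
  case False
  define M where "M = Max ((\<lambda>H. norm (bg H p)) ` \<F>)"
  have M: "norm (bg H p) \<le> M" if "H \<in> \<F>" for H unfolding M_def using fin that by simp
  have M0: "M > 0" using False M bg_nonzero[OF fs p] by (meson ex_in_conv less_le_trans zero_less_norm_iff)
  define r where "r = 1 / M"
  have r: "r > 0" "r * norm (bg H p) \<le> 1" if "H \<in> \<F>" for H
    using M0 M[OF that] by (auto simp: r_def field_simps)
  have r0: "r > 0" using M0 by (simp add: r_def)
  let ?B = "ball p r"
  have i: "intg_on H (indicator ?B)" if "H \<in> \<F>" for H
  proof -
    have "H \<inter> ?B \<in> lmeasurable" by (intro fmeasurable.Int lmeasurable_fs fs that lmeasurable_ball)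
    then have "integrable lebesgue (indicat_real (H \<inter> ?B))"
      by (intro integrable_real_indicator) (auto simp: fmeasurable_def)
    moreover have "(\<lambda>x. indicat_real H x * indicat_real ?B x) = indicat_real (H \<inter> ?B)"
      by (simp add: fun_eq_iff indicator_inter_arith)
    ultimately show ?thesis unfolding intg_on_def by simp
  qed
  have im: "int_on H (indicator ?B) = measure lebesgue (H \<inter> ?B)" for H
    unfolding int_on_def by (simp add: indicator_inter_arith[symmetric])
  have "(\<Sum>H\<in>\<F>. r ^ DIM('a) * (\<theta> / DIM('a))) \<le> (\<Sum>H\<in>\<F>. measure lebesgue (H \<inter> ?B))"
    using measure_ge_angle[OF fs p \<theta> r] by (intro sum_mono) blast
  also have "\<dots> = int_on (\<Union>\<F>) (indicator ?B)"
    using int_on_AE_sum[OF AE_indicator_Union[OF fin fs disj] i] im by simp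
  also have "\<dots> = measure lebesgue (\<Union>\<F> \<inter> ?B)" by (rule im)
  also have "\<dots> \<le> measure lebesgue ?B"
    using fin fs by (intro measure_mono_fmeasurable lmeasurable_ball sets.Int sets.finite_Union) (auto intro: sets_fs)
  also have "\<dots> = r ^ DIM('a) * measure lebesgue (ball (0::'a) 1)" by (rule measure_ball_scaled[OF r0])
  finally have "r ^ DIM('a) * (real (card \<F>) * (\<theta> / DIM('a))) \<le> r ^ DIM('a) * measure lebesgue (ball (0::'a) 1)"
    by (simp add: mult_ac)
  then show ?thesis by (rule mult_left_le_imp_le) (use r0 in simp)
qed

section \<open>Chains of cells around a point\<close>

lemma negligible_UN_finite:
  "finite I ==> (\<And>i. i \<in> I ==> negligible (N i)) ==> negligible (\<Union>i\<in>I. N i)"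
  by (intro negligible_Union) auto

context conf_mesh begin

text \<open>A facet of \<open>K\<close> is encoded by the corner \<open>a\<close> opposite to it;
  \<open>lam K a p = 0\<close> then says that the facet contains \<open>p\<close>.\<close>

definition facet_nb :: "'a set => 'a => 'a set => bool" where
  "facet_nb K a H \<longleftrightarrow> K \<in> \<T> \<and> H \<in> \<T> \<and> H \<noteq> K \<and> a \<in> corners K \<and> corners K - {a} \<subseteq> corners H"

definition boundary_facet :: "'a set => 'a => bool" where
  "boundary_facet K a \<longleftrightarrow> K \<in> \<T> \<and> a \<in> corners K \<and> (\<nexists>H. facet_nb K a H)"

definition star_rel :: "'a => ('a set \<times> 'a set) set" where
  "star_rel p = {(K, H). \<exists>a. facet_nb K a H \<and> p \<in> K \<and> lam K a p = 0}"

lemma facet_nb_apex: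
  assumes "facet_nb K a H"
  obtains a' where "facet_nb H a' K" "a' \<notin> corners K" "a \<notin> corners H" "corners H - {a'} = corners K - {a}"
proof -
  have t: "K \<in> \<T>" "H \<in> \<T>" "H \<noteq> K" "a \<in> corners K" "corners K - {a} \<subseteq> corners H"
    using assms by (auto simp: facet_nb_def)
  note c = card_corners[OF full[OF t(1)]] card_corners[OF full[OF t(2)]]
  note f = finite_corners[OF full[OF t(1)]] finite_corners[OF full[OF t(2)]]
  have "corners H \<noteq> corners K"
    using hull_corners[OF full[OF t(1)]] hull_corners[OF full[OF t(2)]] t(3) by metis
  then have "\<not> corners H \<subseteq> corners K" using card_subset_eq[OF f(1)] c by metis
  then obtain a' where a': "a' \<in> corners H" "a' \<notin> corners K" by blast
  have "card (corners K - {a}) = card (corners H - {a'})" using c f t(4) a'(1) by simp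
  then have eq: "corners K - {a} = corners H - {a'}"
    using card_subset_eq[of "corners H - {a'}" "corners K - {a}"] f t(5) a'(2) by blast
  have "a \<notin> corners H" using eq a'(2) t(4) by blast
  then show ?thesis using that[of a'] t a' eq unfolding facet_nb_def by blast
qed

text \<open>Both coordinates are affine and vanish on the common facet, hence are proportional. A
  positive factor would put the cells on the same side of it, and near the centroid of the facet
  their interiors would meet.\<close>

lemma lam_facet_nb:
  assumes nb: "facet_nb K a H" and a': "facet_nb H a' K" "corners H - {a'} = corners K - {a}"
  shows "lam K a x = lam H a' x * lam K a a'" "lam K a a' < 0"
proof -
  have t: "K \<in> \<T>" "H \<in> \<T>" "H \<noteq> K" "a \<in> corners K" "a' \<in> corners H"
    using nb a' by (auto simp: facet_nb_def)
  note fs = full[OF t(1)] full[OF t(2)]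
  have eq: "lam K a x = lam H a' x * lam K a a'" for x
  proof -
    have "lam K a x = lam K a (\<Sum>q\<in>corners H. lam H q x *\<^sub>R q)" using lam_sum_x[OF fs(2)] by simp
    also have "\<dots> = (\<Sum>q\<in>corners H. lam H q x * lam K a q)"
      by (rule lam_sum[OF finite_corners[OF fs(2)] lam_sum_1[OF fs(2)]])
    also have "\<dots> = (\<Sum>q\<in>{a'}. lam H q x * lam K a q)"
    proof (rule sum.mono_neutral_right[OF finite_corners[OF fs(2)]])
      show "\<forall>q\<in>corners H - {a'}. lam H q x * lam K a q = 0"
        using a'(2) lam_corner[OF fs(1) t(4)] by auto
    qed (use t in auto)
    finally show ?thesis by simp
  qed
  then show "lam K a x = lam H a' x * lam K a a'" .
  show "lam K a a' < 0"
  proof (rule ccontr)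
    assume "\<not> lam K a a' < 0"
    moreover have "lam K a a' \<noteq> 0" using eq[of a] lam_corner[OF fs(1) t(4,4)] by auto
    ultimately have mu: "lam K a a' > 0" by simp
    define C where "C = corners K - {a}"
    have C: "C \<subseteq> corners K" "C \<subseteq> corners H" "C \<noteq> {}" "finite C"
      using a'(2) other_corner[OF fs(1), of a] finite_corners[OF fs(1)] by (auto simp: C_def)
    let ?c = "centroid C"
    have lc: "lam K q ?c > 0" "lam H q ?c > 0" if "q \<in> C" for q
      using lam_centroid[OF fs(1) C(1,3), of q] lam_centroid[OF fs(2) C(2,3), of q] that C
      by (auto simp: card_gt_0_iff)
    have lc0: "lam K a ?c = 0" using lam_centroid[OF fs(1) C(1,3) t(4)] by (simp add: C_def)
    let ?U = "(\<Inter>q\<in>C. {x. 0 < lam K q x}) \<inter> (\<Inter>q\<in>C. {x. 0 < lam H q x})"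
    have "open ?U"
      using C(4) continuous_on_lam by (intro open_Int open_INT ballI open_Collect_less) auto
    moreover have "?c \<in> ?U" using lc by simp
    ultimately obtain e where e: "e > 0" "ball ?c e \<subseteq> ?U" using open_contains_ball by metis
    have anc: "norm (a - ?c) > 0" using lc0 lam_corner[OF fs(1) t(4,4)] by auto
    define s where "s = e / (2 * norm (a - ?c))"
    have s: "s > 0" "s * norm (a - ?c) < e" using e anc by (simp_all add: s_def)
    define x where "x = ?c + s *\<^sub>R (a - ?c)"
    have "x \<in> ball ?c e" using s by (simp add: x_def dist_norm)
    then have xU: "x \<in> ?U" using e by blast
    have la: "lam K a x = s"
      using lam_diff[of K a x ?c] lam_diff[of K a a ?c] lc0 lam_corner[OF fs(1) t(4,4)] by (simp add: x_def)
    then have "lam H a' x > 0" using eq[of x] s mu by (metis zero_less_mult_pos2)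
    then have "x \<in> interior H" using xU a'(2) unfolding mem_interior_simplex_iff[OF fs(2)] C_def by auto
    moreover have "x \<in> interior K" using xU la s unfolding mem_interior_simplex_iff[OF fs(1)] C_def by auto
    ultimately show False using interior_unique[OF t(2,1)] interior_subset t(3) by blast
  qed
qed

lemma facet_hull:
  assumes "K \<in> \<T>" "a \<in> corners K" "p \<in> K" "lam K a p = 0" "H \<in> \<T>" "corners K - {a} \<subseteq> corners H"
  shows "p \<in> H"
proof -
  have "p \<in> convex hull (corners K - {a})"
    using mem_convex_hull_corners[OF full[OF assms(1)], of "corners K - {a}" p] assms
      mem_simplex_iff[OF full[OF assms(1)]] by auto
  then have "p \<in> convex hull (corners H)" using hull_mono[OF assms(6)] by blast
  then show ?thesis using hull_corners[OF full[OF assms(5)]] by simp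
qed

text \<open>A point of the facet in \<Omega> puts the centroid of the facet in \<Omega>. Just beyond
  the centroid there is another cell; it contains the centroid and therefore all corners of the
  facet.\<close>

lemma boundary_facet_outside:
  assumes bf: "boundary_facet K a" and x: "x \<in> K" "lam K a x = 0"
  shows "x \<notin> \<Omega>"
proof
  assume x\<Omega>: "x \<in> \<Omega>"
  have t: "K \<in> \<T>" "a \<in> corners K" using bf by (auto simp: boundary_facet_def)
  note fs = full[OF t(1)]
  define C where "C = corners K - {a}"
  have C: "C \<subseteq> corners K" "C \<noteq> {}" "finite C"
    using other_corner[OF fs, of a] finite_corners[OF fs] by (auto simp: C_def)
  let ?c = "centroid C"
  have lc: "lam K q ?c > 0" if "q \<in> C" for q
    using lam_centroid[OF fs C(1,2), of q] that C by (auto simp: card_gt_0_iff)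
  have lc0: "lam K a ?c = 0" using lam_centroid[OF fs C(1,2) t(2)] by (simp add: C_def)
  have cK: "?c \<in> K" using lc lc0 mem_simplex_iff[OF fs] unfolding C_def by (metis Diff_iff order.strict_implies_order order_refl singletonD)
  have "?c \<in> \<Omega>"
  proof (rule mem_dom_transfer[OF t(1) cK x(1) x\<Omega>])
    fix q assume "q \<in> corners K" "lam K q x > 0"
    then show "lam K q ?c > 0" using x(2) lc[of q] unfolding C_def by (cases "q = a") auto
  qed
  then obtain e where e: "e > 0" "ball ?c e \<subseteq> \<Omega>" using open_dom open_contains_ball by blast
  obtain e1 where e1: "e1 > 0" "\<forall>H\<in>\<T>. H \<inter> ball ?c e1 \<noteq> {} \<longrightarrow> ?c \<in> H"
    using ball_meets_only_containing[OF finite_mesh closed_fs[OF full]] by blast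
  have anc: "norm (a - ?c) > 0" using lc0 lam_corner[OF fs t(2,2)] by auto
  define s where "s = min e e1 / (2 * norm (a - ?c))"
  have "min e e1 > 0" using e e1 by simp
  then have s: "s > 0" "s * norm (a - ?c) < min e e1" using anc by (simp_all add: s_def del: min_less_iff_conj)
  define y where "y = ?c - s *\<^sub>R (a - ?c)"
  have "y \<in> ball ?c (min e e1)" using s by (simp add: y_def dist_norm)
  then have y: "y \<in> ball ?c e" "y \<in> ball ?c e1" by auto
  have la: "lam K a y = - s"
    using lam_diff[of K a y ?c] lam_diff[of K a a ?c] lc0 lam_corner[OF fs t(2,2)] by (simp add: y_def)
  then have "y \<notin> K" using s t(2) mem_simplex_iff[OF fs] by (metis neg_less_0_iff_less not_le)
  obtain H where H: "H \<in> \<T>" "y \<in> H" using y(1) e(2) Union_mesh closure_subset by blast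
  then have cH: "?c \<in> H" using e1(2) y(2) by blast
  have "C \<subseteq> corners H" using lam_pos_common[OF H(1) t(1) cH cK] lc C(1) by blast
  moreover have "H \<noteq> K" using H(2) \<open>y \<notin> K\<close> by blast
  ultimately have "facet_nb K a H" using H(1) t by (simp add: facet_nb_def C_def)
  then show False using bf by (simp add: boundary_facet_def)
qed

lemma star_rel_Image:
  assumes "(K, H) \<in> star_rel p" shows "K \<in> \<T>" "H \<in> \<T>" "p \<in> K" "p \<in> H"
  using assms facet_hull unfolding star_rel_def facet_nb_def by blast+

lemma star_rel_rtrancl:
  assumes "(K, H) \<in> (star_rel p)\<^sup>*" "K \<in> \<T>" "p \<in> K" shows "H \<in> \<T>" "p \<in> H"
  using assms by (induction rule: rtrancl_induct) (auto dest: star_rel_Image)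

text \<open>A segment in general position crosses the mesh through the relative interiors of facets only, so
  a face-connected component of the star without boundary facets at \<open>p\<close> fills a ball around \<open>p\<close>.\<close>

lemma star_chain:
  assumes dim: "DIM('a) \<ge> 2" and K0: "K0 \<in> \<T>" "p \<in> K0"
  shows "(\<exists>K a. (K0, K) \<in> (star_rel p)\<^sup>* \<and> boundary_facet K a \<and> lam K a p = 0) \<or>
    (p \<in> \<Omega> \<and> (\<forall>H\<in>\<T>. p \<in> H \<longrightarrow> (K0, H) \<in> (star_rel p)\<^sup>*))"
proof (rule disjCI)
  assume nall: "\<not> (p \<in> \<Omega> \<and> (\<forall>H\<in>\<T>. p \<in> H \<longrightarrow> (K0, H) \<in> (star_rel p)\<^sup>*))"
  define Comp where "Comp = (star_rel p)\<^sup>* `` {K0}"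
  have CompT: "Comp \<subseteq> \<T>" unfolding Comp_def using star_rel_rtrancl[OF _ K0] by blast
  have Compp: "p \<in> K" if "K \<in> Comp" for K using that unfolding Comp_def using star_rel_rtrancl[OF _ K0] by blast
  define X where "X = \<Union>Comp"
  have finC: "finite Comp" using CompT finite_mesh finite_subset by blast
  have clX: "closed X" unfolding X_def using finC CompT closed_fs[OF full] by (intro closed_Union) auto
  show "\<exists>K a. (K0, K) \<in> (star_rel p)\<^sup>* \<and> boundary_facet K a \<and> lam K a p = 0"
  proof (rule ccontr)
    assume "\<not> ?thesis"
    then have nb: "\<not> boundary_facet K a" if "K \<in> Comp" "lam K a p = 0" for K a
      using that unfolding Comp_def by blast
    \<comment> \<open>In this neighbourhood only coordinates that vanish at \<open>p\<close> can
      vanish, so every facet met there contains \<open>p\<close>.\<close>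
    let ?W = "\<Inter>K\<in>\<T>. \<Inter>a\<in>{a\<in>corners K. lam K a p > 0}. {x. lam K a x > 0}"
    have "open ?W"
    proof (intro open_INT ballI finite_mesh open_Collect_less continuous_on_const continuous_on_lam)
      fix K assume "K \<in> \<T>"
      then show "finite {a \<in> corners K. lam K a p > 0}" using finite_corners[OF full] by simp
    qed
    moreover have "p \<in> ?W" by auto
    ultimately have "\<exists>e>0. ball p e \<subseteq> ?W" unfolding open_contains_ball by (rule bspec)
    then obtain e where e: "e > 0" "ball p e \<subseteq> ?W" by (elim exE conjE)
    have pos: "lam K a x > 0" if "x \<in> ball p e" "K \<in> \<T>" "a \<in> corners K" "lam K a p > 0" for x K a
      using subsetD[OF e(2) that(1)] that(2-) by simp
    \<comment> \<open>With at most one vanishing coordinate, \<open>z\<close> is inside a cell or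
      inside a facet. In the second case the two cells at the facet cover a neighbourhood of
      \<open>z\<close>, and the neighbour belongs to the component.\<close>
    have local: "z \<in> interior X"
      if z: "z \<in> ball p e" "z \<in> X" and gen: "\<And>K a b. K \<in> \<T> ==> a \<in> corners K ==> b \<in> corners K ==> a \<noteq> b
        ==> \<not> (lam K a z = 0 \<and> lam K b z = 0)" for z
    proof -
      obtain K where K: "K \<in> Comp" "z \<in> K" using z(2) unfolding X_def by blast
      have KT: "K \<in> \<T>" using K(1) CompT by blast
      note fs = full[OF KT]
      show ?thesis
      proof (cases "z \<in> interior K")
        case True
        have "K \<subseteq> X" unfolding X_def using K by blast
        then show ?thesis using True interior_mono by blast
      next
        case False
        then obtain a where a: "a \<in> corners K" "\<not> lam K a z > 0" unfolding mem_interior_simplex_iff[OF fs] by blast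
        then have a0: "lam K a z = 0" using K(2) mem_simplex_iff[OF fs] by force
        have qpos: "lam K q z > 0" if "q \<in> corners K - {a}" for q
        proof -
          have "lam K q z \<ge> 0" using that K(2) mem_simplex_iff[OF fs] by blast
          moreover have "lam K q z \<noteq> 0" using gen[OF KT a(1), of q] a0 that by blast
          ultimately show ?thesis by simp
        qed
        have pK: "p \<in> K" using Compp[OF K(1)] .
        have ap: "lam K a p = 0"
        proof (rule ccontr)
          assume "lam K a p \<noteq> 0"
          then have "lam K a p > 0" using pK a(1) mem_simplex_iff[OF fs] by force
          then show False using pos[OF z(1) KT a(1)] a(2) by blast
        qed
        obtain H where H: "facet_nb K a H" using nb[OF K(1) ap] KT a(1) unfolding boundary_facet_def by blast
        have HT: "H \<in> \<T>" using H by (simp add: facet_nb_def)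
        obtain a' where a': "facet_nb H a' K" "a' \<notin> corners K" "a \<notin> corners H" "corners H - {a'} = corners K - {a}"
          using facet_nb_apex[OF H] .
        have "(K, H) \<in> star_rel p" using H pK ap unfolding star_rel_def by blast
        then have HC: "H \<in> Comp" using K(1) unfolding Comp_def by (auto intro: rtrancl_into_rtrancl)
        have zH: "z \<in> H" using facet_hull[OF KT a(1) K(2) a0 HT] H by (simp add: facet_nb_def)
        let ?U = "\<Inter>q\<in>corners K - {a}. {x. lam K q x > 0} \<inter> {x. lam H q x > 0}"
        have "open ?U"
          using finite_corners[OF fs] continuous_on_lam by (intro open_INT ballI open_Int open_Collect_less) auto
        moreover have "z \<in> ?U"
          using qpos lam_common[OF HT KT zH K(2)] H by (auto simp: facet_nb_def)
        moreover have "?U \<subseteq> X"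
        proof
          fix x assume x: "x \<in> ?U"
          show "x \<in> X"
          proof (cases "lam K a x \<ge> 0")
            case True
            moreover have "lam K q x \<ge> 0" if "q \<in> corners K - {a}" for q
              using x that by (auto intro: less_imp_le)
            ultimately have "x \<in> K" unfolding mem_simplex_iff[OF fs] by blast
            then show ?thesis using K(1) unfolding X_def by blast
          next
            case False
            have "lam H a' x * lam K a a' < 0" using lam_facet_nb(1)[OF H a'(1,4), of x] False by simp
            then have "lam H a' x \<ge> 0" using lam_facet_nb(2)[OF H a'(1,4)] by (simp add: mult_less_0_iff)
            moreover have "lam H q x \<ge> 0" if "q \<in> corners H - {a'}" for q
              using x that unfolding a'(4) by (auto intro: less_imp_le)
            ultimately have "x \<in> H" unfolding mem_simplex_iff[OF full[OF HT]] by blast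
            then show ?thesis using HC unfolding X_def by blast
          qed
        qed
        ultimately show ?thesis by (meson interiorI)
      qed
    qed
    have dense: "y \<in> X" if y: "y \<in> ball p e" and ygen: "\<And>K a. K \<in> \<T> ==> a \<in> corners K ==> lam K a y \<noteq> 0" for y
    proof -
      \<comment> \<open>The hyperplane through \<open>y\<close> and the plane of codimension two
        where the coordinates of \<open>a\<close> and \<open>b\<close> both vanish. A segment to
        \<open>y\<close> that starts off these finitely many hyperplanes never has two vanishing
        coordinates of one cell. A third corner, available in dimension at least two, shows that the
        normal vector is not zero.\<close>
      define Hy where "Hy K a b = {x. (lam K b y *\<^sub>R bg K a - lam K a y *\<^sub>R bg K b) \<bullet> x
        = lam K b y * (bg K a \<bullet> a - 1) - lam K a y * (bg K b \<bullet> b - 1)}" for K a b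
      have Hneg: "negligible (Hy K a b)" if "K \<in> \<T>" "a \<in> corners K" "b \<in> corners K" "a \<noteq> b" for K a b
      proof -
        note fs = full[OF that(1)]
        have "\<not> corners K \<subseteq> {a, b}"
          using card_corners[OF fs] card_mono[of "{a, b}" "corners K"] card_insert_le_m1[of 2 "{b}" a] dim by auto
        then obtain r where r: "r \<in> corners K" "r \<noteq> a" "r \<noteq> b" by blast
        have "bg K a \<bullet> (a - r) = 1" using bg_corner[OF fs that(2) r(1,2)] by (simp add: algebra_simps)
        moreover have "bg K b \<bullet> (a - r) = 0"
          using bg_corner[OF fs that(3) r(1,3)] bg_corner[OF fs that(3,2) that(4)] by (simp add: algebra_simps)
        ultimately have "(lam K b y *\<^sub>R bg K a - lam K a y *\<^sub>R bg K b) \<bullet> (a - r) = lam K b y"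
          by (simp add: inner_diff_left)
        then have "lam K b y *\<^sub>R bg K a - lam K a y *\<^sub>R bg K b \<noteq> 0" using ygen[OF that(1,3)] by auto
        then show ?thesis unfolding Hy_def by (intro negligible_hyperplane) auto
      qed
      define Bad where "Bad = (\<Union>K\<in>\<T>. \<Union>a\<in>corners K. \<Union>b\<in>corners K - {a}. Hy K a b)"
      have "negligible Bad" unfolding Bad_def
        using Hneg by (intro negligible_UN_finite finite_mesh finite_Diff finite_corners[OF full]) auto
      moreover have "p \<in> closure (interior K0)" using closure_interior_fs[OF full[OF K0(1)]] K0(2) by simp
      then have "interior K0 \<inter> ball p e \<noteq> {}"
        using e(1) by (meson closure_iff_nhds_not_empty centre_in_ball open_ball subset_refl)
      then have "\<not> negligible (interior K0 \<inter> ball p e)"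
        using open_not_negligible[of "interior K0 \<inter> ball p e"] by blast
      ultimately have "\<not> interior K0 \<inter> ball p e \<subseteq> Bad" using negligible_subset by blast
      then obtain x where x: "x \<in> interior K0" "x \<in> ball p e" "x \<notin> Bad" by blast
      let ?g = "\<lambda>t. x + t *\<^sub>R (y - x)"
      let ?S = "{t \<in> {0..1::real}. ?g t \<in> X}"
      have gball: "?g t \<in> ball p e" if "t \<in> {0..1}" for t
      proof -
        have "?g t = (1 - t) *\<^sub>R x + t *\<^sub>R y" by (simp add: algebra_simps)
        then show ?thesis using convex_ball[of p e] x(2) y that unfolding convex_alt by auto
      qed
      have ggen: "\<not> (lam K a (?g t) = 0 \<and> lam K b (?g t) = 0)"
        if "K \<in> \<T>" "a \<in> corners K" "b \<in> corners K" "a \<noteq> b" for K a b t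
      proof
        assume 0: "lam K a (?g t) = 0 \<and> lam K b (?g t) = 0"
        have lg: "lam K q (?g t) = (1 - t) * lam K q x + t * lam K q y" for q
        proof -
          have "lam K q (?g t) - lam K q x = t * (lam K q y - lam K q x)" unfolding lam_diff by simp
          then show ?thesis by (simp add: algebra_simps)
        qed
        have t1: "t \<noteq> 1" using 0 lg[of a] ygen[OF that(1,2)] by auto
        have "(1 - t) * (lam K b y * lam K a x - lam K a y * lam K b x)
          = lam K b y * ((1 - t) * lam K a x + t * lam K a y) - lam K a y * ((1 - t) * lam K b x + t * lam K b y)"
          by (simp add: algebra_simps)
        also have "\<dots> = 0" using 0 unfolding lg by simp
        finally have "lam K b y * lam K a x - lam K a y * lam K b x = 0" using t1 by simp
        moreover have "lam K q x = bg K q \<bullet> x - (bg K q \<bullet> q - 1)" for q by (simp add: lam_def inner_diff_right)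
        ultimately have "lam K b y * (bg K a \<bullet> x - (bg K a \<bullet> a - 1)) - lam K a y * (bg K b \<bullet> x - (bg K b \<bullet> b - 1)) = 0"
          by (simp only:)
        then have "x \<in> Hy K a b" unfolding Hy_def by (simp add: inner_diff_left algebra_simps)
        then show False using x(3) that unfolding Bad_def by blast
      qed
      have gc: "continuous_on {0..1} ?g" by (intro continuous_intros)
      have "closedin (top_of_set {0..1}) ?S"
        using continuous_closedin_preimage[OF gc clX] by (simp add: vimage_def Int_def conj_commute)
      moreover have "openin (top_of_set {0..1}) ?S"
      proof -
        have "?S = {0..1} \<inter> ?g -` interior X"
          using local[OF gball _ ggen] interior_subset[of X] by auto
        then show ?thesis using continuous_openin_preimage_gen[OF gc open_interior[of X]] by simp
      qed
      moreover have "0 \<in> ?S"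
      proof -
        have "K0 \<in> Comp" unfolding Comp_def by blast
        then show ?thesis using x(1) interior_subset[of K0] unfolding X_def by auto
      qed
      moreover have "connected {0..1::real}" by simp
      ultimately have "?S = {0..1}" unfolding connected_clopen by blast
      then have "1 \<in> ?S" by simp
      then show "y \<in> X" by simp
    qed
    have ballX: "ball p e \<subseteq> X"
    proof (rule ccontr)
      assume "\<not> ball p e \<subseteq> X"
      then have "ball p e \<inter> - X \<noteq> {}" by blast
      moreover have "open (ball p e \<inter> - X)" using clX by (intro open_Int open_ball) (simp add: open_Compl)
      ultimately have nn: "\<not> negligible (ball p e \<inter> - X)" using open_not_negligible by blast
      have "negligible (\<Union>K\<in>\<T>. \<Union>a\<in>corners K. {y. bg K a \<bullet> y = bg K a \<bullet> a - 1})"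
        using bg_nonzero[OF full] by (intro negligible_UN_finite finite_mesh finite_corners[OF full] negligible_hyperplane) auto
      then have "\<not> ball p e \<inter> - X \<subseteq> (\<Union>K\<in>\<T>. \<Union>a\<in>corners K. {y. bg K a \<bullet> y = bg K a \<bullet> a - 1})"
        using nn negligible_subset by blast
      then obtain y where y: "y \<in> ball p e" "y \<notin> X"
        "\<And>K a. K \<in> \<T> ==> a \<in> corners K ==> bg K a \<bullet> y \<noteq> bg K a \<bullet> a - 1" by blast
      have "lam K a y \<noteq> 0" if "K \<in> \<T>" "a \<in> corners K" for K a
        using y(3)[OF that] by (auto simp: lam_def inner_diff_right)
      then show False using dense[OF y(1)] y(2) by blast
    qed
    have "(K0, H) \<in> (star_rel p)\<^sup>*" if H: "H \<in> \<T>" "p \<in> H" for H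
    proof -
      have "p \<in> closure (interior H)" using closure_interior_fs[OF full[OF H(1)]] H(2) by simp
      then have "interior H \<inter> ball p e \<noteq> {}"
        using e(1) by (meson closure_iff_nhds_not_empty centre_in_ball open_ball subset_refl)
      then obtain x where x: "x \<in> interior H" "x \<in> X" using ballX by blast
      then obtain K where "K \<in> Comp" "x \<in> K" unfolding X_def by blast
      then have "K = H" using interior_unique[of K H x] CompT H(1) x(1) by blast
      then show ?thesis using \<open>K \<in> Comp\<close> unfolding Comp_def by blast
    qed
    moreover have "p \<in> \<Omega>"
    proof -
      have "X \<subseteq> closure \<Omega>" unfolding X_def using CompT Union_mesh by blast
      then have "ball p e \<subseteq> closure \<Omega>" using ballX by blast
      then have "p \<in> interior (closure \<Omega>)" using e(1) by (meson centre_in_ball interiorI open_ball)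
      then show ?thesis using regular_dom by simp
    qed
    ultimately show False using nall by blast
  qed
qed

end

section \<open>Cell sizes in a red-green sequence\<close>

text \<open>\<open>size_le\<close> is restricted to cells that are refined next: a cell left alone
  once is kept for ever by \<open>unrefined\<close> and becomes arbitrarily large against
  \<open>2^-j\<close>.\<close>

locale graded_meshes =
  fixes \<Omega> :: "'a::euclidean_space set" and T :: "nat => 'a set set" and \<theta> \<kappa> h0 h1 :: real
  assumes dim: "DIM('a) \<ge> 2"
    and conf: "conf_mesh \<Omega> (T j)"
    and father: "H \<in> T (Suc j) ==> \<exists>!K. K \<in> T j \<and> H \<subseteq> K"
    and son_corners: "H \<in> T (Suc j) ==> K \<in> T j ==> H \<subseteq> K ==> corners H \<subseteq> corners K \<union> edge_midpoints K"
    and unrefined: "K \<in> T j ==> K \<in> T (Suc j) ==> K \<in> T (Suc (Suc j))"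
    and angle_pos: "\<theta> > 0"
    and angle: "K \<in> T j ==> p \<in> corners K ==> \<theta> \<le> interior_angle K p"
    and shape: "K \<in> T j ==> p \<in> corners K ==> norm (bg K p) * diameter K \<le> \<kappa>"
    and kappa_pos: "\<kappa> > 0"
    and h0_pos: "h0 > 0" and h1_pos: "h1 > 0"
    and size_ge: "K \<in> T j ==> h0 / 2 ^ j \<le> diameter K"
    and size_le: "K \<in> T j ==> K \<notin> T (Suc j) ==> diameter K \<le> h1 / 2 ^ j"

text \<open>Extreme points of a hull are among its generators, and by counting a full simplex leaves
  none of them out.\<close>

lemma corners_hull_eq:
  fixes S :: "'a::euclidean_space set"
  assumes "full_simplex (convex hull S)" "finite S" "card S \<le> Suc DIM('a)"
  shows "corners (convex hull S) = S"
proof -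
  have "corners (convex hull S) \<subseteq> S" unfolding corners_def using extreme_point_of_convex_hull by blast
  then show ?thesis using card_corners[OF assms(1)] assms(2,3) by (intro card_seteq) auto
qed

lemma Ints_eqI: "x \<in> \<int> ==> x = y ==> y \<in> \<int>"
  by simp

lemma even_classes:
  fixes X Y :: real
  assumes "\<And>Z. Z \<in> S ==> (A - Z) / 2 \<in> \<int>" "X \<in> S" "Y \<in> S"
  shows "(X - Y) / 2 \<in> \<int>"
proof -
  have "(A - Y) / 2 - (A - X) / 2 \<in> \<int>" using assms by (intro Ints_diff) auto
  then show ?thesis by (rule Ints_eqI) (simp add: field_simps)
qed

lemma even_trans:
  fixes X Y Z :: real
  assumes "(X - Y) / 2 \<in> \<int>" "(Y - Z) / 2 \<in> \<int>" shows "(X - Z) / 2 \<in> \<int>"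
  by (rule Ints_eqI[OF Ints_add[OF assms]]) (simp add: field_simps)

lemma inner_midpoint: "g \<bullet> midpoint x y = (g \<bullet> x + g \<bullet> y) / 2"
  by (simp add: midpoint_def inner_add_right)

text \<open>The edges of the father are integer combinations of doubled edges of any son of a regular
  refinement. Hence a functional that is integral on the edges of a cell of level \<open>j\<close> is a multiple
  of \<open>2^j\<close> on the edges of its ancestor of level \<open>0\<close>, which bounds the diameter from above.\<close>

lemma regular_son_edges:
  fixes K :: "'a::euclidean_space set"
  assumes reg: "regular_refinement K S" and H: "H \<in> S" "full_simplex H"
    and int: "\<And>x y. x \<in> corners H ==> y \<in> corners H ==> g \<bullet> (x - y) \<in> \<int>"
    and xy: "x \<in> corners K" "y \<in> corners K"
  shows "g \<bullet> (x - y) / 2 \<in> \<int>"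
proof -
  have D: "g \<bullet> x - g \<bullet> y \<in> \<int>" if "H = convex hull V" "finite V" "card V \<le> Suc DIM('a)" "x \<in> V" "y \<in> V" for V x y
    using int corners_hull_eq[of V] that H(2) by (auto simp: inner_diff_right)
  have fin: "(X - Y) / 2 \<in> \<int>" if "(\<And>Z. Z \<in> P ==> (A - Z) / 2 \<in> \<int>)" "X \<in> P" "Y \<in> P" for P and A X Y :: real
    using even_classes that by blast
  consider (2) a b c where "DIM('a) = 2" "corners K = {a, b, c}" "S = red_triangle a b c"
    | (3) a b c e where "DIM('a) = 3" "corners K = {a, b, c, e}" "S = red_tetrahedron a b c e"
    using reg unfolding regular_refinement_def by blast
  then show ?thesis
  proof cases
    case 2
    define A B C where "A = g \<bullet> a" and "B = g \<bullet> b" and "C = g \<bullet> c"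
    have card3: "card {u, v, w} \<le> Suc DIM('a)" for u v w :: 'a
      using 2(1) by (simp add: card_insert_if)
    have "(A - B) / 2 \<in> \<int> \<and> (A - C) / 2 \<in> \<int>"
    proof -
      consider "H = convex hull {a, midpoint a b, midpoint a c}" | "H = convex hull {b, midpoint a b, midpoint b c}"
        | "H = convex hull {c, midpoint a c, midpoint b c}" | "H = convex hull {midpoint a b, midpoint a c, midpoint b c}"
        using H(1) 2(3) unfolding red_triangle_def by blast
      then show ?thesis
      proof cases
        case 1
        note d = D[OF this _ card3, simplified]
        have "(A - B) / 2 \<in> \<int>" by (rule Ints_eqI[OF d[of a "midpoint a b"]]; simp add: inner_midpoint A_def B_def field_simps)
        moreover have "(A - C) / 2 \<in> \<int>" by (rule Ints_eqI[OF d[of a "midpoint a c"]]; simp add: inner_midpoint A_def C_def field_simps)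
        ultimately show ?thesis by blast
      next
        case 2
        note d = D[OF this _ card3, simplified]
        have "(A - B) / 2 \<in> \<int>" by (rule Ints_eqI[OF d[of "midpoint a b" b]]; simp add: inner_midpoint A_def B_def field_simps)
        moreover have "(A - C) / 2 \<in> \<int>" by (rule Ints_eqI[OF d[of "midpoint a b" "midpoint b c"]]; simp add: inner_midpoint A_def C_def field_simps)
        ultimately show ?thesis by blast
      next
        case 3
        note d = D[OF this _ card3, simplified]
        have "(A - C) / 2 \<in> \<int>" by (rule Ints_eqI[OF d[of "midpoint a c" c]]; simp add: inner_midpoint A_def C_def field_simps)
        moreover have "(A - B) / 2 \<in> \<int>" by (rule Ints_eqI[OF d[of "midpoint a c" "midpoint b c"]]; simp add: inner_midpoint A_def B_def field_simps)
        ultimately show ?thesis by blast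
      next
        case 4
        note d = D[OF this _ card3, simplified]
        have "(A - B) / 2 \<in> \<int>" by (rule Ints_eqI[OF d[of "midpoint a c" "midpoint b c"]]; simp add: inner_midpoint A_def B_def field_simps)
        moreover have "(A - C) / 2 \<in> \<int>" by (rule Ints_eqI[OF d[of "midpoint a b" "midpoint b c"]]; simp add: inner_midpoint A_def C_def field_simps)
        ultimately show ?thesis by blast
      qed
    qed
    then have "(A - Z) / 2 \<in> \<int>" if "Z \<in> (\<bullet>) g ` corners K" for Z
      using that unfolding 2(2) A_def B_def C_def by auto
    from fin[OF this, where X = "g \<bullet> x" and Y = "g \<bullet> y"] xy show ?thesis by (simp add: inner_diff_right)
  next
    case 3
    define A B C E where "A = g \<bullet> a" and "B = g \<bullet> b" and "C = g \<bullet> c" and "E = g \<bullet> e"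
    note defs = A_def B_def C_def E_def inner_midpoint
    have card4: "card {u, v, w, z} \<le> Suc DIM('a)" for u v w z :: 'a
      using 3(1) by (simp add: card_insert_if)
    have "(A - B) / 2 \<in> \<int> \<and> (A - C) / 2 \<in> \<int> \<and> (A - E) / 2 \<in> \<int>"
    proof -
      let ?ab = "midpoint a b" and ?ac = "midpoint a c" and ?ae = "midpoint a e"
        and ?bc = "midpoint b c" and ?be = "midpoint b e" and ?ce = "midpoint c e"
      consider "H = convex hull {a, ?ab, ?ac, ?ae}" | "H = convex hull {b, ?ab, ?bc, ?be}"
        | "H = convex hull {c, ?ac, ?bc, ?ce}" | "H = convex hull {e, ?ae, ?be, ?ce}"
        | "H = convex hull {?ab, ?ce, ?ac, ?bc}" | "H = convex hull {?ab, ?ce, ?bc, ?be}"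
        | "H = convex hull {?ab, ?ce, ?be, ?ae}" | "H = convex hull {?ab, ?ce, ?ae, ?ac}"
        using H(1) 3(3) unfolding red_tetrahedron_def by blast
      then show ?thesis
      proof cases
        case 1
        note d = D[OF this _ card4, simplified]
        have "(A - B) / 2 \<in> \<int>" by (rule Ints_eqI[OF d[of a ?ab]]; simp add: defs field_simps)
        moreover have "(A - C) / 2 \<in> \<int>" by (rule Ints_eqI[OF d[of a ?ac]]; simp add: defs field_simps)
        moreover have "(A - E) / 2 \<in> \<int>" by (rule Ints_eqI[OF d[of a ?ae]]; simp add: defs field_simps)
        ultimately show ?thesis by blast
      next
        case 2
        note d = D[OF this _ card4, simplified]
        have "(A - B) / 2 \<in> \<int>" by (rule Ints_eqI[OF d[of ?ab b]]; simp add: defs field_simps)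
        moreover have "(A - C) / 2 \<in> \<int>" by (rule Ints_eqI[OF d[of ?ab ?bc]]; simp add: defs field_simps)
        moreover have "(A - E) / 2 \<in> \<int>" by (rule Ints_eqI[OF d[of ?ab ?be]]; simp add: defs field_simps)
        ultimately show ?thesis by blast
      next
        case 3
        note d = D[OF this _ card4, simplified]
        have "(A - B) / 2 \<in> \<int>" by (rule Ints_eqI[OF d[of ?ac ?bc]]; simp add: defs field_simps)
        moreover have "(A - C) / 2 \<in> \<int>" by (rule Ints_eqI[OF d[of ?ac c]]; simp add: defs field_simps)
        moreover have "(A - E) / 2 \<in> \<int>" by (rule Ints_eqI[OF d[of ?ac ?ce]]; simp add: defs field_simps)
        ultimately show ?thesis by blast
      next
        case 4
        note d = D[OF this _ card4, simplified]
        have "(A - B) / 2 \<in> \<int>" by (rule Ints_eqI[OF d[of ?ae ?be]]; simp add: defs field_simps)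
        moreover have "(A - C) / 2 \<in> \<int>" by (rule Ints_eqI[OF d[of ?ae ?ce]]; simp add: defs field_simps)
        moreover have "(A - E) / 2 \<in> \<int>" by (rule Ints_eqI[OF d[of ?ae e]]; simp add: defs field_simps)
        ultimately show ?thesis by blast
      next
        case 5
        note d = D[OF this _ card4, simplified]
        have "(A - B) / 2 \<in> \<int>" by (rule Ints_eqI[OF d[of ?ac ?bc]]; simp add: defs field_simps)
        moreover have "(A - C) / 2 \<in> \<int>" by (rule Ints_eqI[OF d[of ?ab ?bc]]; simp add: defs field_simps)
        moreover have "(A - E) / 2 \<in> \<int>" by (rule Ints_eqI[OF d[of ?ac ?ce]]; simp add: defs field_simps)
        ultimately show ?thesis by blast
      next
        case 6
        note d = D[OF this _ card4, simplified]
        have ac: "(A - C) / 2 \<in> \<int>" by (rule Ints_eqI[OF d[of ?ab ?bc]]; simp add: defs field_simps)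
        have ae: "(A - E) / 2 \<in> \<int>" by (rule Ints_eqI[OF d[of ?ab ?be]]; simp add: defs field_simps)
        have "(E - B) / 2 \<in> \<int>" by (rule Ints_eqI[OF d[of ?ce ?bc]]; simp add: defs field_simps)
        then show ?thesis using ac ae even_trans by blast
      next
        case 7
        note d = D[OF this _ card4, simplified]
        have ab: "(A - B) / 2 \<in> \<int>" by (rule Ints_eqI[OF d[of ?ae ?be]]; simp add: defs field_simps)
        have ae: "(A - E) / 2 \<in> \<int>" by (rule Ints_eqI[OF d[of ?ab ?be]]; simp add: defs field_simps)
        have "(B - C) / 2 \<in> \<int>" by (rule Ints_eqI[OF d[of ?be ?ce]]; simp add: defs field_simps)
        then show ?thesis using ab ae even_trans by blast
      next
        case 8
        note d = D[OF this _ card4, simplified]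
        have ac: "(A - C) / 2 \<in> \<int>" by (rule Ints_eqI[OF d[of ?ae ?ce]]; simp add: defs field_simps)
        have ae: "(A - E) / 2 \<in> \<int>" by (rule Ints_eqI[OF d[of ?ac ?ce]]; simp add: defs field_simps)
        have "(C - B) / 2 \<in> \<int>" by (rule Ints_eqI[OF d[of ?ac ?ab]]; simp add: defs field_simps)
        then show ?thesis using ac ae even_trans by blast
      qed
    qed
    then have "(A - Z) / 2 \<in> \<int>" if "Z \<in> (\<bullet>) g ` corners K" for Z
      using that unfolding 3(2) A_def B_def C_def E_def by auto
    from fin[OF this, where X = "g \<bullet> x" and Y = "g \<bullet> y"] xy show ?thesis by (simp add: inner_diff_right)
  qed
qed

section \<open>Grading constants from the refinement rules\<close>

context red_green_sequence begin

lemma conf_mesh_T: "polyhedral_domain \<Omega> ==> conf_mesh \<Omega> (T j)"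
  unfolding conf_mesh_def polyhedral_domain_def using mesh conforming by blast

lemma unrefined_stays: "K \<in> T j ==> K \<in> T (Suc j) ==> K \<in> T (Suc (Suc j))"
proof (rule ccontr)
  assume t: "K \<in> T j" "K \<in> T (Suc j)" "K \<notin> T (Suc (Suc j))"
  have "level T K = Suc j" using refined_level[OF t(2,3)] .
  moreover have "level T K \<le> j" unfolding level_def using t(1) by (rule Least_le)
  ultimately show False by simp
qed

text \<open>Only cells of level exactly \<open>Suc j\<close> are refined next, so \<open>H\<close>
  is new at that level; as irregular cells are final, its father was divided regularly.\<close>

lemma father_of_refined:
  assumes dom: "polyhedral_domain \<Omega>" and H: "H \<in> T (Suc j)" "H \<notin> T (Suc (Suc j))"
  shows "\<exists>K\<in>T j. K \<notin> T (Suc j) \<and> H \<in> sons T j K \<and> regular_refinement K (sons T j K)"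
proof -
  interpret M: conf_mesh \<Omega> "T (Suc j)" by (rule conf_mesh_T[OF dom])
  have lev: "level T H = Suc j" using refined_level[OF H] .
  have Hj: "H \<notin> T j" using not_less_Least[of j "\<lambda>j. H \<in> T j"] lev unfolding level_def by simp
  obtain K where K: "K \<in> T j" "H \<subseteq> K" using nested[OF H(1)] by blast
  have son: "H \<in> sons T j K" using H(1) K(2) by (simp add: sons_def)
  have "K \<notin> T (Suc j)"
  proof
    assume t: "K \<in> T (Suc j)"
    obtain x where "x \<in> interior H" using interior_fs_nonempty[OF M.full[OF H(1)]] by blast
    then have "K = H" using M.interior_unique[OF t H(1)] K(2) interior_subset by blast
    then show False using K(1) Hj by simp
  qed
  moreover have "regular_refinement K (sons T j K)"
  proof -
    have "sons T j K \<noteq> {K}" using son K(1) Hj by auto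
    moreover have "\<not> irregular_refinement K (sons T j K)"
    proof
      assume "irregular_refinement K (sons T j K)"
      then have "irregular T H" using K(1) son unfolding irregular_def by blast
      then show False using irregular_final[OF H(1)] H(2) by blast
    qed
    ultimately show ?thesis using refinement[OF K(1)] by blast
  qed
  ultimately show ?thesis using K(1) son by blast
qed

text \<open>Each refinement halves the lattice of possible corners. Distinct corners thus differ by
  at least \<open>2^-j\<close> in some coordinate of the ancestor, which yields the lower size
  bound.\<close>

lemma ancestor_lattice:
  assumes dom: "polyhedral_domain \<Omega>"
  shows "K \<in> T j ==> \<exists>K0\<in>T 0. \<forall>p\<in>corners K. \<forall>a\<in>corners K0. lam K0 a p * 2 ^ j \<in> \<int>"
proof (induction j arbitrary: K)
  case 0
  interpret M: conf_mesh \<Omega> "T 0" by (rule conf_mesh_T[OF dom])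
  show ?case using 0 lam_corner[OF M.full[OF 0]] by (intro bexI[of _ K]) auto
next
  case (Suc j)
  interpret M: conf_mesh \<Omega> "T 0" by (rule conf_mesh_T[OF dom])
  obtain K' where K': "K' \<in> T j" "K \<subseteq> K'" using nested[OF Suc.prems] by blast
  obtain K0 where K0: "K0 \<in> T 0" "\<forall>p\<in>corners K'. \<forall>a\<in>corners K0. lam K0 a p * 2 ^ j \<in> \<int>"
    using Suc.IH[OF K'(1)] by blast
  have "lam K0 a p * 2 ^ Suc j \<in> \<int>" if p: "p \<in> corners K" and a: "a \<in> corners K0" for p a
  proof -
    consider "p \<in> corners K'" | q r where "q \<in> corners K'" "r \<in> corners K'" "p = midpoint q r"
      using nested_corners[OF Suc.prems K'] p unfolding edge_midpoints_def by blast
    then show ?thesis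
    proof cases
      case 1
      then have "lam K0 a p * 2 ^ j \<in> \<int>" using K0(2) a by blast
      from Ints_add[OF this this] show ?thesis by (simp add: algebra_simps)
    next
      case 2
      then have i: "lam K0 a q * 2 ^ j \<in> \<int>" "lam K0 a r * 2 ^ j \<in> \<int>" using K0(2) a by blast+
      have "lam K0 a p = (lam K0 a q + lam K0 a r) / 2"
        unfolding 2(3) by (simp add: lam_def inner_diff_right inner_midpoint field_simps)
      then have eq: "2 * lam K0 a p = lam K0 a q + lam K0 a r" by simp
      have "lam K0 a p * 2 ^ Suc j = (2 * lam K0 a p) * 2 ^ j" by simp
      then have "lam K0 a p * 2 ^ Suc j = lam K0 a q * 2 ^ j + lam K0 a r * 2 ^ j" unfolding eq by (simp add: distrib_right)
      then show ?thesis using Ints_add[OF i] by simp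
    qed
  qed
  then show ?case using K0(1) by blast
qed

text \<open>The counterpart of \<open>ancestor_lattice\<close> for the upper size bound: all fathers
  of a cell that is still refined were divided regularly, and by \<open>regular_son_edges\<close>
  each of them contributes a factor two on the edges.\<close>

lemma refined_lattice:
  assumes dom: "polyhedral_domain \<Omega>"
  shows "K \<in> T j ==> K \<notin> T (Suc j) ==> \<exists>K0\<in>T 0. \<forall>g. (\<forall>x\<in>corners K. \<forall>y\<in>corners K. g \<bullet> (x - y) \<in> \<int>) \<longrightarrow>
    (\<forall>p\<in>corners K0. \<forall>q\<in>corners K0. g \<bullet> (p - q) / 2 ^ j \<in> \<int>)"
proof (induction j arbitrary: K)
  case 0 then show ?case by (intro bexI[of _ K]) auto
next
  case (Suc j)
  interpret M: conf_mesh \<Omega> "T (Suc j)" by (rule conf_mesh_T[OF dom])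
  obtain K' where K': "K' \<in> T j" "K' \<notin> T (Suc j)" "K \<in> sons T j K'" "regular_refinement K' (sons T j K')"
    using father_of_refined[OF dom Suc.prems] by blast
  obtain K0 where K0: "K0 \<in> T 0" "\<forall>g. (\<forall>x\<in>corners K'. \<forall>y\<in>corners K'. g \<bullet> (x - y) \<in> \<int>) \<longrightarrow>
    (\<forall>p\<in>corners K0. \<forall>q\<in>corners K0. g \<bullet> (p - q) / 2 ^ j \<in> \<int>)"
    using Suc.IH[OF K'(1,2)] by blast
  have "g \<bullet> (p - q) / 2 ^ Suc j \<in> \<int>"
    if g: "\<forall>x\<in>corners K. \<forall>y\<in>corners K. g \<bullet> (x - y) \<in> \<int>" and pq: "p \<in> corners K0" "q \<in> corners K0" for g p q
  proof -
    have "((1/2) *\<^sub>R g) \<bullet> (x - y) \<in> \<int>" if "x \<in> corners K'" "y \<in> corners K'" for x y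
      using regular_son_edges[OF K'(4,3) M.full[OF Suc.prems(1)] _ that, of g] g by simp
    then have "((1/2) *\<^sub>R g) \<bullet> (p - q) / 2 ^ j \<in> \<int>" using K0(2) pq by blast
    then show ?thesis by simp
  qed
  then show ?case using K0(1) by blast
qed

lemma graded:
  assumes dims: "DIM('a) \<in> {2, 3}" and dom: "polyhedral_domain \<Omega>"
  shows "\<exists>\<theta> \<kappa> h0 h1. graded_meshes \<Omega> T \<theta> \<kappa> h0 h1"
proof -
  interpret M0: conf_mesh \<Omega> "T 0" by (rule conf_mesh_T[OF dom])
  obtain \<theta> where \<theta>: "\<theta> > 0" "\<And>j K p. K \<in> T j ==> p \<in> corners K ==> \<theta> \<le> interior_angle K p"
    using nondegenerate by blast
  define \<kappa> where "\<kappa> = 6 * DIM('a) * measure lebesgue (ball (0::'a) 2) / \<theta>"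
  have shape: "norm (bg K p) * diameter K \<le> \<kappa>" if "K \<in> T j" "p \<in> corners K" for K j p
    unfolding \<kappa>_def
    using height_lower_bound[OF conf_mesh.full[OF conf_mesh_T[OF dom] that(1)] \<theta>(1) \<theta>(2)[OF that(1)] that(2)] .
  have \<kappa>0: "\<kappa> > 0"
    unfolding \<kappa>_def using \<theta>(1) measure_ball_pos[of 2 "0::'a"] DIM_positive[where 'a='a] by (intro divide_pos_pos mult_pos_pos) auto
  have ne: "T 0 \<noteq> {}" using M0.Union_mesh dom unfolding polyhedral_domain_def by auto
  define G where "G = (\<Sum>K\<in>T 0. \<Sum>a\<in>corners K. norm (bg K a))"
  have G: "norm (bg K a) \<le> G" if "K \<in> T 0" "a \<in> corners K" for K a
  proof -
    have "norm (bg K a) \<le> (\<Sum>a\<in>corners K. norm (bg K a))"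
      using that finite_corners[OF M0.full] by (intro member_le_sum) auto
    also have "\<dots> \<le> G" unfolding G_def using that M0.finite_mesh by (intro member_le_sum) (auto intro: sum_nonneg)
    finally show ?thesis .
  qed
  obtain K1 a1 where "K1 \<in> T 0" "a1 \<in> corners K1" using ne other_corner[OF M0.full] by (meson ex_in_conv)
  then have G0: "G > 0" using G bg_nonzero[OF M0.full] by (meson less_le_trans zero_less_norm_iff)
  \<comment> \<open>Two corners with different coordinates differ there by a nonzero multiple of
    \<open>2^-j\<close>, while the gradients of the coordinates on level zero are bounded by
    \<open>G\<close>.\<close>
  have low: "1 / G / 2 ^ j \<le> diameter K" if K: "K \<in> T j" for K j
  proof -
    interpret Mj: conf_mesh \<Omega> "T j" by (rule conf_mesh_T[OF dom])
    obtain K0 where K0: "K0 \<in> T 0" "\<forall>p\<in>corners K. \<forall>a\<in>corners K0. lam K0 a p * 2 ^ j \<in> \<int>"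
      using ancestor_lattice[OF dom K] by blast
    obtain p where p: "p \<in> corners K" using other_corner[OF Mj.full[OF K]] .
    obtain q where q: "q \<in> corners K" "q \<noteq> p" using other_corner[OF Mj.full[OF K]] .
    have "\<exists>a\<in>corners K0. lam K0 a p \<noteq> lam K0 a q"
    proof (rule ccontr)
      assume "\<not> ?thesis"
      then have "(\<Sum>a\<in>corners K0. lam K0 a p *\<^sub>R a) = (\<Sum>a\<in>corners K0. lam K0 a q *\<^sub>R a)" by (intro sum.cong) auto
      then show False using lam_sum_x[OF M0.full[OF K0(1)]] q(2) by metis
    qed
    then obtain a where a: "a \<in> corners K0" "lam K0 a p \<noteq> lam K0 a q" by blast
    have "lam K0 a p * 2 ^ j - lam K0 a q * 2 ^ j \<in> \<int>" using K0(2) a p q by (intro Ints_diff) auto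
    moreover have "lam K0 a p * 2 ^ j - lam K0 a q * 2 ^ j = (bg K0 a \<bullet> (p - q)) * 2 ^ j"
      unfolding lam_diff[symmetric] by (simp add: algebra_simps)
    moreover have "bg K0 a \<bullet> (p - q) \<noteq> 0" using lam_diff[of K0 a p q] a(2) by simp
    ultimately have "1 \<le> \<bar>(bg K0 a \<bullet> (p - q)) * 2 ^ j\<bar>" using Ints_nonzero_abs_ge1 by (metis mult_eq_0_iff power_not_zero zero_neq_numeral)
    also have "\<dots> \<le> (G * diameter K) * 2 ^ j"
    proof -
      have "\<bar>bg K0 a \<bullet> (p - q)\<bar> \<le> norm (bg K0 a) * norm (p - q)" by (rule Cauchy_Schwarz_ineq2)
      also have "\<dots> \<le> G * diameter K"
        using G[OF K0(1) a(1)] diameter_bounded_bound[OF bounded_fs[OF Mj.full[OF K]], of p q] corners_subset p q G0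
        by (intro mult_mono) (auto simp: dist_norm)
      finally show ?thesis by (simp add: abs_mult)
    qed
    finally show ?thesis using G0 by (simp add: field_simps)
  qed
  define D where "D = (\<Sum>K\<in>T 0. diameter K)"
  have D: "diameter K \<le> D" if "K \<in> T 0" for K
    unfolding D_def using that M0.finite_mesh diameter_ge_0[OF bounded_fs[OF M0.full]] by (intro member_le_sum) auto
  have D0: "D > 0" using D ne diameter_corners[OF M0.full] by (metis ex_in_conv less_le_trans)
  \<comment> \<open>The lattice property is applied to \<open>bg K a\<close>, whose values on the
    edges of \<open>K\<close> are \<open>0\<close>, \<open>1\<close> and \<open>- 1\<close>. It is
    not constant on the ancestor, so it changes by at least \<open>2 ^ j\<close> over a distance of
    at most \<open>D\<close>, while its norm is at most
    \<open>\<kappa> / diameter K\<close>.\<close>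
  have up: "diameter K \<le> \<kappa> * D / 2 ^ j" if K: "K \<in> T j" "K \<notin> T (Suc j)" for K j
  proof -
    interpret Mj: conf_mesh \<Omega> "T j" by (rule conf_mesh_T[OF dom])
    note fs = Mj.full[OF K(1)]
    obtain K0 where K0: "K0 \<in> T 0" "\<And>g. (\<forall>x\<in>corners K. \<forall>y\<in>corners K. g \<bullet> (x - y) \<in> \<int>) ==>
      (\<forall>p\<in>corners K0. \<forall>q\<in>corners K0. g \<bullet> (p - q) / 2 ^ j \<in> \<int>)"
      using refined_lattice[OF dom K] by blast
    note fs0 = M0.full[OF K0(1)]
    obtain a where a: "a \<in> corners K" using other_corner[OF fs] .
    obtain b where b: "b \<in> corners K" "b \<noteq> a" using other_corner[OF fs] .
    have "bg K a \<bullet> (x - y) \<in> \<int>" if "x \<in> corners K" "y \<in> corners K" for x y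
      using lam_diff[of K a x y] lam_corner[OF fs a that(1)] lam_corner[OF fs a that(2)] by (auto split: if_splits simp flip: lam_diff)
    then have int: "bg K a \<bullet> (p - q) / 2 ^ j \<in> \<int>" if "p \<in> corners K0" "q \<in> corners K0" for p q
      using K0(2)[of "bg K a"] that by blast
    obtain p where p: "p \<in> corners K0" using other_corner[OF fs0] .
    have "\<exists>q\<in>corners K0. bg K a \<bullet> (q - p) \<noteq> 0"
    proof (rule ccontr)
      assume n: "\<not> ?thesis"
      have const: "lam K a x = lam K a p" for x
      proof -
        have "lam K a x = (\<Sum>q\<in>corners K0. lam K0 q x * lam K a q)"
          using lam_sum[OF finite_corners[OF fs0] lam_sum_1[OF fs0], of K a x] lam_sum_x[OF fs0, of x] by simp
        also have "\<dots> = (\<Sum>q\<in>corners K0. lam K0 q x * lam K a p)"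
        proof (intro sum.cong refl)
          fix q assume "q \<in> corners K0"
          then show "lam K0 q x * lam K a q = lam K0 q x * lam K a p" using n lam_diff[of K a q p] by auto
        qed
        also have "\<dots> = lam K a p" using lam_sum_1[OF fs0, of x] by (simp add: sum_distrib_right[symmetric])
        finally show ?thesis .
      qed
      show False using const[of a] const[of b] lam_corner[OF fs a a] lam_corner[OF fs a b(1)] b(2) by simp
    qed
    then obtain q where q: "q \<in> corners K0" "bg K a \<bullet> (q - p) \<noteq> 0" by blast
    have "1 \<le> \<bar>bg K a \<bullet> (q - p) / 2 ^ j\<bar>" using int[OF q(1) p] q(2) by (intro Ints_nonzero_abs_ge1) auto
    then have "2 ^ j \<le> \<bar>bg K a \<bullet> (q - p)\<bar>" by (simp add: field_simps)
    also have "\<dots> \<le> norm (bg K a) * norm (q - p)" by (rule Cauchy_Schwarz_ineq2)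
    also have "\<dots> \<le> norm (bg K a) * D"
      using diameter_bounded_bound[OF bounded_fs[OF fs0], of q p] corners_subset p q D[OF K0(1)]
      by (intro mult_left_mono) (auto simp: dist_norm intro: order_trans)
    finally have "2 ^ j * diameter K \<le> norm (bg K a) * D * diameter K"
      using diameter_ge_0[OF bounded_fs[OF fs]] by (intro mult_right_mono) auto
    also have "\<dots> \<le> \<kappa> * D" using shape[OF K(1) a] D0 by (simp add: mult.commute mult.left_commute mult_left_mono)
    finally show ?thesis by (simp add: field_simps)
  qed
  have "graded_meshes \<Omega> T \<theta> \<kappa> (1 / G) (\<kappa> * D)"
    by (rule graded_meshes.intro)
      (use dims conf_mesh_T[OF dom] nested nested_corners unrefined_stays \<theta> shape G0 \<kappa>0 D0 low up in auto)
  then show ?thesis by blast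
qed

end

section \<open>Sums with geometric weights\<close>

lemma two_power_sq: "(2 ^ k)\<^sup>2 = (4 ^ k :: real)"
  by (simp add: power2_eq_square flip: power_mult_distrib)

lemma sum_sq_le:
  fixes x y :: "'i => real"
  shows "(\<Sum>i\<in>I. x i * y i)\<^sup>2 \<le> (\<Sum>i\<in>I. (x i)\<^sup>2) * (\<Sum>i\<in>I. (y i)\<^sup>2)"
  by (rule Cauchy_Schwarz_ineq_sum)

lemma geometric_sum_le:
  fixes q :: real assumes "0 \<le> q" "q < 1"
  shows "(\<Sum>k\<in>{j..J}. q ^ (k - j)) \<le> 1 / (1 - q)" "(\<Sum>j\<in>{..k}. q ^ (k - j)) \<le> 1 / (1 - q)"
proof -
  have g: "(\<Sum>i<n. q ^ i) \<le> 1 / (1 - q)" for n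
    using sum_le_suminf[of "\<lambda>i. q ^ i" "{..<n}"] suminf_geometric[of q] summable_geometric[of q] assms by simp
  have "(\<Sum>k\<in>{j..J}. q ^ (k - j)) = (\<Sum>i<Suc J - j. q ^ i)"
    by (rule sum.reindex_bij_witness[of _ "\<lambda>i. i + j" "\<lambda>k. k - j"]) auto
  then show "(\<Sum>k\<in>{j..J}. q ^ (k - j)) \<le> 1 / (1 - q)" using g by simp
  have "(\<Sum>j\<in>{..k}. q ^ (k - j)) = (\<Sum>i<Suc k. q ^ i)"
    by (rule sum.reindex_bij_witness[of _ "\<lambda>i. k - i" "\<lambda>i. k - i"]) auto
  then show "(\<Sum>j\<in>{..k}. q ^ (k - j)) \<le> 1 / (1 - q)" using g[of "Suc k"] by simp
qed

text \<open>The discrete Young inequality for convolution with a geometric sequence: Cauchy-Schwarz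
  with the weight split into two square roots; summing the weight over either index costs
  \<open>1 / (1 - q)\<close>.\<close>

lemma young_geometric:
  fixes a b :: "nat => real"
  assumes q: "0 \<le> q" "q < 1" and C: "C \<ge> 0" and a: "\<And>j. j \<le> J ==> 0 \<le> a j"
    and le: "\<And>j. j \<le> J ==> a j \<le> C * (\<Sum>k\<in>{j..J}. q ^ (k - j) * b k)"
  shows "(\<Sum>j\<le>J. (a j)\<^sup>2) \<le> (C / (1 - q))\<^sup>2 * (\<Sum>k\<le>J. (b k)\<^sup>2)"
proof -
  let ?r = "1 / (1 - q)"
  have r: "?r \<ge> 0" using q by simp
  have one: "(a j)\<^sup>2 \<le> C\<^sup>2 * ?r * (\<Sum>k\<in>{j..J}. q ^ (k - j) * (b k)\<^sup>2)" if j: "j \<le> J" for j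
  proof -
    have "(\<Sum>k\<in>{j..J}. q ^ (k - j) * b k)\<^sup>2 = (\<Sum>k\<in>{j..J}. sqrt (q ^ (k - j)) * (sqrt (q ^ (k - j)) * b k))\<^sup>2"
      using q by (simp add: mult.assoc[symmetric])
    also have "\<dots> \<le> (\<Sum>k\<in>{j..J}. (sqrt (q ^ (k - j)))\<^sup>2) * (\<Sum>k\<in>{j..J}. (sqrt (q ^ (k - j)) * b k)\<^sup>2)"
      by (rule sum_sq_le)
    also have "\<dots> = (\<Sum>k\<in>{j..J}. q ^ (k - j)) * (\<Sum>k\<in>{j..J}. q ^ (k - j) * (b k)\<^sup>2)"
      using q by (simp add: power_mult_distrib)
    also have "\<dots> \<le> ?r * (\<Sum>k\<in>{j..J}. q ^ (k - j) * (b k)\<^sup>2)"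
      using q by (intro mult_right_mono geometric_sum_le sum_nonneg) auto
    finally have s: "(\<Sum>k\<in>{j..J}. q ^ (k - j) * b k)\<^sup>2 \<le> ?r * (\<Sum>k\<in>{j..J}. q ^ (k - j) * (b k)\<^sup>2)" .
    have "(a j)\<^sup>2 \<le> (C * (\<Sum>k\<in>{j..J}. q ^ (k - j) * b k))\<^sup>2" using le[OF j] a[OF j] by (intro power_mono)
    also have "\<dots> \<le> C\<^sup>2 * (?r * (\<Sum>k\<in>{j..J}. q ^ (k - j) * (b k)\<^sup>2))"
      unfolding power_mult_distrib by (intro mult_left_mono s) auto
    finally show ?thesis by (simp only: mult.assoc)
  qed
  have "(\<Sum>j\<le>J. (a j)\<^sup>2) \<le> (\<Sum>j\<le>J. C\<^sup>2 * ?r * (\<Sum>k\<in>{j..J}. q ^ (k - j) * (b k)\<^sup>2))"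
    using one by (intro sum_mono) auto
  also have "\<dots> = C\<^sup>2 * ?r * (\<Sum>j\<le>J. \<Sum>k\<in>{j..J}. q ^ (k - j) * (b k)\<^sup>2)" by (simp add: sum_distrib_left)
  finally have 1: "(\<Sum>j\<le>J. (a j)\<^sup>2) \<le> C\<^sup>2 * ?r * (\<Sum>j\<le>J. \<Sum>k\<in>{j..J}. q ^ (k - j) * (b k)\<^sup>2)" .
  have "(\<Sum>j\<le>J. \<Sum>k\<in>{j..J}. q ^ (k - j) * (b k)\<^sup>2) = (\<Sum>k\<le>J. \<Sum>j\<in>{..k}. q ^ (k - j) * (b k)\<^sup>2)"
  proof -
    have "(\<Sum>j\<le>J. \<Sum>k\<in>{j..J}. q ^ (k - j) * (b k)\<^sup>2) = (\<Sum>j\<in>{..J}. \<Sum>k\<in>{k\<in>{..J}. j \<le> k}. q ^ (k - j) * (b k)\<^sup>2)"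
      by (intro sum.cong) auto
    also have "\<dots> = (\<Sum>k\<in>{..J}. \<Sum>j\<in>{j\<in>{..J}. j \<le> k}. q ^ (k - j) * (b k)\<^sup>2)"
      by (rule sum.swap_restrict) auto
    also have "\<dots> = (\<Sum>k\<le>J. \<Sum>j\<in>{..k}. q ^ (k - j) * (b k)\<^sup>2)"
      by (intro sum.cong) auto
    finally show ?thesis .
  qed
  also have "\<dots> = (\<Sum>k\<le>J. (\<Sum>j\<in>{..k}. q ^ (k - j)) * (b k)\<^sup>2)" by (simp add: sum_distrib_right)
  also have "\<dots> \<le> (\<Sum>k\<le>J. ?r * (b k)\<^sup>2)" using q by (intro sum_mono mult_right_mono geometric_sum_le) auto
  finally have "C\<^sup>2 * ?r * (\<Sum>j\<le>J. \<Sum>k\<in>{j..J}. q ^ (k - j) * (b k)\<^sup>2) \<le> C\<^sup>2 * ?r * (\<Sum>k\<le>J. ?r * (b k)\<^sup>2)"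
    using r by (intro mult_left_mono mult_nonneg_nonneg) auto
  note order_trans[OF 1 this]
  also have "\<dots> = (C / (1 - q))\<^sup>2 * (\<Sum>k\<le>J. (b k)\<^sup>2)"
    by (simp add: sum_distrib_left[symmetric] power2_eq_square sum_divide_distrib[symmetric])
  finally show ?thesis .
qed

section \<open>Nested meshes\<close>

abbreviation vol :: "'a::euclidean_space set => real" where "vol \<equiv> measure lebesgue"

context graded_meshes begin

lemma fullT: "K \<in> T j ==> full_simplex K"
  using conf_mesh.full[OF conf] .

lemma finiteT: "finite (T j)"
  using conf_mesh.finite_mesh[OF conf] .

lemma vol_pos: "K \<in> T j ==> vol K > 0"
  using measure_fs_pos[OF fullT] .

lemma same_cell:
  assumes "H \<in> T j" "K \<in> T j" "x \<in> H" "x \<in> interior K" shows "H = K"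
  using conf_mesh.interior_unique[OF conf assms] .

lemma ancestor:
  assumes "j \<le> m" "H \<in> T m" shows "\<exists>K\<in>T j. H \<subseteq> K"
  using assms
proof (induction m arbitrary: H rule: dec_induct)
  case base then show ?case by blast
next
  case (step m)
  obtain K where "K \<in> T m" "H \<subseteq> K" using father[OF step.prems] by blast
  then show ?case using step.IH[of K] by blast
qed

lemma ancestor_unique:
  assumes "H \<in> T m" "K \<in> T j" "K' \<in> T j" "H \<subseteq> K" "H \<subseteq> K'" shows "K = K'"
proof -
  obtain x where "x \<in> interior H" using interior_fs_nonempty[OF fullT[OF assms(1)]] by blast
  then have "x \<in> interior K'" "x \<in> K" using assms interior_mono interior_subset by blast+
  then show ?thesis using same_cell assms by blast
qed

definition desc :: "'a set => nat => 'a set set" where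
  "desc K m = {H \<in> T m. H \<subseteq> K}"

lemma finite_desc: "finite (desc K m)"
  unfolding desc_def using finiteT by simp

lemma descD: "H \<in> desc K m ==> H \<in> T m" "H \<in> desc K m ==> H \<subseteq> K"
  by (auto simp: desc_def)

lemma desc_self: "K \<in> T j ==> desc K j = {K}"
  using ancestor_unique[of _ j _ j] by (auto simp: desc_def)

lemma Union_desc:
  assumes "K \<in> T j" "j \<le> m" shows "\<Union>(desc K m) = K"
proof
  show "\<Union>(desc K m) \<subseteq> K" using descD by blast
  have "interior K \<subseteq> \<Union>(desc K m)"
  proof
    fix x assume x: "x \<in> interior K"
    then have "x \<in> closure \<Omega>" using conf_mesh.interior_cell_dom[OF conf assms(1)] closure_subset by blast
    then obtain H where H: "H \<in> T m" "x \<in> H" using conf_mesh.Union_mesh[OF conf, of m] by blast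
    obtain K' where K': "K' \<in> T j" "H \<subseteq> K'" using ancestor[OF assms(2) H(1)] by blast
    then have "K' = K" using same_cell[OF K'(1) assms(1) _ x] H(2) by blast
    then show "x \<in> \<Union>(desc K m)" using H K' by (auto simp: desc_def)
  qed
  moreover have "closed (\<Union>(desc K m))" by (intro closed_Union finite_desc ballI closed_fs[OF fullT[OF descD(1)]])
  ultimately have "closure (interior K) \<subseteq> \<Union>(desc K m)" by (rule closure_minimal)
  then show "K \<subseteq> \<Union>(desc K m)" using closure_interior_fs[OF fullT[OF assms(1)]] by simp
qed

lemma int_on_desc:
  assumes "K \<in> T j" "j \<le> m" "\<And>H. H \<in> desc K m ==> intg_on H f"
  shows "int_on K f = (\<Sum>H\<in>desc K m. int_on H f)"
proof -
  have disj: "interior H \<inter> interior H' = {}" if "H \<in> desc K m" "H' \<in> desc K m" "H \<noteq> H'" for H H'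
  proof (rule ccontr)
    assume "interior H \<inter> interior H' \<noteq> {}"
    then obtain x where "x \<in> interior H" "x \<in> interior H'" by blast
    then show False using same_cell[OF descD(1)[OF that(1)] descD(1)[OF that(2)]] interior_subset that(3) by blast
  qed
  have "AE x in lebesgue. indicat_real (\<Union>(desc K m)) x = (\<Sum>H\<in>desc K m. indicator H x)"
    by (rule AE_indicator_Union[OF finite_desc fullT[OF descD(1)] disj])
  then show ?thesis using int_on_AE_sum[of K "desc K m" f] assms Union_desc[OF assms(1,2)] by simp
qed

lemma vol_desc:
  assumes "K \<in> T j" "j \<le> m" shows "vol K = (\<Sum>H\<in>desc K m. vol H)"
proof -
  have "int_on K (\<lambda>x. 1) = (\<Sum>H\<in>desc K m. int_on H (\<lambda>x. 1))"
    using assms lmeasurable_fs[OF fullT] descD(1) by (intro int_on_desc intg_on_const) blast+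
  also have "\<dots> = (\<Sum>H\<in>desc K m. vol H)"
    using int_on_const[OF lmeasurable_fs[OF fullT[OF descD(1)]], of _ K m 1] by (intro sum.cong) auto
  finally show ?thesis using int_on_const[OF lmeasurable_fs[OF fullT[OF assms(1)]], of 1] by simp
qed

lemma sum_desc:
  assumes "j \<le> m" shows "(\<Sum>H\<in>T m. f H) = (\<Sum>K\<in>T j. \<Sum>H\<in>desc K m. f H)"
proof -
  have "T m = (\<Union>K\<in>T j. desc K m)" using ancestor[OF assms] by (auto simp: desc_def)
  moreover have "(\<Sum>H\<in>(\<Union>K\<in>T j. desc K m). f H) = (\<Sum>K\<in>T j. \<Sum>H\<in>desc K m. f H)"
    using ancestor_unique[of _ m _ j] by (intro sum.UNION_disjoint finiteT ballI finite_desc impI) (unfold desc_def, blast)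
  ultimately show ?thesis by simp
qed

lemma sum_desc_desc:
  assumes K: "K \<in> T j" and jm: "j \<le> m" "m \<le> n"
  shows "(\<Sum>H\<in>desc K n. f H) = (\<Sum>K'\<in>desc K m. \<Sum>H\<in>desc K' n. f H)"
proof -
  have "desc K n = (\<Union>K'\<in>desc K m. desc K' n)"
  proof
    show "desc K n \<subseteq> (\<Union>K'\<in>desc K m. desc K' n)"
    proof
      fix H assume s: "H \<in> desc K n"
      obtain K' where K': "K' \<in> T m" "H \<subseteq> K'" using ancestor[OF jm(2) descD(1)[OF s]] by blast
      obtain K'' where "K'' \<in> T j" "K' \<subseteq> K''" using ancestor[OF jm(1) K'(1)] by blast
      then have "K' \<subseteq> K" using ancestor_unique[OF descD(1)[OF s] _ K, of K''] descD(2)[OF s] K'(2) by blast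
      then show "H \<in> (\<Union>K'\<in>desc K m. desc K' n)" using s K' by (auto simp: desc_def)
    qed
  qed (auto simp: desc_def)
  moreover have "(\<Sum>H\<in>(\<Union>K'\<in>desc K m. desc K' n). f H) = (\<Sum>K'\<in>desc K m. \<Sum>H\<in>desc K' n. f H)"
    using ancestor_unique[of _ n _ m] by (intro sum.UNION_disjoint ballI finite_desc impI) (unfold desc_def, blast)
  ultimately show ?thesis by simp
qed

lemma unrefined_later:
  assumes "K \<in> T j" "K \<in> T (Suc j)" "j \<le> m" shows "K \<in> T m"
proof -
  have "K \<in> T m \<and> K \<in> T (Suc m)" using assms(3)
    by (induction m rule: dec_induct) (use assms unrefined in auto)
  then show ?thesis by blast
qed

lemma desc_unrefined:
  assumes "K \<in> T j" "K \<in> T (Suc j)" "j \<le> m" shows "desc K m = {K}"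
  using desc_self[OF unrefined_later[OF assms]] .

lemma fe_mono:
  assumes "j \<le> m" "u \<in> fe_space \<Omega> (T j)" shows "u \<in> fe_space \<Omega> (T m)"
proof -
  have "\<exists>g c. \<forall>x\<in>H. u x = g \<bullet> x + c" if s: "H \<in> T m" for H
  proof -
    obtain K where K: "K \<in> T j" "H \<subseteq> K" using ancestor[OF assms(1) s] by (elim bexE)
    show ?thesis
      using affine_on_subset[OF conf_mesh.fe_affine[OF conf assms(2) K(1)] K(2)] unfolding affine_on_def .
  qed
  moreover have "continuous_on (closure \<Omega>) u" "\<forall>x. x \<notin> \<Omega> \<longrightarrow> u x = 0" using assms(2) unfolding fe_space_def by simp_all
  ultimately show ?thesis unfolding fe_space_def by simp
qed

text \<open>For \<open>u\<close> in the space of level \<open>J\<close>, these means of the gradient form a martingale along the refinement.\<close>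

definition mgrad :: "nat => ('a => real) => 'a set => 'a" where
  "mgrad J u K = (1 / vol K) *\<^sub>R (\<Sum>H\<in>desc K J. vol H *\<^sub>R gr u H)"

lemma vol_mgrad: "K \<in> T j ==> vol K *\<^sub>R mgrad J u K = (\<Sum>H\<in>desc K J. vol H *\<^sub>R gr u H)"
  using vol_pos[of K j] by (simp add: mgrad_def)

lemma mgrad_affine:
  assumes "K \<in> T j" "j \<le> J" "affine_on K u" shows "mgrad J u K = gr u K"
proof -
  have "(\<Sum>H\<in>desc K J. vol H *\<^sub>R gr u H) = (\<Sum>H\<in>desc K J. vol H *\<^sub>R gr u K)"
    using gr_affine_subset[OF fullT[OF assms(1)] fullT _ assms(3)] by (intro sum.cong) (auto simp: desc_def)
  also have "\<dots> = vol K *\<^sub>R gr u K" by (simp add: scaleR_sum_left[symmetric] vol_desc[OF assms(1,2)])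
  finally show ?thesis using vol_pos[OF assms(1)] by (simp add: mgrad_def)
qed

lemma mgrad_top: "K \<in> T J ==> mgrad J u K = gr u K"
  using vol_pos[of K J] by (simp add: mgrad_def desc_self)

lemma vol_mgrad_desc:
  assumes "K \<in> T j" "j \<le> m" "m \<le> J"
  shows "vol K *\<^sub>R mgrad J u K = (\<Sum>H\<in>desc K m. vol H *\<^sub>R mgrad J u H)"
proof -
  have "vol K *\<^sub>R mgrad J u K = (\<Sum>K'\<in>desc K m. \<Sum>H\<in>desc K' J. vol H *\<^sub>R gr u H)"
    unfolding vol_mgrad[OF assms(1)] by (rule sum_desc_desc[OF assms])
  also have "\<dots> = (\<Sum>H\<in>desc K m. vol H *\<^sub>R mgrad J u H)"
    using vol_mgrad[OF descD(1)] by (intro sum.cong) auto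
  finally show ?thesis .
qed

lemma mgrad_level:
  assumes "K \<in> T j" "j \<le> k" "k \<le> J" "u \<in> fe_space \<Omega> (T k)"
  shows "mgrad J u K = mgrad k u K"
proof -
  have "vol K *\<^sub>R mgrad J u K = (\<Sum>H\<in>desc K k. vol H *\<^sub>R gr u H)"
    unfolding vol_mgrad_desc[OF assms(1-3)]
    using mgrad_affine[OF descD(1) assms(3) conf_mesh.fe_affine[OF conf assms(4) descD(1)]]
    by (intro sum.cong) auto
  then show ?thesis using vol_mgrad[OF assms(1), of k u] vol_pos[OF assms(1)] by (metis scaleR_cancel_left less_irrefl)
qed

lemma mgrad_sum: "mgrad J (\<lambda>x. \<Sum>i\<in>I. u i x) K = (\<Sum>i\<in>I. mgrad J (u i) K)"
  unfolding mgrad_def gr_sum scaleR_sum_right by (rule sum.swap)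

text \<open>The conditional variance of the next martingale step on \<open>K\<close>, weighted by
  volume; it vanishes if \<open>K\<close> is not refined.\<close>

definition fluct :: "nat => ('a => real) => nat => 'a set => real" where
  "fluct J u m K = (\<Sum>H\<in>desc K (Suc m). vol H * (norm (mgrad J u H - mgrad J u K))\<^sup>2)"

lemma fluct_nonneg: "0 \<le> fluct J u m K"
  unfolding fluct_def by (intro sum_nonneg) auto

lemma fluct_eq:
  assumes "K \<in> T m" "m < J"
  shows "(\<Sum>H\<in>desc K (Suc m). vol H * (norm (mgrad J u H))\<^sup>2) = vol K * (norm (mgrad J u K))\<^sup>2 + fluct J u m K"
proof -
  let ?a = "mgrad J u"
  have n: "(norm (?a H))\<^sup>2 = (norm (?a H - ?a K))\<^sup>2 + 2 * (?a H \<bullet> ?a K) - (norm (?a K))\<^sup>2" for H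
    by (simp add: power2_norm_eq_inner algebra_simps inner_commute)
  have c: "(\<Sum>H\<in>desc K (Suc m). vol H * (?a H \<bullet> ?a K)) = vol K * (norm (?a K))\<^sup>2"
  proof -
    have "(\<Sum>H\<in>desc K (Suc m). vol H * (?a H \<bullet> ?a K)) = (\<Sum>H\<in>desc K (Suc m). vol H *\<^sub>R ?a H) \<bullet> ?a K"
      by (simp add: inner_sum_left)
    also have "\<dots> = (vol K *\<^sub>R ?a K) \<bullet> ?a K" using vol_mgrad_desc[OF assms(1), of "Suc m" J u] assms(2) by simp
    finally show ?thesis by (simp add: power2_norm_eq_inner)
  qed
  have "(\<Sum>H\<in>desc K (Suc m). vol H * (norm (?a H))\<^sup>2)
    = fluct J u m K + 2 * (\<Sum>H\<in>desc K (Suc m). vol H * (?a H \<bullet> ?a K)) - (\<Sum>H\<in>desc K (Suc m). vol H) * (norm (?a K))\<^sup>2"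
    unfolding fluct_def sum_distrib_left sum_distrib_right sum.distrib[symmetric] sum_subtractf[symmetric]
    by (intro sum.cong refl) (subst n, simp add: algebra_simps)
  also have "\<dots> = fluct J u m K + vol K * (norm (?a K))\<^sup>2"
    using vol_desc[OF assms(1), of "Suc m"] unfolding c by simp
  finally show ?thesis by simp
qed

text \<open>Orthogonality of martingale increments, in the form of the variance decomposition
  \<open>fluct_eq\<close> on each cell.\<close>

lemma martingale_energy:
  assumes "k \<le> J"
  shows "(\<Sum>K\<in>T k. vol K * (norm (mgrad J u K))\<^sup>2)
    = (\<Sum>K\<in>T 0. vol K * (norm (mgrad J u K))\<^sup>2) + (\<Sum>m<k. \<Sum>K\<in>T m. fluct J u m K)"
  using assms
proof (induction k)
  case (Suc k)
  have "(\<Sum>K\<in>T (Suc k). vol K * (norm (mgrad J u K))\<^sup>2)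
    = (\<Sum>K\<in>T k. \<Sum>H\<in>desc K (Suc k). vol H * (norm (mgrad J u H))\<^sup>2)" by (rule sum_desc) simp
  also have "\<dots> = (\<Sum>K\<in>T k. vol K * (norm (mgrad J u K))\<^sup>2 + fluct J u k K)"
    using Suc.prems by (intro sum.cong refl fluct_eq) auto
  finally show ?case using Suc by (simp add: sum.distrib)
qed simp

lemma fluct_sum_le:
  "(\<Sum>m<J. \<Sum>K\<in>T m. fluct J u m K) \<le> (\<Sum>K\<in>T J. vol K * (norm (gr u K))\<^sup>2)"
proof -
  have "(\<Sum>K\<in>T J. vol K * (norm (gr u K))\<^sup>2) = (\<Sum>K\<in>T J. vol K * (norm (mgrad J u K))\<^sup>2)"
    by (intro sum.cong) (auto simp: mgrad_top)
  moreover have "0 \<le> (\<Sum>K\<in>T 0. vol K * (norm (mgrad J u K))\<^sup>2)" by (intro sum_nonneg) auto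
  ultimately show ?thesis using martingale_energy[of J J u] by simp
qed

section \<open>Uniform bounds for cells\<close>

lemma diameter_pos: "K \<in> T j ==> diameter K > 0"
  using diameter_corners[OF fullT] by blast

lemma norm_bg_le_diam: "K \<in> T j ==> p \<in> corners K ==> norm (bg K p) \<le> \<kappa> / diameter K"
  using shape diameter_pos by (simp add: pos_le_divide_eq)

lemma norm_bg_le:
  assumes "K \<in> T j" "p \<in> corners K" shows "norm (bg K p) \<le> \<kappa> / h0 * 2 ^ j"
proof -
  have "\<kappa> / diameter K \<le> \<kappa> / (h0 / 2 ^ j)"
    using size_ge[OF assms(1)] kappa_pos h0_pos diameter_pos[OF assms(1)] by (intro divide_left_mono) auto
  then show ?thesis using norm_bg_le_diam[OF assms] by simp
qed

definition cvol :: real where "cvol = (1 / \<kappa>) ^ DIM('a) * (\<theta> / DIM('a))"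
definition Cvol :: real where "Cvol = 2 ^ DIM('a) * measure lebesgue (ball (0::'a) 1)"

lemma cvol_pos: "cvol > 0" and Cvol_pos: "Cvol > 0"
  using kappa_pos angle_pos DIM_positive[where 'a='a] measure_ball_pos[of 1 "0::'a"]
  by (simp_all add: cvol_def Cvol_def)

lemma vol_ge: assumes "K \<in> T j" shows "cvol * diameter K ^ DIM('a) \<le> vol K"
proof -
  note fs = fullT[OF assms]
  obtain p where p: "p \<in> corners K" using other_corner[OF fs] .
  let ?r = "diameter K / \<kappa>"
  have r: "0 < ?r" "?r * norm (bg K p) \<le> 1"
    using diameter_pos[OF assms] kappa_pos shape[OF assms p] by (simp_all add: divide_le_eq mult.commute)
  have "?r ^ DIM('a) * (\<theta> / DIM('a)) \<le> vol (K \<inter> ball p ?r)"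
    by (rule measure_ge_angle[OF fs p angle_pos angle[OF assms p] r])
  also have "\<dots> \<le> vol K" by (intro measure_mono_fmeasurable lmeasurable_fs fs sets.Int sets_fs[OF fs]) auto
  finally show ?thesis by (simp add: cvol_def power_divide field_simps)
qed

lemma vol_le: "K \<in> T j ==> vol K \<le> Cvol * diameter K ^ DIM('a)"
  using measure_le_diameter[OF fullT, of K j] by (simp add: Cvol_def power_mult_distrib mult_ac)

text \<open>Corners of a son are corners or edge midpoints of the father, so their coordinates are
  multiples of one half, and two of them differ by at least that much in some coordinate. This
  covers regular and irregular sons at once.\<close>

lemma son_diameter:
  assumes "K \<in> T j" "H \<in> T (Suc j)" "H \<subseteq> K" shows "diameter K \<le> 2 * \<kappa> * diameter H"
proof -
  note fs = fullT[OF assms(1)] fullT[OF assms(2)]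
  obtain p where p: "p \<in> corners H" using other_corner[OF fs(2)] .
  obtain q where q: "q \<in> corners H" "q \<noteq> p" using other_corner[OF fs(2)] .
  have half: "2 * lam K a x \<in> \<int>" if "x \<in> corners H" "a \<in> corners K" for x a
  proof -
    consider "x \<in> corners K" | y z where "y \<in> corners K" "z \<in> corners K" "x = midpoint y z"
      using son_corners[OF assms(2,1,3)] \<open>x \<in> corners H\<close> unfolding edge_midpoints_def by blast
    then show ?thesis
    proof cases
      case 1 then show ?thesis using lam_corner[OF fs(1) that(2)] by simp
    next
      case 2
      have "2 * lam K a x = lam K a y + lam K a z"
        unfolding 2(3) by (simp add: lam_def inner_diff_right inner_midpoint field_simps)
      then show ?thesis using lam_corner[OF fs(1) that(2)] 2 by simp
    qed
  qed
  have "\<exists>a\<in>corners K. lam K a p \<noteq> lam K a q"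
  proof (rule ccontr)
    assume "\<not> ?thesis"
    then have "(\<Sum>a\<in>corners K. lam K a p *\<^sub>R a) = (\<Sum>a\<in>corners K. lam K a q *\<^sub>R a)" by (intro sum.cong) auto
    then show False using lam_sum_x[OF fs(1)] q(2) by metis
  qed
  then obtain a where a: "a \<in> corners K" "lam K a p \<noteq> lam K a q" by blast
  have "2 * lam K a p - 2 * lam K a q \<in> \<int>" using half a p q by (intro Ints_diff) auto
  then have "1 \<le> \<bar>2 * lam K a p - 2 * lam K a q\<bar>" using a(2) by (intro Ints_nonzero_abs_ge1) auto
  also have "\<dots> = 2 * \<bar>bg K a \<bullet> (p - q)\<bar>" using lam_diff[of K a p q] by simp
  also have "\<dots> \<le> 2 * (norm (bg K a) * norm (p - q))" using Cauchy_Schwarz_ineq2 by (intro mult_left_mono) auto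
  also have "\<dots> \<le> 2 * (\<kappa> / diameter K * diameter H)"
    using norm_bg_le_diam[OF assms(1) a(1)] diameter_bounded_bound[OF bounded_fs[OF fs(2)], of p q] corners_subset p q
      kappa_pos diameter_pos[OF assms(1)]
    by (intro mult_left_mono mult_mono) (auto simp: dist_norm)
  finally show ?thesis using diameter_pos[OF assms(1)] by (simp add: field_simps)
qed

definition Cson :: real where "Cson = Cvol * (2 * \<kappa>) ^ DIM('a) / cvol"

lemma Cson_pos: "Cson > 0"
  using Cvol_pos cvol_pos kappa_pos by (simp add: Cson_def)

lemma son_vol:
  assumes "K \<in> T j" "H \<in> T (Suc j)" "H \<subseteq> K" shows "vol K \<le> Cson * vol H"
proof -
  have "vol K \<le> Cvol * diameter K ^ DIM('a)" by (rule vol_le[OF assms(1)])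
  also have "\<dots> \<le> Cvol * (2 * \<kappa> * diameter H) ^ DIM('a)"
    using son_diameter[OF assms] Cvol_pos diameter_pos[OF assms(1)] by (intro mult_left_mono power_mono) auto
  also have "\<dots> = Cson * (cvol * diameter H ^ DIM('a))"
    using cvol_pos by (simp add: Cson_def power_mult_distrib)
  also have "\<dots> \<le> Cson * vol H" using vol_ge[OF assms(2)] Cson_pos by (intro mult_left_mono) auto
  finally show ?thesis .
qed

definition Cinv :: real where "Cinv = (real (Suc DIM('a)) * (\<kappa> / h0))\<^sup>2 * 4 ^ Suc DIM('a)"

lemma Cinv_pos: "Cinv > 0"
  using kappa_pos h0_pos by (simp add: Cinv_def)

text \<open>The gradients of the coordinates are bounded through the lower size bound, so the factor
  \<open>4 ^ k\<close> is valid also for cells much larger than \<open>2^-k\<close>.\<close>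

lemma inverse_gradient:
  assumes K: "K \<in> T k" and u: "affine_on K u"
  shows "vol K * (norm (gr u K))\<^sup>2 \<le> Cinv * 4 ^ k * int_on K (\<lambda>x. (u x)\<^sup>2)"
proof -
  note fs = fullT[OF K]
  let ?I = "4 ^ Suc DIM('a) * int_on K (\<lambda>x. (u x)\<^sup>2)"
  have I0: "?I \<ge> 0" by (intro mult_nonneg_nonneg int_on_nonneg) auto
  have v: "vol K > 0" using vol_pos[OF K] .
  have up: "\<bar>u p\<bar> \<le> sqrt (?I / vol K)" if "p \<in> corners K" for p
  proof -
    have "(u p)\<^sup>2 \<le> ?I / vol K" using inverse_estimate_corners[OF fs u that] v by (simp add: pos_le_divide_eq mult.commute)
    then show ?thesis using real_sqrt_le_mono by fastforce
  qed
  have "norm (gr u K) \<le> (\<Sum>p\<in>corners K. norm (u p *\<^sub>R bg K p))" unfolding gr_def by (rule norm_sum)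
  also have "\<dots> \<le> (\<Sum>p\<in>corners K. sqrt (?I / vol K) * (\<kappa> / h0 * 2 ^ k))"
  proof (rule sum_mono)
    fix p assume p: "p \<in> corners K"
    have "\<bar>u p\<bar> * norm (bg K p) \<le> sqrt (?I / vol K) * (\<kappa> / h0 * 2 ^ k)"
      using up[OF p] norm_bg_le[OF K p] I0 v by (intro mult_mono) auto
    then show "norm (u p *\<^sub>R bg K p) \<le> sqrt (?I / vol K) * (\<kappa> / h0 * 2 ^ k)" by simp
  qed
  also have "\<dots> = real (Suc DIM('a)) * (\<kappa> / h0) * 2 ^ k * sqrt (?I / vol K)" by (simp add: card_corners[OF fs] mult_ac)
  finally have "(norm (gr u K))\<^sup>2 \<le> (real (Suc DIM('a)) * (\<kappa> / h0) * 2 ^ k * sqrt (?I / vol K))\<^sup>2"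
    by (intro power_mono) auto
  also have "\<dots> = (real (Suc DIM('a)) * (\<kappa> / h0))\<^sup>2 * (2 ^ k)\<^sup>2 * (?I / vol K)"
    unfolding power_mult_distrib using I0 v by simp
  also have "(2 ^ k)\<^sup>2 = (4 ^ k :: real)" by (rule two_power_sq)
  finally have "vol K * (norm (gr u K))\<^sup>2 \<le> vol K * ((real (Suc DIM('a)) * (\<kappa> / h0))\<^sup>2 * 4 ^ k * (?I / vol K))"
    using v by (intro mult_left_mono) auto
  also have "\<dots> = (real (Suc DIM('a)) * (\<kappa> / h0))\<^sup>2 * 4 ^ k * ?I" using v by (simp add: field_simps)
  also have "\<dots> = Cinv * 4 ^ k * int_on K (\<lambda>x. (u x)\<^sup>2)" unfolding Cinv_def by (simp only: mult_ac)
  finally show ?thesis .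
qed

end

section \<open>Integration by parts on a simplex\<close>

lemma DERIV_line_cong:
  fixes f g :: "'a::real_normed_vector => real"
  assumes "open S" "x \<in> S" "\<And>y. y \<in> S ==> f y = g y"
    and "((\<lambda>t. g (x + t *\<^sub>R v)) has_real_derivative D) (at 0)"
  shows "((\<lambda>t. f (x + t *\<^sub>R v)) has_real_derivative D) (at 0)"
proof -
  have "isCont (\<lambda>t. x + t *\<^sub>R v) 0" by (intro continuous_intros)
  then have "((\<lambda>t. x + t *\<^sub>R v) \<longlongrightarrow> x) (nhds 0)"
    using tendsto_at_iff_tendsto_nhds[of "\<lambda>t. x + t *\<^sub>R v" 0] unfolding isCont_def by simp
  from topological_tendstoD[OF this assms(1,2)]
  have "\<forall>\<^sub>F t in nhds 0. f (x + t *\<^sub>R v) = g (x + t *\<^sub>R v)" by (rule eventually_mono) (rule assms(3))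
  then show ?thesis using assms(4)
      DERIV_cong_ev[of 0 0 "\<lambda>t. f (x + t *\<^sub>R v)" "\<lambda>t. g (x + t *\<^sub>R v)" D D] by simp
qed

lemma AE_notin_frontier: "full_simplex K ==> AE x in lebesgue. x \<notin> frontier K"
  by (intro AE_not_in) (simp add: negligible_convex_frontier convex_fs flip: negligible_iff_null_sets)

lemma lipschitz_on_mult_bounded:
  fixes f g :: "'a::metric_space => real"
  assumes f: "A-lipschitz_on X f" "\<And>x. x \<in> X ==> \<bar>f x\<bar> \<le> a" and g: "B-lipschitz_on X g" "\<And>x. x \<in> X ==> \<bar>g x\<bar> \<le> b"
    and ab: "a \<ge> 0" "b \<ge> 0"
  shows "(A * b + a * B)-lipschitz_on X (\<lambda>x. f x * g x)"
proof (rule lipschitz_onI)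
  have AB: "A \<ge> 0" "B \<ge> 0" using f g lipschitz_on_nonneg by blast+
  then show "0 \<le> A * b + a * B" using ab by simp
  fix x y assume xy: "x \<in> X" "y \<in> X"
  have "f x * g x - f y * g y = (f x - f y) * g x + f y * (g x - g y)" by (simp add: algebra_simps)
  then have "\<bar>f x * g x - f y * g y\<bar> \<le> \<bar>f x - f y\<bar> * \<bar>g x\<bar> + \<bar>f y\<bar> * \<bar>g x - g y\<bar>"
    using abs_triangle_ineq[of "(f x - f y) * g x" "f y * (g x - g y)"] by (simp add: abs_mult)
  also have "\<dots> \<le> (A * dist x y) * b + a * (B * dist x y)"
    using lipschitz_onD[OF f(1) xy] lipschitz_onD[OF g(1) xy] f(2)[OF xy(2)] g(2)[OF xy(1)] ab AB
    by (intro add_mono mult_mono) (auto simp: dist_real_def)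
  finally show "dist (f x * g x) (f y * g y) \<le> (A * b + a * B) * dist x y" by (simp add: dist_real_def algebra_simps)
qed

text \<open>A line in the direction of an edge leaves the simplex through one of the two facets not
  containing that edge, so the extension of \<open>f\<close> by zero is Lipschitz continuous along it.\<close>

lemma simplex_directional_integral_zero:
  fixes K :: "'a::euclidean_space set"
  assumes fs: "full_simplex K" and pr: "p \<in> corners K" "r \<in> corners K" "p \<noteq> r"
    and L: "L-lipschitz_on K f"
    and z: "\<And>x. x \<in> K ==> lam K p x = 0 \<or> lam K r x = 0 ==> f x = 0"
    and D: "AE x in lebesgue. x \<in> interior K \<longrightarrow> ((\<lambda>t. f (x + t *\<^sub>R (r - p))) has_real_derivative D x) (at 0)"
  shows "int_on K D = 0"
proof -
  let ?v = "r - p" and ?g = "\<lambda>x. indicator K x * f x"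
  have L0: "L \<ge> 0" using L by (rule lipschitz_on_nonneg)
  have lam_v: "lam K s (x + t *\<^sub>R ?v) = lam K s x + t * ((if s = r then 1 else 0) - (if s = p then 1 else 0))"
    if "s \<in> corners K" for s x t
  proof -
    have "bg K s \<bullet> ?v = (if s = r then 1 else 0) - (if s = p then 1 else 0)"
      unfolding lam_diff[of K s r p, symmetric] lam_corner[OF fs that pr(1)] lam_corner[OF fs that pr(2)]
      by (simp add: eq_commute)
    then show ?thesis using lam_diff[of K s "x + t *\<^sub>R ?v" x] by simp
  qed
  have out: "\<bar>f x\<bar> \<le> L * norm ?v * \<bar>t\<bar>" if x: "x \<in> K" and y: "x + t *\<^sub>R ?v \<notin> K" for x t
  proof -
    have pos: "lam K s x \<ge> 0" if "s \<in> corners K" for s using x that mem_simplex_iff[OF fs] by blast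
    obtain s where s: "s \<in> corners K" "lam K s (x + t *\<^sub>R ?v) < 0" using y mem_simplex_iff[OF fs] by (meson not_le)
    have sx: "s = p \<and> lam K p x < t \<or> s = r \<and> lam K r x < - t"
      using s(2) pos[OF s(1)] lam_v[OF s(1), of x t] pr(3) by (auto split: if_splits)
    \<comment> \<open>The parameter at which the line meets the facet where the coordinate of
      \<open>p\<close> or of \<open>r\<close> vanishes. There \<open>f\<close> is zero, and this
      point is no farther from \<open>x\<close> than the end point outside.\<close>
    define t' where "t' = (if s = p then lam K p x else - lam K r x)"
    have t': "\<bar>t'\<bar> \<le> \<bar>t\<bar>" using sx pos pr unfolding t'_def by auto
    let ?z = "x + t' *\<^sub>R ?v"
    have "lam K q ?z \<ge> 0" if q: "q \<in> corners K" for q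
      using lam_v[OF q, of x t'] pos[OF q] pos[OF pr(1)] pos[OF pr(2)] sx pr(3) unfolding t'_def by (auto split: if_splits)
    then have zt: "?z \<in> K" using mem_simplex_iff[OF fs] by blast
    have "lam K p ?z = 0 \<or> lam K r ?z = 0"
      using lam_v[OF pr(1), of x t'] lam_v[OF pr(2), of x t'] sx pr(3) unfolding t'_def by (auto split: if_splits)
    then have "f ?z = 0" using z[OF zt] by blast
    then have "\<bar>f x\<bar> \<le> L * norm (t' *\<^sub>R ?v)" using lipschitz_onD[OF L x zt] by (simp add: dist_norm)
    also have "\<dots> \<le> L * norm ?v * \<bar>t\<bar>" using t' L0
      by (simp add: mult.assoc mult.commute[of "norm _"] mult_left_mono mult_right_mono)
    finally show ?thesis .
  qed
  have lip: "\<bar>?g (x + t *\<^sub>R ?v) - ?g x\<bar> \<le> L * norm ?v * \<bar>t\<bar>" for x t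
  proof -
    let ?y = "x + t *\<^sub>R ?v"
    have b: "0 \<le> L * norm ?v * \<bar>t\<bar>" using L0 by simp
    consider "x \<in> K" "?y \<in> K" | "x \<in> K" "?y \<notin> K" | "x \<notin> K" "?y \<in> K" | "x \<notin> K" "?y \<notin> K" by blast
    then show ?thesis
    proof cases
      case 1 then show ?thesis using lipschitz_onD[OF L, of ?y x] by (simp add: dist_norm mult_ac)
    next
      case 2 then show ?thesis using out by simp
    next
      case 3
      have "?y + (- t) *\<^sub>R ?v = x" by simp
      then show ?thesis using 3 out[of ?y "- t"] by simp
    next
      case 4 then show ?thesis using b by simp
    qed
  qed
  have fc: "continuous_on K f" using lipschitz_on_continuous_on[OF L] .
  have gb: "?g \<in> borel_measurable borel"
    using borel_measurable_continuous_on_indicator[OF _ fc] closed_fs[OF fs] by simp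
  have gi: "integrable lebesgue ?g" using intg_on_continuous[OF compact_fs[OF fs] fc] by (simp add: intg_on_def)
  obtain R where R: "\<forall>x\<in>K. norm x \<le> R" using bounded_fs[OF fs] unfolding bounded_iff by blast
  have "AE x in lebesgue. ((\<lambda>t. ?g (x + t *\<^sub>R ?v)) has_real_derivative indicator K x * D x) (at 0)"
    using D AE_notin_frontier[OF fs]
  proof eventually_elim
    case (elim x)
    show ?case
    proof (cases "x \<in> K")
      case True
      then have xi: "x \<in> interior K" using elim(2) closure_subset by (auto simp: frontier_def)
      then have d: "((\<lambda>t. f (x + t *\<^sub>R ?v)) has_real_derivative indicator K x * D x) (at 0)" using elim(1) True by simp
      show ?thesis by (rule DERIV_line_cong[OF open_interior xi _ d, where f="?g"]) (auto dest: subsetD[OF interior_subset])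
    next
      case False
      then have d: "((\<lambda>t. 0) has_real_derivative indicator K x * D x) (at 0)" by simp
      show ?thesis
        by (rule DERIV_line_cong[of "- K", OF _ _ _ d, where f="?g"]) (use False closed_fs[OF fs] in auto)
    qed
  qed
  from directional_derivative_integral_zero[OF gb gi lip _ this, of R]
  show ?thesis unfolding int_on_def using R by (auto simp: indicator_def)
qed

section \<open>Bernstein monomials and radial derivatives\<close>

definition bmono :: "'a::euclidean_space set => 'a multiset => 'a => real" where
  "bmono K ms x = (\<Prod>p\<in>#ms. lam K p x)"

text \<open>The product rule, one term per occurrence; multisets of corners serve as
  multi-indices.\<close>

definition dbmono :: "'a::euclidean_space set => 'a multiset => 'a => 'a => real" where
  "dbmono K ms x v = (\<Sum>s\<in>#ms. (bg K s \<bullet> v) * bmono K (ms - {#s#}) x)"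

lemma bmono_empty: "bmono K {#} x = 1" and bmono_add: "bmono K (add_mset p ms) x = lam K p x * bmono K ms x"
  by (simp_all add: bmono_def)

lemma dbmono_add: "dbmono K (add_mset p ms) x v = (bg K p \<bullet> v) * bmono K ms x + lam K p x * dbmono K ms x v"
proof -
  have "(\<Sum>s\<in>#ms. (bg K s \<bullet> v) * bmono K (add_mset p ms - {#s#}) x)
    = (\<Sum>s\<in>#ms. lam K p x * ((bg K s \<bullet> v) * bmono K (ms - {#s#}) x))"
  proof (intro arg_cong[where f=sum_mset] image_mset_cong)
    fix s assume "s \<in># ms"
    then have "add_mset p ms - {#s#} = add_mset p (ms - {#s#})" by simp
    then show "(bg K s \<bullet> v) * bmono K (add_mset p ms - {#s#}) x = lam K p x * ((bg K s \<bullet> v) * bmono K (ms - {#s#}) x)"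
      by (simp add: bmono_add)
  qed
  then show ?thesis by (simp add: dbmono_def sum_mset_distrib_left)
qed

lemma bmono_has_derivative: "(bmono K ms has_derivative dbmono K ms x) (at x)"
proof (induction ms)
  case empty
  have "bmono K {#} = (\<lambda>x. 1)" "dbmono K {#} x = (\<lambda>v. 0)" by (auto simp: bmono_def dbmono_def)
  then show ?case by simp
next
  case (add p ms)
  have "(lam K p has_derivative (\<lambda>v. bg K p \<bullet> v)) (at x)"
    unfolding lam_def[abs_def] by (auto intro!: derivative_eq_intros)
  from has_derivative_mult[OF this add]
  have "((\<lambda>y. lam K p y * bmono K ms y) has_derivative (\<lambda>v. lam K p x * dbmono K ms x v + (bg K p \<bullet> v) * bmono K ms x)) (at x)" .
  moreover have "bmono K (add_mset p ms) = (\<lambda>y. lam K p y * bmono K ms y)"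
    "dbmono K (add_mset p ms) x = (\<lambda>v. lam K p x * dbmono K ms x v + (bg K p \<bullet> v) * bmono K ms x)"
    by (auto simp: bmono_add dbmono_add)
  ultimately show ?case by simp
qed

lemma bmono_continuous: "continuous_on S (bmono K ms)"
  by (induction ms) (auto simp: bmono_add bmono_empty[abs_def] bmono_add[abs_def] intro!: continuous_intros continuous_on_lam
      simp flip: eta_contract_eq)

lemma bmono_bounds:
  assumes "full_simplex K" "set_mset ms \<subseteq> corners K" "x \<in> K"
  shows "0 \<le> bmono K ms x" "bmono K ms x \<le> 1"
proof -
  have "0 \<le> bmono K ms x \<and> bmono K ms x \<le> 1"
    using assms(2)
  proof (induction ms)
    case empty then show ?case by (simp add: bmono_empty)
  next
    case (add p ms)
    have "0 \<le> lam K p x" "lam K p x \<le> 1"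
      using mem_simplex_iff[OF assms(1)] lam_le_1[OF assms(1,3)] assms(3) add.prems by auto
    then show ?case using add by (simp add: bmono_add mult_le_one)
  qed
  then show "0 \<le> bmono K ms x" "bmono K ms x \<le> 1" by auto
qed

lemma bmono_lipschitz:
  assumes fs: "full_simplex K" and ms: "set_mset ms \<subseteq> corners K" and xy: "x \<in> K" "y \<in> K"
    and G: "\<And>p. p \<in> corners K ==> norm (bg K p) \<le> G"
  shows "\<bar>bmono K ms x - bmono K ms y\<bar> \<le> real (size ms) * G * norm (x - y)"
  using ms
proof (induction ms)
  case empty then show ?case by (simp add: bmono_empty)
next
  case (add p ms)
  have p: "p \<in> corners K" using add.prems by simp
  have l: "\<bar>lam K p x - lam K p y\<bar> \<le> G * norm (x - y)"
    unfolding lam_diff using Cauchy_Schwarz_ineq2[of "bg K p" "x - y"] mult_right_mono[OF G[OF p], of "norm (x - y)"] by simp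
  have "bmono K (add_mset p ms) x - bmono K (add_mset p ms) y
    = (lam K p x - lam K p y) * bmono K ms x + lam K p y * (bmono K ms x - bmono K ms y)"
    by (simp add: bmono_add algebra_simps)
  moreover have "\<bar>(lam K p x - lam K p y) * bmono K ms x\<bar> \<le> G * norm (x - y) * 1"
    unfolding abs_mult using l bmono_bounds[OF fs _ xy(1), of ms] add.prems by (intro mult_mono) auto
  moreover have "\<bar>lam K p y * (bmono K ms x - bmono K ms y)\<bar> \<le> 1 * (real (size ms) * G * norm (x - y))"
    unfolding abs_mult using add lam_le_1[OF fs xy(2) p] mem_simplex_iff[OF fs, of y] xy(2) p by (intro mult_mono) auto
  ultimately show ?case by (simp add: algebra_simps)
qed

lemma dbmono_continuous: "continuous_on S (\<lambda>x. dbmono K ms x v)"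
  by (induction ms) (auto simp: dbmono_add dbmono_def[of _ "{#}"] intro!: continuous_intros continuous_on_lam bmono_continuous)

text \<open>If \<open>c\<close> is the value and \<open>D\<close> the derivative at \<open>x\<close>
  of a function \<open>f\<close>, the left side sums the derivatives of \<open>lam K r * f\<close>
  along \<open>r - p\<close>. The result is the divergence of \<open>f\<close> times the radial
  field \<open>x - p\<close>.\<close>

lemma radial_sum:
  fixes D :: "'a::euclidean_space => real"
  assumes fs: "full_simplex K" and p: "p \<in> corners K" and lin: "linear D"
  shows "(\<Sum>r\<in>corners K - {p}. (bg K r \<bullet> (r - p)) * c + lam K r x * D (r - p)) = D (x - p) + real DIM('a) * c"
proof -
  let ?K = "corners K - {p}"
  have one: "bg K r \<bullet> (r - p) = 1" if "r \<in> ?K" for r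
    unfolding lam_diff[symmetric] using lam_corner[OF fs, of r r] lam_corner[OF fs, of r p] that p by auto
  have "(\<Sum>r\<in>?K. lam K r x *\<^sub>R (r - p)) = (\<Sum>r\<in>corners K. lam K r x *\<^sub>R (r - p))"
    using finite_corners[OF fs] by (intro sum.mono_neutral_left) auto
  also have "\<dots> = x - p"
    using lam_sum_x[OF fs, of x] lam_sum_1[OF fs, of x]
    by (simp add: scaleR_diff_right sum_subtractf scaleR_sum_left[symmetric])
  finally have xp: "(\<Sum>r\<in>?K. lam K r x *\<^sub>R (r - p)) = x - p" .
  have "(\<Sum>r\<in>?K. lam K r x * D (r - p)) = D (x - p)"
    unfolding xp[symmetric] by (simp only: linear_sum[OF lin] linear_cmul[OF lin] real_scaleR_def)
  moreover have "card ?K = DIM('a)" using card_corners[OF fs] p finite_corners[OF fs] by simp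
  ultimately show ?thesis using one by (simp add: sum.distrib)
qed

text \<open>Euler's relation for homogeneous polynomials, taken from the corner \<open>p\<close>: in
  direction \<open>x - p\<close> each coordinate changes by its own value, less one for the
  coordinate of \<open>p\<close>.\<close>

lemma dbmono_radial:
  fixes K :: "'a::euclidean_space set"
  assumes fs: "full_simplex K" and p: "p \<in> corners K" and ms: "set_mset ms \<subseteq> corners K"
  shows "(\<Sum>r\<in>corners K - {p}. dbmono K (add_mset r ms) x (r - p))
    = real (DIM('a) + size ms) * bmono K ms x - real (count ms p) * bmono K (ms - {#p#}) x"
proof -
  have lin: "linear (dbmono K ms x)"
    using bmono_has_derivative has_derivative_bounded_linear bounded_linear.linear by blast
  have "(\<Sum>r\<in>corners K - {p}. dbmono K (add_mset r ms) x (r - p)) = dbmono K ms x (x - p) + real DIM('a) * bmono K ms x"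
    using radial_sum[OF fs p lin, where x=x and c="bmono K ms x"] by (simp add: dbmono_add add.commute)
  also have "dbmono K ms x (x - p) = (\<Sum>s\<in>#ms. bmono K ms x + (if s = p then - bmono K (ms - {#p#}) x else 0))"
    unfolding dbmono_def
  proof (intro arg_cong[where f=sum_mset] image_mset_cong)
    fix s assume s: "s \<in># ms"
    have "bg K s \<bullet> (x - p) = lam K s x - (if s = p then 1 else 0)"
      using lam_diff[of K s x p] lam_corner[OF fs _ p, of s] s ms by (auto split: if_splits)
    moreover have "lam K s x * bmono K (ms - {#s#}) x = bmono K ms x"
      using bmono_add[of K s "ms - {#s#}" x] s by simp
    ultimately show "(bg K s \<bullet> (x - p)) * bmono K (ms - {#s#}) x = bmono K ms x + (if s = p then - bmono K (ms - {#p#}) x else 0)"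
      by (simp add: left_diff_distrib)
  qed
  also have "\<dots> = real (size ms) * bmono K ms x - real (count ms p) * bmono K (ms - {#p#}) x"
    by (simp add: sum_mset.distrib sum_mset_delta mult.commute)
  finally show ?thesis by (simp add: algebra_simps)
qed

section \<open>Directional fluxes of piecewise affine functions\<close>

context graded_meshes begin

definition piecewise :: "nat => 'a set => ('a => real) => bool" where
  "piecewise J K w \<longleftrightarrow> (\<exists>L. L-lipschitz_on K w) \<and> (\<forall>H\<in>desc K J. affine_on H w)"

lemma AE_interior_desc:
  assumes "K \<in> T j" "j \<le> J"
  shows "AE x in lebesgue. x \<in> interior K \<longrightarrow> (\<exists>H\<in>desc K J. x \<in> interior H)"
proof -
  have "AE x in lebesgue. \<forall>H\<in>desc K J. x \<notin> frontier H"
    using finite_desc AE_notin_frontier[OF fullT[OF descD(1)]] by (simp add: AE_finite_all)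
  then show ?thesis
  proof eventually_elim
    case (elim x)
    show ?case
    proof
      assume "x \<in> interior K"
      then obtain H where "H \<in> desc K J" "x \<in> H" using Union_desc[OF assms] interior_subset by blast
      then show "\<exists>H\<in>desc K J. x \<in> interior H" using elim closure_subset by (auto simp: frontier_def)
    qed
  qed
qed

lemma affine_directional:
  assumes "full_simplex H" "affine_on H w" "x \<in> interior H"
  shows "(w has_derivative (\<lambda>v. gr w H \<bullet> v)) (at x)"
proof -
  have "((\<lambda>y. w x + gr w H \<bullet> (y - x)) has_derivative (\<lambda>v. gr w H \<bullet> v)) (at x)" by (auto intro!: derivative_eq_intros)
  then show ?thesis
  proof (rule has_derivative_transform_within_open[OF _ open_interior assms(3)])
    fix y assume "y \<in> interior H"
    then show "w x + gr w H \<bullet> (y - x) = w y"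
      using affine_on_gr[OF assms(1,2), of y x] assms(3) interior_subset by fastforce
  qed
qed

lemma int_on_interior:
  assumes fs: "full_simplex H" and sub: "H \<subseteq> K" and f: "continuous_on H f"
  shows "int_on K (\<lambda>x. indicator (interior H) x * f x) = int_on H f"
proof -
  have m: "(\<lambda>x. indicator H x * f x) \<in> borel_measurable lebesgue"
    using intg_on_continuous[OF compact_fs[OF fs] f] unfolding intg_on_def by (rule borel_measurable_integrable)
  have e: "indicator K x * (indicator (interior H) x * f x) = indicator (interior H) x * (indicator H x * f x)" for x
    using sub interior_subset[of H] by (auto simp: indicator_def)
  from AE_notin_frontier[OF fs] have ae: "AE x in lebesgue. indicator (interior H) x * (indicator H x * f x) = indicator H x * f x"
    by eventually_elim (auto simp: frontier_def indicator_def closure_closed[OF closed_fs[OF fs]])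
  show ?thesis unfolding int_on_def e
    by (intro integral_cong_AE ae borel_measurable_times m borel_measurable_indicator) (simp add: borel_open)
qed

text \<open>\<open>gflux\<close> is the integral over \<open>K\<close> of the derivative of \<open>w * \<psi>\<close> in the direction \<open>v\<close>, where \<open>d\<close> is the
  derivative of \<open>\<psi>\<close>.\<close>

definition weight :: "('a => real) => ('a => 'a => real) => bool" where
  "weight \<psi> d \<longleftrightarrow> (\<forall>x. (\<psi> has_derivative d x) (at x)) \<and> (\<forall>v. continuous_on UNIV (\<lambda>x. d x v))"

definition gflux :: "nat => 'a set => ('a => real) => ('a => real) => ('a => 'a => real) => 'a => real" where
  "gflux J K w \<psi> d v = (\<Sum>H\<in>desc K J. (gr w H \<bullet> v) * int_on H \<psi>) + int_on K (\<lambda>x. w x * d x v)"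

abbreviation flux :: "nat => 'a set => ('a => real) => 'a multiset => 'a => real" where
  "flux J K w ms \<equiv> gflux J K w (bmono K ms) (dbmono K ms)"

text \<open>The density of \<open>gflux\<close>; with the cell interiors as indicators it is the
  pointwise derivative almost everywhere.\<close>

definition fluxd :: "nat => 'a set => ('a => real) => ('a => real) => ('a => 'a => real) => 'a => 'a => real" where
  "fluxd J K w \<psi> d v x = (\<Sum>H\<in>desc K J. (gr w H \<bullet> v) * (indicator (interior H) x * \<psi> x)) + w x * d x v"

lemma weight_continuous: "weight \<psi> d ==> continuous_on X \<psi>" "weight \<psi> d ==> continuous_on X (\<lambda>x. d x v)"
  unfolding weight_def
  by (blast intro: has_derivative_continuous continuous_at_imp_continuous_on) (blast intro: continuous_on_subset)

lemma weight_bmono: "weight (bmono K ms) (dbmono K ms)"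
  unfolding weight_def using bmono_has_derivative dbmono_continuous by blast

lemma continuous_bounded_fs:
  assumes "full_simplex K" "continuous_on K f" obtains A where "A \<ge> 0" "\<And>x. x \<in> K ==> \<bar>f x\<bar> \<le> (A::real)"
proof -
  obtain A where "\<And>x. x \<in> K ==> \<bar>f x\<bar> \<le> A"
    using compact_imp_bounded[OF compact_continuous_image[OF assms(2) compact_fs[OF assms(1)]]] unfolding bounded_iff by fastforce
  then show ?thesis using that[of "max 0 A"] by fastforce
qed

lemma weight_lipschitz:
  assumes fs: "full_simplex K" and wt: "weight \<psi> d" shows "\<exists>L. L-lipschitz_on K \<psi>"
proof -
  have "continuous_on K (\<lambda>x. \<Sum>b\<in>Basis. \<bar>d x b\<bar>)" by (intro continuous_intros weight_continuous[OF wt])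
  from continuous_bounded_fs[OF fs this]
  obtain B where B: "B \<ge> 0" "\<And>x. x \<in> K ==> \<bar>\<Sum>b\<in>Basis. \<bar>d x b\<bar>\<bar> \<le> B" by metis
  have der: "(\<psi> has_derivative d x) (at x)" for x using wt unfolding weight_def by blast
  have "onorm (d x) \<le> B" if x: "x \<in> K" for x
  proof (rule onorm_le)
    fix v
    have lin: "linear (d x)" using der has_derivative_bounded_linear bounded_linear.linear by blast
    have "d x v = d x (\<Sum>b\<in>Basis. (v \<bullet> b) *\<^sub>R b)" by (simp only: euclidean_representation)
    also have "\<dots> = (\<Sum>b\<in>Basis. (v \<bullet> b) * d x b)" by (simp add: linear_sum[OF lin] linear_cmul[OF lin])
    also have "\<bar>\<dots>\<bar> \<le> (\<Sum>b\<in>Basis. norm v * \<bar>d x b\<bar>)"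
      by (intro order_trans[OF sum_abs] sum_mono) (simp add: abs_mult Basis_le_norm mult_right_mono)
    also have "\<dots> \<le> B * norm v" using mult_left_mono[OF abs_le_D1[OF B(2)[OF x]], of "norm v"] by (simp add: sum_distrib_left mult.commute)
    finally show "norm (d x v) \<le> B * norm v" by simp
  qed
  then have "dist (\<psi> x) (\<psi> y) \<le> B * dist x y" if "x \<in> K" "y \<in> K" for x y
    unfolding dist_norm using that has_derivative_at_withinI[OF der]
    by (intro differentiable_bound[OF convex_fs[OF fs]]) auto
  then show ?thesis using B(1) by (intro exI[of _ B] lipschitz_onI)
qed

lemma int_on_fluxd:
  assumes K: "K \<in> T j" "j \<le> J" and w: "continuous_on K w" and wt: "weight \<psi> d"
  shows "intg_on K (fluxd J K w \<psi> d v)" "int_on K (fluxd J K w \<psi> d v) = gflux J K w \<psi> d v"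
proof -
  note fs = fullT[OF K(1)] and wc = weight_continuous[OF wt]
  let ?g = "\<lambda>x. \<Sum>H\<in>desc K J. (gr w H \<bullet> v) * (indicator (interior H) x * \<psi> x)"
  have gi: "intg_on K (\<lambda>x. indicator (interior H) x * \<psi> x)" for H
  proof -
    have "integrable lebesgue (\<lambda>x. indicator (interior H) x * (indicator K x * \<psi> x))"
      using integrable_mult_indicator[OF _ intg_on_continuous[OF compact_fs[OF fs] wc(1), unfolded intg_on_def],
          of "interior H"] by (simp add: borel_open)
    then show ?thesis unfolding intg_on_def by (simp add: mult_ac)
  qed
  have wi: "intg_on K (\<lambda>x. w x * d x v)" by (intro intg_on_continuous compact_fs fs continuous_intros w wc(2))
  have gg: "intg_on K ?g" by (intro intg_on_sum intg_on_cmult gi)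
  have "int_on K ?g = (\<Sum>H\<in>desc K J. (gr w H \<bullet> v) * int_on H \<psi>)"
    using int_on_interior[OF fullT[OF descD(1)] descD(2) wc(1)]
    by (subst int_on_sum[OF intg_on_cmult[OF gi]]) (simp add: int_on_cmult)
  then show "intg_on K (fluxd J K w \<psi> d v)" "int_on K (fluxd J K w \<psi> d v) = gflux J K w \<psi> d v"
    unfolding fluxd_def[abs_def] gflux_def using intg_on_add[OF gg wi] int_on_add[OF gg wi] by simp_all
qed

lemma fluxd_derivative:
  assumes K: "K \<in> T j" "j \<le> J" and w: "\<And>H. H \<in> desc K J ==> affine_on H w" and wt: "weight \<psi> d"
  shows "AE x in lebesgue. x \<in> interior K \<longrightarrow>
    ((\<lambda>t. w (x + t *\<^sub>R v) * \<psi> (x + t *\<^sub>R v)) has_real_derivative fluxd J K w \<psi> d v x) (at 0)"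
  using AE_interior_desc[OF K]
proof eventually_elim
  case (elim x)
  show ?case
  proof
    assume "x \<in> interior K"
    then obtain H where H: "H \<in> desc K J" "x \<in> interior H" using elim by blast
    have disj: "x \<notin> interior H'" if "H' \<in> desc K J" "H' \<noteq> H" for H'
      using same_cell[OF descD(1)[OF H(1)] descD(1)[OF that(1)], of x] that H(2) interior_subset by blast
    have fx: "fluxd J K w \<psi> d v x = w x * d x v + (gr w H \<bullet> v) * \<psi> x"
    proof -
      have "(\<Sum>H'\<in>desc K J. (gr w H' \<bullet> v) * (indicator (interior H') x * \<psi> x))
        = (\<Sum>H'\<in>desc K J. if H' = H then (gr w H \<bullet> v) * \<psi> x else 0)"
        using disj H by (intro sum.cong) (auto simp: indicator_def)
      then show ?thesis using H finite_desc by (simp add: fluxd_def)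
    qed
    have "(w has_derivative (\<lambda>v. gr w H \<bullet> v)) (at x)"
      using affine_directional[OF fullT[OF descD(1)[OF H(1)]] w[OF H(1)] H(2)] .
    moreover have d: "(\<psi> has_derivative d x) (at x)" using wt unfolding weight_def by blast
    ultimately have h: "((\<lambda>y. w y * \<psi> y) has_derivative (\<lambda>v. w x * d x v + (gr w H \<bullet> v) * \<psi> x)) (at (x + 0 *\<^sub>R v))"
      using has_derivative_mult by simp
    have l: "((\<lambda>t. x + t *\<^sub>R v) has_derivative (\<lambda>t. t *\<^sub>R v)) (at 0)" by (auto intro!: derivative_eq_intros)
    have "linear (d x)" using d has_derivative_bounded_linear bounded_linear.linear by blast
    then have "w x * d x (t *\<^sub>R v) + (gr w H \<bullet> (t *\<^sub>R v)) * \<psi> x = t * fluxd J K w \<psi> d v x" for t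
      unfolding fx by (simp add: linear_cmul algebra_simps)
    with has_derivative_compose[OF l h]
    show "((\<lambda>t. w (x + t *\<^sub>R v) * \<psi> (x + t *\<^sub>R v)) has_real_derivative fluxd J K w \<psi> d v x) (at 0)"
      by (simp add: has_field_derivative_def mult_commute_abs)
  qed
qed

lemma gflux_edge:
  assumes K: "K \<in> T j" "j \<le> J" and w: "piecewise J K w" and pr: "p \<in> corners K" "r \<in> corners K" "p \<noteq> r"
    and wt: "weight \<psi> d" and z: "\<And>x. x \<in> K ==> lam K p x = 0 \<or> lam K r x = 0 ==> w x * \<psi> x = 0"
  shows "gflux J K w \<psi> d (r - p) = 0"
proof -
  note fs = fullT[OF K(1)]
  obtain L M where L: "L-lipschitz_on K w" "M-lipschitz_on K \<psi>" using w weight_lipschitz[OF fs wt] unfolding piecewise_def by blast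
  have wc: "continuous_on K w" using lipschitz_on_continuous_on[OF L(1)] .
  obtain A where A: "A \<ge> 0" "\<And>x. x \<in> K ==> \<bar>w x\<bar> \<le> A" using continuous_bounded_fs[OF fs wc] by metis
  obtain B where B: "B \<ge> 0" "\<And>x. x \<in> K ==> \<bar>\<psi> x\<bar> \<le> B" using continuous_bounded_fs[OF fs weight_continuous(1)[OF wt]] by metis
  note Lk = lipschitz_on_mult_bounded[OF L(1) A(2) L(2) B(2) A(1) B(1)]
  have aff: "affine_on H w" if "H \<in> desc K J" for H using w that unfolding piecewise_def by blast
  show ?thesis
    using simplex_directional_integral_zero[OF fs pr Lk z fluxd_derivative[OF K aff wt]] int_on_fluxd(2)[OF K wc wt] by simp
qed

lemma flux_corners:
  assumes "K \<in> T j" "j \<le> J" "piecewise J K w" "p \<in># ms" "r \<in># ms" "p \<noteq> r" "set_mset ms \<subseteq> corners K"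
  shows "flux J K w ms (r - p) = 0"
proof (rule gflux_edge[OF assms(1-3) _ _ assms(6) weight_bmono])
  fix x assume "x \<in> K" "lam K p x = 0 \<or> lam K r x = 0"
  then show "w x * bmono K ms x = 0"
    using bmono_add[of K p "ms - {#p#}" x] bmono_add[of K r "ms - {#r#}" x] assms by auto
qed (use assms in auto)

end

section \<open>Oscillation of the gradient\<close>

context graded_meshes begin

text \<open>The factor \<open>(1/2) ^ m\<close> is, up to \<open>h1\<close>, the size of the cells
  of level \<open>m\<close> whose fluctuation is not zero.\<close>

definition osc :: "nat => ('a => real) => nat => 'a set => real" where
  "osc J u j K = (\<Sum>m\<in>{j..<J}. (1/2) ^ m * sqrt (\<Sum>K'\<in>desc K m. fluct J u m K'))"

lemma osc_nonneg: "0 \<le> osc J u j K"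
  unfolding osc_def by (intro sum_nonneg mult_nonneg_nonneg real_sqrt_ge_zero sum_nonneg fluct_nonneg) auto

lemma sqrt_sum_mult_le:
  fixes a b :: "'b => real"
  assumes "\<And>i. i \<in> I ==> a i \<ge> 0" "\<And>i. i \<in> I ==> b i \<ge> 0"
  shows "(\<Sum>i\<in>I. sqrt (a i) * sqrt (b i)) \<le> sqrt (\<Sum>i\<in>I. a i) * sqrt (\<Sum>i\<in>I. b i)"
proof -
  have "(\<Sum>i\<in>I. \<bar>sqrt (a i)\<bar> * \<bar>sqrt (b i)\<bar>) \<le> L2_set (\<lambda>i. sqrt (a i)) I * L2_set (\<lambda>i. sqrt (b i)) I"
    by (rule L2_set_mult_ineq)
  moreover have "(\<Sum>i\<in>I. (sqrt (a i))\<^sup>2) = sum a I" "(\<Sum>i\<in>I. (sqrt (b i))\<^sup>2) = sum b I"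
    using assms by (auto intro: sum.cong)
  moreover have "(\<Sum>i\<in>I. \<bar>sqrt (a i)\<bar> * \<bar>sqrt (b i)\<bar>) = (\<Sum>i\<in>I. sqrt (a i) * sqrt (b i))"
    using assms by (intro sum.cong) auto
  ultimately show ?thesis by (simp add: L2_set_def)
qed

text \<open>Martingale steps have mean zero, so \<psi> may be reduced by its value at one point of
  \<open>K\<close>. The step vanishes unless \<open>K\<close> is refined, and then
  \<open>size_le\<close> makes \<open>K\<close> small.\<close>

lemma cell_oscillation:
  assumes K: "K \<in> T m" "m < J" and c: "continuous_on K \<psi>" and W: "W \<ge> 0"
    and lip: "\<And>x y. x \<in> K ==> y \<in> K ==> \<bar>\<psi> x - \<psi> y\<bar> \<le> W * norm (x - y)"
  shows "\<bar>\<Sum>H\<in>desc K (Suc m). ((mgrad J u H - mgrad J u K) \<bullet> v) * int_on H \<psi>\<bar>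
    \<le> W * h1 * norm v * ((1/2) ^ m * (sqrt (vol K) * sqrt (fluct J u m K)))"
proof (cases "K \<in> T (Suc m)")
  case True
  have "desc K (Suc m) = {K}" using desc_unrefined[OF K(1) True] by simp
  then show ?thesis using W h1_pos fluct_nonneg by simp
next
  case False
  let ?d = "\<lambda>H. mgrad J u H - mgrad J u K"
  note fs = fullT[OF K(1)]
  obtain x0 where x0: "x0 \<in> K" using interior_fs_nonempty[OF fs] interior_subset by blast
  have "(\<Sum>H\<in>desc K (Suc m). vol H *\<^sub>R ?d H) = 0"
    using vol_mgrad_desc[OF K(1), of "Suc m" J u] K(2) vol_desc[OF K(1), of "Suc m"]
    by (simp add: scaleR_diff_right sum_subtractf scaleR_sum_left[symmetric])
  then have "(\<Sum>H\<in>desc K (Suc m). vol H *\<^sub>R ?d H) \<bullet> (\<psi> x0 *\<^sub>R v) = 0" by simp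
  then have "(\<Sum>H\<in>desc K (Suc m). (?d H \<bullet> v) * (\<psi> x0 * vol H)) = 0"
    unfolding inner_sum_left by (simp add: mult_ac)
  then have "(\<Sum>H\<in>desc K (Suc m). (?d H \<bullet> v) * int_on H \<psi>)
    = (\<Sum>H\<in>desc K (Suc m). (?d H \<bullet> v) * (int_on H \<psi> - \<psi> x0 * vol H))"
    by (simp add: right_diff_distrib sum_subtractf)
  also have "\<bar>\<dots>\<bar> \<le> (\<Sum>H\<in>desc K (Suc m). \<bar>(?d H \<bullet> v) * (int_on H \<psi> - \<psi> x0 * vol H)\<bar>)" by (rule sum_abs)
  also have "\<dots> \<le> (\<Sum>H\<in>desc K (Suc m). (W * (h1 / 2 ^ m) * norm v) * (sqrt (vol H) * sqrt (vol H * (norm (?d H))\<^sup>2)))"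
  proof (rule sum_mono)
    fix H assume H: "H \<in> desc K (Suc m)"
    note fs' = fullT[OF descD(1)[OF H]]
    have "int_on H \<psi> - \<psi> x0 * vol H = int_on H (\<lambda>x. \<psi> x - \<psi> x0)"
      using int_on_diff[OF intg_on_continuous[OF compact_fs[OF fs']] intg_on_const[OF lmeasurable_fs[OF fs']], of \<psi>]
        continuous_on_subset[OF c descD(2)[OF H]] int_on_const[OF lmeasurable_fs[OF fs']] by simp
    moreover have "\<bar>int_on H (\<lambda>x. \<psi> x - \<psi> x0)\<bar> \<le> (W * (h1 / 2 ^ m)) * vol H"
    proof (rule int_on_abs_le[OF lmeasurable_fs[OF fs']])
      show "0 \<le> W * (h1 / 2 ^ m)" using W h1_pos by simp
      fix x assume "x \<in> H"
      then have x: "x \<in> K" using descD(2)[OF H] by blast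
      have "norm (x - x0) \<le> h1 / 2 ^ m"
        using diameter_bounded_bound[OF bounded_fs[OF fs] x x0] size_le[OF K(1) False] by (simp add: dist_norm)
      then show "\<bar>\<psi> x - \<psi> x0\<bar> \<le> W * (h1 / 2 ^ m)" using lip[OF x x0] W mult_left_mono order_trans by blast
    qed
    ultimately have "\<bar>(?d H \<bullet> v) * (int_on H \<psi> - \<psi> x0 * vol H)\<bar> \<le> (norm (?d H) * norm v) * ((W * (h1 / 2 ^ m)) * vol H)"
      unfolding abs_mult using Cauchy_Schwarz_ineq2 by (intro mult_mono) auto
    also have "\<dots> = (W * (h1 / 2 ^ m) * norm v) * (sqrt (vol H) * sqrt (vol H * (norm (?d H))\<^sup>2))"
      by (simp add: real_sqrt_mult)
    finally show "\<bar>(?d H \<bullet> v) * (int_on H \<psi> - \<psi> x0 * vol H)\<bar>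
      \<le> (W * (h1 / 2 ^ m) * norm v) * (sqrt (vol H) * sqrt (vol H * (norm (?d H))\<^sup>2))" .
  qed
  also have "\<dots> \<le> (W * (h1 / 2 ^ m) * norm v) * (sqrt (\<Sum>H\<in>desc K (Suc m). vol H) * sqrt (fluct J u m K))"
    unfolding sum_distrib_left[symmetric] fluct_def
    using W h1_pos by (intro mult_left_mono sqrt_sum_mult_le) auto
  also have "(\<Sum>H\<in>desc K (Suc m). vol H) = vol K" using vol_desc[OF K(1), of "Suc m"] by simp
  finally show ?thesis by (simp add: power_divide mult_ac)
qed

text \<open>The gradient minus its mean telescopes into martingale steps; those of level
  \<open>m\<close> are tested on the cells of that level, where the weight varies by no more than
  its Lipschitz constant times the cell size.\<close>

lemma oscillation:
  assumes K: "K \<in> T j" "j \<le> J" and c: "continuous_on K \<psi>" and W: "W \<ge> 0"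
    and lip: "\<And>x y. x \<in> K ==> y \<in> K ==> \<bar>\<psi> x - \<psi> y\<bar> \<le> W * norm (x - y)"
  shows "\<bar>\<Sum>H\<in>desc K J. ((gr u H - mgrad J u K) \<bullet> v) * int_on H \<psi>\<bar> \<le> W * h1 * norm v * (sqrt (vol K) * osc J u j K)"
proof -
  define g where "g m = (\<Sum>H\<in>desc K m. (mgrad J u H \<bullet> v) * int_on H \<psi>)" for m
  have ic: "intg_on H \<psi>" if "H \<in> desc K m" for H m
    using continuous_on_subset[OF c descD(2)[OF that]] compact_fs[OF fullT[OF descD(1)[OF that]]] by (intro intg_on_continuous)
  have gJ: "g J = (\<Sum>H\<in>desc K J. (gr u H \<bullet> v) * int_on H \<psi>)"
    unfolding g_def using mgrad_top[OF descD(1)] by (intro sum.cong) auto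
  have gj: "g j = (\<Sum>H\<in>desc K J. (mgrad J u K \<bullet> v) * int_on H \<psi>)"
    unfolding g_def desc_self[OF K(1)] using int_on_desc[OF K ic] by (simp add: sum_distrib_left)
  have step: "g (Suc m) - g m = (\<Sum>K'\<in>desc K m. \<Sum>H\<in>desc K' (Suc m). ((mgrad J u H - mgrad J u K') \<bullet> v) * int_on H \<psi>)"
    if m: "m \<in> {j..<J}" for m
  proof -
    have "g (Suc m) = (\<Sum>K'\<in>desc K m. \<Sum>H\<in>desc K' (Suc m). (mgrad J u H \<bullet> v) * int_on H \<psi>)"
      unfolding g_def using m by (intro sum_desc_desc[OF K(1)]) auto
    moreover have "g m = (\<Sum>K'\<in>desc K m. \<Sum>H\<in>desc K' (Suc m). (mgrad J u K' \<bullet> v) * int_on H \<psi>)"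
      unfolding g_def
    proof (intro sum.cong refl)
      fix K' assume K': "K' \<in> desc K m"
      have "int_on K' \<psi> = (\<Sum>H\<in>desc K' (Suc m). int_on H \<psi>)"
      proof (rule int_on_desc[OF descD(1)[OF K']])
        fix H assume "H \<in> desc K' (Suc m)"
        then have "H \<in> desc K (Suc m)" using descD(2)[OF K'] by (auto simp: desc_def)
        then show "intg_on H \<psi>" by (rule ic)
      qed simp
      then show "(mgrad J u K' \<bullet> v) * int_on K' \<psi> = (\<Sum>H\<in>desc K' (Suc m). (mgrad J u K' \<bullet> v) * int_on H \<psi>)"
        by (simp add: sum_distrib_left)
    qed
    ultimately show ?thesis by (simp add: sum_subtractf[symmetric] inner_diff_left left_diff_distrib)
  qed
  have "(\<Sum>H\<in>desc K J. ((gr u H - mgrad J u K) \<bullet> v) * int_on H \<psi>) = g J - g j"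
    unfolding gJ gj by (simp add: sum_subtractf[symmetric] inner_diff_left left_diff_distrib)
  also have "\<dots> = (\<Sum>m\<in>{j..<J}. g (Suc m) - g m)" using sum_Suc_diff'[OF K(2), of g] by simp
  also have "\<bar>\<dots>\<bar> \<le> (\<Sum>m\<in>{j..<J}. \<bar>g (Suc m) - g m\<bar>)" by (rule sum_abs)
  also have "\<dots> \<le> (\<Sum>m\<in>{j..<J}. W * h1 * norm v * (sqrt (vol K) * ((1/2) ^ m * sqrt (\<Sum>K'\<in>desc K m. fluct J u m K'))))"
  proof (rule sum_mono)
    fix m assume m: "m \<in> {j..<J}"
    have "\<bar>g (Suc m) - g m\<bar> \<le> (\<Sum>K'\<in>desc K m. \<bar>\<Sum>H\<in>desc K' (Suc m). ((mgrad J u H - mgrad J u K') \<bullet> v) * int_on H \<psi>\<bar>)"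
      unfolding step[OF m] by (rule sum_abs)
    also have "\<dots> \<le> (\<Sum>K'\<in>desc K m. W * h1 * norm v * ((1/2) ^ m * (sqrt (vol K') * sqrt (fluct J u m K'))))"
    proof (intro sum_mono)
      fix K' assume K': "K' \<in> desc K m"
      show "\<bar>\<Sum>H\<in>desc K' (Suc m). ((mgrad J u H - mgrad J u K') \<bullet> v) * int_on H \<psi>\<bar>
        \<le> W * h1 * norm v * ((1/2) ^ m * (sqrt (vol K') * sqrt (fluct J u m K')))"
        using m lip descD[OF K'] continuous_on_subset[OF c] by (intro cell_oscillation W) auto
    qed
    also have "\<dots> \<le> W * h1 * norm v * ((1/2) ^ m * (sqrt (\<Sum>K'\<in>desc K m. vol K') * sqrt (\<Sum>K'\<in>desc K m. fluct J u m K')))"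
      unfolding sum_distrib_left[symmetric]
      using W h1_pos fluct_nonneg by (intro mult_left_mono sqrt_sum_mult_le) auto
    also have "(\<Sum>K'\<in>desc K m. vol K') = vol K" using vol_desc[OF K(1), of m] m by simp
    finally show "\<bar>g (Suc m) - g m\<bar> \<le> W * h1 * norm v * (sqrt (vol K) * ((1/2) ^ m * sqrt (\<Sum>K'\<in>desc K m. fluct J u m K')))"
      by (simp add: mult_ac)
  qed
  finally show ?thesis by (simp add: osc_def sum_distrib_left)
qed

section \<open>Local affine approximation and its moments\<close>

definition meanaff :: "nat => ('a => real) => 'a set => 'a => real" where
  "meanaff J u K x = int_on K (\<lambda>y. u y - mgrad J u K \<bullet> y) / vol K + mgrad J u K \<bullet> x"

lemma meanaff_diff: "meanaff J u K x - meanaff J u K y = mgrad J u K \<bullet> (x - y)"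
  by (simp add: meanaff_def inner_diff_right)

lemma affine_meanaff: "affine_on S (meanaff J u K)"
  unfolding affine_on_def
  by (intro exI[of _ "mgrad J u K"] exI[of _ "int_on K (\<lambda>y. u y - mgrad J u K \<bullet> y) / vol K"]) (simp add: meanaff_def)

lemma gr_meanaff: "full_simplex H ==> gr (meanaff J u K) H = mgrad J u K"
  by (rule gr_unique[where c="int_on K (\<lambda>y. u y - mgrad J u K \<bullet> y) / vol K"]) (auto simp: meanaff_def)

lemma lipschitz_meanaff: "\<exists>L. L-lipschitz_on S (meanaff J u K)"
proof (intro exI lipschitz_onI)
  fix x y
  show "dist (meanaff J u K x) (meanaff J u K y) \<le> norm (mgrad J u K) * dist x y"
    unfolding dist_norm meanaff_diff real_norm_def by (rule Cauchy_Schwarz_ineq2)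
qed simp

lemma piecewise_fe: assumes "u \<in> fe_space \<Omega> (T J)" "K \<in> T j" shows "piecewise J K u"
  unfolding piecewise_def
  using conf_mesh.fe_lipschitz[OF conf assms(1)] conf_mesh.fe_affine[OF conf assms(1) descD(1)] lipschitz_on_subset by blast

lemma piecewise_meanaff: "piecewise J K (meanaff J u K')"
  unfolding piecewise_def using lipschitz_meanaff affine_meanaff by blast

lemma piecewise_diff:
  assumes "piecewise J K v" "piecewise J K w" shows "piecewise J K (\<lambda>x. v x - w x)"
  using assms lipschitz_on_diff affine_on_diff unfolding piecewise_def by blast

lemma piecewise_continuous: "piecewise J K w ==> continuous_on K w"
  unfolding piecewise_def using lipschitz_on_continuous_on by blast

lemma int_on_sub_meanaff:
  assumes "K \<in> T j" "continuous_on K u" shows "int_on K (\<lambda>x. u x - meanaff J u K x) = 0"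
proof -
  note fs = fullT[OF assms(1)]
  let ?f = "\<lambda>y. u y - mgrad J u K \<bullet> y"
  have "int_on K (\<lambda>x. u x - meanaff J u K x) = int_on K (\<lambda>x. ?f x - int_on K ?f / vol K)"
    by (intro int_on_cong) (simp add: meanaff_def)
  also have "\<dots> = int_on K ?f - int_on K ?f / vol K * vol K"
    using int_on_diff[OF intg_on_continuous[OF compact_fs[OF fs]] intg_on_const[OF lmeasurable_fs[OF fs]], of ?f]
      int_on_const[OF lmeasurable_fs[OF fs]] assms(2) by (simp add: continuous_intros)
  finally show ?thesis using vol_pos[OF assms(1)] by simp
qed

text \<open>Each flux along \<open>r - p\<close> with the weight of \<open>add_mset r ms\<close>
  vanishes by \<open>flux_corners\<close>. Their sum over the edges at \<open>p\<close> is a radial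
  divergence, which trades the moment of \<open>ms\<close> for one of lower degree and gradient
  terms.\<close>

lemma moment_recursion:
  assumes K: "K \<in> T j" "j \<le> J" and w: "piecewise J K w" and p: "p \<in># ms" and ms: "set_mset ms \<subseteq> corners K"
  shows "real (DIM('a) + size ms) * int_on K (\<lambda>x. w x * bmono K ms x)
    = real (count ms p) * int_on K (\<lambda>x. w x * bmono K (ms - {#p#}) x)
      - (\<Sum>r\<in>corners K - {p}. \<Sum>H\<in>desc K J. (gr w H \<bullet> (r - p)) * int_on H (bmono K (add_mset r ms)))"
proof -
  note fs = fullT[OF K(1)]
  let ?K = "corners K - {p}"
  have pc: "p \<in> corners K" using p ms by auto
  have i: "intg_on K (\<lambda>x. w x * g x)" if "continuous_on K g" for g
    using that piecewise_continuous[OF w] by (intro intg_on_continuous compact_fs fs continuous_intros)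
  have "flux J K w (add_mset r ms) (r - p) = 0" if "r \<in> ?K" for r
    using that p ms by (intro flux_corners[OF K w]) auto
  then have "0 = (\<Sum>r\<in>?K. flux J K w (add_mset r ms) (r - p))" by simp
  also have "\<dots> = (\<Sum>r\<in>?K. \<Sum>H\<in>desc K J. (gr w H \<bullet> (r - p)) * int_on H (bmono K (add_mset r ms)))
    + int_on K (\<lambda>x. \<Sum>r\<in>?K. w x * dbmono K (add_mset r ms) x (r - p))"
    unfolding gflux_def sum.distrib by (subst int_on_sum[OF i[OF dbmono_continuous]]) simp
  also have "int_on K (\<lambda>x. \<Sum>r\<in>?K. w x * dbmono K (add_mset r ms) x (r - p))
    = int_on K (\<lambda>x. real (DIM('a) + size ms) * (w x * bmono K ms x) - real (count ms p) * (w x * bmono K (ms - {#p#}) x))"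
    unfolding sum_distrib_left[symmetric] dbmono_radial[OF fs pc ms] by (simp only: right_diff_distrib mult_ac)
  also have "\<dots> = real (DIM('a) + size ms) * int_on K (\<lambda>x. w x * bmono K ms x) - real (count ms p) * int_on K (\<lambda>x. w x * bmono K (ms - {#p#}) x)"
    using int_on_diff[OF intg_on_cmult[OF i[OF bmono_continuous]] intg_on_cmult[OF i[OF bmono_continuous]]] by (simp add: int_on_cmult)
  finally show ?thesis by simp
qed

lemma piecewise_const: "piecewise J K (\<lambda>x. c)"
proof -
  have "0-lipschitz_on K (\<lambda>x. c)" by (intro lipschitz_onI) auto
  moreover have "affine_on H (\<lambda>x. c)" for H :: "'a set"
    unfolding affine_on_def by (intro exI[of _ 0] exI[of _ c]) simp
  ultimately show ?thesis unfolding piecewise_def by blast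
qed

lemma gr_const: "full_simplex H ==> gr (\<lambda>x. c) H = 0"
  by (rule gr_unique[where c=c]) auto

text \<open>The recursion on constants, known from Dirichlet integrals of barycentric
  monomials.\<close>

lemma moment_exact:
  assumes K: "K \<in> T j" and p: "p \<in># ms" and ms: "set_mset ms \<subseteq> corners K"
  shows "real (DIM('a) + size ms) * int_on K (bmono K ms) = real (count ms p) * int_on K (bmono K (ms - {#p#}))"
  using moment_recursion[OF K order_refl piecewise_const[of _ _ 1] p ms] gr_const[OF fullT[OF descD(1)], of _ K j] by simp

text \<open>Induction on the degree: the moment of degree zero vanishes by the choice of
  \<open>meanaff\<close>, and every further degree adds an oscillation term through
  \<open>moment_recursion\<close>.\<close>

lemma moment_small:
  assumes K: "K \<in> T j" "j \<le> J" and u: "u \<in> fe_space \<Omega> (T J)" and ms: "set_mset ms \<subseteq> corners K"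
  shows "\<bar>int_on K (\<lambda>x. (u x - meanaff J u K x) * bmono K ms x)\<bar>
    \<le> real (size ms * Suc (size ms)) * (\<kappa> * h1 * (sqrt (vol K) * osc J u j K))"
  using ms
proof (induction ms)
  case empty
  show ?case using int_on_sub_meanaff[OF K(1) piecewise_continuous[OF piecewise_fe[OF u K(1)]]] by (simp add: bmono_empty)
next
  case (add p ms)
  let ?e = "\<lambda>x. u x - meanaff J u K x" and ?n = "size ms"
  let ?R = "\<kappa> * h1 * (sqrt (vol K) * osc J u j K)"
  note fs = fullT[OF K(1)]
  have p: "p \<in> corners K" using add.prems by simp
  have R0: "?R \<ge> 0" using kappa_pos h1_pos osc_nonneg by simp
  have pe: "piecewise J K ?e" by (intro piecewise_diff piecewise_fe[OF u K(1)] piecewise_meanaff)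
  have ge: "gr ?e H = gr u H - mgrad J u K" if "H \<in> desc K J" for H
    unfolding gr_diff gr_meanaff[OF fullT[OF descD(1)[OF that]]] ..
  have fl: "\<bar>\<Sum>H\<in>desc K J. (gr ?e H \<bullet> (r - p)) * int_on H (bmono K (add_mset r (add_mset p ms)))\<bar> \<le> real (?n + 2) * ?R"
    if r: "r \<in> corners K - {p}" for r
  proof -
    let ?G = "\<kappa> / diameter K"
    have "\<bar>\<Sum>H\<in>desc K J. ((gr u H - mgrad J u K) \<bullet> (r - p)) * int_on H (bmono K (add_mset r (add_mset p ms)))\<bar>
      \<le> (real (size (add_mset r (add_mset p ms))) * ?G) * h1 * norm (r - p) * (sqrt (vol K) * osc J u j K)"
    proof (rule oscillation[OF K bmono_continuous])
      show "0 \<le> real (size (add_mset r (add_mset p ms))) * ?G" using kappa_pos diameter_pos[OF K(1)] by simp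
      fix x y assume "x \<in> K" "y \<in> K"
      then show "\<bar>bmono K (add_mset r (add_mset p ms)) x - bmono K (add_mset r (add_mset p ms)) y\<bar>
        \<le> real (size (add_mset r (add_mset p ms))) * ?G * norm (x - y)"
        using r add.prems by (intro bmono_lipschitz[OF fs _ _ _ norm_bg_le_diam[OF K(1)]]) auto
    qed
    also have "\<dots> = real (?n + 2) * (?G * norm (r - p)) * (h1 * (sqrt (vol K) * osc J u j K))" by simp
    also have "\<dots> \<le> real (?n + 2) * \<kappa> * (h1 * (sqrt (vol K) * osc J u j K))"
    proof (intro mult_right_mono mult_left_mono)
      have "norm (r - p) \<le> diameter K"
        using diameter_bounded_bound[OF bounded_fs[OF fs], of r p] corners_subset r p by (auto simp: dist_norm)
      then show "?G * norm (r - p) \<le> \<kappa>" using kappa_pos diameter_pos[OF K(1)] by (simp add: pos_divide_le_eq)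
    qed (use h1_pos osc_nonneg in auto)
    finally show ?thesis using ge by (simp add: mult_ac)
  qed
  let ?X = "\<lambda>ms. int_on K (\<lambda>x. ?e x * bmono K ms x)"
  have "real (DIM('a) + size (add_mset p ms)) * \<bar>?X (add_mset p ms)\<bar> = \<bar>real (DIM('a) + size (add_mset p ms)) * ?X (add_mset p ms)\<bar>"
    by (simp add: abs_mult)
  also have "\<dots> \<le> \<bar>real (count (add_mset p ms) p) * ?X ms\<bar>
    + \<bar>\<Sum>r\<in>corners K - {p}. \<Sum>H\<in>desc K J. (gr ?e H \<bullet> (r - p)) * int_on H (bmono K (add_mset r (add_mset p ms)))\<bar>"
    using moment_recursion[OF K pe _ add.prems, of p] by simp
  also have "\<bar>real (count (add_mset p ms) p) * ?X ms\<bar> \<le> real (DIM('a) + size (add_mset p ms)) * \<bar>?X ms\<bar>"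
    unfolding abs_mult using count_le_size[of ms p] by (intro mult_right_mono) auto
  also have "\<bar>\<Sum>r\<in>corners K - {p}. \<Sum>H\<in>desc K J. (gr ?e H \<bullet> (r - p)) * int_on H (bmono K (add_mset r (add_mset p ms)))\<bar>
    \<le> (\<Sum>r\<in>corners K - {p}. real (?n + 2) * ?R)"
    by (intro order_trans[OF sum_abs] sum_mono fl)
  also have "\<dots> \<le> real (DIM('a) + size (add_mset p ms)) * (real (?n + 2) * ?R)"
  proof -
    have "card (corners K - {p}) = DIM('a)" using card_corners[OF fs] p finite_corners[OF fs] by simp
    then show ?thesis unfolding sum_constant using R0 by (intro mult_right_mono) auto
  qed
  finally have "real (DIM('a) + size (add_mset p ms)) * \<bar>?X (add_mset p ms)\<bar>
    \<le> real (DIM('a) + size (add_mset p ms)) * (\<bar>?X ms\<bar> + real (?n + 2) * ?R)" by (simp add: distrib_left)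
  then have "\<bar>?X (add_mset p ms)\<bar> \<le> \<bar>?X ms\<bar> + real (?n + 2) * ?R" by (subst (asm) mult_le_cancel_left_pos) auto
  also have "\<dots> \<le> real (?n * Suc ?n) * ?R + real (?n + 2) * ?R" using add by simp
  \<comment> \<open>This is \<open>n * (n + 1) + (n + 2) \<le> (n + 1) * (n + 2)\<close>.\<close>
  also have "\<dots> \<le> real (size (add_mset p ms) * Suc (size (add_mset p ms))) * ?R"
    unfolding distrib_right[symmetric] of_nat_add[symmetric] using R0 by (intro mult_right_mono of_nat_mono) (auto simp: algebra_simps)
  finally show ?case .
qed

end

section \<open>A strengthened inverse estimate\<close>

lemma int_on_Cauchy_Schwarz:
  fixes v w :: "'a::euclidean_space => real"
  assumes Z: "compact Z" and v: "continuous_on Z v" and w: "continuous_on Z w"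
  shows "\<bar>int_on Z (\<lambda>x. v x * w x)\<bar> \<le> sqrt (int_on Z (\<lambda>x. (v x)\<^sup>2)) * sqrt (int_on Z (\<lambda>x. (w x)\<^sup>2))"
proof -
  have Zs: "Z \<in> sets lebesgue" using lmeasurable_compact[OF Z] by (rule fmeasurableD)
  have L: "f \<in> L2 Z" if f: "continuous_on Z f" for f
  proof -
    have "integrable (lebesgue_on Z) (\<lambda>x. (f x)\<^sup>2)"
      using intg_on_continuous[OF Z, of "\<lambda>x. (f x)\<^sup>2"] Zs f
      by (subst integrable_restrict_space) (auto simp: intg_on_def intro!: continuous_intros)
    then show ?thesis unfolding L2_def using continuous_imp_measurable_on_sets_lebesgue[OF f Zs] by simp
  qed
  show ?thesis
    using L2_Cauchy_Schwarz[OF L[OF v] L[OF w]] unfolding L2_norm_def L2_inner_int_on[OF Zs] power2_eq_square .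
qed

lemma corner_edge_le: "full_simplex K ==> p \<in> corners K ==> q \<in> corners K ==> norm (p - q) \<le> diameter K"
  using diameter_bounded_bound[OF bounded_fs, of K p q] corners_subset by (auto simp: dist_norm)

lemma L2_set_norm_sum_le:
  fixes f :: "nat => 'b => 'c::real_normed_vector" and w :: "'b => real"
  assumes w: "\<And>H. w H \<ge> 0"
  shows "L2_set (\<lambda>H. w H * norm (\<Sum>k\<in>Lk. f k H)) S \<le> (\<Sum>k\<in>Lk. L2_set (\<lambda>H. w H * norm (f k H)) S)"
proof (induction Lk rule: infinite_finite_induct)
  case (insert k Lk)
  have "L2_set (\<lambda>H. w H * norm (\<Sum>k\<in>insert k Lk. f k H)) S \<le> L2_set (\<lambda>H. w H * norm (f k H) + w H * norm (\<Sum>k\<in>Lk. f k H)) S"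
    using insert.hyps w norm_triangle_ineq
    by (intro L2_set_mono) (auto simp: distrib_left[symmetric] intro!: mult_left_mono)
  also have "\<dots> \<le> L2_set (\<lambda>H. w H * norm (f k H)) S + L2_set (\<lambda>H. w H * norm (\<Sum>k\<in>Lk. f k H)) S"
    by (rule L2_set_triangle_ineq)
  finally show ?case using insert by simp
qed (auto simp: L2_set_def)

context graded_meshes begin

lemma weight_lam: "weight (lam K p) (\<lambda>x v. bg K p \<bullet> v)"
  unfolding weight_def lam_def[abs_def] by (auto intro!: derivative_eq_intros)

lemma weight_mult:
  assumes f: "weight f df" and g: "weight g dg" shows "weight (\<lambda>x. f x * g x) (\<lambda>x v. f x * dg x v + df x v * g x)"
  using assms weight_continuous[OF f] weight_continuous[OF g] unfolding weight_def
  by (auto intro!: has_derivative_mult continuous_intros)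

lemma weight_one_minus: "weight f df ==> weight (\<lambda>x. 1 - f x) (\<lambda>x v. - df x v)"
  unfolding weight_def by (auto intro!: derivative_eq_intros continuous_intros)

lemma weight_power:
  assumes f: "weight f df" shows "weight (\<lambda>x. f x ^ m) (\<lambda>x v. m * (f x ^ (m - 1) * df x v))"
  using assms weight_continuous[OF f] unfolding weight_def
  by (auto intro!: derivative_eq_intros continuous_intros)

text \<open>The weights \<open>lam p * (1 - lam p) ^ m * lam r\<close> vanish on the facets opposite to \<open>p\<close> and \<open>r\<close>;
  the derivatives along \<open>r - p\<close> add up to a radial derivative.\<close>

lemma power_moment:
  assumes K: "K \<in> T j" and p: "p \<in> corners K"
  shows "real (DIM('a) + m) * int_on K (\<lambda>x. (1 - lam K p x) ^ m) = real DIM('a) * vol K"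
proof (induction m)
  case 0
  show ?case using int_on_const[OF lmeasurable_fs[OF fullT[OF K]], of 1] by simp
next
  case (Suc m)
  note fs = fullT[OF K]
  let ?K = "corners K - {p}" and ?l = "lam K" and ?u = "\<lambda>x. 1 - lam K p x"
  define D where "D x v = ?l p x * (m * (?u x ^ (m - 1) * - (bg K p \<bullet> v))) + (bg K p \<bullet> v) * ?u x ^ m" for x v
  define d where "d r x v = (?l p x * ?u x ^ m) * (bg K r \<bullet> v) + D x v * ?l r x" for r x v
  have wt: "weight (\<lambda>x. (?l p x * ?u x ^ m) * ?l r x) (d r)" for r
    unfolding d_def D_def by (intro weight_mult weight_power weight_one_minus weight_lam)
  have ir: "int_on K (\<lambda>x. d r x (r - p)) = 0" if r: "r \<in> ?K" for r
  proof -
    have "gflux j K (\<lambda>x. 1) (\<lambda>x. (?l p x * ?u x ^ m) * ?l r x) (d r) (r - p) = 0"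
      using r by (intro gflux_edge[OF K order_refl piecewise_const p _ _ wt]) auto
    then show ?thesis using gr_const[OF fullT[OF descD(1)], of _ K j 1] by (simp add: gflux_def)
  qed
  have sum: "(\<Sum>r\<in>?K. d r x (r - p)) = real (DIM('a) + m) * ?u x ^ m - real (DIM('a) + Suc m) * ?u x ^ Suc m" for x
  proof -
    have lin: "linear (D x)" unfolding D_def by unfold_locales (simp_all add: inner_add_right algebra_simps)
    have bx: "bg K p \<bullet> (x - p) = - ?u x" using lam_diff[of K p x p] lam_corner[OF fs p p] by simp
    have "(\<Sum>r\<in>?K. d r x (r - p)) = D x (x - p) + real DIM('a) * (?l p x * ?u x ^ m)"
      using radial_sum[OF fs p lin, where x=x and c="?l p x * ?u x ^ m"] by (simp add: d_def mult_ac add.commute)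
    moreover have "D x (x - p) = ?l p x * (m * ?u x ^ m) - ?u x * ?u x ^ m"
      unfolding D_def bx by (cases m) (auto simp: algebra_simps)
    ultimately show ?thesis by (simp add: algebra_simps)
  qed
  have ui: "intg_on K (\<lambda>x. ?u x ^ n)" for n
    by (intro intg_on_continuous compact_fs fs continuous_intros continuous_on_lam)
  have "0 = int_on K (\<lambda>x. \<Sum>r\<in>?K. d r x (r - p))"
    using ir by (subst int_on_sum) (auto intro!: intg_on_continuous compact_fs fs weight_continuous(2)[OF wt])
  also have "\<dots> = real (DIM('a) + m) * int_on K (\<lambda>x. ?u x ^ m) - real (DIM('a) + Suc m) * int_on K (\<lambda>x. ?u x ^ Suc m)"
    unfolding sum int_on_diff[OF intg_on_cmult[OF ui] intg_on_cmult[OF ui]] int_on_cmult ..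
  finally show ?case using Suc by simp
qed

lemma power_moment_le:
  assumes K: "K \<in> T j" and p: "p \<in> corners K" and n: "n \<ge> 1" "n \<le> DIM('a) + m"
  shows "int_on K (\<lambda>x. (1 - lam K p x) ^ m) \<le> real DIM('a) / n * vol K"
proof -
  have "real n * int_on K (\<lambda>x. (1 - lam K p x) ^ m) \<le> real (DIM('a) + m) * int_on K (\<lambda>x. (1 - lam K p x) ^ m)"
    using n lam_le_1[OF fullT[OF K] _ p] by (intro mult_right_mono int_on_nonneg) auto
  then show ?thesis unfolding power_moment[OF K p] using n by (simp add: field_simps)
qed

text \<open>The weight \<open>(1 - (1 - lam p) ^ N) * (1 - (1 - lam r) ^ N)\<close> with \<open>N = 2 ^ (k - j)\<close> is close to one
  away from strips of width \<open>2 ^ - k\<close> along two facets of the coarse cell, so that only the strips contribute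
  to the mean derivative along the edge off these facets.\<close>

lemma mean_edge_derivative:
  assumes K: "K \<in> T j" and jk: "j \<le> k" and v: "v \<in> fe_space \<Omega> (T k)" and pr: "p \<in> corners K" "r \<in> corners K" "p \<noteq> r"
  shows "sqrt (vol K) * \<bar>mgrad k v K \<bullet> (r - p)\<bar>
    \<le> sqrt (2 * DIM('a) * ((1/2) ^ (k - j) * 4 ^ k * int_on K (\<lambda>x. (v x)\<^sup>2))) * (diameter K * (sqrt Cinv + 1 / h0))"
proof -
  note fs = fullT[OF K]
  let ?e = "r - p" and ?D = "desc K k" and ?A = "int_on K (\<lambda>x. (v x)\<^sup>2)"
  define N :: nat where "N = 2 ^ (k - j)"
  have N: "N \<ge> 1" by (simp add: N_def)
  \<comment> \<open>Up to a constant the volume of the two strips; the factor \<open>1 / N\<close>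
    in it is the whole gain.\<close>
  define V where "V = 2 * DIM('a) / N * vol K"
  define u where "u q x = 1 - lam K q x" for q x
  define \<psi> where "\<psi> x = (1 - u p x ^ N) * (1 - u r x ^ N)" for x
  define d where "d x w = (1 - u p x ^ N) * - (N * (u r x ^ (N - 1) * - (bg K r \<bullet> w)))
    + - (N * (u p x ^ (N - 1) * - (bg K p \<bullet> w))) * (1 - u r x ^ N)" for x w
  have wt: "weight \<psi> d"
    unfolding \<psi>_def[abs_def] d_def[abs_def] u_def[abs_def] by (intro weight_mult weight_power weight_one_minus weight_lam)
  note wc = weight_continuous[OF wt]
  have u: "0 \<le> u q x" "u q x \<le> 1" "0 \<le> u q x ^ m" "u q x ^ m \<le> 1" if "x \<in> K" "q \<in> corners K" for q x m
    using lam_le_1[OF fs that] that mem_simplex_iff[OF fs] unfolding u_def by (auto intro!: power_le_one)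
  have ui: "intg_on K (\<lambda>x. u q x ^ m)" for q m
    unfolding u_def by (intro intg_on_continuous compact_fs fs continuous_intros continuous_on_lam)
  have um: "int_on K (\<lambda>x. u p x ^ m + u r x ^ m) \<le> V" if "N \<le> DIM('a) + m" for m
    unfolding int_on_add[OF ui ui] V_def
    using add_mono[OF power_moment_le[OF K pr(1) N that] power_moment_le[OF K pr(2) N that]] unfolding u_def[symmetric] by simp
  have \<psi>01: "0 \<le> \<psi> x" "1 - \<psi> x \<le> u p x ^ N + u r x ^ N" if "x \<in> K" for x
    using u(3,4)[OF that pr(1), of N] u(3,4)[OF that pr(2), of N] mult_nonneg_nonneg[of "1 - u p x ^ N" "1 - u r x ^ N"]
    by (auto simp: \<psi>_def algebra_simps)
  have \<psi>1: "\<psi> x \<le> 1" if "x \<in> K" for x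
    using u(3,4)[OF that pr(1), of N] u(3,4)[OF that pr(2), of N] unfolding \<psi>_def by (intro mult_le_one) auto
  have V: "0 \<le> V" using vol_pos[OF K] unfolding V_def by simp
  have pw: "piecewise k K v" by (rule piecewise_fe[OF v K])
  have vc: "continuous_on K v" by (rule piecewise_continuous[OF pw])
  have aff: "affine_on H v" if "H \<in> ?D" for H using pw that unfolding piecewise_def by blast
  have zero: "(\<Sum>H\<in>?D. (gr v H \<bullet> ?e) * int_on H \<psi>) + int_on K (\<lambda>x. v x * d x ?e) = 0"
    unfolding gflux_def[symmetric] by (rule gflux_edge[OF K jk pw pr wt]) (auto simp: \<psi>_def u_def)
  let ?a = "\<lambda>H. int_on H (\<lambda>x. 1 - \<psi> x)"
  have one: "vol H - int_on H \<psi> = ?a H" "0 \<le> ?a H" "?a H \<le> vol H" if H: "H \<in> ?D" for H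
  proof -
    note fs' = fullT[OF descD(1)[OF H]]
    show "vol H - int_on H \<psi> = ?a H"
      using int_on_diff[OF intg_on_const[OF lmeasurable_fs[OF fs'], of 1] intg_on_continuous[OF compact_fs[OF fs'] wc(1)]]
        int_on_const[OF lmeasurable_fs[OF fs'], of 1] by simp
    moreover have "0 \<le> int_on H \<psi>" using \<psi>01 descD(2)[OF H] by (intro int_on_nonneg) auto
    ultimately show "?a H \<le> vol H" by simp
    show "0 \<le> ?a H" using \<psi>1 descD(2)[OF H] by (intro int_on_nonneg) auto
  qed
  have asum: "(\<Sum>H\<in>?D. ?a H) \<le> V"
  proof -
    have ci: "intg_on X (\<lambda>x. 1 - \<psi> x)" if "compact X" for X by (intro intg_on_continuous that continuous_intros wc)
    have "(\<Sum>H\<in>?D. ?a H) = int_on K (\<lambda>x. 1 - \<psi> x)"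
      by (rule int_on_desc[OF K jk ci[OF compact_fs[OF fullT[OF descD(1)]]], symmetric])
    also have "\<dots> \<le> int_on K (\<lambda>x. u p x ^ N + u r x ^ N)"
      by (intro int_on_mono ci compact_fs fs intg_on_add ui \<psi>01)
    also have "\<dots> \<le> V" by (rule um) simp
    finally show ?thesis .
  qed
  have dsq: "int_on K (\<lambda>x. (d x ?e)\<^sup>2) \<le> (real N)\<^sup>2 * V"
  proof -
    have slope: "bg K p \<bullet> ?e = - 1" "bg K r \<bullet> ?e = 1"
      unfolding lam_diff[symmetric] using lam_corner[OF fs] pr by auto
    have "int_on K (\<lambda>x. (d x ?e)\<^sup>2) \<le> int_on K (\<lambda>x. (real N)\<^sup>2 * (u p x ^ (2 * (N - 1)) + u r x ^ (2 * (N - 1))))"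
    proof (intro int_on_mono intg_on_cmult intg_on_add ui)
      show "intg_on K (\<lambda>x. (d x ?e)\<^sup>2)" by (intro intg_on_continuous compact_fs fs continuous_intros wc)
      fix x assume x: "x \<in> K"
      let ?s = "(1 - u p x ^ N) * u r x ^ (N - 1)" and ?t = "u p x ^ (N - 1) * (1 - u r x ^ N)"
      have st: "0 \<le> ?s" "?s \<le> u r x ^ (N - 1)" "0 \<le> ?t" "?t \<le> u p x ^ (N - 1)"
        using u(3,4)[OF x] pr by (auto intro!: mult_left_le_one_le mult_left_le)
      have "(?s - ?t)\<^sup>2 \<le> ?s\<^sup>2 + ?t\<^sup>2" using mult_nonneg_nonneg[OF st(1,3)] unfolding power2_diff by linarith
      also have "\<dots> \<le> (u r x ^ (N - 1))\<^sup>2 + (u p x ^ (N - 1))\<^sup>2" by (intro add_mono power_mono st)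
      finally have "(real N)\<^sup>2 * (?s - ?t)\<^sup>2 \<le> (real N)\<^sup>2 * (u p x ^ (2 * (N - 1)) + u r x ^ (2 * (N - 1)))"
        by (intro mult_left_mono) (auto simp: power_mult[symmetric] mult.commute)
      moreover have "d x ?e = real N * (?s - ?t)" unfolding d_def slope by (simp add: algebra_simps)
      ultimately show "(d x ?e)\<^sup>2 \<le> (real N)\<^sup>2 * (u p x ^ (2 * (N - 1)) + u r x ^ (2 * (N - 1)))"
        by (simp add: power_mult_distrib)
    qed
    \<comment> \<open>The derivative carries the exponent \<open>N - 1\<close>, its square
      \<open>2 * (N - 1)\<close>; for \<open>N = 1\<close> the inequality rests on the dimension
      being positive.\<close>
    moreover have "N \<le> DIM('a) + 2 * (N - 1)" using N DIM_positive[where 'a='a] by linarith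
    ultimately show ?thesis
      unfolding int_on_cmult by (rule order_trans[OF _ mult_left_mono[OF um]]) simp
  qed
  have "vol K * (mgrad k v K \<bullet> ?e) = (vol K *\<^sub>R mgrad k v K) \<bullet> ?e" by simp
  also have "\<dots> = (\<Sum>H\<in>?D. (gr v H \<bullet> ?e) * vol H)"
    unfolding vol_mgrad[OF K] by (simp add: inner_sum_left mult.commute)
  \<comment> \<open>Each volume is split into the integrals of \<open>1 - \<psi>\<close> and of
    \<psi>; the vanishing flux \<open>zero\<close> replaces the second part by the term with the
    derivative of \<psi>.\<close>
  also have "\<dots> = (\<Sum>H\<in>?D. (gr v H \<bullet> ?e) * ?a H) - int_on K (\<lambda>x. v x * d x ?e)"
  proof -
    have "(\<Sum>H\<in>?D. (gr v H \<bullet> ?e) * vol H) = (\<Sum>H\<in>?D. (gr v H \<bullet> ?e) * ?a H) + (\<Sum>H\<in>?D. (gr v H \<bullet> ?e) * int_on H \<psi>)"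
      unfolding sum.distrib[symmetric]
      by (intro sum.cong refl) (simp add: one(1)[symmetric] distrib_left[symmetric])
    then show ?thesis using zero by linarith
  qed
  finally have "\<bar>vol K * (mgrad k v K \<bullet> ?e)\<bar> \<le> \<bar>\<Sum>H\<in>?D. (gr v H \<bullet> ?e) * ?a H\<bar> + \<bar>int_on K (\<lambda>x. v x * d x ?e)\<bar>"
    by linarith
  moreover have "\<bar>\<Sum>H\<in>?D. (gr v H \<bullet> ?e) * ?a H\<bar> \<le> sqrt (4 ^ k * ?A) * (diameter K * sqrt Cinv) * sqrt V"
  proof -
    have "\<bar>\<Sum>H\<in>?D. (gr v H \<bullet> ?e) * ?a H\<bar> \<le> (\<Sum>H\<in>?D. sqrt (vol H * (gr v H \<bullet> ?e)\<^sup>2) * sqrt (?a H))"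
    proof (rule order_trans[OF sum_abs sum_mono])
      fix H assume H: "H \<in> ?D"
      \<comment> \<open>One square root of the strip integral is enlarged to the full volume, as the
        inverse estimate requires; the other is kept and sums up to \<open>V\<close>.\<close>
      have "?a H = sqrt (?a H) * sqrt (?a H)" using one(2)[OF H] by simp
      also have "\<dots> \<le> sqrt (vol H) * sqrt (?a H)" using one(2,3)[OF H] by (intro mult_right_mono) auto
      finally have "\<bar>gr v H \<bullet> ?e\<bar> * ?a H \<le> \<bar>gr v H \<bullet> ?e\<bar> * (sqrt (vol H) * sqrt (?a H))" by (rule mult_left_mono) simp
      then show "\<bar>(gr v H \<bullet> ?e) * ?a H\<bar> \<le> sqrt (vol H * (gr v H \<bullet> ?e)\<^sup>2) * sqrt (?a H)"
        using one(2)[OF H] by (simp add: abs_mult real_sqrt_mult mult_ac)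
    qed
    also have "\<dots> \<le> sqrt (\<Sum>H\<in>?D. vol H * (gr v H \<bullet> ?e)\<^sup>2) * sqrt (\<Sum>H\<in>?D. ?a H)"
      using one(2) by (intro sqrt_sum_mult_le) auto
    also have "\<dots> \<le> sqrt ((diameter K)\<^sup>2 * (Cinv * (4 ^ k * ?A))) * sqrt V"
    proof (intro mult_mono real_sqrt_le_mono asum)
      have "(\<Sum>H\<in>?D. vol H * (gr v H \<bullet> ?e)\<^sup>2) \<le> (\<Sum>H\<in>?D. (diameter K)\<^sup>2 * (Cinv * 4 ^ k * int_on H (\<lambda>x. (v x)\<^sup>2)))"
      proof (rule sum_mono)
        fix H assume H: "H \<in> ?D"
        have "\<bar>gr v H \<bullet> ?e\<bar> \<le> norm (gr v H) * diameter K"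
          using order_trans[OF Cauchy_Schwarz_ineq2 mult_left_mono[OF corner_edge_le[OF fs pr(2,1)]]] by simp
        from power_mono[OF this, of 2] have "vol H * (gr v H \<bullet> ?e)\<^sup>2 \<le> vol H * ((norm (gr v H))\<^sup>2 * (diameter K)\<^sup>2)"
          by (intro mult_left_mono) (auto simp: power_mult_distrib)
        also have "\<dots> = (diameter K)\<^sup>2 * (vol H * (norm (gr v H))\<^sup>2)" by simp
        also have "\<dots> \<le> (diameter K)\<^sup>2 * (Cinv * 4 ^ k * int_on H (\<lambda>x. (v x)\<^sup>2))"
          by (intro mult_left_mono inverse_gradient[OF descD(1)[OF H] aff[OF H]]) simp
        finally show "vol H * (gr v H \<bullet> ?e)\<^sup>2 \<le> (diameter K)\<^sup>2 * (Cinv * 4 ^ k * int_on H (\<lambda>x. (v x)\<^sup>2))" .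
      qed
      also have "\<dots> = (diameter K)\<^sup>2 * (Cinv * (4 ^ k * ?A))"
      proof -
        have "?A = (\<Sum>H\<in>?D. int_on H (\<lambda>x. (v x)\<^sup>2))"
          using compact_fs[OF fullT[OF descD(1)]] affine_on_continuous[OF aff]
          by (intro int_on_desc[OF K jk] intg_on_continuous continuous_intros) auto
        then show ?thesis by (simp add: sum_distrib_left mult_ac)
      qed
      finally show "(\<Sum>H\<in>?D. vol H * (gr v H \<bullet> ?e)\<^sup>2) \<le> (diameter K)\<^sup>2 * (Cinv * (4 ^ k * ?A))" .
      show "0 \<le> sqrt (\<Sum>H\<in>?D. ?a H)" by (intro real_sqrt_ge_zero sum_nonneg one(2))
      show "0 \<le> sqrt ((diameter K)\<^sup>2 * (Cinv * (4 ^ k * ?A)))"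
        using less_imp_le[OF Cinv_pos] by (intro real_sqrt_ge_zero mult_nonneg_nonneg int_on_nonneg) auto
    qed
    finally show ?thesis using diameter_pos[OF K] by (simp add: real_sqrt_mult mult_ac)
  qed
  moreover have "\<bar>int_on K (\<lambda>x. v x * d x ?e)\<bar> \<le> sqrt (4 ^ k * ?A) * (diameter K * (1 / h0)) * sqrt V"
  proof -
    have A0: "0 \<le> ?A" by (intro int_on_nonneg) simp
    have "\<bar>int_on K (\<lambda>x. v x * d x ?e)\<bar> \<le> sqrt ?A * sqrt (int_on K (\<lambda>x. (d x ?e)\<^sup>2))"
      by (rule int_on_Cauchy_Schwarz[OF compact_fs[OF fs] vc wc(2)])
    also have "\<dots> \<le> sqrt ?A * (real N * sqrt V)"
      using real_sqrt_le_mono[OF dsq] A0 by (intro mult_left_mono) (auto simp: real_sqrt_mult)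
    also have "\<dots> \<le> sqrt ?A * ((2 ^ k * (diameter K * (1 / h0))) * sqrt V)"
    proof (intro mult_left_mono mult_right_mono)
      \<comment> \<open>The factor \<open>N\<close> from the derivative of the weight is absorbed by
        the diameter of \<open>K\<close>, through the lower size bound.\<close>
      have "1 / 2 ^ j \<le> diameter K * (1 / h0)" using size_ge[OF K] h0_pos by (simp add: field_simps)
      from mult_left_mono[OF this, of "2 ^ k"] show "real N \<le> 2 ^ k * (diameter K * (1 / h0))" using jk by (simp add: N_def power_diff[where a="2::real"])
    qed (use V A0 in auto)
    also have "2 ^ k = sqrt (4 ^ k)" by (simp add: real_sqrt_power)
    finally show ?thesis by (simp add: real_sqrt_mult mult_ac)
  qed
  ultimately have "\<bar>vol K * (mgrad k v K \<bullet> ?e)\<bar> \<le> sqrt (4 ^ k * ?A) * (diameter K * (sqrt Cinv + 1 / h0)) * sqrt V"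
    by (simp add: algebra_simps)
  \<comment> \<open>Here \<open>1 / N\<close> in \<open>V\<close> turns into
    \<open>(1/2) ^ (k - j)\<close>.\<close>
  also have "\<dots> = sqrt (vol K) * (sqrt (2 * DIM('a) * ((1/2) ^ (k - j) * 4 ^ k * ?A)) * (diameter K * (sqrt Cinv + 1 / h0)))"
    by (simp add: V_def N_def real_sqrt_mult real_sqrt_divide power_divide)
  finally have "sqrt (vol K) * (sqrt (vol K) * \<bar>mgrad k v K \<bullet> ?e\<bar>)
    \<le> sqrt (vol K) * (sqrt (2 * DIM('a) * ((1/2) ^ (k - j) * 4 ^ k * ?A)) * (diameter K * (sqrt Cinv + 1 / h0)))"
    using vol_pos[OF K] by (simp add: abs_mult mult.assoc[symmetric])
  then show ?thesis using vol_pos[OF K] by simp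
qed

definition Cmean :: real where "Cmean = 2 * DIM('a) ^ 3 * \<kappa>\<^sup>2 * (sqrt Cinv + 1 / h0)\<^sup>2"

lemma Cmean_nonneg: "Cmean \<ge> 0"
  by (simp add: Cmean_def)

text \<open>A vector is recovered from its products with the edges at one corner, with the gradients
  of the coordinates as dual basis.\<close>

lemma mean_gradient_le:
  assumes jk: "j \<le> k" and v: "v \<in> fe_space \<Omega> (T k)"
  shows "(\<Sum>K\<in>T j. vol K * (norm (mgrad k v K))\<^sup>2) \<le> Cmean * ((1/2) ^ (k - j) * 4 ^ k * (L2_norm \<Omega> v)\<^sup>2)"
proof -
  interpret M: conf_mesh \<Omega> "T k" by (rule conf)
  have "(\<Sum>K\<in>T j. vol K * (norm (mgrad k v K))\<^sup>2) \<le> (\<Sum>K\<in>T j. Cmean * ((1/2) ^ (k - j) * 4 ^ k * int_on K (\<lambda>x. (v x)\<^sup>2)))"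
  proof (rule sum_mono)
    fix K assume K: "K \<in> T j"
    note fs = fullT[OF K]
    let ?g = "mgrad k v K" and ?c = "sqrt Cinv + 1 / h0"
    let ?B = "(1/2) ^ (k - j) * 4 ^ k * int_on K (\<lambda>x. (v x)\<^sup>2)"
    have B0: "?B \<ge> 0" by (intro mult_nonneg_nonneg int_on_nonneg) auto
    obtain p where p: "p \<in> corners K" using other_corner[OF fs] .
    have cd: "card (corners K - {p}) = DIM('a)" using card_corners[OF fs] p finite_corners[OF fs] by simp
    have "?g = gr (\<lambda>x. ?g \<bullet> (x - p)) K"
      by (rule gr_unique[OF fs, symmetric, where c="- (?g \<bullet> p)"]) (simp add: inner_diff_right)
    also have "\<dots> = (\<Sum>r\<in>corners K - {p}. (?g \<bullet> (r - p)) *\<^sub>R bg K r)"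
      unfolding gr_def using finite_corners[OF fs] by (intro sum.mono_neutral_right) auto
    finally have "norm ?g \<le> (\<Sum>r\<in>corners K - {p}. norm ((?g \<bullet> (r - p)) *\<^sub>R bg K r))" by (metis norm_sum)
    then have "sqrt (vol K) * norm ?g \<le> sqrt (vol K) * (\<Sum>r\<in>corners K - {p}. norm ((?g \<bullet> (r - p)) *\<^sub>R bg K r))"
      by (rule mult_left_mono) simp
    also have "\<dots> \<le> (\<Sum>r\<in>corners K - {p}. (sqrt (2 * DIM('a) * ?B) * (diameter K * ?c)) * (\<kappa> / diameter K))"
      unfolding sum_distrib_left
    proof (rule sum_mono)
      fix r assume r: "r \<in> corners K - {p}"
      have "(sqrt (vol K) * \<bar>?g \<bullet> (r - p)\<bar>) * norm (bg K r) \<le> (sqrt (2 * DIM('a) * ?B) * (diameter K * ?c)) * (\<kappa> / diameter K)"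
      proof (rule mult_mono[OF mean_edge_derivative[OF K jk v p] norm_bg_le_diam[OF K]])
        show "0 \<le> sqrt (2 * DIM('a) * ?B) * (diameter K * ?c)"
          using int_on_nonneg[of K "\<lambda>x. (v x)\<^sup>2"] diameter_pos[OF K] Cinv_pos h0_pos
          by (intro mult_nonneg_nonneg real_sqrt_ge_zero) auto
      qed (use r in auto)
      then show "sqrt (vol K) * norm ((?g \<bullet> (r - p)) *\<^sub>R bg K r) \<le> (sqrt (2 * DIM('a) * ?B) * (diameter K * ?c)) * (\<kappa> / diameter K)"
        by (simp add: mult.assoc)
    qed
    also have "\<dots> = DIM('a) * \<kappa> * ?c * sqrt (2 * DIM('a) * ?B)" using cd diameter_pos[OF K] by simp
    finally have "(sqrt (vol K) * norm ?g)\<^sup>2 \<le> (DIM('a) * \<kappa> * ?c * sqrt (2 * DIM('a) * ?B))\<^sup>2" by (intro power_mono) auto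
    moreover have "(DIM('a) * \<kappa> * ?c * sqrt (2 * DIM('a) * ?B))\<^sup>2 = Cmean * ?B"
      unfolding power_mult_distrib Cmean_def using B0 by (simp add: power2_eq_square power3_eq_cube)
    ultimately show "vol K * (norm ?g)\<^sup>2 \<le> Cmean * ?B" by (simp add: power_mult_distrib)
  qed
  also have "\<dots> = Cmean * ((1/2) ^ (k - j) * 4 ^ k * (\<Sum>K\<in>T j. int_on K (\<lambda>x. (v x)\<^sup>2)))"
    by (simp add: sum_distrib_left)
  also have "(\<Sum>K\<in>T j. int_on K (\<lambda>x. (v x)\<^sup>2)) = (\<Sum>K\<in>T j. \<Sum>H\<in>desc K k. int_on H (\<lambda>x. (v x)\<^sup>2))"
    using M.fe_affine[OF v] descD(1)
    by (intro sum.cong refl int_on_desc[OF _ jk] intg_on_continuous compact_fs fullT continuous_intros affine_on_continuous) blast+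
  also have "\<dots> = (\<Sum>H\<in>T k. int_on H (\<lambda>x. (v x)\<^sup>2))" by (rule sum_desc[OF jk, symmetric])
  also have "\<dots> = (L2_norm \<Omega> v)\<^sup>2" by (rule M.fe_L2_norm_sq[OF v, symmetric])
  finally show ?thesis .
qed

text \<open>The gradients are averaged over the cells of level \<open>j\<close>, minus the average over the father
  if \<open>j\<close> is positive: components of level less than \<open>j\<close> do not contribute.\<close>

lemma bernstein:
  assumes v: "\<And>k. k \<le> J ==> v k \<in> fe_space \<Omega> (T k)"
  shows "(\<Sum>K\<in>T J. vol K * (norm (gr (\<lambda>x. \<Sum>k\<le>J. v k x) K))\<^sup>2)
    \<le> (sqrt Cmean / (1 - sqrt (1/2)))\<^sup>2 * (\<Sum>k\<le>J. 4 ^ k * (L2_norm \<Omega> (v k))\<^sup>2)"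
proof -
  let ?u = "\<lambda>x. \<Sum>k\<le>J. v k x" and ?q = "sqrt (1/2)"
  have q: "0 \<le> ?q" "?q < 1" by (auto simp del: real_sqrt_divide)
  define b where "b k = 2 ^ k * L2_norm \<Omega> (v k)" for k
  have q2: "(?q ^ n)\<^sup>2 = (1/2) ^ n" for n
    unfolding power_mult[symmetric] mult.commute[of n] unfolding power_mult by (simp del: real_sqrt_divide)
  define fa where "fa j H = (THE K. K \<in> T (j - 1) \<and> H \<subseteq> K)" for j H
  have fa: "fa (Suc m) H = K" if "K \<in> T m" "H \<in> desc K (Suc m)" for m H K
    unfolding fa_def
  proof (rule the_equality)
    show "K \<in> T (Suc m - 1) \<and> H \<subseteq> K" using that descD(2) by simp
    show "K' = K" if "K' \<in> T (Suc m - 1) \<and> H \<subseteq> K'" for K'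
      using that ancestor_unique[OF descD(1)[OF \<open>H \<in> desc K (Suc m)\<close>] _ \<open>K \<in> T m\<close> _ descD(2)[OF \<open>H \<in> desc K (Suc m)\<close>]] by simp
  qed
  \<comment> \<open>The martingale increment of level \<open>j\<close>; for \<open>j = 0\<close> the
    initial value itself counts as increment.\<close>
  define e where "e j w H = mgrad J w H - (if j = 0 then 0 else mgrad J w (fa j H))" for j w H
  define a where "a j w = L2_set (\<lambda>H. sqrt (vol H) * norm (e j w H)) (T j)" for j w
  have asq: "(a j w)\<^sup>2 = (\<Sum>H\<in>T j. vol H * (norm (e j w H))\<^sup>2)" for j w
    unfolding a_def L2_set_def by (simp add: sum_nonneg power_mult_distrib)
  have a0: "(a 0 w)\<^sup>2 = (\<Sum>K\<in>T 0. vol K * (norm (mgrad J w K))\<^sup>2)" for w unfolding asq by (simp add: e_def)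
  have aS: "(a (Suc m) w)\<^sup>2 = (\<Sum>K\<in>T m. fluct J w m K)" for m w
    unfolding asq sum_desc[OF le_SucI[OF order_refl], of _ m] fluct_def e_def using fa by (intro sum.cong) auto
  have ale: "(a j w)\<^sup>2 \<le> (\<Sum>H\<in>T j. vol H * (norm (mgrad J w H))\<^sup>2)" if "j \<le> J" for j w
  proof (cases j)
    case (Suc m)
    have "(a j w)\<^sup>2 \<le> (\<Sum>K\<in>T m. vol K * (norm (mgrad J w K))\<^sup>2 + fluct J w m K)"
      unfolding Suc aS by (intro sum_mono) simp
    also have "\<dots> = (\<Sum>H\<in>T j. vol H * (norm (mgrad J w H))\<^sup>2)"
      unfolding Suc sum_desc[OF le_SucI[OF order_refl], of _ m] using fluct_eq[of _ m] that Suc by (intro sum.cong) auto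
    finally show ?thesis .
  qed (simp add: a0)
  have al: "a j ?u \<le> sqrt Cmean * (\<Sum>k\<in>{j..J}. ?q ^ (k - j) * b k)" if j: "j \<le> J" for j
  proof -
    have "e j ?u H = (\<Sum>k\<le>J. e j (v k) H)" for H
      unfolding e_def mgrad_sum by (cases "j = 0") (auto simp: sum_subtractf)
    then have "a j ?u \<le> (\<Sum>k\<le>J. a j (v k))" unfolding a_def using L2_set_norm_sum_le[of "\<lambda>H. sqrt (vol H)"] by simp
    also have "\<dots> = (\<Sum>k\<in>{j..J}. a j (v k))"
    proof (rule sum.mono_neutral_right)
      show "\<forall>k\<in>{..J} - {j..J}. a j (v k) = 0"
      proof
        fix k assume k: "k \<in> {..J} - {j..J}"
        then obtain m where m: "j = Suc m" "k \<le> m" "m \<le> J" using j by (cases j) auto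
        have vm: "v k \<in> fe_space \<Omega> (T m)" using fe_mono[OF m(2) v] k by auto
        have "e j (v k) H = 0" if H: "H \<in> T j" for H
        proof -
          obtain K where K: "K \<in> T m" "H \<in> desc K (Suc m)" using ancestor[of m "Suc m" H] H m by (auto simp: desc_def)
          have aff: "affine_on K (v k)" using conf_mesh.fe_affine[OF conf vm K(1)] .
          have "mgrad J (v k) K = gr (v k) K" using mgrad_affine[OF K(1) m(3) aff] .
          moreover have "mgrad J (v k) H = gr (v k) H"
            using mgrad_affine[OF H j affine_on_subset[OF aff descD(2)[OF K(2)]]] .
          moreover have "gr (v k) H = gr (v k) K" using gr_affine_subset[OF fullT[OF K(1)] fullT[OF H] descD(2)[OF K(2)] aff] .
          ultimately show ?thesis unfolding e_def m(1) using fa[OF K] by simp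
        qed
        then show "a j (v k) = 0" unfolding a_def L2_set_def by simp
      qed
    qed auto
    also have "\<dots> \<le> (\<Sum>k\<in>{j..J}. sqrt Cmean * (?q ^ (k - j) * b k))"
    proof (rule sum_mono)
      fix k assume k: "k \<in> {j..J}"
      have vk: "v k \<in> fe_space \<Omega> (T k)" using v k by auto
      have "(a j (v k))\<^sup>2 \<le> (\<Sum>H\<in>T j. vol H * (norm (mgrad k (v k) H))\<^sup>2)"
        using ale[OF j, of "v k"] mgrad_level[OF _ _ _ vk, of _ j J] k by simp
      also have "\<dots> \<le> Cmean * ((1/2) ^ (k - j) * 4 ^ k * (L2_norm \<Omega> (v k))\<^sup>2)"
        using k by (intro mean_gradient_le vk) auto
      also have "\<dots> = (sqrt Cmean * (?q ^ (k - j) * b k))\<^sup>2"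
        using Cmean_nonneg by (simp add: b_def power_mult_distrib two_power_sq q2 del: real_sqrt_divide)
      finally show "a j (v k) \<le> sqrt Cmean * (?q ^ (k - j) * b k)"
        by (rule power2_le_imp_le) (simp add: b_def Cmean_nonneg L2_norm_nonneg)
    qed
    finally show ?thesis by (simp add: sum_distrib_left)
  qed
  have "(\<Sum>K\<in>T J. vol K * (norm (gr ?u K))\<^sup>2) = (\<Sum>K\<in>T J. vol K * (norm (mgrad J ?u K))\<^sup>2)"
    by (intro sum.cong) (auto simp: mgrad_top)
  also have "\<dots> = (\<Sum>j\<le>J. (a j ?u)\<^sup>2)"
    unfolding martingale_energy[of J J ?u, OF order_refl] aS[symmetric] a0[symmetric]
    using sum.lessThan_Suc_shift[of "\<lambda>j. (a j ?u)\<^sup>2" J] by (simp add: lessThan_Suc_atMost)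
  also have "\<dots> \<le> (sqrt Cmean / (1 - ?q))\<^sup>2 * (\<Sum>k\<le>J. (b k)\<^sup>2)"
    by (rule young_geometric[OF q _ _ al]) (use Cmean_nonneg in \<open>auto simp: a_def\<close>)
  also have "(\<Sum>k\<le>J. (b k)\<^sup>2) = (\<Sum>k\<le>J. 4 ^ k * (L2_norm \<Omega> (v k))\<^sup>2)"
    unfolding b_def by (simp add: power_mult_distrib two_power_sq)
  finally show ?thesis .
qed

end

section \<open>Neighbouring cells\<close>

lemma ramp_lipschitz: "\<bar>min 1 (max 0 s) - min 1 (max 0 t)\<bar> \<le> \<bar>s - (t::real)\<bar>"
  by (auto simp: min_def max_def)

lemma lipschitz_prod_mset:
  fixes \<psi> :: "'b => 'a::real_normed_vector => real"
  assumes "\<And>s. \<exists>M. M-lipschitz_on UNIV (\<psi> s)" "\<And>s x. 0 \<le> \<psi> s x" "\<And>s x. \<psi> s x \<le> 1"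
  shows "\<exists>M. M-lipschitz_on UNIV (\<lambda>x. \<Prod>s\<in>#N. \<psi> s x)"
proof (induction N)
  case empty
  have "0-lipschitz_on UNIV (\<lambda>x::'a. 1::real)" by (intro lipschitz_onI) auto
  then show ?case by auto
next
  case (add s N)
  let ?P = "\<lambda>x. \<Prod>s\<in>#N. \<psi> s x"
  have P: "0 \<le> ?P x \<and> ?P x \<le> 1" for x
  proof (induction N)
    case (add s N)
    then show ?case using assms(2,3) by (simp add: mult_le_one)
  qed simp
  obtain A B where A: "A-lipschitz_on UNIV (\<psi> s)" and B: "B-lipschitz_on UNIV ?P" using assms(1) add.IH by blast
  have "(A * 1 + 1 * B)-lipschitz_on UNIV (\<lambda>x. \<psi> s x * ?P x)"
    using P assms by (intro lipschitz_on_mult_bounded A B) auto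
  then show ?case by auto
qed

context graded_meshes begin

abbreviation facet_nb :: "nat => 'a set => 'a => 'a set => bool" where
  "facet_nb j \<equiv> conf_mesh.facet_nb (T j)"

text \<open>The product of the hat functions of the corners of the common facet is supported on the two cells.
  It is written with functions that are affine on either side of the facet and continuous across it.\<close>

lemma flux_facet:
  assumes nb: "facet_nb j K a H" and jJ: "j \<le> J" and L: "L-lipschitz_on UNIV w"
    and aff: "\<And>\<rho>. \<rho> \<in> desc K J ==> affine_on \<rho> w" "\<And>\<rho>. \<rho> \<in> desc H J ==> affine_on \<rho> w"
    and ms: "set_mset ms = corners K - {a}"
  shows "flux J K w ms v + flux J H w ms v = 0"
proof -
  interpret M: conf_mesh \<Omega> "T j" by (rule conf)
  obtain a' where a': "facet_nb j H a' K" "a' \<notin> corners K" "a \<notin> corners H" "corners H - {a'} = corners K - {a}"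
    using M.facet_nb_apex[OF nb] .
  have t: "K \<in> T j" "H \<in> T j" "H \<noteq> K" "a \<in> corners K" "a' \<in> corners H"
    using nb a'(1) by (auto simp: M.facet_nb_def)
  note fs = fullT[OF t(1)] fullT[OF t(2)]
  note la = M.lam_facet_nb[OF nb a'(1,4)]
  \<comment> \<open>Chosen so that the coordinate of \<open>s\<close> in \<open>H\<close> is that in
    \<open>K\<close> plus a multiple of \<open>lam K a\<close>, which vanishes on the common
    facet.\<close>
  define c where "c s = - lam K s a' / lam K a a'" for s
  have cs: "lam H s x = lam K s x + c s * lam K a x" if s: "s \<in> corners K - {a}" for s x
  proof -
    have s': "s \<in> corners H" "s \<noteq> a'" using s a'(2,4) by auto
    have "lam K s x = (\<Sum>q\<in>corners H. lam H q x * lam K s q)"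
      using lam_sum[OF finite_corners[OF fs(2)] lam_sum_1[OF fs(2)], of K s x] lam_sum_x[OF fs(2), of x] by simp
    also have "\<dots> = (\<Sum>q\<in>corners H. (if q = s then lam H s x else 0) + (if q = a' then lam H a' x * lam K s a' else 0))"
    proof (intro sum.cong refl)
      fix q assume q: "q \<in> corners H"
      have "q \<noteq> a' ==> q \<in> corners K" using q a'(4) by blast
      then show "lam H q x * lam K s q = (if q = s then lam H s x else 0) + (if q = a' then lam H a' x * lam K s a' else 0)"
        using lam_corner[OF fs(1), of s q] s s' by auto
    qed
    also have "\<dots> = lam H s x + lam H a' x * lam K s a'"
      using s' t finite_corners[OF fs(2)] by (simp add: sum.distrib)
    finally show ?thesis using la(1)[of x] la(2) by (simp add: c_def field_simps)
  qed
  \<comment> \<open>\<open>min 0\<close> switches between the two affine branches at the facet.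
    Clamping to the interval from 0 to 1 changes nothing on the two cells and makes the product
    vanish outside them.\<close>
  define \<psi> where "\<psi> s x = min 1 (max 0 (lam K s x + c s * min 0 (lam K a x)))" for s x
  define \<phi> where "\<phi> x = (\<Prod>s\<in>#ms. \<psi> s x)" for x
  have "\<exists>M. M-lipschitz_on UNIV (\<psi> s)" for s
  proof (intro exI lipschitz_onI)
    fix x y
    have "\<bar>\<psi> s x - \<psi> s y\<bar> \<le> \<bar>(lam K s x + c s * min 0 (lam K a x)) - (lam K s y + c s * min 0 (lam K a y))\<bar>"
      unfolding \<psi>_def by (rule ramp_lipschitz)
    also have "\<dots> \<le> \<bar>lam K s x - lam K s y\<bar> + \<bar>c s * (min 0 (lam K a x) - min 0 (lam K a y))\<bar>"
      using abs_triangle_ineq[of "lam K s x - lam K s y" "c s * (min 0 (lam K a x) - min 0 (lam K a y))"]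
      by (simp add: algebra_simps)
    also have "\<bar>lam K s x - lam K s y\<bar> \<le> norm (bg K s) * norm (x - y)"
      unfolding lam_diff by (rule Cauchy_Schwarz_ineq2)
    also have "\<bar>c s * (min 0 (lam K a x) - min 0 (lam K a y))\<bar> \<le> \<bar>c s\<bar> * \<bar>lam K a x - lam K a y\<bar>"
      unfolding abs_mult by (intro mult_left_mono) auto
    also have "\<bar>c s\<bar> * \<bar>lam K a x - lam K a y\<bar> \<le> \<bar>c s\<bar> * (norm (bg K a) * norm (x - y))"
      unfolding lam_diff by (intro mult_left_mono Cauchy_Schwarz_ineq2) simp
    finally show "dist (\<psi> s x) (\<psi> s y) \<le> (norm (bg K s) + \<bar>c s\<bar> * norm (bg K a)) * dist x y"
      by (simp add: dist_norm algebra_simps)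
  qed simp
  then obtain Lk where Lk: "Lk-lipschitz_on UNIV \<phi>"
    unfolding \<phi>_def using lipschitz_prod_mset[of \<psi> ms] by (auto simp: \<psi>_def)
  have inK: "\<phi> x = bmono K ms x" if x: "x \<in> K" for x
    unfolding \<phi>_def bmono_def
  proof (intro arg_cong[where f=prod_mset] image_mset_cong)
    fix s assume "s \<in># ms"
    then have s: "s \<in> corners K" using ms by auto
    show "\<psi> s x = lam K s x"
      using x s t mem_simplex_iff[OF fs(1), of x] lam_le_1[OF fs(1) x s] by (simp add: \<psi>_def)
  qed
  have inH: "\<phi> x = bmono H ms x" if x: "x \<in> H" for x
    unfolding \<phi>_def bmono_def
  proof (intro arg_cong[where f=prod_mset] image_mset_cong)
    fix s assume "s \<in># ms"
    then have s: "s \<in> corners K - {a}" "s \<in> corners H" using ms a'(4) by auto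
    have "lam H a' x \<ge> 0" using x t mem_simplex_iff[OF fs(2), of x] by simp
    then have "lam K a x \<le> 0" unfolding la(1)[of x] using la(2) by (simp add: mult_nonneg_nonpos)
    then show "\<psi> s x = lam H s x"
      using bspec[OF iffD1[OF mem_simplex_iff[OF fs(2)] x] s(2)] lam_le_1[OF fs(2) x s(2)] cs[OF s(1), of x] by (simp add: \<psi>_def)
  qed
  have out: "\<phi> x = 0" if x: "x \<notin> K" "x \<notin> H" for x
  proof (rule ccontr)
    assume "\<phi> x \<noteq> 0"
    then have pos: "lam K s x + c s * min 0 (lam K a x) > 0" if "s \<in> corners K - {a}" for s
    proof -
      have "\<psi> s x \<noteq> 0" using \<open>\<phi> x \<noteq> 0\<close> that unfolding ms[symmetric] \<phi>_def by (force simp: prod_mset_zero_iff)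
      then show ?thesis by (rule contrapos_np) (simp add: \<psi>_def)
    qed
    show False
    proof (cases "lam K a x \<ge> 0")
      case True
      have "lam K s x \<ge> 0" if "s \<in> corners K" for s
        using pos[of s] True that by (cases "s = a") auto
      then show False using mem_simplex_iff[OF fs(1)] x by blast
    next
      case False
      have "lam H s x \<ge> 0" if s: "s \<in> corners H" for s
      proof (cases "s = a'")
        case True
        show ?thesis using False la(1)[of x] la(2) True by (simp add: zero_le_mult_iff)
      next
        case n: False
        then have "s \<in> corners K - {a}" using s a'(4) by auto
        from pos[OF this] cs[OF this, of x] False show ?thesis by simp
      qed
      then show False using mem_simplex_iff[OF fs(2)] x by blast
    qed
  qed
  obtain R where R: "\<forall>x\<in>K \<union> H. norm x \<le> R"
    using bounded_Un[of K H] bounded_fs[OF fs(1)] bounded_fs[OF fs(2)] unfolding bounded_iff by blast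
  have supp: "\<phi> x = 0" if "x \<notin> cball 0 R" for x using out[of x] R that by fastforce
  obtain Lk' where Lk': "Lk'-lipschitz_on UNIV (\<lambda>x. w x * \<phi> x)"
    using M.lipschitz_mult_compact_support[OF L Lk supp] by blast
  have wc: "continuous_on S w" for S using lipschitz_continuous[OF L] .
  have fd: "AE x in lebesgue. x \<in> interior K \<longrightarrow> ((\<lambda>t. w (x + t *\<^sub>R v) * bmono K ms (x + t *\<^sub>R v)) has_real_derivative fluxd J K w (bmono K ms) (dbmono K ms) v x) (at 0)"
    "AE x in lebesgue. x \<in> interior H \<longrightarrow> ((\<lambda>t. w (x + t *\<^sub>R v) * bmono H ms (x + t *\<^sub>R v)) has_real_derivative fluxd J H w (bmono H ms) (dbmono H ms) v x) (at 0)"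
    by (rule fluxd_derivative[OF t(1) jJ aff(1) weight_bmono] fluxd_derivative[OF t(2) jJ aff(2) weight_bmono]; assumption)+
  let ?D = "\<lambda>x. indicator K x * fluxd J K w (bmono K ms) (dbmono K ms) v x + indicator H x * fluxd J H w (bmono H ms) (dbmono H ms) v x"
  have "AE x in lebesgue. ((\<lambda>t. w (x + t *\<^sub>R v) * \<phi> (x + t *\<^sub>R v)) has_real_derivative ?D x) (at 0)"
    using fd AE_notin_frontier[OF fs(1)] AE_notin_frontier[OF fs(2)]
  proof eventually_elim
    case (elim x)
    consider "x \<in> interior K" "x \<notin> H" | "x \<in> interior H" "x \<notin> K" | "x \<in> - (K \<union> H)"
      using elim(3,4) M.interior_unique[OF t(1,2), of x] M.interior_unique[OF t(2,1), of x] t(3) closure_subset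
      by (auto simp: frontier_def)
    then show ?case
    proof cases
      case 1
      have d: "((\<lambda>t. w (x + t *\<^sub>R v) * bmono K ms (x + t *\<^sub>R v)) has_real_derivative ?D x) (at 0)"
        using elim(1) 1 interior_subset[of K] by (auto simp: indicator_def)
      show ?thesis
        by (rule DERIV_line_cong[OF open_interior 1(1) _ d, where f="\<lambda>y. w y * \<phi> y"]) (use inK interior_subset in auto)
    next
      case 2
      have d: "((\<lambda>t. w (x + t *\<^sub>R v) * bmono H ms (x + t *\<^sub>R v)) has_real_derivative ?D x) (at 0)"
        using elim(2) 2 interior_subset[of H] by (auto simp: indicator_def)
      show ?thesis
        by (rule DERIV_line_cong[OF open_interior 2(1) _ d, where f="\<lambda>y. w y * \<phi> y"]) (use inH interior_subset in auto)
    next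
      case 3
      have o: "open (- (K \<union> H))" using closed_fs[OF fs(1)] closed_fs[OF fs(2)] by blast
      have d: "((\<lambda>t. 0) has_real_derivative ?D x) (at 0)" using 3 by simp
      show ?thesis
        by (rule DERIV_line_cong[OF o 3 _ d, where f="\<lambda>y. w y * \<phi> y"]) (use out in auto)
    qed
  qed
  from lipschitz_directional_integral_zero[OF Lk' _ this, of R]
  have "(LINT x|lebesgue. ?D x) = 0" using supp by simp
  moreover have "(LINT x|lebesgue. ?D x) = flux J K w ms v + flux J H w ms v"
    using int_on_fluxd[OF t(1) jJ wc weight_bmono] int_on_fluxd[OF t(2) jJ wc weight_bmono] by (simp add: intg_on_def int_on_def)
  ultimately show ?thesis by simp
qed

lemma flux_diff:
  assumes K: "K \<in> T j" and w: "continuous_on K w1" "continuous_on K w2"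
  shows "flux J K (\<lambda>x. w1 x - w2 x) ms v = flux J K w1 ms v - flux J K w2 ms v"
proof -
  have i: "intg_on K (\<lambda>x. w x * dbmono K ms x v)" if "continuous_on K w" for w
    using that by (intro intg_on_continuous compact_fs fullT[OF K] continuous_intros dbmono_continuous)
  show ?thesis
    using int_on_diff[OF i[OF w(1)] i[OF w(2)]]
    by (simp add: gflux_def gr_diff inner_diff_left left_diff_distrib sum_subtractf)
qed

lemma int_on_dbmono:
  assumes K: "K \<in> T j" and w: "continuous_on K w"
  shows "int_on K (\<lambda>x. w x * dbmono K ms x v) = (\<Sum>s\<in>#ms. (bg K s \<bullet> v) * int_on K (\<lambda>x. w x * bmono K (ms - {#s#}) x))"
proof -
  note cp = compact_fs[OF fullT[OF K]]
  have "intg_on K (\<lambda>x. \<Sum>s\<in>#A. c s * (w x * bmono K (N s) x)) \<and>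
    int_on K (\<lambda>x. \<Sum>s\<in>#A. c s * (w x * bmono K (N s) x)) = (\<Sum>s\<in>#A. c s * int_on K (\<lambda>x. w x * bmono K (N s) x))" for A c N
  proof (induction A)
    case empty
    show ?case by (simp add: intg_on_def int_on_def)
  next
    case (add s A)
    have "intg_on K (\<lambda>x. c s * (w x * bmono K (N s) x))"
      by (intro intg_on_continuous cp continuous_intros w bmono_continuous)
    then show ?case using intg_on_add[OF _ conjunct1[OF add]] int_on_add[OF _ conjunct1[OF add]] add by (simp add: int_on_cmult)
  qed
  from conjunct2[OF this] have "int_on K (\<lambda>x. \<Sum>s\<in>#ms. (bg K s \<bullet> v) * (w x * bmono K (ms - {#s#}) x))
    = (\<Sum>s\<in>#ms. (bg K s \<bullet> v) * int_on K (\<lambda>x. w x * bmono K (ms - {#s#}) x))" .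
  then show ?thesis by (simp only: dbmono_def sum_mset_distrib_left mult.left_commute)
qed

lemma abs_sum_mset_le:
  fixes f :: "'b => real"
  assumes "\<And>s. s \<in># A ==> \<bar>f s\<bar> \<le> B" shows "\<bar>\<Sum>s\<in>#A. f s\<bar> \<le> real (size A) * B"
  using assms
proof (induction A)
  case (add s A)
  have "\<bar>f s\<bar> \<le> B" "\<bar>\<Sum>s\<in>#A. f s\<bar> \<le> real (size A) * B" using add by auto
  then show ?case using abs_triangle_ineq[of "f s" "\<Sum>s\<in>#A. f s"] by (simp add: distrib_right)
qed simp

section \<open>Flux deviations and facet values\<close>

definition Kflux :: "nat => real" where
  "Kflux n = real n * \<kappa> * h1 * (1 + real (n * Suc n) * \<kappa>)"

lemma Kflux_nonneg: "Kflux n \<ge> 0"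
  using kappa_pos h1_pos by (simp add: Kflux_def)

text \<open>The gradient part is an oscillation against a Lipschitz weight, the remaining part a
  combination of moments of \<open>u - meanaff\<close>.\<close>

lemma flux_deviation:
  assumes K: "K \<in> T j" "j \<le> J" and u: "u \<in> fe_space \<Omega> (T J)" and ms: "set_mset ms \<subseteq> corners K"
    and v: "norm v \<le> \<rho> * diameter K"
  shows "\<bar>flux J K (\<lambda>x. u x - meanaff J u K x) ms v\<bar> \<le> \<rho> * Kflux (size ms) * (sqrt (vol K) * osc J u j K)"
proof -
  let ?e = "\<lambda>x. u x - meanaff J u K x" and ?n = "size ms" and ?G = "\<kappa> / diameter K"
  let ?V = "sqrt (vol K) * osc J u j K"
  note fs = fullT[OF K(1)]
  have V0: "?V \<ge> 0" using osc_nonneg by simp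
  have Gv: "?G * norm v \<le> \<kappa> * \<rho>" using v diameter_pos[OF K(1)] kappa_pos by (simp add: pos_divide_le_eq mult_left_mono mult.assoc)
  have ec: "continuous_on K ?e"
    by (rule piecewise_continuous[OF piecewise_diff[OF piecewise_fe[OF u K(1)] piecewise_meanaff]])
  have "(\<Sum>H\<in>desc K J. (gr ?e H \<bullet> v) * int_on H (bmono K ms)) = (\<Sum>H\<in>desc K J. ((gr u H - mgrad J u K) \<bullet> v) * int_on H (bmono K ms))"
    by (intro sum.cong refl) (subst gr_diff, subst gr_meanaff, auto intro: fullT descD(1))
  also have "\<bar>\<dots>\<bar> \<le> (real ?n * ?G) * h1 * norm v * ?V"
    using bmono_lipschitz[OF fs ms _ _ norm_bg_le_diam[OF K(1)]] kappa_pos diameter_pos[OF K(1)]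
    by (intro oscillation[OF K bmono_continuous]) auto
  also have "\<dots> = real ?n * h1 * ?V * (?G * norm v)" by simp
  also have "\<dots> \<le> real ?n * h1 * ?V * (\<kappa> * \<rho>)"
    using Gv V0 h1_pos by (intro mult_left_mono) auto
  finally have 1: "\<bar>\<Sum>H\<in>desc K J. (gr ?e H \<bullet> v) * int_on H (bmono K ms)\<bar> \<le> real ?n * h1 * ?V * (\<kappa> * \<rho>)" .
  have kr: "\<kappa> * \<rho> \<ge> 0" using Gv kappa_pos diameter_pos[OF K(1)] by (meson divide_nonneg_pos less_imp_le mult_nonneg_nonneg norm_ge_zero order_trans)
  have 2: "\<bar>int_on K (\<lambda>x. ?e x * dbmono K ms x v)\<bar> \<le> real ?n * ((\<kappa> * \<rho>) * (real (?n * Suc ?n) * (\<kappa> * h1 * ?V)))"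
    unfolding int_on_dbmono[OF K(1) ec]
  proof (rule abs_sum_mset_le)
    fix s assume s: "s \<in># ms"
    have "\<bar>bg K s \<bullet> v\<bar> \<le> norm (bg K s) * norm v" by (rule Cauchy_Schwarz_ineq2)
    also have "\<dots> \<le> ?G * norm v" using norm_bg_le_diam[OF K(1), of s] s ms by (intro mult_right_mono) auto
    finally have a: "\<bar>bg K s \<bullet> v\<bar> \<le> \<kappa> * \<rho>" using Gv by simp
    have "\<bar>int_on K (\<lambda>x. ?e x * bmono K (ms - {#s#}) x)\<bar> \<le> real (size (ms - {#s#}) * Suc (size (ms - {#s#}))) * (\<kappa> * h1 * ?V)"
      using ms by (intro moment_small[OF K u]) (auto dest: in_diffD)
    also have "\<dots> \<le> real (?n * Suc ?n) * (\<kappa> * h1 * ?V)"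
      using V0 kappa_pos h1_pos size_mset_mono[of "ms - {#s#}" ms] by (intro mult_right_mono of_nat_mono mult_le_mono) auto
    finally show "\<bar>(bg K s \<bullet> v) * int_on K (\<lambda>x. ?e x * bmono K (ms - {#s#}) x)\<bar> \<le> (\<kappa> * \<rho>) * (real (?n * Suc ?n) * (\<kappa> * h1 * ?V))"
      unfolding abs_mult using a kr by (intro mult_mono) auto
  qed
  have "\<bar>flux J K ?e ms v\<bar> \<le> real ?n * h1 * ?V * (\<kappa> * \<rho>) + real ?n * ((\<kappa> * \<rho>) * (real (?n * Suc ?n) * (\<kappa> * h1 * ?V)))"
    unfolding gflux_def using 1 2 by linarith
  also have "\<dots> = \<rho> * Kflux ?n * ?V" by (simp add: Kflux_def algebra_simps)
  finally show ?thesis .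
qed

text \<open>Expanded in coordinates, the term of \<open>p\<close> drops out: it is the flux of the
  constant one under a weight that vanishes on the facets opposite to \<open>p\<close> and
  \<open>q\<close>. The other terms follow from exact moments.\<close>

lemma flux_affine:
  assumes K: "K \<in> T j" "j \<le> J" and p: "p \<in> corners K" and ms: "set_mset ms \<subseteq> corners K - {p}" and q: "q \<in># ms"
    and \<delta>: "affine_on K \<delta>"
  shows "flux J K \<delta> ms (q - p)
    = (\<Sum>s\<in>corners K - {p}. \<delta> s * (real (DIM('a) + Suc (size ms)) * int_on K (bmono K (add_mset s ms))))"
proof -
  note fs = fullT[OF K(1)]
  let ?v = "q - p"
  have qp: "q \<in> corners K" "q \<noteq> p" using q ms by auto
  let ?I = "\<lambda>ms. int_on K (\<lambda>x. dbmono K ms x ?v)"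
  have i: "intg_on K f" if "continuous_on K f" for f using that by (intro intg_on_continuous compact_fs fs)
  have add: "?I (add_mset s ms) = (bg K s \<bullet> ?v) * int_on K (bmono K ms) + int_on K (\<lambda>x. lam K s x * dbmono K ms x ?v)" for s
    unfolding dbmono_add
    by (subst int_on_add) (auto simp: int_on_cmult intro!: i continuous_intros bmono_continuous dbmono_continuous continuous_on_lam)
  have "(\<Sum>H\<in>desc K J. (gr \<delta> H \<bullet> ?v) * int_on H (bmono K ms)) = (gr \<delta> K \<bullet> ?v) * int_on K (bmono K ms)"
  proof -
    have "int_on K (bmono K ms) = (\<Sum>H\<in>desc K J. int_on H (bmono K ms))"
      using compact_fs[OF fullT[OF descD(1)]] by (intro int_on_desc[OF K] intg_on_continuous bmono_continuous) blast
    then show ?thesis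
      using gr_affine_subset[OF fs fullT[OF descD(1)] descD(2) \<delta>] by (simp add: sum_distrib_left)
  qed
  also have "gr \<delta> K \<bullet> ?v = (\<Sum>s\<in>corners K. \<delta> s * (bg K s \<bullet> ?v))" by (simp add: gr_def inner_sum_left)
  finally have g: "(\<Sum>H\<in>desc K J. (gr \<delta> H \<bullet> ?v) * int_on H (bmono K ms))
    = (\<Sum>s\<in>corners K. \<delta> s * ((bg K s \<bullet> ?v) * int_on K (bmono K ms)))" by (simp add: sum_distrib_right mult.assoc)
  have "int_on K (\<lambda>x. \<delta> x * dbmono K ms x ?v) = int_on K (\<lambda>x. \<Sum>s\<in>corners K. \<delta> s * (lam K s x * dbmono K ms x ?v))"
    by (intro int_on_cong) (subst affine_on_lam[OF fs \<delta>], simp_all add: sum_distrib_right sum_distrib_left mult_ac)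
  also have "\<dots> = (\<Sum>s\<in>corners K. \<delta> s * int_on K (\<lambda>x. lam K s x * dbmono K ms x ?v))"
    by (subst int_on_sum) (auto simp: int_on_cmult intro!: i continuous_intros dbmono_continuous continuous_on_lam)
  finally have "flux J K \<delta> ms ?v = (\<Sum>s\<in>corners K. \<delta> s * ?I (add_mset s ms))"
    unfolding gflux_def g add by (simp add: sum.distrib[symmetric] distrib_left)
  also have "\<dots> = (\<Sum>s\<in>corners K - {p}. \<delta> s * ?I (add_mset s ms))"
  proof -
    have "flux J K (\<lambda>x. 1) (add_mset p ms) ?v = 0"
      using ms q qp p by (intro flux_corners[OF K piecewise_const]) auto
    then have "?I (add_mset p ms) = 0" unfolding gflux_def using gr_const[OF fullT[OF descD(1)]] by simp
    then show ?thesis using finite_corners[OF fs] by (intro sum.mono_neutral_right) auto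
  qed
  also have "\<dots> = (\<Sum>s\<in>corners K - {p}. \<delta> s * (real (DIM('a) + Suc (size ms)) * int_on K (bmono K (add_mset s ms))))"
  proof (intro sum.cong refl arg_cong2[where f=times])
    fix s assume s: "s \<in> corners K - {p}"
    let ?N = "add_mset s ms"
    have "?I ?N = (\<Sum>r\<in>#?N. (bg K r \<bullet> ?v) * int_on K (bmono K (?N - {#r#})))"
      using int_on_dbmono[OF K(1) continuous_on_const[of K 1]] by simp
    also have "\<dots> = (\<Sum>r\<in>#?N. if r = q then int_on K (bmono K (?N - {#q#})) else 0)"
    proof (intro arg_cong[where f=sum_mset] image_mset_cong)
      fix r assume "r \<in># ?N"
      then have r: "r \<in> corners K" "r \<noteq> p" using s ms by auto
      have "bg K r \<bullet> ?v = (if r = q then 1 else 0)"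
        unfolding lam_diff[symmetric] using lam_corner[OF fs r(1) qp(1)] lam_corner[OF fs r(1) p] r(2) by auto
      then show "(bg K r \<bullet> ?v) * int_on K (bmono K (?N - {#r#})) = (if r = q then int_on K (bmono K (?N - {#q#})) else 0)" by simp
    qed
    also have "\<dots> = real (count ?N q) * int_on K (bmono K (?N - {#q#}))" by (simp only: sum_mset_delta) simp
    also have "\<dots> = real (DIM('a) + Suc (size ms)) * int_on K (bmono K ?N)"
      using q s ms by (intro moment_exact[OF K(1), of q ?N, symmetric, simplified size_add_mset]) auto
    finally show "?I ?N = real (DIM('a) + Suc (size ms)) * int_on K (bmono K ?N)" .
  qed
  finally show ?thesis .
qed

definition Cfac :: real where "Cfac = real (2 * DIM('a) + 1) * real (2 * DIM('a)) ^ DIM('a)"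

lemma Cfac_pos: "Cfac > 0"
  by (simp add: Cfac_def)

text \<open>Removing one corner from the monomial multiplies its integral by the dimension plus the
  degree, which is at most twice the dimension.\<close>

lemma bubble_lower:
  assumes K: "K \<in> T j" and S: "S \<subseteq> corners K" "card S \<le> DIM('a)"
  shows "vol K \<le> real (2 * DIM('a)) ^ card S * int_on K (bmono K (mset_set S))"
proof -
  have "finite S" using S(1) finite_corners[OF fullT[OF K]] finite_subset by blast
  then show ?thesis using S
  proof (induction S)
    case empty
    show ?case using int_on_const[OF lmeasurable_fs[OF fullT[OF K]], of 1] by (simp add: bmono_def[abs_def])
  next
    case (insert p S)
    have "real (DIM('a) + Suc (card S)) * int_on K (bmono K (mset_set (insert p S))) = int_on K (bmono K (mset_set S))"
      using moment_exact[OF K, of p "mset_set (insert p S)"] insert.hyps insert.prems by simp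
    moreover have "real (DIM('a) + Suc (card S)) * int_on K (bmono K (mset_set (insert p S)))
      \<le> real (2 * DIM('a)) * int_on K (bmono K (mset_set (insert p S)))"
      using insert bmono_bounds(1)[OF fullT[OF K], of "mset_set (insert p S)"]
      by (intro mult_right_mono int_on_nonneg) auto
    ultimately have "int_on K (bmono K (mset_set S)) \<le> real (2 * DIM('a)) * int_on K (bmono K (mset_set (insert p S)))" by simp
    then have "real (2 * DIM('a)) ^ card S * int_on K (bmono K (mset_set S))
      \<le> real (2 * DIM('a)) ^ card S * (real (2 * DIM('a)) * int_on K (bmono K (mset_set (insert p S))))"
      by (intro mult_left_mono) auto
    from order_trans[OF insert.IH this]
    show ?case using insert.hyps insert.prems by (simp add: mult_ac power_mult_distrib)
  qed
qed

text \<open>Up to a positive factor, the flux with the weight of \<open>q\<close> is \<open>\<delta> q + 2 * (\<Sum>s. \<delta> s)\<close>, the sum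
  extending over the corners of the facet.\<close>

lemma facet_value:
  assumes K: "K \<in> T j" "j \<le> J" and p: "p \<in> corners K" and \<delta>: "affine_on K \<delta>" and q0: "q0 \<in> corners K - {p}"
    and R: "\<And>q. q \<in> corners K - {p} ==> \<bar>flux J K \<delta> (add_mset q (mset_set (corners K - {p}))) (q0 - p)\<bar> \<le> R"
    and q: "q \<in> corners K - {p}"
  shows "\<bar>\<delta> q\<bar> \<le> Cfac * R / vol K"
proof -
  note fs = fullT[OF K(1)]
  let ?F = "corners K - {p}" and ?d = "real DIM('a)"
  let ?M = "mset_set ?F"
  have fF: "finite ?F" using finite_corners[OF fs] by simp
  have cF: "card ?F = DIM('a)" using card_corners[OF fs] p finite_corners[OF fs] by simp
  have d: "?d > 0" by simp
  \<comment> \<open>The common value of the integrals of the facet bubble times one more coordinate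
    of the facet: multiplicity 2 over dimension plus degree, \<open>2 * ?d + 1\<close>.\<close>
  define X where "X = 2 * int_on K (bmono K ?M) / (2 * ?d + 1)"
  have M: "vol K \<le> real (2 * DIM('a)) ^ DIM('a) * int_on K (bmono K ?M)"
    using bubble_lower[OF K(1), of ?F] cF by simp
  then have M0: "int_on K (bmono K ?M) > 0"
    using vol_pos[OF K(1)] by (smt (verit) mult_nonneg_nonpos of_nat_0_le_iff zero_le_power)
  have X0: "X > 0" using M0 by (simp add: X_def)
  have one: "int_on K (bmono K (add_mset q ?M)) = X" if q: "q \<in> ?F" for q
  proof -
    have "real (DIM('a) + size (add_mset q ?M)) * int_on K (bmono K (add_mset q ?M)) = real (count (add_mset q ?M) q) * int_on K (bmono K (add_mset q ?M - {#q#}))"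
      using q fF by (intro moment_exact[OF K(1)]) auto
    then show ?thesis using q fF cF by (simp add: X_def field_simps)
  qed
  have two: "real (DIM('a) + Suc (size (add_mset q ?M))) * int_on K (bmono K (add_mset s (add_mset q ?M))) = (2 + (if s = q then 1 else 0)) * X"
    if q: "q \<in> ?F" and s: "s \<in> ?F" for q s
  proof -
    have "real (DIM('a) + size (add_mset s (add_mset q ?M))) * int_on K (bmono K (add_mset s (add_mset q ?M)))
      = real (count (add_mset s (add_mset q ?M)) s) * int_on K (bmono K (add_mset s (add_mset q ?M) - {#s#}))"
      using q s fF by (intro moment_exact[OF K(1)]) auto
    then show ?thesis using q s fF one[OF q] by simp
  qed
  define S where "S = (\<Sum>s\<in>?F. \<delta> s)"
  have flx: "flux J K \<delta> (add_mset q ?M) (q0 - p) = X * (\<delta> q + 2 * S)" if q: "q \<in> ?F" for q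
  proof -
    have "flux J K \<delta> (add_mset q ?M) (q0 - p)
      = (\<Sum>s\<in>?F. \<delta> s * (real (DIM('a) + Suc (size (add_mset q ?M))) * int_on K (bmono K (add_mset s (add_mset q ?M)))))"
      using q q0 fF by (intro flux_affine[OF K p _ _ \<delta>]) auto
    also have "\<dots> = (\<Sum>s\<in>?F. 2 * X * \<delta> s + (if s = q then X * \<delta> q else 0))"
      by (intro sum.cong refl) (simp only: two[OF q], simp add: algebra_simps)
    also have "\<dots> = X * (\<delta> q + 2 * S)" using q fF by (simp add: sum.distrib S_def sum_distrib_left algebra_simps)
    finally show ?thesis .
  qed
  have b: "\<bar>\<delta> q + 2 * S\<bar> \<le> R / X" if "q \<in> ?F" for q
    using R[OF that] X0 unfolding flx[OF that] abs_mult by (simp add: pos_le_divide_eq mult.commute)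
  have RX: "R / X \<ge> 0" using b[OF q] by linarith
  \<comment> \<open>Summation over the corners of the facet isolates \<open>S\<close>; with
    \<open>S\<close> bounded each single value follows.\<close>
  have "(\<Sum>q\<in>?F. \<delta> q + 2 * S) = (2 * ?d + 1) * S" by (simp add: sum.distrib cF S_def algebra_simps)
  moreover have "\<bar>\<Sum>q\<in>?F. \<delta> q + 2 * S\<bar> \<le> (\<Sum>q\<in>?F. R / X)" by (intro order_trans[OF sum_abs] sum_mono b)
  ultimately have "(2 * ?d + 1) * \<bar>S\<bar> \<le> ?d * (R / X)" using cF by (simp add: abs_mult)
  moreover have "2 * ?d * \<bar>S\<bar> \<le> (2 * ?d + 1) * \<bar>S\<bar>" by (intro mult_right_mono) auto
  ultimately have "?d * (2 * \<bar>S\<bar>) \<le> ?d * (R / X)" by linarith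
  then have "2 * \<bar>S\<bar> \<le> R / X" using d by (subst (asm) mult_le_cancel_left_pos) auto
  then have "\<bar>\<delta> q\<bar> \<le> 2 * (R / X)" using b[OF q] by linarith
  also have "\<dots> = (2 * ?d + 1) * R / int_on K (bmono K ?M)" using M0 by (simp add: X_def field_simps)
  also have "\<dots> \<le> (2 * ?d + 1) * R / (vol K / real (2 * DIM('a)) ^ DIM('a))"
  proof (rule divide_left_mono)
    show "vol K / real (2 * DIM('a)) ^ DIM('a) \<le> int_on K (bmono K ?M)" using M by (simp add: field_simps)
    have "R \<ge> 0" using RX X0 by (simp add: zero_le_divide_iff)
    then show "0 \<le> (2 * ?d + 1) * R" by simp
    show "0 < int_on K (bmono K ?M) * (vol K / real (2 * DIM('a)) ^ DIM('a))" using M0 vol_pos[OF K(1)] by simp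
  qed
  also have "\<dots> = Cfac * R / vol K" by (simp add: Cfac_def)
  finally show ?thesis .
qed

text \<open>In dimension at least two a facet has an edge. It belongs to both cells, and by shape
  regularity its length is at least \<open>diameter K / \<kappa>\<close>.\<close>

lemma facet_diameter:
  assumes "facet_nb j K a H" shows "diameter K \<le> \<kappa> * diameter H"
proof -
  interpret M: conf_mesh \<Omega> "T j" by (rule conf)
  have t: "K \<in> T j" "H \<in> T j" "a \<in> corners K" "corners K - {a} \<subseteq> corners H" using assms by (auto simp: M.facet_nb_def)
  note fs = fullT[OF t(1)] fullT[OF t(2)]
  have "card (corners K - {a}) \<ge> 2" using card_corners[OF fs(1)] t finite_corners[OF fs(1)] dim by simp
  then obtain p q where pq: "p \<in> corners K - {a}" "q \<in> corners K - {a}" "p \<noteq> q"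
    using card_le_Suc0_iff_eq[OF finite_Diff[OF finite_corners[OF fs(1)]], of "{a}"] by (auto simp del: Diff_iff)
  have "1 = bg K p \<bullet> (p - q)" unfolding lam_diff[symmetric] using lam_corner[OF fs(1), of p] pq by simp
  also have "\<dots> \<le> norm (bg K p) * norm (p - q)" by (rule norm_cauchy_schwarz)
  also have "\<dots> \<le> \<kappa> / diameter K * diameter H"
    using norm_bg_le_diam[OF t(1), of p] pq t(4) corners_subset diameter_bounded_bound[OF bounded_fs[OF fs(2)], of p q]
      kappa_pos diameter_pos[OF t(1)] by (intro mult_mono) (auto simp: dist_norm)
  finally show ?thesis using diameter_pos[OF t(1)] by (simp add: field_simps)
qed

definition Cnb :: real where "Cnb = Cvol * \<kappa> ^ DIM('a) / cvol"

lemma Cnb_pos: "Cnb > 0"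
  using Cvol_pos cvol_pos kappa_pos by (simp add: Cnb_def)

lemma facet_vol:
  assumes "facet_nb j K a H" shows "vol K \<le> Cnb * vol H"
proof -
  interpret M: conf_mesh \<Omega> "T j" by (rule conf)
  have t: "K \<in> T j" "H \<in> T j" using assms by (auto simp: M.facet_nb_def)
  have "vol K \<le> Cvol * diameter K ^ DIM('a)" by (rule vol_le[OF t(1)])
  also have "\<dots> \<le> Cvol * (\<kappa> * diameter H) ^ DIM('a)"
    using facet_diameter[OF assms] Cvol_pos diameter_pos[OF t(1)] by (intro mult_left_mono power_mono) auto
  also have "\<dots> = Cnb * (cvol * diameter H ^ DIM('a))" using cvol_pos by (simp add: Cnb_def power_mult_distrib)
  also have "\<dots> \<le> Cnb * vol H" using vol_ge[OF t(2)] Cnb_pos by (intro mult_left_mono) auto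
  finally show ?thesis .
qed

definition Ccross :: real where
  "Ccross = Cfac * Kflux (Suc DIM('a)) * (1 + \<kappa> * Cnb)"

lemma Ccross_nonneg: "Ccross \<ge> 0"
  using Cfac_pos Kflux_nonneg kappa_pos Cnb_pos by (simp add: Ccross_def)

text \<open>\<open>osc\<close> scales like an \<open>L2\<close> norm over the cell; division by the
  root of the volume gives the scale of point values.\<close>

definition rosc :: "nat => ('a => real) => nat => 'a set => real" where
  "rosc J u j K = osc J u j K / sqrt (vol K)"

lemma rosc_nonneg: "0 \<le> rosc J u j K"
  using osc_nonneg by (simp add: rosc_def)

lemma sqrt_vol_osc: "K \<in> T j ==> sqrt (vol K) * osc J u i K = vol K * rosc J u i K"
  using vol_pos[of K j] by (simp add: rosc_def field_simps)

text \<open>\<open>u\<close> and the affine function of \<open>H\<close> are both continuous across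
  the facet, so for each of them the fluxes over the two cells cancel. Hence the flux of the
  difference of the two affine functions over \<open>K\<close> consists of deviations of
  \<open>u\<close> from its local approximations, and \<open>facet_value\<close> turns it into point
  values.\<close>

lemma crossing:
  assumes nb: "facet_nb j K a H" and jJ: "j \<le> J" and u: "u \<in> fe_space \<Omega> (T J)" and q: "q \<in> corners K - {a}"
  shows "\<bar>meanaff J u K q - meanaff J u H q\<bar> \<le> Ccross * (rosc J u j K + rosc J u j H)"
proof -
  interpret M: conf_mesh \<Omega> "T j" by (rule conf)
  obtain a' where a': "facet_nb j H a' K" "corners H - {a'} = corners K - {a}" using M.facet_nb_apex[OF nb] by metis
  have t: "K \<in> T j" "H \<in> T j" "a \<in> corners K" using nb by (auto simp: M.facet_nb_def)
  note fs = fullT[OF t(1)] fullT[OF t(2)]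
  let ?F = "corners K - {a}" and ?v = "q - a"
  let ?B = "meanaff J u K" and ?B' = "meanaff J u H" and ?n = "Suc DIM('a)"
  have fF: "finite ?F" using finite_corners[OF fs(1)] by simp
  have cF: "card ?F = DIM('a)" using card_corners[OF fs(1)] t finite_corners[OF fs(1)] by simp
  obtain L L' where L: "L-lipschitz_on UNIV u" "L'-lipschitz_on UNIV ?B'"
    using conf_mesh.fe_lipschitz[OF conf u] lipschitz_meanaff by metis
  have c: "continuous_on S u" "continuous_on S ?B'" "continuous_on S ?B" for S
    using lipschitz_continuous[OF L(1)] lipschitz_continuous[OF L(2)] affine_on_continuous[OF affine_meanaff] by auto
  have v: "norm ?v \<le> 1 * diameter K" "norm ?v \<le> \<kappa> * diameter H"
    using corner_edge_le[OF fs(1), of q a] q t facet_diameter[OF nb] by auto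
  let ?R = "Kflux ?n * (vol K * rosc J u j K + \<kappa> * (vol H * rosc J u j H))"
  have "\<bar>flux J K (\<lambda>x. ?B x - ?B' x) (add_mset s (mset_set ?F)) ?v\<bar> \<le> ?R" if s: "s \<in> ?F" for s
  proof -
    let ?N = "add_mset s (mset_set ?F)"
    have N: "set_mset ?N = ?F" "set_mset ?N \<subseteq> corners K" "set_mset ?N \<subseteq> corners H" "size ?N = ?n"
      using s fF cF a'(2) by auto
    have "flux J K u ?N ?v + flux J H u ?N ?v = 0"
      using conf_mesh.fe_affine[OF conf u descD(1)] by (intro flux_facet[OF nb jJ L(1) _ _ N(1)]) auto
    moreover have "flux J K ?B' ?N ?v + flux J H ?B' ?N ?v = 0"
      by (intro flux_facet[OF nb jJ L(2) _ _ N(1)] affine_meanaff)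
    ultimately have "flux J K (\<lambda>x. ?B x - ?B' x) ?N ?v = - flux J K (\<lambda>x. u x - ?B x) ?N ?v - flux J H (\<lambda>x. u x - ?B' x) ?N ?v"
      using flux_diff[OF t(1) c(3,2)] flux_diff[OF t(1) c(1,3)] flux_diff[OF t(2) c(1,2)] by simp
    moreover have "\<bar>flux J K (\<lambda>x. u x - ?B x) ?N ?v\<bar> \<le> 1 * Kflux (size ?N) * (sqrt (vol K) * osc J u j K)"
      by (rule flux_deviation[OF t(1) jJ u N(2) v(1)])
    moreover have "\<bar>flux J H (\<lambda>x. u x - ?B' x) ?N ?v\<bar> \<le> \<kappa> * Kflux (size ?N) * (sqrt (vol H) * osc J u j H)"
      by (rule flux_deviation[OF t(2) jJ u N(3) v(2)])
    ultimately have "\<bar>flux J K (\<lambda>x. ?B x - ?B' x) ?N ?v\<bar>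
      \<le> 1 * Kflux (size ?N) * (sqrt (vol K) * osc J u j K) + \<kappa> * Kflux (size ?N) * (sqrt (vol H) * osc J u j H)" by linarith
    then show ?thesis unfolding N(4) sqrt_vol_osc[OF t(1)] sqrt_vol_osc[OF t(2)] by (simp add: algebra_simps)
  qed
  from facet_value[OF t(1) jJ t(3) affine_on_diff[OF affine_meanaff affine_meanaff] q this q]
  have "\<bar>?B q - ?B' q\<bar> \<le> Cfac * ?R / vol K" .
  also have "\<dots> = Cfac * Kflux ?n * (rosc J u j K + \<kappa> * (vol H / vol K * rosc J u j H))"
    using vol_pos[OF t(1)] by (simp add: field_simps)
  also have "\<dots> \<le> Cfac * Kflux ?n * (rosc J u j K + \<kappa> * (Cnb * rosc J u j H))"
  proof -
    have "vol H / vol K \<le> Cnb" using facet_vol[OF a'(1)] vol_pos[OF t(1)] by (simp add: pos_divide_le_eq)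
    then show ?thesis using Cfac_pos Kflux_nonneg kappa_pos rosc_nonneg by (intro mult_left_mono add_left_mono mult_right_mono) auto
  qed
  also have "\<dots> \<le> Cfac * Kflux ?n * ((1 + \<kappa> * Cnb) * (rosc J u j K + rosc J u j H))"
    using Cfac_pos Kflux_nonneg kappa_pos Cnb_pos rosc_nonneg by (intro mult_left_mono) (auto simp: algebra_simps)
  finally show ?thesis by (simp add: Ccross_def mult_ac)
qed

text \<open>\<open>u\<close> vanishes on a boundary facet, so its flux over the single cell is zero;
  this replaces the cancellation across an inner facet.\<close>

lemma crossing_boundary:
  assumes bf: "conf_mesh.boundary_facet (T j) K a" and jJ: "j \<le> J" and u: "u \<in> fe_space \<Omega> (T J)" and q: "q \<in> corners K - {a}"
  shows "\<bar>meanaff J u K q\<bar> \<le> Ccross * rosc J u j K"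
proof -
  interpret M: conf_mesh \<Omega> "T j" by (rule conf)
  have t: "K \<in> T j" "a \<in> corners K" using bf by (auto simp: M.boundary_facet_def)
  note fs = fullT[OF t(1)]
  let ?F = "corners K - {a}" and ?v = "q - a" and ?B = "meanaff J u K" and ?n = "Suc DIM('a)"
  have fF: "finite ?F" using finite_corners[OF fs] by simp
  have cF: "card ?F = DIM('a)" using card_corners[OF fs] t finite_corners[OF fs] by simp
  have c: "continuous_on K u" "continuous_on K ?B"
    using piecewise_continuous[OF piecewise_fe[OF u t(1)]] affine_on_continuous[OF affine_meanaff] by auto
  have v: "norm ?v \<le> 1 * diameter K" using corner_edge_le[OF fs, of q a] q t by auto
  have "\<bar>flux J K ?B (add_mset s (mset_set ?F)) ?v\<bar> \<le> Kflux ?n * (vol K * rosc J u j K)" if s: "s \<in> ?F" for s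
  proof -
    let ?N = "add_mset s (mset_set ?F)"
    have N: "set_mset ?N \<subseteq> corners K" "size ?N = ?n" "q \<in># ?N" using s q fF cF by auto
    have "flux J K u ?N ?v = 0"
    proof (rule gflux_edge[OF t(1) jJ piecewise_fe[OF u t(1)] t(2) _ _ weight_bmono])
      fix x assume x: "x \<in> K" "lam K a x = 0 \<or> lam K q x = 0"
      show "u x * bmono K ?N x = 0"
      proof (cases "lam K a x = 0")
        case True
        then have "x \<notin> \<Omega>" using M.boundary_facet_outside[OF bf x(1)] by blast
        then show ?thesis using conf_mesh.fe_zero[OF conf u] by simp
      next
        case False
        then show ?thesis using x(2) bmono_add[of K q "?N - {#q#}" x] insert_DiffM[OF N(3)] by simp
      qed
    qed (use q in auto)
    then have "flux J K ?B ?N ?v = - flux J K (\<lambda>x. u x - ?B x) ?N ?v"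
      using flux_diff[OF t(1) c] by simp
    moreover have "\<bar>flux J K (\<lambda>x. u x - ?B x) ?N ?v\<bar> \<le> 1 * Kflux (size ?N) * (sqrt (vol K) * osc J u j K)"
      by (rule flux_deviation[OF t(1) jJ u N(1) v])
    ultimately show ?thesis unfolding N(2) sqrt_vol_osc[OF t(1)] by simp
  qed
  from facet_value[OF t(1) jJ t(2) affine_meanaff q this q]
  have "\<bar>?B q\<bar> \<le> Cfac * (Kflux ?n * (vol K * rosc J u j K)) / vol K" .
  also have "\<dots> = Cfac * Kflux ?n * 1 * rosc J u j K" using vol_pos[OF t(1)] by simp
  also have "\<dots> \<le> Ccross * rosc J u j K"
    unfolding Ccross_def using Cfac_pos Kflux_nonneg kappa_pos Cnb_pos rosc_nonneg by (intro mult_right_mono mult_left_mono) auto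
  finally show ?thesis .
qed

end

section \<open>Quasi-interpolation\<close>

text \<open>A chain can be taken no longer than the number of related pairs. This crude count is the
  source of the squares of \<open>Nst\<close> and \<open>Cson\<close> below.\<close>

lemma rtrancl_bounded:
  assumes "(a, b) \<in> R\<^sup>*" "R \<subseteq> S \<times> S" "finite S" "real (card S) \<le> N"
  obtains n where "(a, b) \<in> R ^^ n" "real n \<le> N\<^sup>2"
proof -
  have fR: "finite R" using assms(2,3) finite_subset by blast
  obtain n where n: "(a, b) \<in> R ^^ n" "n \<le> card R" using assms(1) unfolding rtrancl_finite_eq_relpow[OF fR] by blast
  have "card R \<le> card S * card S" using card_mono[OF _ assms(2)] assms(3) by (simp add: card_cartesian_product)
  then have "real n \<le> real (card S) * real (card S)" using n(2) by (simp add: of_nat_mult[symmetric] del: of_nat_mult)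
  also have "\<dots> \<le> N * N" using assms(4) by (intro mult_mono) auto
  finally show ?thesis using that n(1) by (simp add: power2_eq_square)
qed

text \<open>Otherwise the sets reachable from \<open>H\<close> and the remaining ones would have
  disjoint closed unions.\<close>

lemma connected_cover_chain:
  assumes "connected (\<Union>D)" "finite D" "\<And>\<rho>. \<rho> \<in> D ==> closed \<rho> \<and> \<rho> \<noteq> {}" "H \<in> D" "H' \<in> D"
  shows "(H, H') \<in> {(\<rho>, \<rho>'). \<rho> \<in> D \<and> \<rho>' \<in> D \<and> \<rho> \<inter> \<rho>' \<noteq> {}}\<^sup>*"
proof (rule ccontr)
  define R where "R = {(\<rho>, \<rho>'). \<rho> \<in> D \<and> \<rho>' \<in> D \<and> \<rho> \<inter> \<rho>' \<noteq> {}}"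
  define X where "X = {\<rho> \<in> D. (H, \<rho>) \<in> R\<^sup>*}"
  assume "(H, H') \<notin> {(\<rho>, \<rho>'). \<rho> \<in> D \<and> \<rho>' \<in> D \<and> \<rho> \<inter> \<rho>' \<noteq> {}}\<^sup>*"
  then have s: "H \<in> X" "H' \<in> D - X" using assms(4,5) unfolding X_def R_def[symmetric] by auto
  have X: "\<rho>' \<in> X" if "\<rho> \<in> X" "\<rho>' \<in> D" "x \<in> \<rho>" "x \<in> \<rho>'" for \<rho> \<rho>' x
  proof -
    have "(\<rho>, \<rho>') \<in> R" using that unfolding R_def X_def by blast
    then show ?thesis using that rtrancl_into_rtrancl[of H \<rho> R \<rho>'] unfolding X_def by blast
  qed
  have "closed (\<Union>X)" "closed (\<Union>(D - X))"
    using assms(2,3) finite_subset[of X D] unfolding X_def by (auto intro!: closed_Union)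
  moreover have "\<Union>X \<inter> \<Union>(D - X) \<inter> \<Union>D = {}" using X by blast
  moreover have "\<Union>D \<subseteq> \<Union>X \<union> \<Union>(D - X)" by blast
  ultimately have "\<Union>X \<inter> \<Union>D = {} \<or> \<Union>(D - X) \<inter> \<Union>D = {}" using connected_closedD[OF assms(1)] by blast
  moreover have "H \<noteq> {}" "H' \<noteq> {}" using assms(3-5) by auto
  ultimately show False using s assms(4) by blast
qed

context graded_meshes begin

definition Nst :: real where "Nst = vol (ball (0::'a) 1) * DIM('a) / \<theta>"

lemma card_star: "real (card {K \<in> T k. p \<in> corners K}) \<le> Nst"
proof -
  let ?F = "{K \<in> T k. p \<in> corners K}"
  have "real (card ?F) * (\<theta> / DIM('a)) \<le> vol (ball (0::'a) 1)"
  proof (rule card_star_le[where p=p])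
    fix H K assume st: "H \<in> ?F" "K \<in> ?F" "H \<noteq> K"
    show "interior H \<inter> interior K = {}"
    proof (rule ccontr)
      assume "interior H \<inter> interior K \<noteq> {}"
      then obtain x where "x \<in> interior H" "x \<in> interior K" by blast
      then show False using same_cell[of H k K x] interior_subset st by blast
    qed
  qed (use finiteT fullT angle angle_pos in auto)
  then show ?thesis using angle_pos by (simp add: Nst_def pos_le_divide_eq field_simps)
qed

lemma Nst_nonneg: "Nst \<ge> 0"
  using angle_pos by (simp add: Nst_def)

definition Cm :: real where "Cm = max 1 Cnb"

text \<open>Bounds the volume ratio along a chain of at most \<open>Nst\<^sup>2\<close> steps; a
  real power because \<open>Nst\<close> need not be an integer.\<close>

definition Kst :: real where "Kst = Cm powr Nst\<^sup>2"

lemma Cm_ge_1: "Cm \<ge> 1" and Kst_ge_1: "Kst \<ge> 1"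
  by (auto simp: Cm_def Kst_def intro!: ge_one_powr_ge_zero)

lemma osc_le_star_sum:
  assumes "H \<in> T k" "P H" shows "osc J u i H \<le> (\<Sum>K'\<in>{K' \<in> T k. P K'}. osc J u i K')"
  using assms finiteT osc_nonneg by (intro member_le_sum) auto

lemma sqrt_vol_rosc:
  assumes "vol K \<le> Lk * vol H" "H \<in> T k" shows "sqrt (vol K) * rosc J u i H \<le> sqrt Lk * osc J u i H"
proof -
  have "sqrt (vol K) \<le> sqrt Lk * sqrt (vol H)" using real_sqrt_le_mono[OF assms(1)] by (simp add: real_sqrt_mult)
  then have "sqrt (vol K) * rosc J u i H \<le> sqrt Lk * sqrt (vol H) * rosc J u i H"
    using rosc_nonneg by (intro mult_right_mono)
  then show ?thesis using vol_pos[OF assms(2)] by (simp add: rosc_def)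
qed

text \<open>Every step crosses a facet with \<open>q\<close> among its corners, so
  \<open>crossing\<close> applies. Volumes stay comparable along the chain, so that
  \<open>rosc\<close> on any member, weighted with the volume of the first cell, is again bounded by
  \<open>osc\<close>.\<close>

lemma star_chain_le:
  assumes K: "K \<in> T k" "q \<in> corners K" and k: "k \<le> J" and u: "u \<in> fe_space \<Omega> (T J)"
    and R: "(K, H) \<in> (conf_mesh.star_rel (T k) q)\<^sup>*"
  shows "H \<in> T k" "q \<in> corners H" "vol K \<le> Kst * vol H"
    "sqrt (vol K) * \<bar>meanaff J u K q - meanaff J u H q\<bar>
      \<le> Nst\<^sup>2 * (2 * Ccross * sqrt Kst) * (\<Sum>K'\<in>{K' \<in> T k. q \<in> corners K'}. osc J u k K')"
proof -
  interpret M: conf_mesh \<Omega> "T k" by (rule conf)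
  let ?S = "{K' \<in> T k. q \<in> corners K'}" and ?B = "\<lambda>K. meanaff J u K q"
  let ?W = "\<Sum>K'\<in>?S. osc J u k K'"
  have W0: "?W \<ge> 0" by (intro sum_nonneg osc_nonneg)
  have step: "\<exists>a. facet_nb k \<rho> a \<rho>' \<and> q \<in> corners \<rho> - {a} \<and> \<rho>' \<in> T k \<and> q \<in> corners \<rho>'"
    if "(\<rho>, \<rho>') \<in> M.star_rel q" for \<rho> \<rho>'
  proof -
    from that obtain a where a: "facet_nb k \<rho> a \<rho>'" "lam \<rho> a q = 0" unfolding M.star_rel_def by blast
    have m: "\<rho> \<in> T k" "\<rho>' \<in> T k" "q \<in> \<rho>" "q \<in> \<rho>'" using M.star_rel_Image[OF that] by auto
    then have "q \<in> corners \<rho>" "q \<in> corners \<rho>'" using M.corner_common[OF _ K(1) _ K(2)] by auto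
    moreover have "q \<noteq> a" using a(2) by (auto simp: lam_def)
    ultimately show ?thesis using a m by blast
  qed
  have "M.star_rel q \<subseteq> ?S \<times> ?S"
  proof (rule subrelI)
    fix \<rho> \<rho>' assume r: "(\<rho>, \<rho>') \<in> M.star_rel q"
    then show "(\<rho>, \<rho>') \<in> ?S \<times> ?S" using step[OF r] M.star_rel_Image(1)[OF r] by auto
  qed
  then obtain n where n: "(K, H) \<in> M.star_rel q ^^ n" "real n \<le> Nst\<^sup>2"
    using rtrancl_bounded[OF R _ _ card_star[of k q]] finiteT by auto
  have "real n \<le> Nst\<^sup>2 ==> H \<in> ?S \<and> vol K \<le> Cm ^ n * vol H \<and>
      sqrt (vol K) * \<bar>?B K - ?B H\<bar> \<le> real n * (2 * Ccross * sqrt Kst) * ?W"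
    using n(1)
  proof (induction n arbitrary: H)
    case 0 then show ?case using K by simp
  next
    case (Suc n)
    from Suc.prems(2) obtain \<rho> where \<rho>: "(K, \<rho>) \<in> M.star_rel q ^^ n" "(\<rho>, H) \<in> M.star_rel q" by auto
    from step[OF \<rho>(2)] obtain a where a: "facet_nb k \<rho> a H" "q \<in> corners \<rho> - {a}" "H \<in> ?S" by blast
    have IH: "\<rho> \<in> ?S" "vol K \<le> Cm ^ n * vol \<rho>"
      "sqrt (vol K) * \<bar>?B K - ?B \<rho>\<bar> \<le> real n * (2 * Ccross * sqrt Kst) * ?W"
      using Suc.IH[OF _ \<rho>(1)] Suc.prems(1) by auto
    have pw: "Cm ^ i \<le> Kst" if "real i \<le> Nst\<^sup>2" for i
      unfolding Kst_def using Cm_ge_1 that powr_mono[of "real i" "Nst\<^sup>2" Cm] by (simp add: powr_realpow)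
    have "Cnb * vol H \<le> Cm * vol H" unfolding Cm_def by (intro mult_right_mono) auto
    then have "vol \<rho> \<le> Cm * vol H" using facet_vol[OF a(1)] by linarith
    then have "vol K \<le> Cm ^ n * (Cm * vol H)"
      using order_trans[OF IH(2) mult_left_mono] Cm_ge_1 by simp
    then have vs: "vol K \<le> Cm ^ Suc n * vol H" by (simp add: mult_ac)
    have r: "sqrt (vol K) * rosc J u k \<rho>' \<le> sqrt Kst * ?W" if "\<rho>' \<in> ?S" "vol K \<le> Cm ^ i * vol \<rho>'" "real i \<le> Nst\<^sup>2" for \<rho>' i
    proof -
      have "vol K \<le> Kst * vol \<rho>'" using that(2) mult_right_mono[OF pw[OF that(3)], of "vol \<rho>'"] by simp
      then have "sqrt (vol K) * rosc J u k \<rho>' \<le> sqrt Kst * osc J u k \<rho>'" using that(1) by (intro sqrt_vol_rosc) auto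
      also have "\<dots> \<le> sqrt Kst * ?W" using that(1) Kst_ge_1 osc_le_star_sum[of \<rho>' k] by (intro mult_left_mono) auto
      finally show ?thesis .
    qed
    have "sqrt (vol K) * \<bar>?B \<rho> - ?B H\<bar> \<le> sqrt (vol K) * (Ccross * (rosc J u k \<rho> + rosc J u k H))"
      by (intro mult_left_mono crossing[OF a(1) k u a(2)]) auto
    also have "\<dots> = Ccross * (sqrt (vol K) * rosc J u k \<rho> + sqrt (vol K) * rosc J u k H)" by (simp add: algebra_simps)
    also have "\<dots> \<le> Ccross * (sqrt Kst * ?W + sqrt Kst * ?W)"
      using IH vs a(3) Suc.prems(1) Ccross_nonneg by (intro mult_left_mono add_mono r[of _ n] r[of _ "Suc n"]) auto
    finally have "sqrt (vol K) * \<bar>?B \<rho> - ?B H\<bar> \<le> 2 * Ccross * sqrt Kst * ?W" by simp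
    moreover have "sqrt (vol K) * \<bar>?B K - ?B H\<bar> \<le> sqrt (vol K) * \<bar>?B K - ?B \<rho>\<bar> + sqrt (vol K) * \<bar>?B \<rho> - ?B H\<bar>"
      unfolding distrib_left[symmetric] by (intro mult_left_mono) auto
    ultimately show ?case using IH(3) vs a(3) by (simp add: distrib_right)
  qed
  from this[OF n(2)] have s: "H \<in> ?S" "vol K \<le> Cm ^ n * vol H"
    and b: "sqrt (vol K) * \<bar>?B K - ?B H\<bar> \<le> real n * (2 * Ccross * sqrt Kst) * ?W" by auto
  show "H \<in> T k" "q \<in> corners H" using s by auto
  have "Cm ^ n \<le> Kst"
    unfolding Kst_def using Cm_ge_1 n(2) powr_mono[of "real n" "Nst\<^sup>2" Cm] by (simp add: powr_realpow)
  then show "vol K \<le> Kst * vol H" using s(2) mult_right_mono[of "Cm ^ n" Kst "vol H"] by simp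
  have "real n * (2 * Ccross * sqrt Kst * ?W) \<le> Nst\<^sup>2 * (2 * Ccross * sqrt Kst * ?W)"
    using n(2) Ccross_nonneg Kst_ge_1 W0 by (intro mult_right_mono) auto
  then show "sqrt (vol K) * \<bar>?B K - ?B H\<bar> \<le> Nst\<^sup>2 * (2 * Ccross * sqrt Kst) * ?W" using b by (simp add: mult_ac)
qed

definition node_val :: "nat => ('a => real) => nat => 'a => real" where
  "node_val J u k q = (if q \<in> \<Omega> then meanaff J u (SOME K. K \<in> T k \<and> q \<in> K) q else 0)"

definition Cnode :: real where "Cnode = Nst\<^sup>2 * (2 * Ccross * sqrt Kst) + Ccross * sqrt Kst"

lemma Cnode_nonneg: "Cnode \<ge> 0"
  using Ccross_nonneg Kst_ge_1 by (simp add: Cnode_def)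

text \<open>The two cases of \<open>star_chain\<close>: a chain to a boundary facet at
  \<open>q\<close>, where the nodal value is zero, or a chain to the cell that
  \<open>node_val\<close> has chosen.\<close>

lemma node_val_le:
  assumes K: "K \<in> T k" "q \<in> corners K" and k: "k \<le> J" and u: "u \<in> fe_space \<Omega> (T J)"
  shows "sqrt (vol K) * \<bar>meanaff J u K q - node_val J u k q\<bar> \<le> Cnode * (\<Sum>K'\<in>{K' \<in> T k. q \<in> corners K'}. osc J u k K')"
proof -
  interpret M: conf_mesh \<Omega> "T k" by (rule conf)
  let ?S = "{K' \<in> T k. q \<in> corners K'}" and ?B = "\<lambda>K. meanaff J u K q"
  let ?W = "\<Sum>K'\<in>?S. osc J u k K'"
  have W0: "?W \<ge> 0" by (intro sum_nonneg osc_nonneg)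
  have qK: "q \<in> K" using corners_subset[OF K(2)] .
  from M.star_chain[OF dim K(1) qK] show ?thesis
  proof (elim disjE exE conjE)
    fix H a assume R: "(K, H) \<in> (M.star_rel q)\<^sup>*" and bf: "M.boundary_facet H a" and l: "lam H a q = 0"
    note ch = star_chain_le[OF K k u R]
    have "q \<notin> \<Omega>" using M.boundary_facet_outside[OF bf _ l] corners_subset[OF ch(2)] by blast
    then have v: "node_val J u k q = 0" by (simp add: node_val_def)
    have "q \<in> corners H - {a}" using ch(2) l by (auto simp: lam_def)
    from mult_left_mono[OF crossing_boundary[OF bf k u this], of "sqrt (vol K)"]
    have "sqrt (vol K) * \<bar>?B H\<bar> \<le> Ccross * (sqrt (vol K) * rosc J u k H)" by (simp add: mult_ac)
    also have "\<dots> \<le> Ccross * (sqrt Kst * ?W)"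
      using ch Kst_ge_1 osc_le_star_sum[of H k "\<lambda>K. q \<in> corners K" J u k]
      by (intro mult_left_mono Ccross_nonneg order_trans[OF sqrt_vol_rosc]) auto
    moreover have "sqrt (vol K) * \<bar>?B K\<bar> \<le> sqrt (vol K) * \<bar>?B K - ?B H\<bar> + sqrt (vol K) * \<bar>?B H\<bar>"
      unfolding distrib_left[symmetric] by (intro mult_left_mono) auto
    ultimately show ?thesis using ch(4) v by (simp add: Cnode_def distrib_right)
  next
    assume q: "q \<in> \<Omega>" and all: "\<forall>H\<in>T k. q \<in> H \<longrightarrow> (K, H) \<in> (M.star_rel q)\<^sup>*"
    let ?H = "SOME H. H \<in> T k \<and> q \<in> H"
    have "?H \<in> T k \<and> q \<in> ?H" by (rule someI[of _ K]) (use K qK in blast)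
    then have "(K, ?H) \<in> (M.star_rel q)\<^sup>*" using all by blast
    note ch = star_chain_le(4)[OF K k u this]
    have "Nst\<^sup>2 * (2 * Ccross * sqrt Kst) * ?W \<le> Cnode * ?W"
      unfolding Cnode_def using Ccross_nonneg Kst_ge_1 W0 by (intro mult_right_mono) auto
    then show ?thesis using ch q by (simp add: node_val_def)
  qed
qed

section \<open>Increments of the quasi-interpolant\<close>

lemma osc_mono:
  assumes "K \<in> T j" "H \<in> desc K (Suc j)" shows "osc J u (Suc j) H \<le> osc J u j K"
proof -
  have "osc J u (Suc j) H \<le> (\<Sum>m\<in>{Suc j..<J}. (1/2) ^ m * sqrt (\<Sum>K'\<in>desc K m. fluct J u m K'))"
    unfolding osc_def using descD(2)[OF assms(2)]
    by (intro sum_mono mult_left_mono real_sqrt_le_mono sum_mono2 finite_desc fluct_nonneg) (auto simp: desc_def)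
  also have "\<dots> \<le> osc J u j K"
    unfolding osc_def by (intro sum_mono2) (auto intro!: mult_nonneg_nonneg sum_nonneg fluct_nonneg)
  finally show ?thesis .
qed

lemma card_sons:
  assumes "K \<in> T j" shows "real (card (desc K (Suc j))) \<le> Cson"
proof -
  have "real (card (desc K (Suc j))) * (vol K / Cson) \<le> (\<Sum>H\<in>desc K (Suc j). vol H)"
    using son_vol[OF assms descD] Cson_pos by (intro sum_bounded_below) (simp add: pos_divide_le_eq mult.commute)
  also have "\<dots> = vol K" using vol_desc[OF assms, of "Suc j"] by simp
  finally show ?thesis using vol_pos[OF assms] Cson_pos by (simp add: field_simps)
qed

definition qi :: "nat => ('a => real) => nat => 'a => real" where
  "qi J u k = nodal_interp \<Omega> (T k) (node_val J u k)"

lemma qi_fe: "qi J u k \<in> fe_space \<Omega> (T k)"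
  unfolding qi_def by (rule conf_mesh.nodal_interp_fe[OF conf])

lemma qi_corner: "K \<in> T k ==> q \<in> corners K ==> qi J u k q = node_val J u k q"
  unfolding qi_def using conf_mesh.nodal_interp_corner[OF conf] by (simp add: node_val_def)

definition Cstep :: real where "Cstep = 2 * (sqrt Cson * (Cnode * Nst)) + sqrt Cson * h1"
definition Cpath :: real where "Cpath = (2 * Cson\<^sup>2 + 1) * Cstep"
definition Clocal :: real where "Clocal = Cpath + (sqrt Cson * (Cnode * Nst) + Cpath + Cnode)"

lemma Clocal_nonneg: "Clocal \<ge> 0" and Cstep_nonneg: "Cstep \<ge> 0" and Cpath_nonneg: "Cpath \<ge> 0"
  using Cson_pos h1_pos Cnode_nonneg Nst_nonneg by (simp_all add: Clocal_def Cpath_def Cstep_def)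

text \<open>Both quasi-interpolants are compared with the affine function \<open>l\<close> that has
  the mean gradient on \<open>K\<close> and the finer nodal value at \<open>q\<close>. Chains of
  touching sons carry the comparison to all finer nodes in \<open>K\<close>, hence to the affine
  functions of the sons, by integration to that of \<open>K\<close>, and from there to the coarse
  nodal values.\<close>

lemma qi_step:
  assumes K: "K \<in> T j" and j: "j < J" and u: "u \<in> fe_space \<Omega> (T J)"
    and H: "H \<in> desc K (Suc j)" and q: "q \<in> corners H"
  shows "sqrt (vol K) * \<bar>qi J u (Suc j) q - qi J u j q\<bar> \<le> Clocal * (\<Sum>K'\<in>{K' \<in> T j. K' \<inter> K \<noteq> {}}. osc J u j K')"
proof -
  interpret M: conf_mesh \<Omega> "T (Suc j)" by (rule conf)
  interpret M0: conf_mesh \<Omega> "T j" by (rule conf)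
  let ?W = "\<Sum>K'\<in>{K' \<in> T j. K' \<inter> K \<noteq> {}}. osc J u j K'"
  let ?V = "sqrt (vol K)" and ?a = "mgrad J u K" and ?D = "desc K (Suc j)" and ?n = "node_val J u (Suc j)"
  note fs = fullT[OF K]
  have V: "?V > 0" using vol_pos[OF K] by simp
  have W0: "?W \<ge> 0" by (intro sum_nonneg osc_nonneg)
  have jJ: "j \<le> J" "Suc j \<le> J" using j by auto
  have oW: "osc J u j K' \<le> ?W" if "K' \<in> T j" "K' \<inter> K \<noteq> {}" for K'
    using osc_le_star_sum[of K' j "\<lambda>K'. K' \<inter> K \<noteq> {}"] that .
  have KK: "osc J u j K \<le> ?W" using oW[OF K] interior_fs_nonempty[OF fs] interior_subset by blast
  have Vs: "?V \<le> sqrt Cson * sqrt (vol \<rho>)" if "\<rho> \<in> ?D" for \<rho>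
    using real_sqrt_le_mono[OF son_vol[OF K descD[OF that]]] by (simp add: real_sqrt_mult)
  have father_node: "?V * \<bar>meanaff J u K x - node_val J u j x\<bar> \<le> Cnode * ?W" if x: "x \<in> corners K" for x
  proof -
    have "(\<Sum>K'\<in>{K' \<in> T j. x \<in> corners K'}. osc J u j K') \<le> ?W"
    proof (rule sum_mono2)
      show "{K' \<in> T j. x \<in> corners K'} \<subseteq> {K' \<in> T j. K' \<inter> K \<noteq> {}}"
        using corners_subset[of x] x by blast
    qed (auto simp: finiteT osc_nonneg)
    from mult_left_mono[OF this Cnode_nonneg] node_val_le[OF K x jJ(1) u] show ?thesis by linarith
  qed
  have son_node: "?V * \<bar>meanaff J u \<rho> x - ?n x\<bar> \<le> sqrt Cson * (Cnode * Nst) * ?W"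
    if \<rho>: "\<rho> \<in> ?D" and x: "x \<in> corners \<rho>" for \<rho> x
  proof -
    let ?S = "{\<rho>' \<in> T (Suc j). x \<in> corners \<rho>'}"
    have "(\<Sum>\<rho>'\<in>?S. osc J u (Suc j) \<rho>') \<le> real (card ?S) * ?W"
    proof (rule sum_bounded_above)
      fix \<rho>' assume r: "\<rho>' \<in> ?S"
      then obtain K' where K': "K' \<in> T j" "\<rho>' \<subseteq> K'" using father[of \<rho>' j] by blast
      have "x \<in> K' \<inter> K" using r K'(2) descD(2)[OF \<rho>] corners_subset x by blast
      then have "K' \<inter> K \<noteq> {}" by blast
      then show "osc J u (Suc j) \<rho>' \<le> ?W"
        using order_trans[OF osc_mono[OF K'(1)] oW[OF K'(1)], of \<rho>'] K'(2) r by (simp add: desc_def)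
    qed
    also have "\<dots> \<le> Nst * ?W" by (intro mult_right_mono card_star W0)
    finally have "sqrt (vol \<rho>) * \<bar>meanaff J u \<rho> x - ?n x\<bar> \<le> Cnode * (Nst * ?W)"
      using node_val_le[OF descD(1)[OF \<rho>] x jJ(2) u] Cnode_nonneg mult_left_mono order_trans by blast
    from mult_left_mono[OF this, of "sqrt Cson"]
    have "sqrt Cson * sqrt (vol \<rho>) * \<bar>meanaff J u \<rho> x - ?n x\<bar> \<le> sqrt Cson * (Cnode * Nst) * ?W"
      using Cson_pos by (simp add: mult_ac)
    then show ?thesis using mult_right_mono[OF Vs[OF \<rho>], of "\<bar>meanaff J u \<rho> x - ?n x\<bar>"] by simp
  qed
  \<comment> \<open>Either \<open>K\<close> is kept and the gradients agree, or \<open>K\<close> is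
    refined and therefore small, and the change of the mean gradient is part of the
    fluctuation.\<close>
  have grad: "?V * \<bar>(mgrad J u \<rho> - ?a) \<bullet> (x - y)\<bar> \<le> sqrt Cson * h1 * ?W" if \<rho>: "\<rho> \<in> ?D" and xy: "x \<in> \<rho>" "y \<in> \<rho>" for \<rho> x y
  proof (cases "K \<in> T (Suc j)")
    case True
    then have "\<rho> = K" using desc_unrefined[OF K True, of "Suc j"] \<rho> by simp
    then show ?thesis using W0 Cson_pos h1_pos by simp
  next
    case False
    let ?g = "norm (mgrad J u \<rho> - ?a)"
    have "vol \<rho> * ?g\<^sup>2 \<le> fluct J u j K"
      unfolding fluct_def using \<rho> finite_desc by (intro member_le_sum) auto
    from real_sqrt_le_mono[OF this] have g: "sqrt (vol \<rho>) * ?g \<le> sqrt (fluct J u j K)" by (simp add: real_sqrt_mult)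
    have o: "(1/2) ^ j * sqrt (fluct J u j K) \<le> osc J u j K"
    proof -
      have "(1/2) ^ j * sqrt (\<Sum>K'\<in>desc K j. fluct J u j K') \<le> osc J u j K"
        unfolding osc_def using j by (intro member_le_sum) (auto intro!: mult_nonneg_nonneg sum_nonneg fluct_nonneg)
      then show ?thesis by (simp add: desc_self[OF K])
    qed
    have xy': "norm (x - y) \<le> h1 / 2 ^ j"
      using diameter_bounded_bound[OF bounded_fs[OF fs], of x y] subsetD[OF descD(2)[OF \<rho>] xy(1)]
        subsetD[OF descD(2)[OF \<rho>] xy(2)] size_le[OF K False] by (simp add: dist_norm)
    have "?V * \<bar>(mgrad J u \<rho> - ?a) \<bullet> (x - y)\<bar> \<le> (sqrt Cson * sqrt (vol \<rho>)) * (?g * (h1 / 2 ^ j))"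
      using Vs[OF \<rho>] order_trans[OF Cauchy_Schwarz_ineq2 mult_left_mono[OF xy' norm_ge_zero]] V Cson_pos
      by (intro mult_mono) auto
    also have "\<dots> = sqrt Cson * h1 * ((1/2) ^ j * (sqrt (vol \<rho>) * ?g))" by (simp add: power_divide)
    also have "\<dots> \<le> sqrt Cson * h1 * ((1/2) ^ j * sqrt (fluct J u j K))"
      using g Cson_pos h1_pos by (intro mult_left_mono) auto
    also have "\<dots> \<le> sqrt Cson * h1 * ?W" using o KK Cson_pos h1_pos by (intro mult_left_mono) auto
    finally show ?thesis .
  qed
  \<comment> \<open>Finer nodal values with the slope \<open>?a\<close> removed; they nearly agree
    within each son.\<close>
  let ?h = "\<lambda>x. ?n x - ?a \<bullet> x"
  have same: "?V * \<bar>?h x - ?h y\<bar> \<le> Cstep * ?W" if \<rho>: "\<rho> \<in> ?D" and xy: "x \<in> corners \<rho>" "y \<in> corners \<rho>" for \<rho> x y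
  proof -
    have "?h x - ?h y = (mgrad J u \<rho> - ?a) \<bullet> (x - y) - (meanaff J u \<rho> x - ?n x) + (meanaff J u \<rho> y - ?n y)"
      using meanaff_diff[of J u \<rho> x y] by (simp add: inner_diff_left inner_diff_right)
    then have "\<bar>?h x - ?h y\<bar> \<le> \<bar>(mgrad J u \<rho> - ?a) \<bullet> (x - y)\<bar> + \<bar>meanaff J u \<rho> x - ?n x\<bar> + \<bar>meanaff J u \<rho> y - ?n y\<bar>" by linarith
    from mult_left_mono[OF this less_imp_le[OF V]] show ?thesis
      using grad[OF \<rho> corners_subset[OF xy(1)] corners_subset[OF xy(2)]] son_node[OF \<rho> xy(1)] son_node[OF \<rho> xy(2)]
      by (simp add: Cstep_def algebra_simps)
  qed
  let ?R = "{(\<rho>, \<rho>'). \<rho> \<in> ?D \<and> \<rho>' \<in> ?D \<and> \<rho> \<inter> \<rho>' \<noteq> {}}"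
  have path: "?V * \<bar>?h q - ?h y\<bar> \<le> Cpath * ?W" if \<rho>: "\<rho> \<in> ?D" and y: "y \<in> corners \<rho>" for \<rho> y
  proof -
    obtain n where n: "(H, \<rho>) \<in> ?R ^^ n" "real n \<le> Cson\<^sup>2"
    proof (rule rtrancl_bounded[OF connected_cover_chain[OF _ finite_desc _ H \<rho>] _ finite_desc card_sons[OF K]])
      show "connected (\<Union>?D)" unfolding Union_desc[OF K le_SucI[OF order_refl]] by (rule convex_connected[OF convex_fs[OF fs]])
      show "closed \<rho> \<and> \<rho> \<noteq> {}" if "\<rho> \<in> ?D" for \<rho>
        using closed_fs interior_fs_nonempty fullT[OF descD(1)[OF that]] by fastforce
    qed auto
    have "?V * \<bar>?h q - ?h y\<bar> \<le> (2 * real n + 1) * (Cstep * ?W)"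
      using n(1) \<rho> y
    proof (induction n arbitrary: \<rho> y)
      case 0 then show ?case using same[OF H q] by simp
    next
      case (Suc n)
      from Suc.prems(1) obtain \<rho>' where r: "(H, \<rho>') \<in> ?R ^^ n" "\<rho>' \<in> ?D" "\<rho>' \<inter> \<rho> \<noteq> {}" by auto
      \<comment> \<open>Touching sons share a corner by conformity; the comparison passes through
        it.\<close>
      have "corners \<rho>' \<inter> corners \<rho> \<noteq> {}"
        using M.inter_hull[OF descD(1)[OF r(2)] descD(1)[OF Suc.prems(2)]] r(3) by auto
      then obtain z where z: "z \<in> corners \<rho>'" "z \<in> corners \<rho>" by blast
      have "?V * \<bar>?h q - ?h y\<bar> \<le> ?V * \<bar>?h q - ?h z\<bar> + ?V * \<bar>?h z - ?h y\<bar>"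
        unfolding distrib_left[symmetric] using V by (intro mult_left_mono) auto
      then show ?case
        using Suc.IH[OF r(1,2) z(1)] same[OF Suc.prems(2) z(2) Suc.prems(3)] mult_nonneg_nonneg[OF Cstep_nonneg W0]
        by (simp add: algebra_simps)
    qed
    also have "\<dots> \<le> (2 * Cson\<^sup>2 + 1) * (Cstep * ?W)"
      using n(2) mult_nonneg_nonneg[OF Cstep_nonneg W0] by (intro mult_right_mono) auto
    finally show ?thesis by (simp add: Cpath_def mult_ac)
  qed
  define l where "l x = ?n q + ?a \<bullet> (x - q)" for x
  have la: "affine_on S l" for S
    unfolding affine_on_def l_def by (intro exI[of _ ?a] exI[of _ "?n q - ?a \<bullet> q"]) (simp add: inner_diff_right)
  let ?Y = "sqrt Cson * (Cnode * Nst) + Cpath"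
  have Bl: "\<bar>meanaff J u \<rho> x - l x\<bar> \<le> ?Y * ?W / ?V" if \<rho>: "\<rho> \<in> ?D" and x: "x \<in> \<rho>" for \<rho> x
  proof (rule affine_on_abs_le_corners[OF fullT[OF descD(1)[OF \<rho>]] affine_on_diff[OF affine_meanaff la] x])
    fix y assume y: "y \<in> corners \<rho>"
    have "?n y - l y = ?h y - ?h q" by (simp add: l_def inner_diff_right)
    then have "\<bar>meanaff J u \<rho> y - l y\<bar> \<le> \<bar>meanaff J u \<rho> y - ?n y\<bar> + \<bar>?h q - ?h y\<bar>" by linarith
    from mult_left_mono[OF this less_imp_le[OF V]]
    have "?V * \<bar>meanaff J u \<rho> y - l y\<bar> \<le> ?Y * ?W" using son_node[OF \<rho> y] path[OF \<rho> y] by (simp add: algebra_simps)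
    then show "\<bar>meanaff J u \<rho> y - l y\<bar> \<le> ?Y * ?W / ?V" using V by (simp add: pos_le_divide_eq mult.commute)
  qed
  have uc: "continuous_on S u" for S using conf_mesh.fe_lipschitz[OF conf u] lipschitz_continuous by blast
  have lc: "continuous_on S l" and Bc: "continuous_on S (meanaff J u \<rho>)" for S \<rho>
    using affine_on_continuous[OF la] affine_on_continuous[OF affine_meanaff] by auto
  have Y0: "?Y * ?W / ?V \<ge> 0" using Cson_pos Cnode_nonneg Nst_nonneg Cpath_nonneg W0 by simp
  \<comment> \<open>\<open>u\<close> and its local affine approximation have the same integral over
    every cell of every level, which links sons and father.\<close>
  have tr: "int_on \<rho> (\<lambda>x. u x - l x) = int_on \<rho> (\<lambda>x. meanaff J u \<rho> x - l x)" if "\<rho> \<in> T i" for \<rho> i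
  proof -
    note ig = intg_on_continuous[OF compact_fs[OF fullT[OF that]]]
    have "int_on \<rho> (\<lambda>x. (u x - meanaff J u \<rho> x) + (meanaff J u \<rho> x - l x))
      = int_on \<rho> (\<lambda>x. u x - meanaff J u \<rho> x) + int_on \<rho> (\<lambda>x. meanaff J u \<rho> x - l x)"
      by (intro int_on_add ig continuous_intros uc lc Bc)
    then show ?thesis using int_on_sub_meanaff[OF that uc] by simp
  qed
  have "\<bar>int_on K (\<lambda>x. u x - l x)\<bar> \<le> (\<Sum>\<rho>\<in>?D. \<bar>int_on \<rho> (\<lambda>x. u x - l x)\<bar>)"
  proof -
    have "int_on K (\<lambda>x. u x - l x) = (\<Sum>\<rho>\<in>?D. int_on \<rho> (\<lambda>x. u x - l x))"
      using compact_fs[OF fullT[OF descD(1)]]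
      by (intro int_on_desc[OF K] intg_on_continuous continuous_intros uc lc) auto
    then show ?thesis by (simp add: sum_abs)
  qed
  also have "\<dots> \<le> (\<Sum>\<rho>\<in>?D. (?Y * ?W / ?V) * vol \<rho>)"
  proof (rule sum_mono)
    fix \<rho> assume \<rho>: "\<rho> \<in> ?D"
    show "\<bar>int_on \<rho> (\<lambda>x. u x - l x)\<bar> \<le> (?Y * ?W / ?V) * vol \<rho>"
      unfolding tr[OF descD(1)[OF \<rho>]] by (intro int_on_abs_le lmeasurable_fs fullT[OF descD(1)[OF \<rho>]] Bl[OF \<rho>] Y0)
  qed
  also have "\<dots> = (?Y * ?W / ?V) * vol K" using vol_desc[OF K, of "Suc j"] by (simp add: sum_distrib_left)
  finally have m: "\<bar>int_on K (\<lambda>x. meanaff J u K x - l x)\<bar> \<le> (?Y * ?W / ?V) * vol K" unfolding tr[OF K] .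
  define c where "c = meanaff J u K q - l q"
  \<comment> \<open>Affine functions with equal gradients differ by a constant, which its mean
    controls.\<close>
  have const: "meanaff J u K x - l x = c" for x
    using meanaff_diff[of J u K x q] by (simp add: l_def c_def inner_diff_right)
  have "\<bar>c\<bar> * vol K \<le> (?Y * ?W / ?V) * vol K"
    using m int_on_const[OF lmeasurable_fs[OF fs], of c] vol_pos[OF K] unfolding const by (simp add: abs_mult)
  then have "\<bar>c\<bar> \<le> ?Y * ?W / ?V" by (rule mult_right_le_imp_le) (rule vol_pos[OF K])
  then have fl: "?V * \<bar>meanaff J u K x - l x\<bar> \<le> ?Y * ?W" for x
    unfolding const using V by (simp add: pos_le_divide_eq mult.commute)
  have "\<bar>qi J u j q - l q\<bar> \<le> (?Y + Cnode) * ?W / ?V"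
  proof (rule affine_on_abs_le_corners[OF fs affine_on_diff[OF M0.fe_affine[OF qi_fe K] la]])
    show "q \<in> K" using q corners_subset descD(2)[OF H] by blast
    fix y assume y: "y \<in> corners K"
    have "\<bar>qi J u j y - l y\<bar> \<le> \<bar>meanaff J u K y - node_val J u j y\<bar> + \<bar>meanaff J u K y - l y\<bar>"
      unfolding qi_corner[OF K y] by linarith
    from mult_left_mono[OF this less_imp_le[OF V]]
    have "?V * \<bar>qi J u j y - l y\<bar> \<le> (?Y + Cnode) * ?W" using father_node[OF y] fl[of y] by (simp add: algebra_simps)
    then show "\<bar>qi J u j y - l y\<bar> \<le> (?Y + Cnode) * ?W / ?V" using V by (simp add: pos_le_divide_eq mult.commute)
  qed
  moreover have "l q = qi J u (Suc j) q" using qi_corner[OF descD(1)[OF H] q] by (simp add: l_def)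
  ultimately have "?V * \<bar>qi J u (Suc j) q - qi J u j q\<bar> \<le> (?Y + Cnode) * ?W"
    using V by (simp add: pos_le_divide_eq mult.commute abs_minus_commute)
  also have "\<dots> \<le> Clocal * ?W" unfolding Clocal_def using Cpath_nonneg W0 by (intro mult_right_mono) auto
  finally show ?thesis .
qed

lemma card_touching:
  assumes "K \<in> T j" shows "real (card {K' \<in> T j. K' \<inter> K \<noteq> {}}) \<le> Suc DIM('a) * Nst"
proof -
  interpret M: conf_mesh \<Omega> "T j" by (rule conf)
  let ?S = "\<lambda>p. {K' \<in> T j. p \<in> corners K'}"
  have "{K' \<in> T j. K' \<inter> K \<noteq> {}} \<subseteq> (\<Union>p\<in>corners K. ?S p)"
  proof
    fix K' assume "K' \<in> {K' \<in> T j. K' \<inter> K \<noteq> {}}"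
    then obtain x where "K' \<in> T j" "x \<in> K'" "x \<in> K" by blast
    then have "corners K' \<inter> corners K \<noteq> {}" using M.inter_hull[of K' K] assms by force
    then show "K' \<in> (\<Union>p\<in>corners K. ?S p)" using \<open>K' \<in> T j\<close> by blast
  qed
  then have "card {K' \<in> T j. K' \<inter> K \<noteq> {}} \<le> card (\<Union>p\<in>corners K. ?S p)"
    using finiteT finite_corners[OF fullT[OF assms]] by (intro card_mono) auto
  also have "\<dots> \<le> (\<Sum>p\<in>corners K. card (?S p))" by (rule card_UN_le[OF finite_corners[OF fullT[OF assms]]])
  finally have "real (card {K' \<in> T j. K' \<inter> K \<noteq> {}}) \<le> (\<Sum>p\<in>corners K. real (card (?S p)))"
    by (simp only: of_nat_sum[symmetric] of_nat_le_iff)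
  also have "\<dots> \<le> (\<Sum>p\<in>corners K. Nst)" by (intro sum_mono card_star)
  finally show ?thesis using card_corners[OF fullT[OF assms]] by simp
qed

definition Cqi :: real where "Cqi = Clocal * (Suc DIM('a) * Nst)"

lemma Cqi_nonneg: "Cqi \<ge> 0"
  using Clocal_nonneg Nst_nonneg by (simp add: Cqi_def)

text \<open>Each cell touches a bounded number of cells, so the local bounds are summed with finite
  overlap; the levels in \<open>osc\<close> are then separated by the triangle inequality.\<close>

lemma qi_step_norm:
  assumes j: "j < J" and u: "u \<in> fe_space \<Omega> (T J)"
  shows "L2_norm \<Omega> (\<lambda>x. qi J u (Suc j) x - qi J u j x)
    \<le> Cqi * (\<Sum>m\<in>{j..<J}. (1/2) ^ m * sqrt (\<Sum>K\<in>T m. fluct J u m K))"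
proof -
  interpret M: conf_mesh \<Omega> "T (Suc j)" by (rule conf)
  let ?w = "\<lambda>x. qi J u (Suc j) x - qi J u j x" and ?N = "Suc DIM('a) * Nst"
  let ?S = "\<lambda>K. {K' \<in> T j. K' \<inter> K \<noteq> {}}"
  let ?W = "\<lambda>K. \<Sum>K'\<in>?S K. osc J u j K'"
  have wf: "?w \<in> fe_space \<Omega> (T (Suc j))" by (intro M.fe_diff qi_fe fe_mono[OF _ qi_fe]) simp
  have N0: "?N \<ge> 0" using Nst_nonneg by simp
  have W2: "(?W K)\<^sup>2 \<le> ?N * (\<Sum>K'\<in>?S K. (osc J u j K')\<^sup>2)" if "K \<in> T j" for K
  proof -
    have "(?W K)\<^sup>2 \<le> real (card (?S K)) * (\<Sum>K'\<in>?S K. (osc J u j K')\<^sup>2)"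
      using sum_squared_le_sum_of_squares[of "osc J u j" "?S K"] by (simp add: mult.commute)
    also have "\<dots> \<le> ?N * (\<Sum>K'\<in>?S K. (osc J u j K')\<^sup>2)"
      by (intro mult_right_mono card_touching that sum_nonneg) auto
    finally show ?thesis .
  qed
  have "(L2_norm \<Omega> ?w)\<^sup>2 = (\<Sum>K\<in>T j. \<Sum>H\<in>desc K (Suc j). int_on H (\<lambda>x. (?w x)\<^sup>2))"
    unfolding M.fe_L2_norm_sq[OF wf] by (rule sum_desc) simp
  also have "\<dots> \<le> (\<Sum>K\<in>T j. \<Sum>H\<in>desc K (Suc j). (Clocal * ?W K)\<^sup>2 / vol K * vol H)"
  proof (intro sum_mono)
    fix K H assume K: "K \<in> T j" and H: "H \<in> desc K (Suc j)"
    show "int_on H (\<lambda>x. (?w x)\<^sup>2) \<le> (Clocal * ?W K)\<^sup>2 / vol K * vol H"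
    proof (rule int_on_sq_le_corners[OF fullT[OF descD(1)[OF H]] M.fe_affine[OF wf descD(1)[OF H]]])
      fix q assume "q \<in> corners H"
      from power_mono[OF qi_step[OF K j u H this], of 2]
      have "vol K * (?w q)\<^sup>2 \<le> (Clocal * ?W K)\<^sup>2" by (simp add: power_mult_distrib)
      then show "(?w q)\<^sup>2 \<le> (Clocal * ?W K)\<^sup>2 / vol K" using vol_pos[OF K] by (simp add: pos_le_divide_eq mult.commute)
    qed
  qed
  also have "\<dots> = (\<Sum>K\<in>T j. (Clocal * ?W K)\<^sup>2)"
  proof (intro sum.cong refl)
    fix K assume K: "K \<in> T j"
    show "(\<Sum>H\<in>desc K (Suc j). (Clocal * ?W K)\<^sup>2 / vol K * vol H) = (Clocal * ?W K)\<^sup>2"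
      unfolding sum_distrib_left[symmetric] vol_desc[OF K le_SucI[OF order_refl], symmetric] using vol_pos[OF K] by simp
  qed
  also have "\<dots> \<le> (\<Sum>K\<in>T j. Clocal\<^sup>2 * (?N * (\<Sum>K'\<in>?S K. (osc J u j K')\<^sup>2)))"
    unfolding power_mult_distrib by (intro sum_mono mult_left_mono W2) auto
  also have "\<dots> = Clocal\<^sup>2 * ?N * (\<Sum>K\<in>T j. \<Sum>K'\<in>T j. if K' \<inter> K \<noteq> {} then (osc J u j K')\<^sup>2 else 0)"
    using finiteT by (simp add: sum_distrib_left sum.inter_filter mult.assoc)
  \<comment> \<open>After the exchange of summation each \<open>K'\<close> is counted once for every
    cell that it touches.\<close>
  also have "\<dots> = Clocal\<^sup>2 * ?N * (\<Sum>K'\<in>T j. \<Sum>K\<in>T j. if K \<inter> K' \<noteq> {} then (osc J u j K')\<^sup>2 else 0)"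
    by (subst sum.swap) (simp only: Int_commute)
  also have "\<dots> = Clocal\<^sup>2 * ?N * (\<Sum>K'\<in>T j. real (card (?S K')) * (osc J u j K')\<^sup>2)"
    using finiteT by (simp add: sum.inter_filter[symmetric])
  also have "\<dots> \<le> Clocal\<^sup>2 * ?N * (\<Sum>K'\<in>T j. ?N * (osc J u j K')\<^sup>2)"
    using N0 by (intro mult_left_mono sum_mono mult_right_mono card_touching) auto
  also have "\<dots> = (Cqi * L2_set (osc J u j) (T j))\<^sup>2"
    by (simp add: Cqi_def L2_set_def power_mult_distrib sum_nonneg sum_distrib_left[symmetric] power2_eq_square)
  finally have "L2_norm \<Omega> ?w \<le> Cqi * L2_set (osc J u j) (T j)"
    by (rule power2_le_imp_le) (intro mult_nonneg_nonneg Cqi_nonneg L2_set_nonneg)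
  moreover have "L2_set (osc J u j) (T j) \<le> (\<Sum>m\<in>{j..<J}. (1/2) ^ m * sqrt (\<Sum>K\<in>T m. fluct J u m K))"
  proof -
    let ?f = "\<lambda>m K. (1/2) ^ m * sqrt (\<Sum>K'\<in>desc K m. fluct J u m K')"
    have "L2_set (osc J u j) (T j) = L2_set (\<lambda>K. 1 * norm (\<Sum>m\<in>{j..<J}. ?f m K)) (T j)"
      using osc_nonneg[of J u j] by (simp add: osc_def[symmetric])
    also have "\<dots> \<le> (\<Sum>m\<in>{j..<J}. L2_set (\<lambda>K. 1 * norm (?f m K)) (T j))" by (rule L2_set_norm_sum_le) simp
    also have "\<dots> = (\<Sum>m\<in>{j..<J}. (1/2) ^ m * sqrt (\<Sum>K\<in>T m. fluct J u m K))"
    proof (intro sum.cong refl)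
      fix m assume "m \<in> {j..<J}"
      then have "(\<Sum>K\<in>T m. fluct J u m K) = (\<Sum>K\<in>T j. \<Sum>K'\<in>desc K m. fluct J u m K')" by (intro sum_desc) simp
      then show "L2_set (\<lambda>K. 1 * norm (?f m K)) (T j) = (1/2) ^ m * sqrt (\<Sum>K\<in>T m. fluct J u m K)"
        by (simp add: L2_set_def power_mult_distrib sum_nonneg fluct_nonneg sum_distrib_left[symmetric] real_sqrt_mult)
    qed
    finally show ?thesis .
  qed
  ultimately show ?thesis using Cqi_nonneg mult_left_mono order_trans by blast
qed

text \<open>On the finest level \<open>u\<close> is affine on the chosen cell and hence equal to its
  own mean approximation there.\<close>

lemma qi_top: assumes u: "u \<in> fe_space \<Omega> (T J)" shows "qi J u J = u"
proof (rule conf_mesh.fe_ext[OF conf qi_fe u])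
  interpret M: conf_mesh \<Omega> "T J" by (rule conf)
  fix x assume "x \<in> \<Union>(corners ` T J) \<inter> \<Omega>"
  then obtain K where K: "K \<in> T J" "x \<in> corners K" and x: "x \<in> \<Omega>" by blast
  let ?H = "SOME H. H \<in> T J \<and> x \<in> H"
  have s: "?H \<in> T J \<and> x \<in> ?H" by (rule someI[of _ K]) (use K corners_subset in blast)
  note fs = fullT[OF conjunct1[OF s]]
  let ?e = "\<lambda>y. u y - meanaff J u ?H y"
  have "?e y = ?e x" if "y \<in> ?H" for y
    using affine_on_gr[OF fs M.fe_affine[OF u conjunct1[OF s]] that conjunct2[OF s]]
      meanaff_diff[of J u ?H y x] mgrad_top[OF conjunct1[OF s], of u] by simp
  then have "int_on ?H ?e = ?e x * vol ?H"
    using int_on_cong[of ?H ?e "\<lambda>y. ?e x"] int_on_const[OF lmeasurable_fs[OF fs]] by simp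
  moreover have "int_on ?H ?e = 0"
    by (rule int_on_sub_meanaff[OF conjunct1[OF s] affine_on_continuous[OF M.fe_affine[OF u conjunct1[OF s]]]])
  ultimately have "?e x = 0" using vol_pos[OF conjunct1[OF s]] by simp
  then show "qi J u J x = u x" using x qi_corner[OF K] by (simp add: node_val_def)
qed

text \<open>The difference to \<open>u\<close> telescopes up to \<open>qi_top\<close>. Two geometric
  convolutions of ratio \<open>1/2\<close> arise, from the telescope and from \<open>osc\<close>;
  each costs a factor 2.\<close>

lemma jackson:
  assumes u: "u \<in> fe_space \<Omega> (T J)"
  shows "(\<Sum>j\<le>J. 4 ^ j * (L2_norm \<Omega> (\<lambda>x. u x - qi J u j x))\<^sup>2)
    \<le> (4 * Cqi)\<^sup>2 * (\<Sum>K\<in>T J. vol K * (norm (gr u K))\<^sup>2)"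
proof -
  define w where "w k = (if k < J then 2 ^ k * L2_norm \<Omega> (\<lambda>x. qi J u (Suc k) x - qi J u k x) else 0)" for k
  define b where "b m = (if m < J then sqrt (\<Sum>K\<in>T m. fluct J u m K) else 0)" for m
  define a where "a j = 2 ^ j * L2_norm \<Omega> (\<lambda>x. u x - qi J u j x)" for j
  have wb: "w j \<le> Cqi * (\<Sum>m\<in>{j..J}. (1/2) ^ (m - j) * b m)" if "j \<le> J" for j
  proof (cases "j < J")
    case True
    have "w j \<le> 2 ^ j * (Cqi * (\<Sum>m\<in>{j..<J}. (1/2) ^ m * sqrt (\<Sum>K\<in>T m. fluct J u m K)))"
      using qi_step_norm[OF True u] True by (simp add: w_def)
    also have "\<dots> = Cqi * (\<Sum>m\<in>{j..<J}. (1/2) ^ (m - j) * b m)"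
      unfolding sum_distrib_left by (intro sum.cong refl) (auto simp: b_def power_diff power_divide)
    also have "(\<Sum>m\<in>{j..<J}. (1/2) ^ (m - j) * b m) = (\<Sum>m\<in>{j..J}. (1/2) ^ (m - j) * b m)"
      by (intro sum.mono_neutral_left) (auto simp: b_def)
    finally show ?thesis .
  qed (auto simp: w_def b_def intro!: mult_nonneg_nonneg Cqi_nonneg sum_nonneg fluct_nonneg)
  have aw: "a j \<le> 1 * (\<Sum>k\<in>{j..J}. (1/2) ^ (k - j) * w k)" if "j \<le> J" for j
  proof -
    have L: "(\<lambda>x. qi J u (Suc k) x - qi J u k x) \<in> L2 \<Omega>" for k
      by (intro L2_diff conf_mesh.fe_L2[OF conf qi_fe])
    have "(\<lambda>x. u x - qi J u j x) = (\<lambda>x. \<Sum>k\<in>{j..<J}. qi J u (Suc k) x - qi J u k x)"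
    proof
      fix x show "u x - qi J u j x = (\<Sum>k\<in>{j..<J}. qi J u (Suc k) x - qi J u k x)"
        using sum_Suc_diff'[OF that, of "\<lambda>k. qi J u k x"] qi_top[OF u] by simp
    qed
    then have "a j \<le> 2 ^ j * (\<Sum>k\<in>{j..<J}. L2_norm \<Omega> (\<lambda>x. qi J u (Suc k) x - qi J u k x))"
      unfolding a_def using L2_norm_sum[OF L] by simp
    also have "\<dots> = (\<Sum>k\<in>{j..<J}. (1/2) ^ (k - j) * w k)"
      unfolding sum_distrib_left by (intro sum.cong refl) (auto simp: w_def power_diff power_divide)
    also have "\<dots> = (\<Sum>k\<in>{j..J}. (1/2) ^ (k - j) * w k)"
      by (intro sum.mono_neutral_left) (auto simp: w_def)
    finally show ?thesis by simp
  qed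
  have w0: "0 \<le> w j" and a0: "0 \<le> a j" for j by (auto simp: w_def a_def L2_norm_nonneg)
  have "(\<Sum>j\<le>J. 4 ^ j * (L2_norm \<Omega> (\<lambda>x. u x - qi J u j x))\<^sup>2) = (\<Sum>j\<le>J. (a j)\<^sup>2)"
    by (simp add: a_def power_mult_distrib two_power_sq)
  also have "\<dots> \<le> (1 / (1 - 1/2))\<^sup>2 * (\<Sum>k\<le>J. (w k)\<^sup>2)" by (rule young_geometric[OF _ _ _ a0 aw]) auto
  also have "\<dots> \<le> (1 / (1 - 1/2))\<^sup>2 * ((Cqi / (1 - 1/2))\<^sup>2 * (\<Sum>k\<le>J. (b k)\<^sup>2))"
    by (intro mult_left_mono young_geometric[OF _ _ Cqi_nonneg w0 wb]) auto
  also have "(\<Sum>k\<le>J. (b k)\<^sup>2) = (\<Sum>k<J. \<Sum>K\<in>T k. fluct J u k K)"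
    by (simp add: lessThan_Suc_atMost[symmetric] b_def sum_nonneg fluct_nonneg)
  also have "(1 / (1 - 1/2))\<^sup>2 * ((Cqi / (1 - 1/2))\<^sup>2 * (\<Sum>k<J. \<Sum>K\<in>T k. fluct J u k K))
    \<le> (1 / (1 - 1/2))\<^sup>2 * ((Cqi / (1 - 1/2))\<^sup>2 * (\<Sum>K\<in>T J. vol K * (norm (gr u K))\<^sup>2))"
    by (intro mult_left_mono fluct_sum_le) auto
  finally show ?thesis by (simp add: power2_eq_square)
qed

end

section \<open>Perturbed projections\<close>

context graded_meshes begin

abbreviation N :: "('a => real) => real" where "N \<equiv> L2_norm \<Omega>"
abbreviation S :: "nat => ('a => real) set" where "S k \<equiv> fe_space \<Omega> (T k)"
abbreviation Q :: "nat => ('a => real) => 'a => real" where "Q k \<equiv> L2_proj \<Omega> (T k)"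
abbreviation I :: "nat => ('a => real) => 'a => real" where "I k \<equiv> nodal_interp \<Omega> (T k)"

lemmas fe_L2' = conf_mesh.fe_L2[OF conf] and fe_diff' = conf_mesh.fe_diff[OF conf] and fe_add' = conf_mesh.fe_add[OF conf]
  and Q_fe = conf_mesh.L2_proj_fe[OF conf] and Q_norm = conf_mesh.L2_proj_norm[OF conf]
  and Q_id = conf_mesh.L2_proj_id[OF conf] and Q_diff = conf_mesh.L2_proj_diff[OF conf] and I_fe = conf_mesh.nodal_interp_fe[OF conf]
  and I_id = conf_mesh.nodal_interp_id[OF conf]

definition CI :: real where "CI = sqrt (4 * (Cson * 4 ^ Suc DIM('a)))"

lemma CI_pos: "CI > 0"
  using Cson_pos by (simp add: CI_def)

text \<open>Nodal values are not bounded by the \<open>L2\<close> norm in general. On the next finer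
  space they are: the corners of a cell are corners of its sons, where the inverse estimate holds
  and volumes are comparable.\<close>

lemma interpolation_stable:
  assumes v: "v \<in> S (Suc i)" shows "N (\<lambda>x. v x - I i v x) \<le> CI * N v"
proof -
  interpret M: conf_mesh \<Omega> "T (Suc i)" by (rule conf)
  interpret M0: conf_mesh \<Omega> "T i" by (rule conf)
  let ?w = "\<lambda>x. v x - I i v x" and ?c = "Cson * 4 ^ Suc DIM('a)"
  have wf: "?w \<in> S (Suc i)" by (intro fe_diff' v fe_mono[OF _ I_fe]) simp
  have loc: "(\<Sum>H\<in>desc K (Suc i). int_on H (\<lambda>x. (?w x)\<^sup>2)) \<le> 4 * ?c * (\<Sum>H\<in>desc K (Suc i). int_on H (\<lambda>x. (v x)\<^sup>2))"
    if K: "K \<in> T i" for K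
  proof -
    let ?D = "desc K (Suc i)"
    define A where "A = (\<Sum>H\<in>?D. int_on H (\<lambda>x. (v x)\<^sup>2))"
    define M where "M = sqrt (?c * A / vol K)"
    note fs = fullT[OF K] and V = vol_pos[OF K]
    have A0: "A \<ge> 0" unfolding A_def by (intro sum_nonneg int_on_nonneg) auto
    have M0: "M \<ge> 0" and M2: "M\<^sup>2 = ?c * A / vol K" using A0 V Cson_pos by (simp_all add: M_def)
    have son: "\<bar>v q\<bar> \<le> M" if H: "H \<in> ?D" and q: "q \<in> corners H" for H q
    proof -
      note sd = descD[OF H]
      have "vol K * (v q)\<^sup>2 \<le> Cson * (vol H * (v q)\<^sup>2)"
        using mult_right_mono[OF son_vol[OF K sd], of "(v q)\<^sup>2"] by simp
      also have "\<dots> \<le> Cson * (4 ^ Suc DIM('a) * int_on H (\<lambda>x. (v x)\<^sup>2))"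
        using Cson_pos by (intro mult_left_mono inverse_estimate_corners fullT[OF sd(1)] M.fe_affine[OF v sd(1)] q) auto
      also have "\<dots> \<le> Cson * (4 ^ Suc DIM('a) * A)"
        unfolding A_def using Cson_pos finite_desc H by (intro mult_left_mono member_le_sum int_on_nonneg) auto
      finally have "(v q)\<^sup>2 \<le> M\<^sup>2" unfolding M2 using V by (simp add: pos_le_divide_eq mult_ac)
      then show ?thesis using M0 by (simp add: abs_le_square_iff[symmetric])
    qed
    have father: "\<bar>I i v p\<bar> \<le> M" if p: "p \<in> corners K" for p
    proof -
      obtain H where H: "H \<in> ?D" "p \<in> H" using Union_desc[OF K, of "Suc i"] corners_subset[OF p] by auto
      \<comment> \<open>An extreme point of \<open>K\<close> stays extreme in every subset that
        contains it.\<close>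
      have "p \<in> corners H"
        using p H(2) descD(2)[OF H(1)] unfolding corners_def extreme_point_of_def by blast
      then show ?thesis using son[OF H(1)] M0.nodal_interp_corner[OF K p, of v] M0 by auto
    qed
    have "(\<Sum>H\<in>?D. int_on H (\<lambda>x. (?w x)\<^sup>2)) \<le> (\<Sum>H\<in>?D. 4 * M\<^sup>2 * vol H)"
    proof (rule sum_mono)
      fix H assume H: "H \<in> ?D"
      note sd = descD[OF H]
      show "int_on H (\<lambda>x. (?w x)\<^sup>2) \<le> 4 * M\<^sup>2 * vol H"
      proof (rule int_on_sq_le_corners[OF fullT[OF sd(1)] M.fe_affine[OF wf sd(1)]])
        fix q assume q: "q \<in> corners H"
        have "\<bar>I i v q\<bar> \<le> M"
          using affine_on_abs_le_corners[OF fs M0.fe_affine[OF I_fe K] _ father] q sd(2) corners_subset by blast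
        then have "\<bar>?w q\<bar> \<le> 2 * M" using son[OF H q] by linarith
        from power_mono[OF this, of 2] show "(?w q)\<^sup>2 \<le> 4 * M\<^sup>2" by (simp add: power_mult_distrib)
      qed
    qed
    also have "\<dots> = 4 * M\<^sup>2 * vol K" using vol_desc[OF K, of "Suc i"] by (simp add: sum_distrib_left)
    also have "\<dots> = 4 * ?c * A" unfolding M2 using V by simp
    finally show ?thesis unfolding A_def .
  qed
  have s: "(N z)\<^sup>2 = (\<Sum>K\<in>T i. \<Sum>H\<in>desc K (Suc i). int_on H (\<lambda>x. (z x)\<^sup>2))" if "z \<in> S (Suc i)" for z
    unfolding M.fe_L2_norm_sq[OF that] by (rule sum_desc) simp
  have "(N ?w)\<^sup>2 \<le> 4 * ?c * (N v)\<^sup>2"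
    unfolding s[OF wf] s[OF v] sum_distrib_left[of _ _ "T i"] by (intro sum_mono loc)
  also have "\<dots> = (CI * N v)\<^sup>2" using Cson_pos by (simp add: CI_def power_mult_distrib)
  finally show ?thesis using CI_pos by (intro power2_le_imp_le[of "N ?w"] mult_nonneg_nonneg L2_norm_nonneg) auto
qed

lemma Q_Q: "v \<in> L2 \<Omega> ==> j \<le> k ==> Q j (Q k v) = Q j v"
proof (rule conf_mesh.L2_proj_unique[OF conf, symmetric])
  assume v: "v \<in> L2 \<Omega>" and jk: "j \<le> k"
  show "v \<in> L2 \<Omega>" by (rule v)
  have Qk: "Q k v \<in> L2 \<Omega>" by (rule fe_L2'[OF Q_fe[OF v]])
  show "Q j (Q k v) \<in> S j" by (rule Q_fe[OF Qk])
  fix w assume w: "w \<in> S j"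
  have "L2_inner \<Omega> (\<lambda>x. (v x - Q k v x) + (Q k v x - Q j (Q k v) x)) w
    = L2_inner \<Omega> (\<lambda>x. v x - Q k v x) w + L2_inner \<Omega> (\<lambda>x. Q k v x - Q j (Q k v) x) w"
    by (intro L2_inner_add_left L2_diff v Qk fe_L2'[OF Q_fe[OF Qk]] fe_L2'[OF w])
  then show "L2_inner \<Omega> (\<lambda>x. v x - Q j (Q k v) x) w = 0"
    using conf_mesh.L2_proj_orth[OF conf v fe_mono[OF jk w]] conf_mesh.L2_proj_orth[OF conf Qk w] by simp
qed

lemma Q_compl_norm: assumes v: "v \<in> L2 \<Omega>" shows "N (\<lambda>x. v x - Q k v x) \<le> 2 * N v"
  using L2_norm_diff[OF v fe_L2'[OF Q_fe[OF v, of k]]] Q_norm[OF v, of k] by linarith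

text \<open>Both projections reproduce \<open>p\<close>, so the increment only sees
  \<open>u - p\<close>.\<close>

lemma Q_increment:
  assumes u: "u \<in> L2 \<Omega>" and p: "p \<in> S j"
  shows "N (\<lambda>x. Q (Suc j) u x - Q j u x) \<le> 2 * N (\<lambda>x. u x - p x)"
proof -
  have pS: "p \<in> S (Suc j)" using fe_mono[OF _ p] by simp
  have d: "(\<lambda>x. u x - p x) \<in> L2 \<Omega>" by (intro L2_diff u fe_L2'[OF p])
  have "(\<lambda>x. Q (Suc j) u x - Q j u x) = (\<lambda>x. Q (Suc j) (\<lambda>x. u x - p x) x - Q j (\<lambda>x. u x - p x) x)"
    unfolding Q_diff[OF u fe_L2'[OF p]] Q_id[OF p] Q_id[OF pS] by simp
  then show ?thesis
    using L2_norm_diff[OF fe_L2'[OF Q_fe[OF d, of "Suc j"]] fe_L2'[OF Q_fe[OF d, of j]]] Q_norm[OF d, of j] Q_norm[OF d, of "Suc j"]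
    by simp
qed

end

section \<open>Error recursion for the perturbed projections\<close>

locale perturbed_projections = graded_meshes +
  fixes \<gamma> :: real and Qa :: "nat => ('a => real) => 'a => real"
  assumes gamma: "0 \<le> \<gamma>" "\<gamma> * (4 * CI) \<le> 1"
    and Qa_fe: "v \<in> L2 \<Omega> ==> Qa j v \<in> S j"
    and Qa_near: "v \<in> L2 \<Omega> ==> N (\<lambda>x. Qa j v x - Q j v x) \<le> \<gamma> * N (Q j v)"
begin

definition ut :: "nat => ('a => real) => nat => 'a => real" where "ut J u k = Q_tilde \<Omega> T Qa J (int k) u"

lemma ut_top: "ut J u J = u"
  by (simp add: ut_def Q_tilde_def)

lemma ut_step: assumes "k < J" shows "ut J u k = Q_factor \<Omega> T Qa k (ut J u (Suc k))"
proof -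
  have "[k..<J] = k # [Suc k..<J]" using assms by (rule upt_conv_Cons)
  moreover have "nat (1 + int k) = Suc k" by simp
  ultimately show ?thesis by (simp add: ut_def Q_tilde_def)
qed

lemma ut_fe:
  assumes u: "u \<in> S J" and "k \<le> J" shows "ut J u k \<in> S k"
  using assms(2)
proof (induction rule: inc_induct)
  case base then show ?case using u by (simp add: ut_top)
next
  case (step k)
  have "(\<lambda>y. I (Suc k) (ut J u (Suc k)) y - I k (ut J u (Suc k)) y) \<in> L2 \<Omega>" by (intro L2_diff fe_L2'[OF I_fe])
  then show ?case unfolding ut_step[OF step.hyps(2)] Q_factor_def by (intro fe_add' I_fe Qa_fe)
qed

definition err :: "nat => ('a => real) => nat => real" where "err J u k = N (\<lambda>x. ut J u k x - Q k u x)"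

text \<open>With \<open>z = v - I k v\<close> the new iterate is \<open>Q k v\<close> plus the
  perturbation \<open>Qa k z - Q k z\<close>. Since \<open>I k\<close> reproduces
  \<open>Q k v\<close>, \<open>z\<close> depends on \<open>v\<close> only through
  \<open>v - Q k v\<close>, that is, on an increment of exact projections and the old error.\<close>

lemma err_step:
  assumes u: "u \<in> S J" and k: "k < J"
  shows "err J u k \<le> 3/2 * err J u (Suc k) + 1/4 * N (\<lambda>x. Q (Suc k) u x - Q k u x)"
proof -
  define v where "v = ut J u (Suc k)"
  define e where "e = (\<lambda>x. v x - Q (Suc k) u x)"
  define z where "z = (\<lambda>x. v x - I k v x)"
  define d where "d = (\<lambda>x. Q (Suc k) u x - Q k u x)"
  have uL: "u \<in> L2 \<Omega>" by (rule fe_L2'[OF u])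
  have v: "v \<in> S (Suc k)" unfolding v_def using ut_fe[OF u] k by simp
  note vL = fe_L2'[OF v] and QuL = fe_L2'[OF Q_fe[OF uL]]
  have eL: "e \<in> L2 \<Omega>" and zL: "z \<in> L2 \<Omega>" and dL: "d \<in> L2 \<Omega>"
    unfolding e_def z_def d_def using L2_diff[OF vL QuL] L2_diff[OF vL fe_L2'[OF I_fe]] L2_diff[OF QuL QuL] by auto
  have Qe: "Q k e = (\<lambda>x. Q k v x - Q k u x)"
    unfolding e_def Q_diff[OF vL QuL] Q_Q[OF uL le_SucI[OF order_refl]] ..
  have Qz: "Q k z = (\<lambda>x. Q k v x - I k v x)"
    unfolding z_def Q_diff[OF vL fe_L2'[OF I_fe]] Q_id[OF I_fe] ..
  have eq: "(\<lambda>x. ut J u k x - Q k u x) = (\<lambda>x. Q k e x + (Qa k z x - Q k z x))"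
    unfolding ut_step[OF k] Q_factor_def v_def[symmetric] I_id[OF v] z_def[symmetric] Qe Qz by (simp add: add.commute)
  have vQ: "(\<lambda>x. v x - Q k v x) = (\<lambda>x. d x + (e x - Q k e x))" unfolding Qe by (simp add: e_def d_def)
  let ?y = "\<lambda>x. v x - Q k v x"
  have yS: "?y \<in> S (Suc k)" by (intro fe_diff' v fe_mono[OF _ Q_fe[OF vL]]) simp
  have "z = (\<lambda>x. ?y x - I k ?y x)"
  proof -
    have "I k ?y = (\<lambda>x. I k v x - Q k v x)"
    proof (rule conf_mesh.fe_ext[OF conf I_fe fe_diff'[OF I_fe Q_fe[OF vL]]])
      fix x assume "x \<in> \<Union> (corners ` T k) \<inter> \<Omega>"
      then show "I k ?y x = I k v x - Q k v x" using conf_mesh.nodal_interp_node[OF conf] by simp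
    qed
    then show ?thesis by (simp add: z_def)
  qed
  then have "N z \<le> CI * N ?y" using interpolation_stable[OF yS] by simp
  also have "N ?y \<le> N d + 2 * err J u (Suc k)"
    unfolding vQ using L2_norm_triangle[OF dL L2_diff[OF eL fe_L2'[OF Q_fe[OF eL, of k]]]] Q_compl_norm[OF eL, of k]
    by (simp add: err_def e_def v_def)
  finally have Nz: "N z \<le> CI * (N d + 2 * err J u (Suc k))" using CI_pos by simp
  have E: "N (\<lambda>x. Qa k z x - Q k z x) \<le> 1/4 * (N d + 2 * err J u (Suc k))"
  proof -
    have "N (\<lambda>x. Qa k z x - Q k z x) \<le> \<gamma> * N z" using order_trans[OF Qa_near[OF zL] mult_left_mono[OF Q_norm[OF zL] gamma(1)]] .
    also have "\<dots> \<le> \<gamma> * (CI * (N d + 2 * err J u (Suc k)))" by (rule mult_left_mono[OF Nz gamma(1)])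
    also have "\<dots> = (\<gamma> * CI) * (N d + 2 * err J u (Suc k))" by simp
    also have "\<dots> \<le> 1/4 * (N d + 2 * err J u (Suc k))"
      using gamma(2) by (intro mult_right_mono) (auto simp: err_def L2_norm_nonneg)
    finally show ?thesis .
  qed
  have "err J u k \<le> N (Q k e) + N (\<lambda>x. Qa k z x - Q k z x)"
    unfolding err_def eq by (intro L2_norm_triangle L2_diff fe_L2'[OF Q_fe] fe_L2'[OF Qa_fe] eL zL)
  moreover have "N (Q k e) \<le> err J u (Suc k)" using Q_norm[OF eL] by (simp add: err_def e_def v_def)
  ultimately show ?thesis using E by (simp add: d_def)
qed

text \<open>Under the weight \<open>2 ^ j\<close> the growth factor \<open>3/2\<close> becomes the
  ratio \<open>3/4\<close> of a convergent geometric sum, started by zero error on the top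
  level.\<close>

lemma err_sum:
  assumes u: "u \<in> S J"
  shows "(\<Sum>j\<le>J. 4 ^ j * (err J u j)\<^sup>2) \<le> (\<Sum>j<J. 4 ^ Suc j * (N (\<lambda>x. Q (Suc j) u x - Q j u x))\<^sup>2)"
proof -
  define \<delta> where "\<delta> k = (if k < J then 2 ^ Suc k * N (\<lambda>x. Q (Suc k) u x - Q k u x) else 0)" for k
  have uL: "u \<in> L2 \<Omega>" by (rule fe_L2'[OF u])
  have top: "err J u J = 0"
    unfolding err_def ut_top Q_id[OF u] by (simp add: L2_norm_def L2_inner_def)
  have "2 ^ j * err J u j \<le> 1/8 * (\<Sum>k\<in>{j..J}. (3/4) ^ (k - j) * \<delta> k)" if "j \<le> J" for j
    using that
  proof (induction rule: inc_induct)
    case base then show ?case by (simp add: top \<delta>_def)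
  next
    case (step j)
    have "2 ^ j * err J u j \<le> 2 ^ j * (3/2 * err J u (Suc j) + 1/4 * N (\<lambda>x. Q (Suc j) u x - Q j u x))"
      by (intro mult_left_mono err_step[OF u step.hyps(2)]) auto
    also have "\<dots> = 3/4 * (2 ^ Suc j * err J u (Suc j)) + 1/8 * \<delta> j"
      using step.hyps(2) by (simp add: \<delta>_def algebra_simps)
    also have "\<dots> \<le> 3/4 * (1/8 * (\<Sum>k\<in>{Suc j..J}. (3/4) ^ (k - Suc j) * \<delta> k)) + 1/8 * \<delta> j"
      by (intro add_right_mono mult_left_mono step.IH) auto
    also have "\<dots> = 1/8 * (3/4 * (\<Sum>k\<in>{Suc j..J}. (3/4) ^ (k - Suc j) * \<delta> k) + \<delta> j)"
      by (simp add: algebra_simps)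
    also have "3/4 * (\<Sum>k\<in>{Suc j..J}. (3/4) ^ (k - Suc j) * \<delta> k) = (\<Sum>k\<in>{Suc j..J}. (3/4) ^ (k - j) * \<delta> k)"
      unfolding sum_distrib_left
    proof (intro sum.cong refl)
      fix k assume "k \<in> {Suc j..J}"
      then have "k - j = Suc (k - Suc j)" by auto
      then show "3/4 * ((3/4) ^ (k - Suc j) * \<delta> k) = (3/4) ^ (k - j) * \<delta> k" by simp
    qed
    also have "\<dots> + \<delta> j = (\<Sum>k\<in>{j..J}. (3/4) ^ (k - j) * \<delta> k)"
      using step.hyps(2) by (simp add: sum.atLeast_Suc_atMost)
    finally show ?case .
  qed
  then have "(\<Sum>j\<le>J. (2 ^ j * err J u j)\<^sup>2) \<le> ((1/8) / (1 - 3/4))\<^sup>2 * (\<Sum>k\<le>J. (\<delta> k)\<^sup>2)"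
    by (intro young_geometric) (auto simp: err_def L2_norm_nonneg)
  \<comment> \<open>The constant is \<open>(1/2)\<^sup>2\<close>, generously replaced by
    one.\<close>
  also have "\<dots> \<le> 1 * (\<Sum>k\<le>J. (\<delta> k)\<^sup>2)" by (intro mult_right_mono sum_nonneg) (auto simp: power2_eq_square)
  also have "\<dots> = (\<Sum>j<J. 4 ^ Suc j * (N (\<lambda>x. Q (Suc j) u x - Q j u x))\<^sup>2)"
    by (simp only: lessThan_Suc_atMost[symmetric] sum.lessThan_Suc) (simp add: \<delta>_def power_mult_distrib two_power_sq)
  finally show ?thesis by (simp add: power_mult_distrib two_power_sq)
qed

section \<open>The two-sided estimate\<close>

definition incr :: "nat => ('a => real) => nat => 'a => real" where
  "incr J u j x = Q_tilde \<Omega> T Qa J (int j) u x - Q_tilde \<Omega> T Qa J (int j - 1) u x"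

lemma incr_0: "incr J u 0 = ut J u 0" and incr_Suc: "incr J u (Suc j) = (\<lambda>x. ut J u (Suc j) x - ut J u j x)"
  by (auto simp: incr_def ut_def fun_eq_iff Q_tilde_def[of _ _ _ _ "- 1"])

lemma incr_fe: assumes "u \<in> S J" "j \<le> J" shows "incr J u j \<in> S j"
proof (cases j)
  case 0 then show ?thesis using ut_fe[OF assms] by (simp add: incr_0)
next
  case (Suc i)
  then show ?thesis unfolding Suc incr_Suc using assms Suc by (intro fe_diff' ut_fe fe_mono[OF _ ut_fe]) auto
qed

lemma incr_sum: assumes "u \<in> S J" shows "u = (\<lambda>x. \<Sum>j\<le>J. incr J u j x)"
proof
  have "(\<Sum>j\<le>k. incr J u j x) = ut J u k x" for k x
    by (induction k) (auto simp: incr_0 incr_Suc)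
  then show "u x = (\<Sum>j\<le>J. incr J u j x)" for x by (simp add: ut_top)
qed

lemma sq_add3_le: "((a::real) + b + c)\<^sup>2 \<le> 3 * (a\<^sup>2 + b\<^sup>2 + c\<^sup>2)"
  using sum_squares_bound[of a b] sum_squares_bound[of a c] sum_squares_bound[of b c] by (simp add: power2_eq_square algebra_simps)

text \<open>Each increment is split into three terms, which leads to \<open>3 * ?D + 15 * ?X\<close>
  in \<open>upper_bound\<close>; \<open>?X\<close> is at most \<open>?D\<close>, and
  \<open>18 * 16 = 288\<close> multiplies the Jackson constant.\<close>

definition Cup :: real where "Cup = 6 + 288 * (4 * Cqi)\<^sup>2"

lemma upper_bound:
  assumes u: "u \<in> S J"
  shows "(\<Sum>j\<le>J. 4 ^ j * (N (incr J u j))\<^sup>2) \<le> Cup * (H1_norm \<Omega> u)\<^sup>2"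
proof -
  let ?d = "\<lambda>j. N (\<lambda>x. Q (Suc j) u x - Q j u x)"
  let ?E = "\<Sum>K\<in>T J. vol K * (norm (gr u K))\<^sup>2" and ?D = "\<Sum>j<J. 4 ^ Suc j * (?d j)\<^sup>2"
  let ?X = "\<Sum>j\<le>J. 4 ^ j * (err J u j)\<^sup>2"
  have uL: "u \<in> L2 \<Omega>" by (rule fe_L2'[OF u])
  note QuL = fe_L2'[OF Q_fe[OF uL]]
  have E0: "?E \<ge> 0" by (intro sum_nonneg) auto
  have "?D \<le> (\<Sum>j<J. 16 * (4 ^ j * (N (\<lambda>x. u x - qi J u j x))\<^sup>2))"
  proof (rule sum_mono)
    fix j
    from power_mono[OF Q_increment[OF uL qi_fe[of J u j]] L2_norm_nonneg, of 2]
    show "4 ^ Suc j * (?d j)\<^sup>2 \<le> 16 * (4 ^ j * (N (\<lambda>x. u x - qi J u j x))\<^sup>2)" by (simp add: power_mult_distrib)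
  qed
  also have "\<dots> \<le> 16 * (\<Sum>j\<le>J. 4 ^ j * (N (\<lambda>x. u x - qi J u j x))\<^sup>2)"
    unfolding sum_distrib_left by (intro sum_mono2) auto
  also have "\<dots> \<le> 16 * ((4 * Cqi)\<^sup>2 * ?E)" by (intro mult_left_mono jackson[OF u]) auto
  finally have D: "?D \<le> 16 * (4 * Cqi)\<^sup>2 * ?E" by simp
  have eL: "(\<lambda>x. ut J u j x - Q j u x) \<in> L2 \<Omega>" if "j \<le> J" for j by (intro L2_diff QuL fe_L2'[OF ut_fe[OF u that]])
  have z: "(N (incr J u 0))\<^sup>2 \<le> 3 * (N u)\<^sup>2 + 3 * (err J u 0)\<^sup>2"
  proof -
    have "incr J u 0 = (\<lambda>x. Q 0 u x + (ut J u 0 x - Q 0 u x))" by (simp add: incr_0)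
    then have "N (incr J u 0) \<le> N u + err J u 0 + 0"
      using L2_norm_triangle[OF QuL eL[of 0], of 0] Q_norm[OF uL, of 0] by (simp add: err_def)
    from power_mono[OF this L2_norm_nonneg, of 2] show ?thesis using sq_add3_le[of "N u" "err J u 0" 0] by simp
  qed
  have s: "(N (incr J u (Suc j)))\<^sup>2 \<le> 3 * ((?d j)\<^sup>2 + (err J u (Suc j))\<^sup>2 + (err J u j)\<^sup>2)" if j: "j < J" for j
  proof -
    have "incr J u (Suc j) = (\<lambda>x. ((Q (Suc j) u x - Q j u x) + (ut J u (Suc j) x - Q (Suc j) u x)) - (ut J u j x - Q j u x))"
      by (simp add: incr_Suc)
    moreover have "N (\<lambda>x. ((Q (Suc j) u x - Q j u x) + (ut J u (Suc j) x - Q (Suc j) u x)) - (ut J u j x - Q j u x))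
      \<le> N (\<lambda>x. (Q (Suc j) u x - Q j u x) + (ut J u (Suc j) x - Q (Suc j) u x)) + N (\<lambda>x. ut J u j x - Q j u x)"
      using j by (intro L2_norm_diff L2_add L2_diff[OF QuL QuL] eL) auto
    moreover have "N (\<lambda>x. (Q (Suc j) u x - Q j u x) + (ut J u (Suc j) x - Q (Suc j) u x))
      \<le> ?d j + N (\<lambda>x. ut J u (Suc j) x - Q (Suc j) u x)"
      using j by (intro L2_norm_triangle L2_diff[OF QuL QuL] eL) auto
    ultimately have "N (incr J u (Suc j)) \<le> ?d j + err J u (Suc j) + err J u j" by (simp add: err_def)
    from power_mono[OF this L2_norm_nonneg, of 2] show ?thesis using sq_add3_le order_trans by blast
  qed
  have "(\<Sum>j\<le>J. 4 ^ j * (N (incr J u j))\<^sup>2) = (N (incr J u 0))\<^sup>2 + (\<Sum>j<J. 4 ^ Suc j * (N (incr J u (Suc j)))\<^sup>2)"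
    unfolding lessThan_Suc_atMost[symmetric] sum.lessThan_Suc_shift by simp
  also have "\<dots> \<le> (3 * (N u)\<^sup>2 + 3 * (err J u 0)\<^sup>2)
    + (\<Sum>j<J. 4 ^ Suc j * (3 * ((?d j)\<^sup>2 + (err J u (Suc j))\<^sup>2 + (err J u j)\<^sup>2)))"
    by (intro add_mono z sum_mono mult_left_mono s) auto
  also have "(\<Sum>j<J. 4 ^ Suc j * (3 * ((?d j)\<^sup>2 + (err J u (Suc j))\<^sup>2 + (err J u j)\<^sup>2)))
    = 3 * ?D + 3 * (\<Sum>j<J. 4 ^ Suc j * (err J u (Suc j))\<^sup>2) + 12 * (\<Sum>j<J. 4 ^ j * (err J u j)\<^sup>2)"
    unfolding sum_distrib_left sum.distrib[symmetric] by (intro sum.cong refl) (simp add: algebra_simps)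
  also have "(\<Sum>j<J. 4 ^ j * (err J u j)\<^sup>2) \<le> ?X" by (intro sum_mono2) auto
  also have "(\<Sum>j<J. 4 ^ Suc j * (err J u (Suc j))\<^sup>2) = ?X - (err J u 0)\<^sup>2"
    unfolding lessThan_Suc_atMost[symmetric] sum.lessThan_Suc_shift[of _ J] by simp
  finally have "(\<Sum>j\<le>J. 4 ^ j * (N (incr J u j))\<^sup>2) \<le> 3 * (N u)\<^sup>2 + 3 * ?D + 15 * ?X" by simp
  also have "\<dots> \<le> 3 * (N u)\<^sup>2 + 18 * ?D" using err_sum[OF u] by simp
  also have "\<dots> \<le> 6 * (N u)\<^sup>2 + 18 * (16 * (4 * Cqi)\<^sup>2 * ?E)"
    by (intro add_mono mult_left_mono D mult_right_mono) auto
  also have "\<dots> \<le> Cup * (N u)\<^sup>2 + Cup * ?E"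
  proof (rule add_mono)
    show "6 * (N u)\<^sup>2 \<le> Cup * (N u)\<^sup>2" unfolding Cup_def by (intro mult_right_mono) auto
    show "18 * (16 * (4 * Cqi)\<^sup>2 * ?E) \<le> Cup * ?E"
      unfolding Cup_def mult.assoc[symmetric] using E0 by (intro mult_right_mono) auto
  qed
  also have "\<dots> = Cup * (H1_norm \<Omega> u)\<^sup>2"
    unfolding conf_mesh.H1_norm_fe[OF conf u] by (simp add: distrib_left)
  finally show ?thesis .
qed

definition Clow :: real where "Clow = 4 + (sqrt Cmean / (1 - sqrt (1/2)))\<^sup>2"

lemma Clow_pos: "Clow > 0"
  by (simp add: Clow_def add_pos_nonneg)

lemma lower_bound:
  assumes u: "u \<in> S J"
  shows "(H1_norm \<Omega> u)\<^sup>2 \<le> Clow * (\<Sum>j\<le>J. 4 ^ j * (N (incr J u j))\<^sup>2)"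
proof -
  let ?Y = "\<Sum>j\<le>J. 4 ^ j * (N (incr J u j))\<^sup>2"
  have L: "incr J u j \<in> L2 \<Omega>" if "j \<le> J" for j by (rule fe_L2'[OF incr_fe[OF u that]])
  \<comment> \<open>A sequence supported at zero, for which \<open>young_geometric\<close> becomes a
    weighted Cauchy-Schwarz inequality for the sum over the levels.\<close>
  define a where "a j = (if j = 0 then N u else 0)" for j :: nat
  have "(\<Sum>j\<le>J. (a j)\<^sup>2) \<le> (1 / (1 - 1/2))\<^sup>2 * (\<Sum>k\<le>J. (2 ^ k * N (incr J u k))\<^sup>2)"
  proof (rule young_geometric)
    fix j assume "j \<le> J"
    show "0 \<le> a j" by (simp add: a_def L2_norm_nonneg)
    show "a j \<le> 1 * (\<Sum>k\<in>{j..J}. (1/2) ^ (k - j) * (2 ^ k * N (incr J u k)))"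
    proof (cases "j = 0")
      case True
      have "N u \<le> (\<Sum>k\<le>J. N (incr J u k))" using L2_norm_sum[of "{..J}" "incr J u" \<Omega>] L incr_sum[OF u] by simp
      then show ?thesis by (simp add: a_def True atLeast0AtMost power_divide)
    qed (auto simp: a_def intro!: sum_nonneg mult_nonneg_nonneg L2_norm_nonneg)
  qed auto
  moreover have "(\<Sum>j\<le>J. (a j)\<^sup>2) = (N u)\<^sup>2"
    unfolding lessThan_Suc_atMost[symmetric] sum.lessThan_Suc_shift by (simp add: a_def)
  ultimately have 1: "(N u)\<^sup>2 \<le> 4 * ?Y" by (simp add: power_mult_distrib two_power_sq power2_eq_square[of "2::real"])
  have 2: "(\<Sum>K\<in>T J. vol K * (norm (gr u K))\<^sup>2) \<le> (sqrt Cmean / (1 - sqrt (1/2)))\<^sup>2 * ?Y"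
    using bernstein[of J "incr J u"] incr_fe[OF u] incr_sum[OF u] by simp
  show ?thesis unfolding conf_mesh.H1_norm_fe[OF conf u] Clow_def distrib_right using 1 2 by (rule add_mono)
qed

end

theorem theorem8p2:
  fixes \<Omega> :: "'a::euclidean_space set" and T :: "nat => 'a set set"
  assumes "DIM('a) \<in> {2, 3}"
    and "polyhedral_domain \<Omega>"
    and "red_green_sequence \<Omega> T"
  shows "\<exists>\<gamma>\<^sub>0>0. \<forall>(\<gamma>::real) Qa.
    0 \<le> \<gamma> \<and> \<gamma> < \<gamma>\<^sub>0 \<and>
    (\<forall>j. linear_L2_into_fe \<Omega> (T j) (Qa j)) \<and>
    (\<forall>j. \<forall>v\<in>L2 \<Omega>.
       L2_norm \<Omega> (\<lambda>x. Qa j v x - L2_proj \<Omega> (T j) v x) \<le> \<gamma> * L2_norm \<Omega> (L2_proj \<Omega> (T j) v))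
    \<longrightarrow>
    (\<exists>c>0. \<exists>C>0. \<forall>J. \<forall>u\<in>fe_space \<Omega> (T J).
       c * (H1_norm \<Omega> u)\<^sup>2
         \<le> (\<Sum>j=0..J. 2 ^ (2 * j) *
              (L2_norm \<Omega> (\<lambda>x. Q_tilde \<Omega> T Qa J (int j) u x - Q_tilde \<Omega> T Qa J (int j - 1) u x))\<^sup>2) \<and>
       (\<Sum>j=0..J. 2 ^ (2 * j) *
            (L2_norm \<Omega> (\<lambda>x. Q_tilde \<Omega> T Qa J (int j) u x - Q_tilde \<Omega> T Qa J (int j - 1) u x))\<^sup>2)
         \<le> C * (H1_norm \<Omega> u)\<^sup>2)"
proof -
  obtain \<theta> \<kappa> h0 h1 where g: "graded_meshes \<Omega> T \<theta> \<kappa> h0 h1"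
    using red_green_sequence.graded[OF assms(3,1,2)] by blast
  interpret G: graded_meshes \<Omega> T \<theta> \<kappa> h0 h1 by (rule g)
  show ?thesis
  proof (rule exI[of _ "1 / (4 * G.CI)"], intro conjI allI impI)
    show "1 / (4 * G.CI) > 0" using G.CI_pos by simp
    fix \<gamma> :: real and Qa
    assume a: "0 \<le> \<gamma> \<and> \<gamma> < 1 / (4 * G.CI) \<and> (\<forall>j. linear_L2_into_fe \<Omega> (T j) (Qa j)) \<and>
      (\<forall>j. \<forall>v\<in>L2 \<Omega>. L2_norm \<Omega> (\<lambda>x. Qa j v x - L2_proj \<Omega> (T j) v x) \<le> \<gamma> * L2_norm \<Omega> (L2_proj \<Omega> (T j) v))"
    interpret P: perturbed_projections \<Omega> T \<theta> \<kappa> h0 h1 \<gamma> Qa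
    proof unfold_locales
      show "\<gamma> * (4 * G.CI) \<le> 1" using a G.CI_pos by (simp add: pos_less_divide_eq)
    qed (use a in \<open>auto simp: linear_L2_into_fe_def\<close>)
    have p4: "(2::real) ^ (2 * j) = 4 ^ j" for j by (simp add: power_mult)
    show "\<exists>c>0. \<exists>C>0. \<forall>J. \<forall>u\<in>fe_space \<Omega> (T J).
       c * (H1_norm \<Omega> u)\<^sup>2
         \<le> (\<Sum>j=0..J. 2 ^ (2 * j) *
              (L2_norm \<Omega> (\<lambda>x. Q_tilde \<Omega> T Qa J (int j) u x - Q_tilde \<Omega> T Qa J (int j - 1) u x))\<^sup>2) \<and>
       (\<Sum>j=0..J. 2 ^ (2 * j) *
            (L2_norm \<Omega> (\<lambda>x. Q_tilde \<Omega> T Qa J (int j) u x - Q_tilde \<Omega> T Qa J (int j - 1) u x))\<^sup>2)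
         \<le> C * (H1_norm \<Omega> u)\<^sup>2"
    \<comment> \<open>Both constants are made of mesh constants alone, so they are uniform in
      \<gamma> and \<open>Qa\<close>.\<close>
    proof (rule exI[of _ "1 / P.Clow"], rule conjI, simp add: P.Clow_pos, rule exI[of _ P.Cup], intro conjI allI ballI)
      show "P.Cup > 0" by (simp add: P.Cup_def add_pos_nonneg)
      fix J u assume u: "u \<in> fe_space \<Omega> (T J)"
      have e: "(\<Sum>j=0..J. 2 ^ (2 * j) *
          (L2_norm \<Omega> (\<lambda>x. Q_tilde \<Omega> T Qa J (int j) u x - Q_tilde \<Omega> T Qa J (int j - 1) u x))\<^sup>2)
        = (\<Sum>j\<le>J. 4 ^ j * (L2_norm \<Omega> (P.incr J u j))\<^sup>2)"
        unfolding p4 atLeast0AtMost P.incr_def[abs_def] ..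
      show "1 / P.Clow * (H1_norm \<Omega> u)\<^sup>2 \<le> (\<Sum>j=0..J. 2 ^ (2 * j) *
          (L2_norm \<Omega> (\<lambda>x. Q_tilde \<Omega> T Qa J (int j) u x - Q_tilde \<Omega> T Qa J (int j - 1) u x))\<^sup>2)"
        unfolding e using P.lower_bound[OF u] P.Clow_pos by (simp add: pos_divide_le_eq mult.commute)
      show "(\<Sum>j=0..J. 2 ^ (2 * j) *
          (L2_norm \<Omega> (\<lambda>x. Q_tilde \<Omega> T Qa J (int j) u x - Q_tilde \<Omega> T Qa J (int j - 1) u x))\<^sup>2) \<le> P.Cup * (H1_norm \<Omega> u)\<^sup>2"
        unfolding e by (rule P.upper_bound[OF u])
    qed
  qed
qed

end
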